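(* Let $\lambda\in\mathbb R$, $0<\beta<\tfrac12$, $b\in C_T\mathcal C^{(-\beta)+}$ ($\mathbb R^d$-valued), $v_T\in\mathcal S'$, and let $g:[0,T]\to\mathcal S'$ be continuous. Let $v\in C_TD\mathcal C^{\beta}$. Then $v$ is a weak solution of $$\partial_t v+\tfrac12\Delta v+\nabla v\, b=\lambda v+g,\qquad v(T)=v_T,$$ if and only if $v$ is a mild solution of the same problem.
   Context: Fix $d\ge1$, $T>0$. $\mathcal S$, $\mathcal S'$ are the Schwartz functions and Schwartz distributions on $\mathbb R^d$, with dual pairing $\langle\cdot,\cdot\rangle$. For $\gamma\in\mathbb R$, $\mathcal C^\gamma$ is the Besov (Hölder–Zygmund) space of $f\in\mathcal S'$ with $\|f\|_\gamma:=\sup_j2^{j\gamma}\|\mathcal F^{-1}(\varphi_j\mathcal Ff)\|_\infty<\infty$, $(\varphi_j)$ a dyadic partition of unity (i.e. $B^\gamma_{\infty,\infty}$). $\mathcal C^{\gamma+}=\bigcup_{\alpha>\gamma}\mathcal C^\alpha$. $C_TX:=C([0,T];X)$; $f\in C_T\mathcal C^{\gamma+}$ iff $f\in C_T\mathcal C^\alpha$ for some $\alpha>\gamma$. For $\alpha\in(0,1)$, $D\mathcal C^\alpha$ is the space of differentiable $h:\mathbb R^d\to\mathbb R$ with $\nabla h\in\mathcal C^\alpha$, with norm $\|h\|_{D\mathcal C^\alpha}=|h(0)|+\|\nabla h\|_\alpha$. $P_t$ is the heat semigroup generated by $\tfrac12\Delta$ (convolution with $p_t(x)=(2\pi t)^{-d/2}e^{-|x|^2/(2t)}$),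 extended to $\mathcal S'$ by duality. For $f\in\mathcal C^{\alpha}$, $g\in\mathcal C^{-\alpha'}$ with $\alpha>\alpha'>0$ the (Bony) pointwise product $fg\in\mathcal C^{-\alpha'}$ is well defined and continuous bilinear; $\nabla v\,b:=\nabla v\cdot b$ is understood in this sense. $v\in C_TD\mathcal C^\beta$ is a weak solution if for all $\varphi\in\mathcal S$ and all $t\in[0,T]$ $$\langle\varphi,v_T\rangle-\langle\varphi,v(t)\rangle+\int_t^T\langle\tfrac12\Delta\varphi,v(s)\rangle ds+\int_t^T\langle\varphi,\nabla v(s)b(s)\rangle ds=\int_t^T\langle\varphi,\lambda v(s)+g(s)\rangle ds.$$ $v\in C_TD\mathcal C^\beta$ is a mild solution if for all $t\in[0,T]$ $$v(t)=P_{T-t}v_T+\int_t^TP_{s-t}(\nabla v(s)b(s))\,ds-\int_t^TP_{s-t}(\lambda v(s)+g(s))\,ds,$$ the integrals being $\mathcal S'$-valued. *)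

theory Defs
  imports "HOL-Analysis.Analysis"
begin

section \<open>Schwartz functions and tempered distributions\<close>

definition partial :: "'n::finite \<Rightarrow> (real^'n \<Rightarrow> 'b::real_normed_vector) \<Rightarrow> real^'n \<Rightarrow> 'b" where
  "partial i f x = frechet_derivative f (at x) (axis i 1)"

definition partials :: "'n::finite list \<Rightarrow> (real^'n \<Rightarrow> 'b::real_normed_vector) \<Rightarrow> real^'n \<Rightarrow> 'b" where
  "partials ds f = foldr partial ds f"

definition laplacian :: "(real^'n::finite \<Rightarrow> 'b::real_normed_vector) \<Rightarrow> real^'n \<Rightarrow> 'b" where
  "laplacian f x = (\<Sum>i\<in>UNIV. partials [i, i] f x)"

definition smooth :: "(real^'n::finite \<Rightarrow> 'b::real_normed_vector) \<Rightarrow> bool" where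
  "smooth f \<longleftrightarrow> (\<forall>ds x. partials ds f differentiable (at x))"

type_synonym 'n test = "real^'n \<Rightarrow> complex"

definition schwartz :: "'n::finite test set" where
  "schwartz = {f. smooth f \<and> (\<forall>k ds. bounded (range (\<lambda>x. (1 + norm x) ^ k *\<^sub>R partials ds f x)))}"

definition schwartz_seminorm :: "nat \<Rightarrow> 'n::finite test \<Rightarrow> real" where
  "schwartz_seminorm k f =
     (SUP (x, ds) \<in> UNIV \<times> {ds. length ds \<le> k}. (1 + norm x) ^ k * norm (partials ds f x))"

text \<open>A distribution is a functional of which only the values on \<^const>\<open>schwartz\<close> matter;
  equality of distributions always means agreement on \<^const>\<open>schwartz\<close>.\<close>

type_synonym 'n distr = "'n test \<Rightarrow> complex"

definition tempered :: "'n::finite distr set" where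
  "tempered = {u.
     (\<forall>\<phi>\<in>schwartz. \<forall>\<psi>\<in>schwartz. u (\<lambda>x. \<phi> x + \<psi> x) = u \<phi> + u \<psi>) \<and>
     (\<forall>c. \<forall>\<phi>\<in>schwartz. u (\<lambda>x. c * \<phi> x) = c * u \<phi>) \<and>
     (\<exists>C k. \<forall>\<phi>\<in>schwartz. norm (u \<phi>) \<le> C * schwartz_seminorm k \<phi>)}"

definition real_distr :: "'n::finite distr \<Rightarrow> bool" where
  "real_distr u \<longleftrightarrow> (\<forall>\<phi>\<in>schwartz. u (\<lambda>x. cnj (\<phi> x)) = cnj (u \<phi>))"

definition distr_of :: "(real^'n::finite \<Rightarrow> complex) \<Rightarrow> 'n distr" where
  "distr_of h \<phi> = (LINT x|lborel. \<phi> x * h x)"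

definition distr_of_real :: "(real^'n::finite \<Rightarrow> real) \<Rightarrow> 'n distr" where
  "distr_of_real h = distr_of (\<lambda>x. complex_of_real (h x))"

text \<open>Continuous functions whose pairing with every Schwartz function is an absolutely convergent
  integral.  For these the identification of a function with a distribution is meaningful and
  injective.\<close>

definition pairable :: "(real^'n::finite \<Rightarrow> complex) \<Rightarrow> bool" where
  "pairable h \<longleftrightarrow> continuous_on UNIV h \<and> (\<forall>\<phi>\<in>schwartz. integrable lborel (\<lambda>x. \<phi> x * h x))"

definition cont_rep :: "'n::finite distr \<Rightarrow> real^'n \<Rightarrow> complex" where
  "cont_rep u = (THE h. pairable h \<and> (\<forall>\<phi>\<in>schwartz. u \<phi> = distr_of h \<phi>))"

text \<open>Continuity into the distributions is with respect to the weak-* topology.  As the Schwartz space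
  is Montel, curves on an interval are continuous for this topology iff they are so for the strong
  one.\<close>

definition CT_tempered :: "real \<Rightarrow> (real \<Rightarrow> 'n::finite distr) set" where
  "CT_tempered T = {g. (\<forall>t\<in>{0..T}. g t \<in> tempered) \<and>
     (\<forall>\<phi>\<in>schwartz. continuous_on {0..T} (\<lambda>t. g t \<phi>))}"

text \<open>The integral of a distribution-valued curve, in the weak (Gelfand-Pettis) sense.\<close>

definition distr_integral :: "real \<Rightarrow> real \<Rightarrow> (real \<Rightarrow> 'n::finite distr) \<Rightarrow> 'n distr" where
  "distr_integral a b w = (\<lambda>\<phi>. integral {a..b} (\<lambda>s. w s \<phi>))"


section \<open>Fourier transform\<close>

definition fourier :: "'n::finite test \<Rightarrow> 'n test" where
  "fourier \<phi> \<xi> = (LINT x|lborel. cis (- (x \<bullet> \<xi>)) * \<phi> x)"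

definition inv_fourier :: "'n::finite test \<Rightarrow> 'n test" where
  "inv_fourier \<phi> x = (LINT \<xi>|lborel. cis (x \<bullet> \<xi>) * \<phi> \<xi>) / of_real ((2 * pi) ^ CARD('n))"

definition fourier_distr :: "'n::finite distr \<Rightarrow> 'n distr" where
  "fourier_distr u = (\<lambda>\<phi>. u (fourier \<phi>))"

definition inv_fourier_distr :: "'n::finite distr \<Rightarrow> 'n distr" where
  "inv_fourier_distr u = (\<lambda>\<phi>. u (inv_fourier \<phi>))"

definition mult_distr :: "(real^'n::finite \<Rightarrow> real) \<Rightarrow> 'n distr \<Rightarrow> 'n distr" where
  "mult_distr m u = (\<lambda>\<phi>. u (\<lambda>x. complex_of_real (m x) * \<phi> x))"


section \<open>Besov spaces\<close>

definition supp :: "(real^'n::finite \<Rightarrow> real) \<Rightarrow> (real^'n) set" where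
  "supp f = closure {x. f x \<noteq> 0}"

definition radial :: "(real^'n::finite \<Rightarrow> real) \<Rightarrow> bool" where
  "radial f \<longleftrightarrow> (\<forall>x y. norm x = norm y \<longrightarrow> f x = f y)"

text \<open>Indices start at \<open>0\<close>, the low-frequency block being number \<open>0\<close> rather than \<open>-1\<close>.\<close>

definition dyadic_partition :: "(nat \<Rightarrow> real^'n::finite \<Rightarrow> real) \<Rightarrow> bool" where
  "dyadic_partition \<rho> \<longleftrightarrow>
     smooth (\<rho> 0) \<and> radial (\<rho> 0) \<and> (\<forall>\<xi>. \<rho> 0 \<xi> \<ge> 0) \<and> (\<exists>R. supp (\<rho> 0) \<subseteq> cball 0 R) \<and>
     (\<exists>\<theta>. smooth \<theta> \<and> radial \<theta> \<and> (\<forall>\<xi>. \<theta> \<xi> \<ge> 0) \<and>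
        (\<exists>r>0. \<exists>R. supp \<theta> \<subseteq> {\<xi>. r \<le> norm \<xi> \<and> norm \<xi> \<le> R}) \<and>
        (\<forall>j\<ge>1. \<forall>\<xi>. \<rho> j \<xi> = \<theta> ((1 / 2 ^ j) *\<^sub>R \<xi>))) \<and>
     (\<forall>\<xi>. (\<lambda>j. \<rho> j \<xi>) sums 1) \<and>
     (\<forall>i j. i + 1 < j \<longrightarrow> supp (\<rho> i) \<inter> supp (\<rho> j) = {})"

text \<open>The distribution below has compactly supported Fourier transform and is hence given by a
  continuous (indeed smooth) function of polynomial growth, so that \<^const>\<open>cont_rep\<close> is
  well-defined on it.\<close>

definition LP_block :: "(nat \<Rightarrow> real^'n::finite \<Rightarrow> real) \<Rightarrow> nat \<Rightarrow> 'n distr \<Rightarrow> real^'n \<Rightarrow> complex" where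
  "LP_block \<rho> j u = cont_rep (inv_fourier_distr (mult_distr (\<rho> j) (fourier_distr u)))"

definition besov_norm :: "(nat \<Rightarrow> real^'n::finite \<Rightarrow> real) \<Rightarrow> real \<Rightarrow> 'n distr \<Rightarrow> ennreal" where
  "besov_norm \<rho> \<gamma> u =
     (SUP j. ennreal (2 powr (real j * \<gamma>)) * (SUP x. ennreal (norm (LP_block \<rho> j u x))))"

definition besov :: "(nat \<Rightarrow> real^'n::finite \<Rightarrow> real) \<Rightarrow> real \<Rightarrow> 'n distr set" where
  "besov \<rho> \<gamma> = {u \<in> tempered. besov_norm \<rho> \<gamma> u < \<infinity>}"

definition CT_besov :: "(nat \<Rightarrow> real^'n::finite \<Rightarrow> real) \<Rightarrow> real \<Rightarrow> real \<Rightarrow> (real \<Rightarrow> 'n distr) set" where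
  "CT_besov \<rho> T \<gamma> = {f. (\<forall>t\<in>{0..T}. f t \<in> besov \<rho> \<gamma>) \<and>
     (\<forall>s\<in>{0..T}. ((\<lambda>t. besov_norm \<rho> \<gamma> (\<lambda>\<phi>. f t \<phi> - f s \<phi>)) \<longlongrightarrow> 0) (at s within {0..T}))}"

text \<open>Vector fields are given by their components.\<close>

definition CT_besov_plus_vec ::
  "(nat \<Rightarrow> real^'n::finite \<Rightarrow> real) \<Rightarrow> real \<Rightarrow> real \<Rightarrow> (real \<Rightarrow> 'n \<Rightarrow> 'n distr) set" where
  "CT_besov_plus_vec \<rho> T \<gamma> =
     {b. (\<exists>\<alpha>>\<gamma>. \<forall>i. (\<lambda>t. b t i) \<in> CT_besov \<rho> T \<alpha>) \<and> (\<forall>t\<in>{0..T}. \<forall>i. real_distr (b t i))}"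

text \<open>For \<open>\<alpha> \<in> (0,1)\<close> the elements of the Besov space of order \<open>\<alpha>\<close> are (bounded Hoelder) continuous
  functions; a gradient belonging to it is the continuous function itself, not merely almost everywhere
  equal to it.  The norm of a gradient is the sum of the norms of its components.\<close>

definition DC :: "(nat \<Rightarrow> real^'n::finite \<Rightarrow> real) \<Rightarrow> real \<Rightarrow> (real^'n \<Rightarrow> real) set" where
  "DC \<rho> \<alpha> = {h. (\<forall>x. h differentiable (at x)) \<and>
     (\<forall>i. pairable (\<lambda>x. complex_of_real (partial i h x)) \<and>
          distr_of_real (partial i h) \<in> besov \<rho> \<alpha>)}"

definition DC_norm :: "(nat \<Rightarrow> real^'n::finite \<Rightarrow> real) \<Rightarrow> real \<Rightarrow> (real^'n \<Rightarrow> real) \<Rightarrow> ennreal" where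
  "DC_norm \<rho> \<alpha> h =
     ennreal \<bar>h 0\<bar> + (\<Sum>i\<in>UNIV. besov_norm \<rho> \<alpha> (distr_of_real (partial i h)))"

definition CT_DC :: "(nat \<Rightarrow> real^'n::finite \<Rightarrow> real) \<Rightarrow> real \<Rightarrow> real \<Rightarrow> (real \<Rightarrow> real^'n \<Rightarrow> real) set" where
  "CT_DC \<rho> T \<alpha> = {v. (\<forall>t\<in>{0..T}. v t \<in> DC \<rho> \<alpha>) \<and>
     (\<forall>s\<in>{0..T}. ((\<lambda>t. DC_norm \<rho> \<alpha> (\<lambda>x. v t x - v s x)) \<longlongrightarrow> 0) (at s within {0..T}))}"


section \<open>Bony's product\<close>

text \<open>Paraproduct \<open>f \<prec> g\<close> and resonant product \<open>f \<circ> g\<close>; the series are understood in the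
  distributional sense.\<close>

definition paraproduct ::
  "(nat \<Rightarrow> real^'n::finite \<Rightarrow> real) \<Rightarrow> 'n distr \<Rightarrow> 'n distr \<Rightarrow> 'n distr" where
  "paraproduct \<rho> f g =
     (\<lambda>\<phi>. \<Sum>j. distr_of (\<lambda>x. (\<Sum>i | i + 1 < j. LP_block \<rho> i f x) * LP_block \<rho> j g x) \<phi>)"

definition resonant ::
  "(nat \<Rightarrow> real^'n::finite \<Rightarrow> real) \<Rightarrow> 'n distr \<Rightarrow> 'n distr \<Rightarrow> 'n distr" where
  "resonant \<rho> f g =
     (\<lambda>\<phi>. \<Sum>j. distr_of (\<lambda>x. (\<Sum>i | i \<le> j + 1 \<and> j \<le> i + 1. LP_block \<rho> i f x) * LP_block \<rho> j g x) \<phi>)"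

definition bony_product ::
  "(nat \<Rightarrow> real^'n::finite \<Rightarrow> real) \<Rightarrow> 'n distr \<Rightarrow> 'n distr \<Rightarrow> 'n distr" where
  "bony_product \<rho> f g = (\<lambda>\<phi>. paraproduct \<rho> f g \<phi> + resonant \<rho> f g \<phi> + paraproduct \<rho> g f \<phi>)"

definition grad_prod ::
  "(nat \<Rightarrow> real^'n::finite \<Rightarrow> real) \<Rightarrow> (real^'n \<Rightarrow> real) \<Rightarrow> ('n \<Rightarrow> 'n distr) \<Rightarrow> 'n distr" where
  "grad_prod \<rho> h b = (\<lambda>\<phi>. \<Sum>i\<in>UNIV. bony_product \<rho> (distr_of_real (partial i h)) (b i) \<phi>)"


section \<open>Heat semigroup\<close>

definition heat_kernel :: "real \<Rightarrow> real^'n::finite \<Rightarrow> real" where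
  "heat_kernel t x = (2 * pi * t) powr (- real CARD('n) / 2) * exp (- (norm x)\<^sup>2 / (2 * t))"

definition heat :: "real \<Rightarrow> 'n::finite test \<Rightarrow> 'n test" where
  "heat t \<phi> x =
     (if t = 0 then \<phi> x else LINT y|lborel. complex_of_real (heat_kernel t (x - y)) * \<phi> y)"

definition heat_distr :: "real \<Rightarrow> 'n::finite distr \<Rightarrow> 'n distr" where
  "heat_distr t u = (\<lambda>\<phi>. u (heat t \<phi>))"


section \<open>Weak and mild solutions\<close>

definition weak_solution ::
  "(nat \<Rightarrow> real^'n::finite \<Rightarrow> real) \<Rightarrow> real \<Rightarrow> real \<Rightarrow> (real \<Rightarrow> 'n \<Rightarrow> 'n distr) \<Rightarrow>
   (real \<Rightarrow> 'n distr) \<Rightarrow> 'n distr \<Rightarrow> (real \<Rightarrow> real^'n \<Rightarrow> real) \<Rightarrow> bool" where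
  "weak_solution \<rho> T l b g vT v \<longleftrightarrow>
     (\<forall>\<phi>\<in>schwartz. \<forall>t\<in>{0..T}.
        vT \<phi> - distr_of_real (v t) \<phi>
        + integral {t..T} (\<lambda>s. distr_of_real (v s) (\<lambda>x. 1/2 * laplacian \<phi> x))
        + integral {t..T} (\<lambda>s. grad_prod \<rho> (v s) (b s) \<phi>)
        = integral {t..T} (\<lambda>s. of_real l * distr_of_real (v s) \<phi> + g s \<phi>))"

definition mild_solution ::
  "(nat \<Rightarrow> real^'n::finite \<Rightarrow> real) \<Rightarrow> real \<Rightarrow> real \<Rightarrow> (real \<Rightarrow> 'n \<Rightarrow> 'n distr) \<Rightarrow>
   (real \<Rightarrow> 'n distr) \<Rightarrow> 'n distr \<Rightarrow> (real \<Rightarrow> real^'n \<Rightarrow> real) \<Rightarrow> bool" where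
  "mild_solution \<rho> T l b g vT v \<longleftrightarrow>
     (\<forall>t\<in>{0..T}. \<forall>\<phi>\<in>schwartz.
        distr_of_real (v t) \<phi> =
          heat_distr (T - t) vT \<phi>
          + distr_integral t T (\<lambda>s. heat_distr (s - t) (grad_prod \<rho> (v s) (b s))) \<phi>
          - distr_integral t T
              (\<lambda>s. heat_distr (s - t) (\<lambda>\<psi>. of_real l * distr_of_real (v s) \<psi> + g s \<psi>)) \<phi>)"

end

theory Submission
  imports Defs "HOL-Probability.Probability"
begin

text \<open>Write the equation as an identity between curves \<open>u\<close> and \<open>w = \<nabla>v b - (\<lambda>v + g)\<close> in the tempered
  distributions. If both are weak-* continuous, then weak-to-mild follows by differentiating
  \<open>s \<mapsto> \<langle>P(s - t)\<phi>, u s\<rangle>\<close>: the two Laplacian terms cancel and the derivative is \<open>- \<langle>P(s - t)\<phi>, w s\<rangle>\<close>.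
  Mild-to-weak follows by integrating the mild formula tested against \<open>\<Delta>\<phi> / 2\<close> in time and
  exchanging the order of integration over the triangle. Both steps need a uniform order of the
  distributions along the curve, which the uniform boundedness principle on the Schwartz space provides.
  The remaining point is the weak-* continuity of \<open>w\<close>, i.e. the continuity of Bony's product.\<close>

section \<open>Schwartz functions\<close>

text \<open>The difficulty in time is that the curve and the test function move together, whereas
  weak-* continuity of \<open>u\<close> only speaks about one fixed test function. The heat flow is
  therefore expanded to second order in Schwartz seminorms, and one order of seminorm must serve all
  times at once. In space, blocks are definite descriptions of continuous functions, so nothing can
  be said about them before a tempered distribution has been moved under an integral and continuous
  representatives have been shown unique. For the product, put \<open>a = 2 powr (- \<beta>)\<close>
  and \<open>q = 2 powr (- \<gamma>)\<close> with \<open>- \<beta> < \<gamma> < 0\<close>: tested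
  against a fixed function, every term of the three series is of size \<open>(a * q) ^ j\<close>
  with \<open>a * q < 1\<close>. The function \<open>v t\<close> itself may grow linearly, so it
  enters through its value at the origin and its gradient, and only the gradient is treated as an
  element of a Besov space. Fourier inversion and the time regularity of the heat flow both rest on
  its Gaussian multiplier.\<close>

lemma partial_eqI: "(f has_derivative f') (at x) \<Longrightarrow> partial i f x = f' (axis i 1)"
  unfolding partial_def using frechet_derivative_at[of f f' x] by simp

text \<open>The total derivative in coordinates is the form in which the mean value inequality and
  differentiation under the integral consume \<open>partial\<close>.\<close>

lemma has_derivative_partials:
  fixes f :: "real^'n::finite \<Rightarrow> 'b::real_normed_vector"
  assumes "f differentiable at x"
  shows "(f has_derivative (\<lambda>h. \<Sum>i\<in>UNIV. (h $ i) *\<^sub>R partial i f x)) (at x)"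
proof -
  let ?D = "frechet_derivative f (at x)"
  have D: "(f has_derivative ?D) (at x)" using assms frechet_derivative_works by blast
  then have lin: "linear ?D" by (rule has_derivative_linear)
  have "?D h = (\<Sum>i\<in>UNIV. (h $ i) *\<^sub>R partial i f x)" for h
  proof -
    have "?D h = ?D (\<Sum>i\<in>UNIV. (h $ i) *\<^sub>R axis i 1)"
      using basis_expansion[of h] by (simp add: scalar_mult_eq_scaleR)
    also have "\<dots> = (\<Sum>i\<in>UNIV. (h $ i) *\<^sub>R partial i f x)"
      by (simp add: linear_sum[OF lin] linear_scale[OF lin] partial_def)
    finally show ?thesis .
  qed
  then have "?D = (\<lambda>h. \<Sum>i\<in>UNIV. (h $ i) *\<^sub>R partial i f x)" by blast
  then show ?thesis using D by simp
qed

lemma partials_Nil [simp]: "partials [] f = f"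
  by (simp add: partials_def)

lemma partials_Cons: "partials (d # ds) f = partial d (partials ds f)"
  by (simp add: partials_def)

lemma partials_append: "partials (ds @ es) f = partials ds (partials es f)"
  by (simp add: partials_def)

lemma partials_closed:
  assumes "f \<in> X" "\<And>f i. f \<in> X \<Longrightarrow> partial i f \<in> X"
  shows "partials ds f \<in> X"
  using assms by (induction ds) (auto simp: partials_Cons)

lemma smooth_coinduct:
  assumes "f \<in> X" "\<And>f i. f \<in> X \<Longrightarrow> partial i f \<in> X"
    "\<And>f x. f \<in> X \<Longrightarrow> f differentiable at x"
  shows "smooth f"
  unfolding smooth_def using assms partials_closed[of f X] by blast

lemma bounded_range_iff_norm_le:
  "bounded (range f) \<longleftrightarrow> (\<exists>B. \<forall>x. norm (f x) \<le> B)"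
  by (auto simp: bounded_iff)

text \<open>Both requirements on a Schwartz function quantify over all iterated derivatives. A
  family closed under \<open>partial\<close> reduces them to undifferentiated members, and it may be
  chosen larger than the functions of interest so that the product rule stays inside it.\<close>

lemma schwartz_coinduct:
  fixes f :: "'n::finite test"
  assumes "f \<in> X" "\<And>f i. f \<in> X \<Longrightarrow> partial i f \<in> X"
    "\<And>f x. f \<in> X \<Longrightarrow> f differentiable at x"
    "\<And>f k. f \<in> X \<Longrightarrow> \<exists>B. \<forall>x. (1 + norm x) ^ k * norm (f x) \<le> B"
  shows "f \<in> schwartz"
proof -
  have "\<exists>B. \<forall>x. norm ((1 + norm x) ^ k *\<^sub>R partials ds f x) \<le> B" for k ds
    using assms(4)[OF partials_closed[OF assms(1) assms(2)], of k ds] by (simp add: power_abs)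
  then show ?thesis
    using smooth_coinduct[OF assms(1-3)] by (auto simp: schwartz_def bounded_range_iff_norm_le)
qed

lemma schwartz_differentiable: "\<phi> \<in> schwartz \<Longrightarrow> \<phi> differentiable at x"
  using partials_Nil[of \<phi>] unfolding schwartz_def smooth_def by (metis (lifting) mem_Collect_eq)

lemma schwartz_partials: "\<phi> \<in> schwartz \<Longrightarrow> partials ds \<phi> \<in> schwartz"
  by (simp add: schwartz_def smooth_def partials_append[symmetric])

lemma schwartz_partial: "\<phi> \<in> schwartz \<Longrightarrow> partial i \<phi> \<in> schwartz"
  using schwartz_partials[of \<phi> "[i]"] by (simp add: partials_Cons)

lemma schwartz_boundE:
  fixes \<phi> :: "'n::finite test"
  assumes "\<phi> \<in> schwartz"
  obtains B where "B \<ge> 0" "\<And>x. (1 + norm x) ^ k * norm (\<phi> x) \<le> B"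
proof -
  have "bounded (range (\<lambda>x. (1 + norm x) ^ k *\<^sub>R partials [] \<phi> x))"
    using assms unfolding schwartz_def by blast
  then obtain B where "\<forall>x. norm ((1 + norm x) ^ k *\<^sub>R \<phi> x) \<le> B"
    by (auto simp: bounded_range_iff_norm_le)
  then have "\<And>x. (1 + norm x) ^ k * norm (\<phi> x) \<le> max B 0"
    by (simp add: power_abs le_max_iff_disj)
  then show ?thesis using that[of "max B 0"] by simp
qed

lemma schwartz_bound: "\<phi> \<in> schwartz \<Longrightarrow> \<exists>B. \<forall>x. (1 + norm x) ^ k * norm (\<phi> x) \<le> B"
  by (meson schwartz_boundE)

lemma schwartz_continuous: "\<phi> \<in> schwartz \<Longrightarrow> continuous_on A \<phi>"
  by (meson continuous_at_imp_continuous_on differentiable_imp_continuous_within schwartz_differentiable)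

lemma schwartz_measurable [measurable_dest]: "\<phi> \<in> schwartz \<Longrightarrow> \<phi> \<in> borel_measurable borel"
  by (simp add: borel_measurable_continuous_onI schwartz_continuous)

lemma partial_add:
  assumes "f differentiable at x" "g differentiable at x"
  shows "partial i (\<lambda>x. f x + g x) x = partial i f x + partial i g x"
  using has_derivative_add[OF assms[unfolded frechet_derivative_works]]
  by (subst partial_eqI) (auto simp: partial_def)

lemma partial_diff:
  assumes "f differentiable at x" "g differentiable at x"
  shows "partial i (\<lambda>x. f x - g x) x = partial i f x - partial i g x"
  using has_derivative_diff[OF assms[unfolded frechet_derivative_works]]
  by (subst partial_eqI) (auto simp: partial_def)

lemma partial_mult:
  fixes f g :: "real^'n::finite \<Rightarrow> complex"
  assumes "f differentiable at x" "g differentiable at x"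
  shows "partial i (\<lambda>x. f x * g x) x = f x * partial i g x + partial i f x * g x"
  using has_derivative_mult[OF assms[unfolded frechet_derivative_works]]
  by (subst partial_eqI) (auto simp: partial_def)

lemma partial_const [simp]: "partial i (\<lambda>x. c) = (\<lambda>x. 0)"
  by (rule ext, subst partial_eqI[OF has_derivative_const]) simp

lemma partial_cmult:
  fixes f :: "real^'n::finite \<Rightarrow> complex"
  assumes "f differentiable at x"
  shows "partial i (\<lambda>x. c * f x) x = c * partial i f x"
  using partial_mult[of "\<lambda>x. c" x f i] assms by simp

lemma differentiable_affine:
  fixes f :: "real^'n::finite \<Rightarrow> 'b::real_normed_vector"
  assumes "\<And>y. f differentiable at y"
  shows "(\<lambda>x. f (c *\<^sub>R x + a)) differentiable at x"
    and partial_affine: "partial i (\<lambda>x. f (c *\<^sub>R x + a)) x = c *\<^sub>R partial i f (c *\<^sub>R x + a)"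
proof -
  let ?g = "\<lambda>x. c *\<^sub>R x + a"
  let ?D = "frechet_derivative f (at (?g x))"
  have D: "(f has_derivative ?D) (at (?g x))"
    using assms frechet_derivative_works by blast
  have g: "(?g has_derivative (\<lambda>h. c *\<^sub>R h)) (at x)"
    by (auto intro!: derivative_eq_intros)
  have "((\<lambda>x. f (?g x)) has_derivative (\<lambda>h. ?D (c *\<^sub>R h))) (at x)"
    using has_derivative_compose[OF g D] by simp
  moreover have "?D (c *\<^sub>R h) = c *\<^sub>R ?D h" for h
    using has_derivative_linear[OF D] by (simp add: linear_scale)
  ultimately have "((\<lambda>x. f (?g x)) has_derivative (\<lambda>h. c *\<^sub>R ?D h)) (at x)" by simp
  then show "(\<lambda>x. f (c *\<^sub>R x + a)) differentiable at x"
    and "partial i (\<lambda>x. f (c *\<^sub>R x + a)) x = c *\<^sub>R partial i f (c *\<^sub>R x + a)"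
    by (auto simp: differentiable_def partial_def[of i f] partial_eqI)
qed

lemma schwartz_add:
  assumes "\<phi> \<in> schwartz" "\<psi> \<in> schwartz"
  shows "(\<lambda>x. \<phi> x + \<psi> x) \<in> schwartz"
proof (rule schwartz_coinduct[where X = "{\<lambda>x. \<phi> x + \<psi> x |\<phi> \<psi>. \<phi> \<in> schwartz \<and> \<psi> \<in> schwartz}"])
  fix f k assume "f \<in> {\<lambda>x. \<phi> x + \<psi> x |\<phi> \<psi>. \<phi> \<in> schwartz \<and> \<psi> \<in> schwartz}"
  then obtain \<phi> \<psi> where f: "f = (\<lambda>x. \<phi> x + \<psi> x)" "\<phi> \<in> schwartz" "\<psi> \<in> schwartz" by blast
  obtain B where B: "\<And>x. (1 + norm x) ^ k * norm (\<phi> x) \<le> B" using f(2) schwartz_boundE by blast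
  obtain B' where B': "\<And>x. (1 + norm x) ^ k * norm (\<psi> x) \<le> B'" using f(3) schwartz_boundE by blast
  have "(1 + norm x) ^ k * norm (f x) \<le> B + B'" for x
  proof -
    have "(1 + norm x) ^ k * norm (f x) \<le> (1 + norm x) ^ k * (norm (\<phi> x) + norm (\<psi> x))"
      unfolding f by (intro mult_left_mono norm_triangle_ineq) simp
    then show ?thesis using B[of x] B'[of x] by (simp add: algebra_simps)
  qed
  then show "\<exists>B. \<forall>x. (1 + norm x) ^ k * norm (f x) \<le> B" by blast
next
  fix f i assume "f \<in> {\<lambda>x. \<phi> x + \<psi> x |\<phi> \<psi>. \<phi> \<in> schwartz \<and> \<psi> \<in> schwartz}"
  then obtain \<phi> \<psi> where f: "f = (\<lambda>x. \<phi> x + \<psi> x)" "\<phi> \<in> schwartz" "\<psi> \<in> schwartz" by blast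
  have "partial i f = (\<lambda>x. partial i \<phi> x + partial i \<psi> x)"
    unfolding f using f(2,3) by (intro ext partial_add schwartz_differentiable)
  then show "partial i f \<in> {\<lambda>x. \<phi> x + \<psi> x |\<phi> \<psi>. \<phi> \<in> schwartz \<and> \<psi> \<in> schwartz}"
    using f(2,3) schwartz_partial by blast
qed (use assms in \<open>blast\<close>, auto intro!: differentiable_add intro: schwartz_differentiable)

lemma schwartz_cmult:
  assumes "\<phi> \<in> schwartz"
  shows "(\<lambda>x. c * \<phi> x) \<in> schwartz"
proof (rule schwartz_coinduct[where X = "{\<lambda>x. c * \<phi> x |\<phi>. \<phi> \<in> schwartz}"])
  fix f k assume "f \<in> {\<lambda>x. c * \<phi> x |\<phi>. \<phi> \<in> schwartz}"
  then obtain \<phi> where f: "f = (\<lambda>x. c * \<phi> x)" "\<phi> \<in> schwartz" by blast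
  obtain B where B: "\<And>x. (1 + norm x) ^ k * norm (\<phi> x) \<le> B" using f(2) schwartz_boundE by blast
  have "(1 + norm x) ^ k * norm (f x) \<le> norm c * B" for x
    unfolding f using mult_left_mono[OF B[of x], of "norm c"] by (simp add: norm_mult algebra_simps)
  then show "\<exists>B. \<forall>x. (1 + norm x) ^ k * norm (f x) \<le> B" by blast
next
  fix f i assume "f \<in> {\<lambda>x. c * \<phi> x |\<phi>. \<phi> \<in> schwartz}"
  then obtain \<phi> where f: "f = (\<lambda>x. c * \<phi> x)" "\<phi> \<in> schwartz" by blast
  have "partial i f = (\<lambda>x. c * partial i \<phi> x)"
    unfolding f using f(2) by (intro ext partial_cmult schwartz_differentiable)
  then show "partial i f \<in> {\<lambda>x. c * \<phi> x |\<phi>. \<phi> \<in> schwartz}"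
    using f(2) schwartz_partial by blast
qed (use assms in \<open>blast\<close>, auto intro!: differentiable_mult intro: schwartz_differentiable)

lemma schwartz_diff:
  assumes "\<phi> \<in> schwartz" "\<psi> \<in> schwartz"
  shows "(\<lambda>x. \<phi> x - \<psi> x) \<in> schwartz"
  using schwartz_add[OF assms(1) schwartz_cmult[OF assms(2), of "-1"]] by simp

lemma schwartz_zero [simp]: "(\<lambda>x. 0) \<in> schwartz"
  by (rule schwartz_coinduct[where X = "{\<lambda>x. 0}"]) auto

lemma schwartz_sum:
  "(\<And>i. i \<in> I \<Longrightarrow> \<phi> i \<in> schwartz) \<Longrightarrow> (\<lambda>x. \<Sum>i\<in>I. \<phi> i x) \<in> schwartz"
  by (induction I rule: infinite_finite_induct) (auto intro: schwartz_add)

lemma schwartz_affine: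
  assumes "\<phi> \<in> schwartz" "c \<noteq> 0"
  shows "(\<lambda>x. \<phi> (c *\<^sub>R x + a)) \<in> schwartz"
proof (rule schwartz_coinduct[where X = "{\<lambda>x. \<phi> (c *\<^sub>R x + a) |\<phi>. \<phi> \<in> schwartz}"])
  fix f k assume "f \<in> {\<lambda>x. \<phi> (c *\<^sub>R x + a) |\<phi>. \<phi> \<in> schwartz}"
  then obtain \<phi> where f: "f = (\<lambda>x. \<phi> (c *\<^sub>R x + a))" "\<phi> \<in> schwartz" by blast
  obtain B where B: "\<And>x. (1 + norm x) ^ k * norm (\<phi> x) \<le> B" using f(2) schwartz_boundE by blast
  \<comment> \<open>From \<open>\<bar>c\<bar> * norm x \<le> norm (c *\<^sub>R x + a) + norm
    a\<close>: \<open>C\<close> is the price of exchanging the weight at \<open>x\<close> for the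
    weight at its image.\<close>
  define C where "C = 1 + (1 + norm a) / \<bar>c\<bar>"
  have C: "1 + norm x \<le> C * (1 + norm (c *\<^sub>R x + a))" for x
  proof -
    have "\<bar>c\<bar> * norm x \<le> norm (c *\<^sub>R x + a) + norm a"
      using norm_triangle_ineq4[of "c *\<^sub>R x + a" a] by simp
    then have "norm x \<le> (norm (c *\<^sub>R x + a) + norm a) / \<bar>c\<bar>"
      using \<open>c \<noteq> 0\<close> by (simp add: field_simps)
    also have "\<dots> \<le> (1 + norm a) / \<bar>c\<bar> * (1 + norm (c *\<^sub>R x + a))"
      using \<open>c \<noteq> 0\<close> by (simp add: field_simps)
    finally have "1 + norm x \<le> (1 + norm (c *\<^sub>R x + a)) + (1 + norm a) / \<bar>c\<bar> * (1 + norm (c *\<^sub>R x + a))"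
      using norm_ge_zero[of "c *\<^sub>R x + a"] by linarith
    then show ?thesis by (simp add: C_def distrib_right)
  qed
  have "C \<ge> 0" by (simp add: C_def)
  have "(1 + norm x) ^ k * norm (f x) \<le> C ^ k * B" for x
  proof -
    have "(1 + norm x) ^ k * norm (f x) \<le> (C * (1 + norm (c *\<^sub>R x + a))) ^ k * norm (f x)"
      by (intro mult_right_mono power_mono C) auto
    also have "\<dots> = C ^ k * ((1 + norm (c *\<^sub>R x + a)) ^ k * norm (\<phi> (c *\<^sub>R x + a)))"
      by (simp add: f power_mult_distrib)
    also have "\<dots> \<le> C ^ k * B" using \<open>C \<ge> 0\<close> by (intro mult_left_mono B) simp
    finally show ?thesis .
  qed
  then show "\<exists>B. \<forall>x. (1 + norm x) ^ k * norm (f x) \<le> B" by blast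
next
  fix f i assume "f \<in> {\<lambda>x. \<phi> (c *\<^sub>R x + a) |\<phi>. \<phi> \<in> schwartz}"
  then obtain \<phi> where f: "f = (\<lambda>x. \<phi> (c *\<^sub>R x + a))" "\<phi> \<in> schwartz" by blast
  have "partial i f = (\<lambda>x. (\<lambda>y. complex_of_real c * partial i \<phi> y) (c *\<^sub>R x + a))"
    unfolding f using f(2) by (intro ext) (simp add: partial_affine schwartz_differentiable, simp add: scaleR_conv_of_real)
  then show "partial i f \<in> {\<lambda>x. \<phi> (c *\<^sub>R x + a) |\<phi>. \<phi> \<in> schwartz}"
    using schwartz_cmult[OF schwartz_partial[OF f(2), of i], of "of_real c"]
    by (intro CollectI exI[of _ "\<lambda>y. complex_of_real c * partial i \<phi> y"] conjI)
qed (use assms in \<open>blast\<close>, auto intro!: differentiable_affine intro: schwartz_differentiable)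

lemma differentiable_coord: "(\<lambda>x::real^'n::finite. complex_of_real (x $ i)) differentiable at x"
  and partial_coord: "partial j (\<lambda>x::real^'n::finite. complex_of_real (x $ i)) x = (if i = j then 1 else 0)"
proof -
  have D: "((\<lambda>x::real^'n. complex_of_real (x $ i)) has_derivative (\<lambda>h. complex_of_real (h $ i))) (at x)"
    using bounded_linear_compose[OF bounded_linear_of_real bounded_linear_vec_nth]
    by (rule bounded_linear_imp_has_derivative)
  then show "(\<lambda>x::real^'n. complex_of_real (x $ i)) differentiable at x"
    by (auto simp: differentiable_def)
  show "partial j (\<lambda>x::real^'n. complex_of_real (x $ i)) x = (if i = j then 1 else 0)"
    by (subst partial_eqI[OF D]) (simp add: axis_def)
qed

text \<open>By the product rule, differentiating a coordinate times a Schwartz function leaves a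
  term without the coordinate. The family therefore carries a free Schwartz summand
  \<open>\<psi>\<close>.\<close>

lemma schwartz_coord_mult:
  fixes \<phi> :: "'n::finite test"
  assumes "\<phi> \<in> schwartz"
  shows "(\<lambda>x. complex_of_real (x $ i) * \<phi> x) \<in> schwartz"
proof (rule schwartz_coinduct[where X = "{\<lambda>x. \<psi> x + complex_of_real (x $ i) * \<phi> x |\<psi> \<phi>. \<psi> \<in> schwartz \<and> \<phi> \<in> schwartz}"])
  show "(\<lambda>x. complex_of_real (x $ i) * \<phi> x) \<in> {\<lambda>x. \<psi> x + complex_of_real (x $ i) * \<phi> x |\<psi> \<phi>. \<psi> \<in> schwartz \<and> \<phi> \<in> schwartz}"
    using assms by (intro CollectI exI[of _ "\<lambda>x. 0"] exI[of _ \<phi>]) auto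
next
  fix f :: "'n test" and k assume "f \<in> {\<lambda>x. \<psi> x + complex_of_real (x $ i) * \<phi> x |\<psi> \<phi>. \<psi> \<in> schwartz \<and> \<phi> \<in> schwartz}"
  then obtain \<psi> \<phi> where f: "f = (\<lambda>x. \<psi> x + complex_of_real (x $ i) * \<phi> x)" "\<phi> \<in> schwartz" "\<psi> \<in> schwartz" by blast
  obtain B where B: "\<And>x. (1 + norm x) ^ k * norm (\<psi> x) \<le> B" using f(3) schwartz_boundE by blast
  \<comment> \<open>The extra power of the weight pays for the factor \<open>x $ i\<close>.\<close>
  obtain B' where B': "\<And>x. (1 + norm x) ^ Suc k * norm (\<phi> x) \<le> B'" using f(2) schwartz_boundE by blast
  have "(1 + norm x) ^ k * norm (f x) \<le> B + B'" for x
  proof -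
    have "\<bar>x $ i\<bar> \<le> 1 + norm x" using component_le_norm_cart[of x i] by simp
    then have "norm (f x) \<le> norm (\<psi> x) + (1 + norm x) * norm (\<phi> x)"
      unfolding f by (intro order_trans[OF norm_triangle_ineq] add_left_mono) (simp add: norm_mult mult_right_mono)
    then have "(1 + norm x) ^ k * norm (f x) \<le> (1 + norm x) ^ k * (norm (\<psi> x) + (1 + norm x) * norm (\<phi> x))"
      by (intro mult_left_mono) auto
    then show ?thesis using B[of x] B'[of x] by (simp add: algebra_simps)
  qed
  then show "\<exists>B. \<forall>x. (1 + norm x) ^ k * norm (f x) \<le> B" by blast
next
  fix f :: "'n test" and j assume "f \<in> {\<lambda>x. \<psi> x + complex_of_real (x $ i) * \<phi> x |\<psi> \<phi>. \<psi> \<in> schwartz \<and> \<phi> \<in> schwartz}"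
  then obtain \<psi> \<phi> where f: "f = (\<lambda>x. \<psi> x + complex_of_real (x $ i) * \<phi> x)" "\<phi> \<in> schwartz" "\<psi> \<in> schwartz" by blast
  have "partial j f x = (partial j \<psi> x + (if i = j then 1 else 0) * \<phi> x) + complex_of_real (x $ i) * partial j \<phi> x" for x
    unfolding f using f(2,3)
    by (subst partial_add) (auto simp: partial_mult schwartz_differentiable differentiable_coord partial_coord)
  then have "partial j f = (\<lambda>x. (partial j \<psi> x + (if i = j then 1 else 0) * \<phi> x) + complex_of_real (x $ i) * partial j \<phi> x)"
    by blast
  moreover have "(\<lambda>x. partial j \<psi> x + (if i = j then 1 else 0) * \<phi> x) \<in> schwartz"
    using f(2,3) by (intro schwartz_add schwartz_cmult schwartz_partial)
  ultimately show "partial j f \<in> {\<lambda>x. \<psi> x + complex_of_real (x $ i) * \<phi> x |\<psi> \<phi>. \<psi> \<in> schwartz \<and> \<phi> \<in> schwartz}"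
    using schwartz_partial[OF f(2), of j]
    by (intro CollectI exI[of _ "\<lambda>x. partial j \<psi> x + (if i = j then 1 else 0) * \<phi> x"] exI[of _ "partial j \<phi>"] conjI)
qed (auto intro!: differentiable_add differentiable_mult differentiable_coord intro: schwartz_differentiable)

lemma partials_add:
  assumes "\<phi> \<in> schwartz" "\<psi> \<in> schwartz"
  shows "partials ds (\<lambda>x. \<phi> x + \<psi> x) = (\<lambda>x. partials ds \<phi> x + partials ds \<psi> x)"
  by (induction ds) (auto simp: partials_Cons partial_add schwartz_differentiable schwartz_partials assms)

lemma partials_cmult:
  assumes "\<phi> \<in> schwartz"
  shows "partials ds (\<lambda>x. c * \<phi> x) = (\<lambda>x. c * partials ds \<phi> x)"
  by (induction ds) (auto simp: partials_Cons partial_cmult schwartz_differentiable schwartz_partials assms)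

lemma partials_diff:
  assumes "\<phi> \<in> schwartz" "\<psi> \<in> schwartz"
  shows "partials ds (\<lambda>x. \<phi> x - \<psi> x) = (\<lambda>x. partials ds \<phi> x - partials ds \<psi> x)"
  by (induction ds) (auto simp: partials_Cons partial_diff schwartz_differentiable schwartz_partials assms)

lemma partials_sum:
  assumes "\<And>i. i \<in> I \<Longrightarrow> \<phi> i \<in> schwartz"
  shows "partials ds (\<lambda>x. \<Sum>i\<in>I. \<phi> i x) = (\<lambda>x. \<Sum>i\<in>I. partials ds (\<phi> i) x)"
  using assms
proof (induction I rule: infinite_finite_induct)
  case (infinite A) then show ?case by simp (induction ds, auto simp: partials_Cons)
next
  case empty then show ?case by simp (induction ds, auto simp: partials_Cons)
next
  case (insert x F) then show ?case by (simp add: partials_add schwartz_sum)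
qed

lemma partials_translate:
  fixes \<phi> :: "'n::finite test"
  assumes "\<phi> \<in> schwartz"
  shows "partials ds (\<lambda>y. \<phi> (y - a)) = (\<lambda>y. partials ds \<phi> (y - a))"
proof (induction ds)
  case (Cons d ds)
  have "partial d (\<lambda>y. partials ds \<phi> (y - a)) x = partial d (partials ds \<phi>) (x - a)" for x
    using partial_affine[of "partials ds \<phi>" d 1 "- a" x] schwartz_differentiable[OF schwartz_partials[OF assms, of ds]]
    by simp
  then show ?case using Cons by (auto simp: partials_Cons)
qed simp

lemma schwartz_translate: "\<phi> \<in> schwartz \<Longrightarrow> (\<lambda>y. \<phi> (y - a)) \<in> schwartz"
  using schwartz_affine[of \<phi> 1 "- a"] by simp

section \<open>Seminorms of Schwartz functions and the effect of translations\<close>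

lemma finite_lists_le: "finite {ds :: 'n::finite list. length ds \<le> k}"
  using finite_lists_length_le[of "UNIV :: 'n set" k] by simp

text \<open>A real supremum is informative only over a bounded set. There are finitely many
  derivative lists of length at most \<open>k\<close>, so the sum of the individual bounds is a
  common one.\<close>

lemma schwartz_seminorm_bdd:
  assumes "\<phi> \<in> schwartz"
  shows "bdd_above ((\<lambda>(x, ds). (1 + norm x) ^ k * norm (partials ds \<phi> x)) ` (UNIV \<times> {ds. length ds \<le> k}))"
proof -
  have "\<exists>B. \<forall>x. (1 + norm x) ^ k * norm (partials ds \<phi> x) \<le> B" for ds
    using schwartz_bound schwartz_partials assms by blast
  then obtain B where B: "\<And>ds x. (1 + norm x) ^ k * norm (partials ds \<phi> x) \<le> B ds" by metis
  have "B ds \<ge> 0" for ds using order_trans[OF _ B[of 0 ds]] by simp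
  then have "(1 + norm x) ^ k * norm (partials ds \<phi> x) \<le> (\<Sum>ds | length ds \<le> k. B ds)" if "length ds \<le> k" for x ds
    using that by (intro order_trans[OF B[of x ds]] member_le_sum finite_lists_le) auto
  then show ?thesis by (intro bdd_aboveI2) auto
qed

lemma schwartz_seminorm_ge:
  assumes "\<phi> \<in> schwartz" "length ds \<le> k"
  shows "(1 + norm x) ^ k * norm (partials ds \<phi> x) \<le> schwartz_seminorm k \<phi>"
  unfolding schwartz_seminorm_def
  using cSUP_upper[OF _ schwartz_seminorm_bdd[OF assms(1), of k], of "(x, ds)"] assms(2) by simp

lemma schwartz_seminorm_le:
  assumes "\<And>x ds. length ds \<le> k \<Longrightarrow> (1 + norm x) ^ k * norm (partials ds \<phi> x) \<le> B"
  shows "schwartz_seminorm k \<phi> \<le> B"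
  unfolding schwartz_seminorm_def by (rule cSUP_least) (use assms in \<open>auto intro!: exI[of _ "[]"]\<close>)

lemma schwartz_seminorm_nonneg: "\<phi> \<in> schwartz \<Longrightarrow> schwartz_seminorm k \<phi> \<ge> 0"
  by (rule order_trans[OF _ schwartz_seminorm_ge[of \<phi> "[]" k 0]]) auto

lemma schwartz_seminorm_mono:
  assumes "\<phi> \<in> schwartz" "k \<le> k'"
  shows "schwartz_seminorm k \<phi> \<le> schwartz_seminorm k' \<phi>"
proof (rule schwartz_seminorm_le)
  fix x :: "real^'a" and ds :: "'a list" assume "length ds \<le> k"
  then have "(1 + norm x) ^ k' * norm (partials ds \<phi> x) \<le> schwartz_seminorm k' \<phi>"
    using assms by (intro schwartz_seminorm_ge) auto
  moreover have "(1 + norm x) ^ k * norm (partials ds \<phi> x) \<le> (1 + norm x) ^ k' * norm (partials ds \<phi> x)"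
    using assms by (intro mult_right_mono power_increasing) auto
  ultimately show "(1 + norm x) ^ k * norm (partials ds \<phi> x) \<le> schwartz_seminorm k' \<phi>" by simp
qed

lemma schwartz_seminorm_add:
  assumes "\<phi> \<in> schwartz" "\<psi> \<in> schwartz"
  shows "schwartz_seminorm k (\<lambda>x. \<phi> x + \<psi> x) \<le> schwartz_seminorm k \<phi> + schwartz_seminorm k \<psi>"
proof (rule schwartz_seminorm_le)
  fix x :: "real^'a" and ds :: "'a list" assume ds: "length ds \<le> k"
  have "(1 + norm x) ^ k * norm (partials ds \<phi> x + partials ds \<psi> x)
      \<le> (1 + norm x) ^ k * (norm (partials ds \<phi> x) + norm (partials ds \<psi> x))"
    by (intro mult_left_mono norm_triangle_ineq) simp
  then show "(1 + norm x) ^ k * norm (partials ds (\<lambda>x. \<phi> x + \<psi> x) x) \<le> schwartz_seminorm k \<phi> + schwartz_seminorm k \<psi>"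
    using schwartz_seminorm_ge[OF assms(1) ds, of x] schwartz_seminorm_ge[OF assms(2) ds, of x]
    by (simp add: partials_add assms algebra_simps)
qed

lemma schwartz_seminorm_cmult:
  assumes "\<phi> \<in> schwartz"
  shows "schwartz_seminorm k (\<lambda>x. c * \<phi> x) \<le> norm c * schwartz_seminorm k \<phi>"
proof (rule schwartz_seminorm_le)
  fix x :: "real^'a" and ds :: "'a list" assume ds: "length ds \<le> k"
  show "(1 + norm x) ^ k * norm (partials ds (\<lambda>x. c * \<phi> x) x) \<le> norm c * schwartz_seminorm k \<phi>"
    using mult_left_mono[OF schwartz_seminorm_ge[OF assms ds, of x], of "norm c"]
    by (simp add: partials_cmult assms norm_mult algebra_simps)
qed

text \<open>Submultiplicativity of the weight is the device behind all estimates of translations and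
  convolutions: the weight at \<open>x\<close> is split between \<open>x - y\<close> and
  \<open>y\<close>.\<close>

lemma one_plus_norm_mult_le:
  fixes x y :: "'a::real_normed_vector"
  shows "1 + norm (x + y) \<le> (1 + norm x) * (1 + norm y)"
proof -
  have "1 + norm (x + y) \<le> 1 + norm x + norm y" using norm_triangle_ineq[of x y] by simp
  also have "\<dots> \<le> (1 + norm x) * (1 + norm y)" by (simp add: algebra_simps)
  finally show ?thesis .
qed

lemma one_plus_norm_power_le:
  fixes x y :: "'a::real_normed_vector"
  shows "(1 + norm (x + y)) ^ k \<le> (1 + norm x) ^ k * (1 + norm y) ^ k"
  using power_mono[OF one_plus_norm_mult_le, of x y k] by (simp add: power_mult_distrib)

text \<open>Mean value inequality on the segment from \<open>x\<close> to \<open>x - y\<close>. A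
  point \<open>z\<close> of it has distance at most \<open>norm y\<close> from \<open>x\<close>, so
  moving the weight from \<open>x\<close> to \<open>z\<close> costs \<open>(1 + norm y) ^ k\<close>;
  the factor \<open>CARD('n)\<close> comes from summing over coordinates.\<close>

lemma translate_diff_bound:
  fixes \<phi> :: "'n::finite test" and B :: real
  assumes d: "\<And>x. \<phi> differentiable at x"
    and B: "\<And>i z. (1 + norm z) ^ k * norm (partial i \<phi> z) \<le> B"
  shows "(1 + norm x) ^ k * norm (\<phi> (x - y) - \<phi> x) \<le> CARD('n) * B * norm y * (1 + norm y) ^ k"
proof -
  define M where "M = CARD('n) * B * (1 + norm y) ^ k / (1 + norm x) ^ k"
  have pos: "(1 + norm x) ^ k > 0" by (intro zero_less_power) (simp add: add_pos_nonneg)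
  have "norm (\<phi> (x - y) - \<phi> x) \<le> M * norm ((x - y) - x)"
  proof (rule differentiable_bound[where S = "closed_segment x (x - y)"])
    fix z assume z: "z \<in> closed_segment x (x - y)"
    show "(\<phi> has_derivative (\<lambda>h. \<Sum>i\<in>UNIV. (h $ i) *\<^sub>R partial i \<phi> z)) (at z within closed_segment x (x - y))"
      using has_derivative_partials[OF d] has_derivative_at_withinI by blast
    have zy: "norm (x - z) \<le> norm y"
      using segment_bound(1)[OF z] by (simp add: norm_minus_commute)
    have "(1 + norm x) ^ k \<le> (1 + norm z) ^ k * (1 + norm (x - z)) ^ k"
      using one_plus_norm_power_le[of z "x - z" k] by simp
    also have "\<dots> \<le> (1 + norm z) ^ k * (1 + norm y) ^ k"
      using zy by (intro mult_left_mono power_mono) auto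
    finally have w: "(1 + norm x) ^ k \<le> (1 + norm z) ^ k * (1 + norm y) ^ k" .
    have p: "norm (partial i \<phi> z) \<le> B * (1 + norm y) ^ k / (1 + norm x) ^ k" for i
    proof -
      have "(1 + norm x) ^ k * norm (partial i \<phi> z) \<le> (1 + norm z) ^ k * (1 + norm y) ^ k * norm (partial i \<phi> z)"
        by (intro mult_right_mono w) simp
      also have "\<dots> \<le> B * (1 + norm y) ^ k"
        using mult_right_mono[OF B[of z i], of "(1 + norm y) ^ k"] by (simp add: algebra_simps)
      finally show ?thesis using pos by (simp add: field_simps)
    qed
    show "onorm (\<lambda>h. \<Sum>i\<in>UNIV. (h $ i) *\<^sub>R partial i \<phi> z) \<le> M"
    proof (rule onorm_le)
      fix h :: "real^'n"
      have "norm (\<Sum>i\<in>UNIV. (h $ i) *\<^sub>R partial i \<phi> z) \<le> (\<Sum>i\<in>(UNIV::'n set). norm h * (B * (1 + norm y) ^ k / (1 + norm x) ^ k))"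
        by (intro sum_norm_le) (simp only: norm_scaleR, intro mult_mono p, auto simp: component_le_norm_cart)
      then show "norm (\<Sum>i\<in>UNIV. (h $ i) *\<^sub>R partial i \<phi> z) \<le> M * norm h"
        by (simp add: M_def algebra_simps)
    qed
  qed auto
  then have "(1 + norm x) ^ k * norm (\<phi> (x - y) - \<phi> x) \<le> (1 + norm x) ^ k * (M * norm y)"
    using pos by (intro mult_left_mono) auto
  also have "\<dots> = CARD('n) * B * norm y * (1 + norm y) ^ k"
    unfolding M_def using less_imp_neq[OF pos, symmetric] by (simp del: power_eq_0_iff)
  finally show ?thesis .
qed

lemma schwartz_translate_diff:
  fixes \<phi> :: "'n::finite test"
  assumes "\<phi> \<in> schwartz"
  obtains B where "B \<ge> 0" "\<And>x y. (1 + norm x) ^ k * norm (\<phi> (x - y) - \<phi> x) \<le> B * norm y * (1 + norm y) ^ k"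
proof -
  have "\<exists>B\<ge>0. \<forall>z. (1 + norm z) ^ k * norm (partial i \<phi> z) \<le> B" for i
    using schwartz_boundE[OF schwartz_partial[OF assms, of i], of k] by metis
  then obtain B where B: "\<And>i. B i \<ge> 0" "\<And>i z. (1 + norm z) ^ k * norm (partial i \<phi> z) \<le> B i" by metis
  have "(1 + norm z) ^ k * norm (partial i \<phi> z) \<le> sum B UNIV" for i z
    using B by (intro order_trans[OF B(2)] member_le_sum) auto
  then show ?thesis
    using that[of "real CARD('n) * sum B UNIV"] translate_diff_bound[where \<phi> = \<phi> and k = k and B = "sum B UNIV"] B(1) schwartz_differentiable[OF assms]
    by (auto simp: sum_nonneg)
qed

section \<open>Integration and convolution\<close>

lemma
  fixes f :: "'a::euclidean_space \<Rightarrow> 'b::{banach, second_countable_topology}"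
  assumes [measurable]: "f \<in> borel_measurable borel" and c: "c \<noteq> 0"
  shows integrable_lborel_affine_iff: "integrable lborel (\<lambda>x. f (a + c *\<^sub>R x)) \<longleftrightarrow> integrable lborel f"
    and integral_lborel_affine: "integral\<^sup>L lborel f = \<bar>c\<bar> ^ DIM('a) *\<^sub>R (LINT x|lborel. f (a + c *\<^sub>R x))"
proof -
  let ?D = "distr lborel borel (\<lambda>x. a + c *\<^sub>R x) :: 'a measure"
  have L: "(lborel :: 'a measure) = density ?D (\<lambda>_. \<bar>c\<bar> ^ DIM('a))"
    using lborel_affine[OF c, of a] by simp
  have "integrable lborel f \<longleftrightarrow> integrable (density ?D (\<lambda>_. \<bar>c\<bar> ^ DIM('a))) f"
    using L by simp
  also have "\<dots> \<longleftrightarrow> integrable ?D (\<lambda>x. \<bar>c\<bar> ^ DIM('a) *\<^sub>R f x)"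
    by (subst integrable_density) auto
  also have "\<dots> \<longleftrightarrow> integrable ?D f"
    using c integrable_scaleR_right[of "1 / \<bar>c\<bar> ^ DIM('a)" ?D "\<lambda>x. \<bar>c\<bar> ^ DIM('a) *\<^sub>R f x"]
    by (auto simp: o_def)
  also have "\<dots> \<longleftrightarrow> integrable lborel (\<lambda>x. f (a + c *\<^sub>R x))"
    by (subst integrable_distr_eq) auto
  finally show "integrable lborel (\<lambda>x. f (a + c *\<^sub>R x)) \<longleftrightarrow> integrable lborel f" by simp
  have "integral\<^sup>L lborel f = integral\<^sup>L (density ?D (\<lambda>_. \<bar>c\<bar> ^ DIM('a))) f"
    using L by simp
  also have "\<dots> = (LINT x|?D. \<bar>c\<bar> ^ DIM('a) *\<^sub>R f x)"
    by (subst integral_density) auto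
  also have "\<dots> = (LINT x|lborel. \<bar>c\<bar> ^ DIM('a) *\<^sub>R f (a + c *\<^sub>R x))"
    by (subst integral_distr) auto
  finally show "integral\<^sup>L lborel f = \<bar>c\<bar> ^ DIM('a) *\<^sub>R (LINT x|lborel. f (a + c *\<^sub>R x))" by simp
qed

lemma
  fixes f :: "'a::euclidean_space \<Rightarrow> 'b::{banach, second_countable_topology}"
  assumes [measurable]: "f \<in> borel_measurable borel"
  shows integrable_lborel_translate: "integrable lborel (\<lambda>x. f (x - a)) \<longleftrightarrow> integrable lborel f"
    and integral_lborel_translate: "(LINT x|lborel. f (x - a)) = integral\<^sup>L lborel f"
    and integral_lborel_reflect: "(LINT x|lborel. f (a - x)) = integral\<^sup>L lborel f"
  using integrable_lborel_affine_iff[OF assms, of 1 "-a"] integral_lborel_affine[OF assms, of 1 "-a"]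
    integral_lborel_affine[OF assms, of "-1" a]
  by simp_all

text \<open>Lebesgue measure is the image of the product measure indexed by \<open>Basis\<close>, so
  integrals of products of one-variable functions factor. This reduces both the weight and the
  Gaussian to dimension one.\<close>

lemma
  fixes f :: "'a::euclidean_space \<Rightarrow> real \<Rightarrow> 'b::{real_normed_field, banach, second_countable_topology}"
  assumes f: "\<And>b. b \<in> Basis \<Longrightarrow> integrable lborel (f b)"
  shows integrable_lborel_prod: "integrable lborel (\<lambda>x. \<Prod>b\<in>Basis. f b (x \<bullet> b))"
    and integral_lborel_prod: "(LINT x|lborel. (\<Prod>b\<in>Basis. f b (x \<bullet> b))) = (\<Prod>b\<in>Basis. integral\<^sup>L lborel (f b))"
proof -
  interpret product_sigma_finite "\<lambda>_::'a. lborel :: real measure"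
    by standard
  have [measurable]: "f b \<in> borel_measurable borel" if "b \<in> Basis" for b
    using f[OF that] by simp
  have m: "(\<lambda>x. \<Prod>b\<in>Basis. f b (x \<bullet> b)) \<in> borel_measurable borel"
    by measurable
  have eq: "(\<Prod>b\<in>Basis. f b ((\<Sum>b\<in>Basis. g b *\<^sub>R b) \<bullet> b)) = (\<Prod>b\<in>Basis. f b (g b))" for g :: "'a \<Rightarrow> real"
    by (intro prod.cong) auto
  have T: "(\<lambda>g. \<Sum>b\<in>Basis. g b *\<^sub>R b) \<in> measurable (Pi\<^sub>M Basis (\<lambda>_. lborel)) (borel :: 'a measure)"
    by measurable
  show "integrable lborel (\<lambda>x. \<Prod>b\<in>Basis. f b (x \<bullet> b))"
    unfolding lborel_eq[where ?'a = 'a]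
    by (subst integrable_distr_eq[OF T m], unfold eq) (intro product_integrable_prod f, auto)
  show "(LINT x|lborel. (\<Prod>b\<in>Basis. f b (x \<bullet> b))) = (\<Prod>b\<in>Basis. integral\<^sup>L lborel (f b))"
    unfolding lborel_eq[where ?'a = 'a]
    by (subst integral_distr[OF T m], unfold eq) (intro product_integral_prod f, auto)
qed

lemma norm_ge_component_product:
  fixes x :: "real^'n::finite"
  shows "(\<Prod>b\<in>Basis. 1 + (x \<bullet> b)\<^sup>2) \<le> (1 + norm x) ^ (2 * CARD('n))"
proof -
  have "1 + (x \<bullet> b)\<^sup>2 \<le> (1 + norm x)\<^sup>2" if "b \<in> Basis" for b
  proof -
    have "(x \<bullet> b)\<^sup>2 \<le> (norm x)\<^sup>2"
      using Basis_le_norm[OF that, of x] abs_le_square_iff[of "x \<bullet> b" "norm x"] by simp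
    then show ?thesis by (simp add: power2_sum add_increasing2)
  qed
  then have "(\<Prod>b\<in>Basis. 1 + (x \<bullet> b)\<^sup>2) \<le> (\<Prod>b\<in>(Basis::(real^'n) set). (1 + norm x)\<^sup>2)"
    by (intro prod_mono) auto
  also have "\<dots> = (1 + norm x) ^ (2 * CARD('n))" by (simp add: power_mult)
  finally show ?thesis .
qed

text \<open>Comparison with a product of the one-dimensional functions
  \<open>inverse (1 + s\<^sup>2)\<close>, two powers of the weight for each coordinate; hence the
  exponent \<open>2 * CARD('n)\<close>, which recurs wherever decay is turned into
  integrability.\<close>

lemma integrable_weight: "integrable lborel (\<lambda>x::real^'n::finite. 1 / (1 + norm x) ^ (2 * CARD('n)))"
proof (rule Bochner_Integration.integrable_bound)
  have "integrable lborel (\<lambda>x::real. inverse (1 + x\<^sup>2))"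
    using integrable_inverse_1_plus_square by (simp add: set_integrable_def)
  then show "integrable lborel (\<lambda>x::real^'n. \<Prod>b\<in>Basis. inverse (1 + (x \<bullet> b)\<^sup>2))"
    by (intro integrable_lborel_prod[of "\<lambda>b x. inverse (1 + x\<^sup>2)"])
  have "1 / (1 + norm x) ^ (2 * CARD('n)) \<le> (\<Prod>b\<in>Basis. inverse (1 + (x \<bullet> b)\<^sup>2))" for x :: "real^'n"
  proof -
    have "(\<Prod>b\<in>Basis. 1 + (x \<bullet> b)\<^sup>2) > 0" by (intro prod_pos) (auto simp: add_pos_nonneg)
    then show ?thesis
      using norm_ge_component_product[of x]
      by (simp add: inverse_eq_divide prod_dividef frac_le)
  qed
  then show "AE x in lborel. norm (1 / (1 + norm x) ^ (2 * CARD('n)))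
      \<le> norm (\<Prod>b\<in>Basis. inverse (1 + ((x::real^'n) \<bullet> b)\<^sup>2))"
    by (intro AE_I2) (simp add: power_abs abs_prod)
qed measurable

text \<open>Rapid decay in mean, without smoothness: the class contains Schwartz functions
  multiplied by indicators or other bounded measurable functions, and it is what the second factor
  of a convolution has to satisfy.\<close>

definition rapid :: "(real^'n::finite \<Rightarrow> complex) \<Rightarrow> bool" where
  "rapid f \<longleftrightarrow> (\<forall>k. integrable lborel (\<lambda>x. (1 + norm x) ^ k *\<^sub>R f x))"

definition moment :: "nat \<Rightarrow> (real^'n::finite \<Rightarrow> complex) \<Rightarrow> real" where
  "moment k f = (LINT x|lborel. (1 + norm x) ^ k * norm (f x))"

lemma rapid_integrable: "rapid f \<Longrightarrow> integrable lborel f"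
  unfolding rapid_def by (drule spec[of _ 0]) simp

lemma rapid_measurable [measurable_dest]: "rapid f \<Longrightarrow> f \<in> borel_measurable borel"
  using rapid_integrable borel_measurable_integrable by force

lemma rapid_moment_integrable: "rapid f \<Longrightarrow> integrable lborel (\<lambda>x. (1 + norm x) ^ k * norm (f x))"
  unfolding rapid_def by (drule spec[of _ k], drule integrable_norm) (simp add: power_abs)

lemma moment_nonneg: "moment k f \<ge> 0"
  by (simp add: moment_def)

lemma rapidI_bound:
  fixes f :: "real^'n::finite \<Rightarrow> complex"
  assumes [measurable]: "f \<in> borel_measurable borel"
    and "\<And>k. \<exists>B. \<forall>x. (1 + norm x) ^ k * norm (f x) \<le> B"
  shows "rapid f"
  unfolding rapid_def
proof
  fix k
  \<comment> \<open>The additional \<open>2 * CARD('n)\<close> powers become the integrable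
    weight.\<close>
  obtain B where B: "\<And>x. (1 + norm x) ^ (k + 2 * CARD('n)) * norm (f x) \<le> B" using assms(2) by blast
  show "integrable lborel (\<lambda>x. (1 + norm x) ^ k *\<^sub>R f x)"
  proof (rule Bochner_Integration.integrable_bound)
    show "integrable lborel (\<lambda>x::real^'n. B * (1 / (1 + norm x) ^ (2 * CARD('n))))"
      by (intro integrable_mult_right integrable_weight)
    have "norm ((1 + norm x) ^ k *\<^sub>R f x) \<le> B * (1 / (1 + norm x) ^ (2 * CARD('n)))" for x
      using B[of x] by (simp add: power_add power_abs field_simps add_pos_nonneg)
    then show "AE x in lborel. norm ((1 + norm x) ^ k *\<^sub>R f x) \<le> norm (B * (1 / (1 + norm x) ^ (2 * CARD('n))))"
      by (intro AE_I2) (metis norm_ge_zero order_trans real_norm_def abs_ge_self)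
  qed simp
qed

lemma schwartz_rapid: "\<phi> \<in> schwartz \<Longrightarrow> rapid \<phi>"
  by (intro rapidI_bound schwartz_bound schwartz_measurable)

lemma schwartz_integrable: "\<phi> \<in> schwartz \<Longrightarrow> integrable lborel \<phi>"
  by (intro rapid_integrable schwartz_rapid)

lemma rapid_mult_bounded:
  assumes f: "rapid f" and g[measurable]: "g \<in> borel_measurable borel" and B: "\<And>x. norm (g x) \<le> B"
  shows "rapid (\<lambda>x. g x * f x)"
  unfolding rapid_def
proof
  fix k
  note [measurable] = rapid_measurable[OF f]
  have "norm ((1 + norm x) ^ k *\<^sub>R (g x * f x)) \<le> norm (B * ((1 + norm x) ^ k * norm (f x)))" for x
    using mult_right_mono[OF B[of x], of "(1 + norm x) ^ k * norm (f x)"] order_trans[OF norm_ge_zero B[of x]]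
    by (simp add: norm_mult power_abs abs_mult algebra_simps)
  then show "integrable lborel (\<lambda>x. (1 + norm x) ^ k *\<^sub>R (g x * f x))"
    by (intro Bochner_Integration.integrable_bound[OF integrable_mult_right[OF rapid_moment_integrable[OF f, of k], of B]])
      auto
qed

text \<open>Dominated convergence along an arbitrary sequence of points. By the mean value
  inequality the increment of \<open>G\<close> is at most \<open>w y * norm (x - x0)\<close>, and so
  is the linear term, hence the difference quotients are dominated by \<open>2 * w\<close>.\<close>

lemma has_derivative_integral:
  fixes G :: "'a::euclidean_space \<Rightarrow> 'b \<Rightarrow> complex"
  assumes int: "\<And>x. x \<in> ball x0 1 \<Longrightarrow> integrable M (G x)"
    and D: "\<And>x y. x \<in> ball x0 1 \<Longrightarrow> y \<in> space M \<Longrightarrow> ((\<lambda>x. G x y) has_derivative G' x y) (at x)"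
    and B: "\<And>x y h. x \<in> ball x0 1 \<Longrightarrow> y \<in> space M \<Longrightarrow> norm (G' x y h) \<le> w y * norm h"
    and w: "integrable M w"
    and meas [measurable]: "\<And>h. (\<lambda>y. G' x0 y h) \<in> borel_measurable M"
  shows "((\<lambda>x. LINT y|M. G x y) has_derivative (\<lambda>h. LINT y|M. G' x0 y h)) (at x0)"
proof -
  have x0: "x0 \<in> ball x0 1" by simp
  have int': "integrable M (\<lambda>y. G' x0 y h)" for h
  proof (rule Bochner_Integration.integrable_bound)
    show "integrable M (\<lambda>y. w y * norm h)" using w by simp
    show "AE y in M. norm (G' x0 y h) \<le> norm (w y * norm h)"
      using B[OF x0, of _ h] by (intro AE_I2) (fastforce intro: order_trans[OF _ abs_ge_self])
  qed simp
  have lin: "linear (G' x0 y)" if "y \<in> space M" for y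
    using has_derivative_linear[OF D[OF x0 that]] .
  have bl: "bounded_linear (\<lambda>h. LINT y|M. G' x0 y h)"
  proof (rule bounded_linear_intro[where K = "LINT y|M. w y"])
    fix h k :: 'a
    have "(LINT y|M. G' x0 y (h + k)) = (LINT y|M. G' x0 y h + G' x0 y k)"
      by (intro Bochner_Integration.integral_cong refl) (simp add: linear_add[OF lin])
    then show "(LINT y|M. G' x0 y (h + k)) = (LINT y|M. G' x0 y h) + (LINT y|M. G' x0 y k)"
      using int' by simp
  next
    fix r :: real and h :: 'a
    have "(LINT y|M. G' x0 y (r *\<^sub>R h)) = (LINT y|M. r *\<^sub>R G' x0 y h)"
      by (intro Bochner_Integration.integral_cong refl) (simp add: linear_scale[OF lin])
    then show "(LINT y|M. G' x0 y (r *\<^sub>R h)) = r *\<^sub>R (LINT y|M. G' x0 y h)" by simp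
  next
    fix h
    have "norm (LINT y|M. G' x0 y h) \<le> (LINT y|M. w y * norm h)"
    proof (rule order_trans[OF integral_norm_bound integral_mono])
      show "integrable M (\<lambda>y. norm (G' x0 y h))" using int' by (rule integrable_norm)
      show "integrable M (\<lambda>y. w y * norm h)" using w by simp
    qed (rule B[OF x0])
    then show "norm (LINT y|M. G' x0 y h) \<le> norm h * (LINT y|M. w y)" by (simp add: mult.commute)
  qed
  have "((\<lambda>x. (1 / norm (x - x0)) *\<^sub>R ((LINT y|M. G x y) - ((LINT y|M. G x0 y) + (LINT y|M. G' x0 y (x - x0))))) \<longlongrightarrow> 0)
      (at x0 within UNIV)"
    (is "(?R \<longlongrightarrow> 0) _")
    unfolding tendsto_at_iff_sequentially
  proof (intro allI impI)
    fix X :: "nat \<Rightarrow> 'a"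
    assume X: "\<forall>i. X i \<in> UNIV - {x0}" "X \<longlonglongrightarrow> x0"
    let ?r = "\<lambda>x y. (1 / norm (x - x0)) *\<^sub>R (G x y - (G x0 y + G' x0 y (x - x0)))"
    \<comment> \<open>The domination is known on the unit ball only, so the sequence is shifted into
      it; \<open>LIMSEQ_offset\<close> undoes the shift at the end.\<close>
    obtain N where N: "\<And>n. n \<ge> N \<Longrightarrow> X n \<in> ball x0 1"
      using tendstoD[OF X(2), of 1] by (auto simp: eventually_sequentially dist_commute)
    have X': "(\<lambda>i. X (i + N)) \<longlonglongrightarrow> x0" using X(2) by (rule LIMSEQ_ignore_initial_segment)
    have eq: "(LINT y|M. ?r (X (i + N)) y) = ?R (X (i + N))" for i
      using int[OF N[of "i + N"]] int[OF x0] int' by simp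
    have "(\<lambda>i. LINT y|M. ?r (X (i + N)) y) \<longlonglongrightarrow> (LINT y|M. 0)"
    proof (rule integral_dominated_convergence[where w = "\<lambda>y. 2 * w y"])
      show "integrable M (\<lambda>y. 2 * w y)" using w by simp
      show "(\<lambda>y. ?r (X (i + N)) y) \<in> borel_measurable M" for i
        using int[OF N[of "i + N"]] int[OF x0] int' by simp
      show "AE y in M. (\<lambda>i. ?r (X (i + N)) y) \<longlonglongrightarrow> 0"
      proof (intro AE_I2)
        fix y assume "y \<in> space M"
        then have "((\<lambda>x. ?r x y) \<longlongrightarrow> 0) (at x0 within UNIV)"
          using D[OF x0, of y, unfolded has_derivative_within] by (rule_tac conjunct2)
        from this[unfolded tendsto_at_iff_sequentially, rule_format, of "\<lambda>i. X (i + N)"]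
        show "(\<lambda>i. ?r (X (i + N)) y) \<longlonglongrightarrow> 0"
          using X' X(1) by (simp add: o_def)
      qed
      show "AE y in M. norm (?r (X (i + N)) y) \<le> 2 * w y" for i
      proof (intro AE_I2)
        fix y assume y: "y \<in> space M"
        let ?x = "X (i + N)"
        have x: "?x \<in> ball x0 1" using N by simp
        have "norm (G ?x y - G x0 y) \<le> w y * norm (?x - x0)"
        proof (rule differentiable_bound[where S = "ball x0 1"])
          show "((\<lambda>x. G x y) has_derivative G' z y) (at z within ball x0 1)" if "z \<in> ball x0 1" for z
            using D[OF that y] has_derivative_at_withinI by blast
          show "onorm (G' z y) \<le> w y" if "z \<in> ball x0 1" for z
            using B[OF that y] by (intro onorm_le)
        qed (use x in auto)
        moreover have "norm (G' x0 y (?x - x0)) \<le> w y * norm (?x - x0)" using B[OF x0 y] .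
        moreover have "norm (G ?x y - (G x0 y + G' x0 y (?x - x0)))
            \<le> norm (G ?x y - G x0 y) + norm (G' x0 y (?x - x0))"
          using norm_triangle_ineq4[of "G ?x y - G x0 y" "G' x0 y (?x - x0)"] by (simp add: algebra_simps)
        ultimately have "norm (G ?x y - (G x0 y + G' x0 y (?x - x0))) \<le> 2 * w y * norm (?x - x0)" by simp
        moreover have "norm (?x - x0) > 0" using X(1) by simp
        ultimately show "norm (?r ?x y) \<le> 2 * w y"
          by (subst norm_scaleR) (simp add: divide_le_eq)
      qed
    qed simp
    then have "(\<lambda>i. ?R (X (i + N))) \<longlonglongrightarrow> 0" unfolding eq by simp
    then show "(?R \<circ> X) \<longlonglongrightarrow> 0" unfolding o_def by (rule LIMSEQ_offset)
  qed
  with bl show ?thesis unfolding has_derivative_within by (rule conjI)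
qed

section \<open>Convolution with rapidly decreasing functions\<close>

definition conv :: "(real^'n::finite \<Rightarrow> complex) \<Rightarrow> (real^'n \<Rightarrow> complex) \<Rightarrow> real^'n \<Rightarrow> complex" where
  "conv K f x = (LINT y|lborel. K (x - y) * f y)"

lemma conv_commute:
  assumes [measurable]: "K \<in> borel_measurable borel" "f \<in> borel_measurable borel"
  shows "conv K f = conv f K"
proof
  fix x
  show "conv K f x = conv f K x"
    unfolding conv_def using integral_lborel_reflect[of "\<lambda>y. K (x - y) * f y" x]
    by (simp add: mult.commute)
qed

lemma integrable_mult_bounded:
  fixes f g :: "'a \<Rightarrow> complex"
  assumes "integrable M f" "g \<in> borel_measurable M" "\<And>x. norm (g x) \<le> B"
  shows "integrable M (\<lambda>x. g x * f x)"
proof (rule Bochner_Integration.integrable_bound)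
  show "integrable M (\<lambda>x. B * norm (f x))" using assms(1) by simp
  have "norm (g x * f x) \<le> norm (B * norm (f x))" for x
    using mult_right_mono[OF assms(3)[of x], of "norm (f x)"] using abs_ge_self[of B] by (simp add: norm_mult abs_mult) (meson mult_right_mono norm_ge_zero order_trans)
  then show "AE x in M. norm (g x * f x) \<le> norm (B * norm (f x))" by simp
qed (use assms in auto)

lemma schwartz_bounded: "\<phi> \<in> schwartz \<Longrightarrow> \<exists>B. \<forall>x. norm (\<phi> x) \<le> B"
  using schwartz_bound[of \<phi> 0] by simp

lemma integrable_conv:
  assumes "K \<in> schwartz" "integrable lborel f"
  shows "integrable lborel (\<lambda>y. K (x - y) * f y)"
proof -
  obtain B where "\<And>x. norm (K x) \<le> B" using schwartz_bounded[OF assms(1)] by blast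
  moreover have [measurable]: "K \<in> borel_measurable borel" using assms(1) by (rule schwartz_measurable)
  ultimately show ?thesis by (intro integrable_mult_bounded[OF assms(2)]) auto
qed

lemma conv_bound:
  assumes K: "\<And>z. (1 + norm z) ^ k * norm (K z) \<le> B" and f: "rapid f"
  shows "(1 + norm x) ^ k * norm (conv K f x) \<le> B * moment k f"
proof (cases "integrable lborel (\<lambda>y. K (x - y) * f y)")
  case True
  have "(1 + norm x) ^ k * norm (conv K f x) \<le> (1 + norm x) ^ k * (LINT y|lborel. norm (K (x - y) * f y))"
    unfolding conv_def by (intro mult_left_mono integral_norm_bound) simp
  also have "\<dots> = (LINT y|lborel. (1 + norm x) ^ k * norm (K (x - y) * f y))" by simp
  also have "\<dots> \<le> (LINT y|lborel. B * ((1 + norm y) ^ k * norm (f y)))"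
  proof (rule integral_mono)
    show "integrable lborel (\<lambda>y. (1 + norm x) ^ k * norm (K (x - y) * f y))" using True by simp
    show "integrable lborel (\<lambda>y. B * ((1 + norm y) ^ k * norm (f y)))"
      using rapid_moment_integrable[OF f] by (rule integrable_mult_right)
    fix y
    have "(1 + norm x) ^ k * norm (K (x - y) * f y)
        \<le> ((1 + norm (x - y)) ^ k * (1 + norm y) ^ k) * norm (K (x - y) * f y)"
      using one_plus_norm_power_le[of "x - y" y k] by (intro mult_right_mono) auto
    also have "\<dots> = ((1 + norm (x - y)) ^ k * norm (K (x - y))) * ((1 + norm y) ^ k * norm (f y))"
      by (simp add: norm_mult)
    also have "\<dots> \<le> B * ((1 + norm y) ^ k * norm (f y))" by (intro mult_right_mono K) simp
    finally show "(1 + norm x) ^ k * norm (K (x - y) * f y) \<le> B * ((1 + norm y) ^ k * norm (f y))" .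
  qed
  also have "\<dots> = B * moment k f" by (simp add: moment_def)
  finally show ?thesis .
next
  case False
  \<comment> \<open>Without integrability the integral is 0 by convention, so only the sign of
    \<open>B\<close> matters.\<close>
  have "0 \<le> B" using K[of 0] by (rule order_trans[rotated]) simp
  then show ?thesis using False by (simp add: conv_def not_integrable_integral_eq moment_nonneg)
qed

text \<open>All derivatives fall on \<open>K\<close>, while \<open>f\<close> contributes only its
  moments. The convolutions of Schwartz kernels with a fixed \<open>f\<close> thus form a family
  closed under \<open>partial\<close>.\<close>

lemma
  fixes K f :: "real^'n::finite \<Rightarrow> complex"
  assumes K: "K \<in> schwartz" and f: "rapid f"
  shows differentiable_conv: "conv K f differentiable at x"
    and partial_conv: "partial i (conv K f) = conv (partial i K) f"
proof -
  have "\<exists>B. \<forall>x. norm (partial i K x) \<le> B" for i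
    using schwartz_bounded[OF schwartz_partial[OF K]] .
  then obtain B where B: "\<And>i x. norm (partial i K x) \<le> B i" by metis
  have [measurable]: "partial i K \<in> borel_measurable borel" for i
    using schwartz_partial[OF K] by (rule schwartz_measurable)
  note [measurable] = schwartz_measurable[OF K] rapid_measurable[OF f]
  have D: "(conv K f has_derivative (\<lambda>h. LINT y|lborel. (\<Sum>i\<in>UNIV. h $ i *\<^sub>R partial i K (x - y)) * f y)) (at x)" for x
    unfolding conv_def[abs_def]
  proof (rule has_derivative_integral[where G' = "\<lambda>x y h. (\<Sum>i\<in>UNIV. h $ i *\<^sub>R partial i K (x - y)) * f y"
        and w = "\<lambda>y. (\<Sum>i\<in>UNIV. B i) * norm (f y)"])
    show "integrable lborel (\<lambda>y. K (x - y) * f y)" for x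
      using integrable_conv[OF K rapid_integrable[OF f]] .
    show "((\<lambda>x. K (x - y) * f y) has_derivative (\<lambda>h. (\<Sum>i\<in>UNIV. h $ i *\<^sub>R partial i K (x - y)) * f y)) (at x)" for x y
    proof -
      have "((\<lambda>x. x - y) has_derivative (\<lambda>h. h)) (at x)" by (auto intro!: derivative_eq_intros)
      from has_derivative_compose[OF this has_derivative_partials[OF schwartz_differentiable[OF K]]]
      show ?thesis by (intro has_derivative_mult_left)
    qed
    show "norm ((\<Sum>i\<in>UNIV. h $ i *\<^sub>R partial i K (x - y)) * f y) \<le> (\<Sum>i\<in>UNIV. B i) * norm (f y) * norm h" for x y h
    proof -
      have "norm (\<Sum>i\<in>UNIV. h $ i *\<^sub>R partial i K (x - y)) \<le> (\<Sum>i\<in>UNIV. norm h * B i)"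
        by (intro sum_norm_le) (simp only: norm_scaleR, intro mult_mono B, auto simp: component_le_norm_cart)
      then have "norm (\<Sum>i\<in>UNIV. h $ i *\<^sub>R partial i K (x - y)) * norm (f y) \<le> (\<Sum>i\<in>UNIV. norm h * B i) * norm (f y)"
        by (intro mult_right_mono) auto
      then show ?thesis by (simp add: norm_mult sum_distrib_left[symmetric] sum_distrib_right[symmetric] algebra_simps)
    qed
    show "integrable lborel (\<lambda>y. (\<Sum>i\<in>UNIV. B i) * norm (f y))"
      using rapid_integrable[OF f] by simp
    show "(\<lambda>y. (\<Sum>i\<in>UNIV. h $ i *\<^sub>R partial i K (x - y)) * f y) \<in> borel_measurable lborel" for h
      by measurable
  qed
  then show "conv K f differentiable at x" by (auto simp: differentiable_def)
  show "partial i (conv K f) = conv (partial i K) f"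
  proof
    fix x
    have "(\<Sum>j\<in>UNIV. axis i 1 $ j *\<^sub>R partial j K z) = partial i K z" for z
    proof -
      have "(\<Sum>j\<in>UNIV. axis i 1 $ j *\<^sub>R partial j K z) = (\<Sum>j\<in>UNIV. if j = i then partial j K z else 0)"
        by (intro sum.cong) (auto simp: axis_def)
      then show ?thesis by simp
    qed
    then show "partial i (conv K f) x = conv (partial i K) f x"
      by (subst partial_eqI[OF D]) (simp add: conv_def)
  qed
qed

lemma schwartz_conv:
  assumes "K \<in> schwartz" "rapid f"
  shows "conv K f \<in> schwartz"
proof (rule schwartz_coinduct[where X = "{conv K f |K. K \<in> schwartz}"])
  fix g k assume "g \<in> {conv K f |K. K \<in> schwartz}"
  then obtain K where K: "g = conv K f" "K \<in> schwartz" by blast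
  obtain B where "\<And>z. (1 + norm z) ^ k * norm (K z) \<le> B" using K(2) schwartz_boundE by blast
  then show "\<exists>B. \<forall>x. (1 + norm x) ^ k * norm (g x) \<le> B"
    using conv_bound[of k K B f] assms(2) K(1) by blast
next
  fix g i assume "g \<in> {conv K f |K. K \<in> schwartz}"
  then show "partial i g \<in> {conv K f |K. K \<in> schwartz}"
    using partial_conv[OF _ assms(2)] schwartz_partial by blast
qed (use assms differentiable_conv in auto)

lemma partials_conv:
  assumes "K \<in> schwartz" "rapid f"
  shows "partials ds (conv K f) = conv (partials ds K) f"
  using assms by (induction ds) (auto simp: partials_Cons partial_conv schwartz_partials)

lemma schwartz_seminorm_conv:
  assumes "K \<in> schwartz" "rapid f"
  shows "schwartz_seminorm k (conv K f) \<le> schwartz_seminorm k K * moment k f"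
proof (rule schwartz_seminorm_le)
  fix x :: "real^'a" and ds :: "'a list" assume "length ds \<le> k"
  then show "(1 + norm x) ^ k * norm (partials ds (conv K f) x) \<le> schwartz_seminorm k K * moment k f"
    unfolding partials_conv[OF assms]
    by (intro conv_bound assms(2) schwartz_seminorm_ge[OF assms(1)])
qed

section \<open>Fourier transform\<close>

text \<open>Translation invariance instead of boundary terms: the integral of
  \<open>\<psi> (y + x)\<close> over \<open>y\<close> does not depend on \<open>x\<close>, and
  differentiating it at \<open>x = 0\<close> under the integral sign produces the integrals of the
  partial derivatives.\<close>

lemma integral_partial_eq_0:
  fixes \<psi> :: "real^'n::finite \<Rightarrow> complex"
  assumes d: "\<And>x. \<psi> differentiable at x" and int: "integrable lborel \<psi>"
    and B: "\<And>i x. (1 + norm x) ^ (2 * CARD('n)) * norm (partial i \<psi> x) \<le> B i"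
    and m [measurable]: "\<And>i. partial i \<psi> \<in> borel_measurable borel"
  shows "(LINT x|lborel. partial i \<psi> x) = 0"
proof -
  note [measurable] = borel_measurable_integrable[OF int, simplified]
  have D: "((\<lambda>x. LINT y|lborel. \<psi> (y + x)) has_derivative
      (\<lambda>h. LINT y|lborel. (\<Sum>i\<in>UNIV. h $ i *\<^sub>R partial i \<psi> (y + 0)))) (at 0)"
  \<comment> \<open>For a shift of norm below 1 the weight changes by a factor at most 2 per power,
    hence the constant \<open>2 ^ (2 * CARD('n))\<close> in the majorant.\<close>
  proof (rule has_derivative_integral[where G' = "\<lambda>x y h. \<Sum>i\<in>UNIV. h $ i *\<^sub>R partial i \<psi> (y + x)"
        and w = "\<lambda>y. (\<Sum>i\<in>UNIV. B i) * (2 ^ (2 * CARD('n)) * (1 / (1 + norm y) ^ (2 * CARD('n))))"])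
    show "integrable lborel (\<lambda>y. \<psi> (y + x))" for x
      using integrable_lborel_translate[of \<psi> "-x"] int by simp
    show "((\<lambda>x. \<psi> (y + x)) has_derivative (\<lambda>h. \<Sum>i\<in>UNIV. h $ i *\<^sub>R partial i \<psi> (y + x))) (at x)" for x y
    proof -
      have "((\<lambda>x. y + x) has_derivative (\<lambda>h. h)) (at x)" by (auto intro!: derivative_eq_intros)
      from has_derivative_compose[OF this has_derivative_partials[OF d]] show ?thesis by simp
    qed
    show "norm (\<Sum>i\<in>UNIV. h $ i *\<^sub>R partial i \<psi> (y + x))
        \<le> (\<Sum>i\<in>UNIV. B i) * (2 ^ (2 * CARD('n)) * (1 / (1 + norm y) ^ (2 * CARD('n)))) * norm h"
      if "x \<in> ball 0 1" for x y h :: "real^'n"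
    proof -
      have *: "norm (partial i \<psi> (y + x)) \<le> B i * (2 ^ (2 * CARD('n)) * (1 / (1 + norm y) ^ (2 * CARD('n))))" for i
      proof -
        have "(1 + norm y) ^ (2 * CARD('n)) \<le> (1 + norm (y + x)) ^ (2 * CARD('n)) * (1 + norm x) ^ (2 * CARD('n))"
          using one_plus_norm_power_le[of "y + x" "-x"] by simp
        also have "\<dots> \<le> (1 + norm (y + x)) ^ (2 * CARD('n)) * 2 ^ (2 * CARD('n))"
          using that by (intro mult_left_mono power_mono) auto
        finally have "(1 + norm y) ^ (2 * CARD('n)) * norm (partial i \<psi> (y + x))
            \<le> (1 + norm (y + x)) ^ (2 * CARD('n)) * 2 ^ (2 * CARD('n)) * norm (partial i \<psi> (y + x))"
          by (rule mult_right_mono) simp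
        also have "\<dots> \<le> 2 ^ (2 * CARD('n)) * B i"
          using mult_left_mono[OF B[of "y + x" i], of "2 ^ (2 * CARD('n))"] by (simp add: algebra_simps)
        finally show ?thesis by (simp add: divide_simps algebra_simps add_pos_nonneg)
      qed
      have "norm (\<Sum>i\<in>UNIV. h $ i *\<^sub>R partial i \<psi> (y + x))
          \<le> (\<Sum>i\<in>UNIV. norm h * (B i * (2 ^ (2 * CARD('n)) * (1 / (1 + norm y) ^ (2 * CARD('n))))))"
        by (intro sum_norm_le) (simp only: norm_scaleR, intro mult_mono *, auto simp: component_le_norm_cart)
      then show ?thesis by (simp add: sum_distrib_left sum_distrib_right sum_divide_distrib algebra_simps)
    qed
    show "integrable lborel (\<lambda>y::real^'n. (\<Sum>i\<in>UNIV. B i) * (2 ^ (2 * CARD('n)) * (1 / (1 + norm y) ^ (2 * CARD('n)))))"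
      by (intro integrable_mult_right integrable_weight)
  qed measurable
  have "(LINT y|lborel. \<psi> (y + x)) = integral\<^sup>L lborel \<psi>" for x
    using integral_lborel_translate[of \<psi> "-x"] by simp
  then have "((\<lambda>x. integral\<^sup>L lborel \<psi>) has_derivative
      (\<lambda>h. LINT y|lborel. (\<Sum>i\<in>UNIV. h $ i *\<^sub>R partial i \<psi> y))) (at (0::real^'n))"
    using D by simp
  from has_derivative_unique[OF this has_derivative_const]
  have "(LINT y|lborel. (\<Sum>j\<in>UNIV. axis i 1 $ j *\<^sub>R partial j \<psi> y)) = 0" by meson
  moreover have "(\<Sum>j\<in>UNIV. axis i 1 $ j *\<^sub>R partial j \<psi> y) = partial i \<psi> y" for y
  proof -
    have "(\<Sum>j\<in>UNIV. axis i 1 $ j *\<^sub>R partial j \<psi> y) = (\<Sum>j\<in>UNIV. if j = i then partial j \<psi> y else 0)"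
      by (intro sum.cong) (auto simp: axis_def)
    then show ?thesis by simp
  qed
  ultimately show ?thesis by simp
qed

lemma has_derivative_cis_inner:
  fixes x :: "'a::real_inner"
  shows "((\<lambda>\<xi>. cis (- (x \<bullet> \<xi>))) has_derivative (\<lambda>h. - \<i> * complex_of_real (x \<bullet> h) * cis (- (x \<bullet> \<xi>)))) (at \<xi>)"
proof -
  have 1: "((\<lambda>\<xi>. \<i> * complex_of_real (- (x \<bullet> \<xi>))) has_derivative (\<lambda>h. \<i> * complex_of_real (- (x \<bullet> h)))) (at \<xi>)"
    by (auto intro!: derivative_eq_intros simp: has_derivative_of_real)
  have 2: "(exp has_derivative (\<lambda>h. exp z * h)) (at z)" for z :: complex
    using DERIV_exp[of z] by (simp add: has_field_derivative_def)
  have 3: "(\<lambda>h. exp (\<i> * complex_of_real (- (x \<bullet> \<xi>))) * (\<i> * complex_of_real (- (x \<bullet> h))))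
      = (\<lambda>h. - \<i> * complex_of_real (x \<bullet> h) * exp (\<i> * complex_of_real (- (x \<bullet> \<xi>))))"
    by (rule ext) (simp add: algebra_simps)
  show ?thesis
    using has_derivative_compose[OF 1 2] unfolding cis_conv_exp 3 .
qed

lemma measurable_cis [measurable]: "cis \<in> borel_measurable borel"
  by (intro borel_measurable_continuous_onI continuous_intros)

lemma integrable_cis_mult:
  assumes "integrable M f" "g \<in> borel_measurable M"
  shows "integrable M (\<lambda>x. cis (g x) * f x)"
  using assms by (intro integrable_mult_bounded[where B = 1]) auto

lemma norm_fourier_le: "norm (fourier \<phi> \<xi>) \<le> (LINT x|lborel. norm (\<phi> x))"
  unfolding fourier_def by (rule order_trans[OF integral_norm_bound]) (simp add: norm_mult)

lemma
  fixes \<phi> :: "'n::finite test"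
  assumes \<phi>: "rapid \<phi>"
  shows differentiable_fourier: "fourier \<phi> differentiable at \<xi>"
    and partial_fourier: "partial i (fourier \<phi>) = fourier (\<lambda>x. - \<i> * (complex_of_real (x $ i) * \<phi> x))"
proof -
  note [measurable] = rapid_measurable[OF \<phi>]
  have D: "(fourier \<phi> has_derivative (\<lambda>h. LINT x|lborel. - \<i> * complex_of_real (x \<bullet> h) * cis (- (x \<bullet> \<xi>)) * \<phi> x)) (at \<xi>)" for \<xi>
    unfolding fourier_def[abs_def]
  proof (rule has_derivative_integral[where G' = "\<lambda>\<xi> x h. - \<i> * complex_of_real (x \<bullet> h) * cis (- (x \<bullet> \<xi>)) * \<phi> x"
        and w = "\<lambda>x. (1 + norm x) ^ 1 * norm (\<phi> x)"])
    show "integrable lborel (\<lambda>x. cis (- (x \<bullet> \<xi>)) * \<phi> x)" for \<xi>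
      by (intro integrable_cis_mult rapid_integrable \<phi>) measurable
    show "((\<lambda>\<xi>. cis (- (x \<bullet> \<xi>)) * \<phi> x) has_derivative (\<lambda>h. - \<i> * complex_of_real (x \<bullet> h) * cis (- (x \<bullet> \<xi>)) * \<phi> x)) (at \<xi>)" for x \<xi>
      by (intro has_derivative_mult_left has_derivative_cis_inner)
    show "norm (- \<i> * complex_of_real (x \<bullet> h) * cis (- (x \<bullet> \<xi>)) * \<phi> x) \<le> (1 + norm x) ^ 1 * norm (\<phi> x) * norm h" for \<xi> x h
    proof -
      have "\<bar>x \<bullet> h\<bar> \<le> (1 + norm x) * norm h"
        using Cauchy_Schwarz_ineq2[of x h] by (simp add: algebra_simps add_increasing)
      then have "\<bar>x \<bullet> h\<bar> * norm (\<phi> x) \<le> (1 + norm x) * norm h * norm (\<phi> x)" by (rule mult_right_mono) simp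
      then show ?thesis by (simp add: norm_mult algebra_simps)
    qed
    show "integrable lborel (\<lambda>x. (1 + norm x) ^ 1 * norm (\<phi> x))" by (rule rapid_moment_integrable[OF \<phi>])
  qed measurable
  then show "fourier \<phi> differentiable at \<xi>" by (auto simp: differentiable_def)
  show "partial i (fourier \<phi>) = fourier (\<lambda>x. - \<i> * (complex_of_real (x $ i) * \<phi> x))"
  proof
    fix \<xi>
    show "partial i (fourier \<phi>) \<xi> = fourier (\<lambda>x. - \<i> * (complex_of_real (x $ i) * \<phi> x)) \<xi>"
      by (subst partial_eqI[OF D]) (auto simp: fourier_def cart_eq_inner_axis algebra_simps intro!: Bochner_Integration.integral_cong)
  qed
qed

text \<open>Integration by parts: \<open>integral_partial_eq_0\<close> is applied to the product of
  the character with \<open>\<phi>\<close>, and the product rule supplies both terms.\<close>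

lemma fourier_partial:
  fixes \<phi> :: "'n::finite test"
  assumes \<phi>: "\<phi> \<in> schwartz"
  shows "complex_of_real (\<xi> $ i) * fourier \<phi> \<xi> = fourier (\<lambda>x. - \<i> * partial i \<phi> x) \<xi>"
proof -
  define e where "e x = cis (- (\<xi> \<bullet> x))" for x
  have De: "(e has_derivative (\<lambda>h. - \<i> * complex_of_real (\<xi> \<bullet> h) * e x)) (at x)" for x
    unfolding e_def using has_derivative_cis_inner .
  have e: "e differentiable at x" "partial j e x = - \<i> * complex_of_real (\<xi> $ j) * e x" for x j
    using De[of x] by (auto simp: differentiable_def partial_eqI[OF De] cart_eq_inner_axis)
  have ne: "norm (e x) = 1" for x by (simp add: e_def)
  have [measurable]: "e \<in> borel_measurable borel" unfolding e_def by measurable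
  have P: "partial j (\<lambda>x. e x * \<phi> x) = (\<lambda>x. e x * partial j \<phi> x - \<i> * complex_of_real (\<xi> $ j) * (e x * \<phi> x))" for j
    by (rule ext, subst partial_mult) (auto simp: e schwartz_differentiable \<phi>)
  note [measurable] = schwartz_measurable[OF \<phi>] schwartz_measurable[OF schwartz_partial[OF \<phi>]]
  have "\<exists>B. \<forall>x. (1 + norm x) ^ (2 * CARD('n)) * norm (partial j (\<lambda>x. e x * \<phi> x) x) \<le> B" for j
  proof -
    obtain B where B: "\<And>x. (1 + norm x) ^ (2 * CARD('n)) * norm (partial j \<phi> x) \<le> B"
      using schwartz_bound[OF schwartz_partial[OF \<phi>]] by blast
    obtain B' where B': "\<And>x. (1 + norm x) ^ (2 * CARD('n)) * norm (\<phi> x) \<le> B'"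
      using schwartz_bound[OF \<phi>] by blast
    have "(1 + norm x) ^ (2 * CARD('n)) * norm (partial j (\<lambda>x. e x * \<phi> x) x) \<le> B + \<bar>\<xi> $ j\<bar> * B'" for x
    proof -
      have "norm (partial j (\<lambda>x. e x * \<phi> x) x) \<le> norm (partial j \<phi> x) + \<bar>\<xi> $ j\<bar> * norm (\<phi> x)"
        unfolding P by (rule order_trans[OF norm_triangle_ineq4]) (simp add: norm_mult ne)
      then have "(1 + norm x) ^ (2 * CARD('n)) * norm (partial j (\<lambda>x. e x * \<phi> x) x)
          \<le> (1 + norm x) ^ (2 * CARD('n)) * (norm (partial j \<phi> x) + \<bar>\<xi> $ j\<bar> * norm (\<phi> x))"
        by (rule mult_left_mono) simp
      then show ?thesis using B[of x] mult_left_mono[OF B'[of x], of "\<bar>\<xi> $ j\<bar>"] by (simp add: algebra_simps)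
    qed
    then show ?thesis by blast
  qed
  then obtain B where B: "\<And>j x. (1 + norm x) ^ (2 * CARD('n)) * norm (partial j (\<lambda>x. e x * \<phi> x) x) \<le> B j"
    by metis
  have int: "integrable lborel (\<lambda>x. e x * \<psi> x)" if "\<psi> \<in> schwartz" for \<psi>
    by (rule integrable_mult_bounded[OF schwartz_integrable[OF that], where B = 1]) (auto simp: ne)
  have "(LINT x|lborel. partial i (\<lambda>x. e x * \<phi> x) x) = 0"
  proof (rule integral_partial_eq_0[OF _ int[OF \<phi>] B])
    show "(\<lambda>x. e x * \<phi> x) differentiable at x" for x
      using e(1) schwartz_differentiable[OF \<phi>] by (rule differentiable_mult)
    show "partial j (\<lambda>x. e x * \<phi> x) \<in> borel_measurable borel" for j
      unfolding P by measurable
  qed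
  then have "(LINT x|lborel. e x * partial i \<phi> x) = \<i> * complex_of_real (\<xi> $ i) * (LINT x|lborel. e x * \<phi> x)"
    unfolding P using int[OF \<phi>] int[OF schwartz_partial[OF \<phi>, of i]] by simp
  moreover have "(LINT x|lborel. e x * \<psi> x) = fourier \<psi> \<xi>" for \<psi>
    by (simp add: fourier_def e_def inner_commute)
  ultimately have "fourier (partial i \<phi>) \<xi> = \<i> * complex_of_real (\<xi> $ i) * fourier \<phi> \<xi>" by simp
  moreover have "fourier (\<lambda>x. - \<i> * partial i \<phi> x) \<xi> = - \<i> * fourier (partial i \<phi>) \<xi>"
    unfolding fourier_def by (subst integral_mult_right_zero[symmetric]) (simp add: algebra_simps)
  ultimately show ?thesis by (simp add: algebra_simps)
qed

text \<open>In the induction step one power of \<open>1 + norm \<xi>\<close> is bounded by 1 plus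
  the sum of the \<open>\<bar>\<xi> $ i\<bar>\<close>, and each coordinate factor becomes a
  derivative of \<open>\<phi>\<close>. The induction hypothesis must therefore cover all Schwartz
  functions at once.\<close>

lemma fourier_decay:
  fixes \<phi> :: "'n::finite test"
  assumes "\<phi> \<in> schwartz"
  shows "\<exists>B. \<forall>\<xi>. (1 + norm \<xi>) ^ k * norm (fourier \<phi> \<xi>) \<le> B"
  using assms
proof (induction k arbitrary: \<phi>)
  case 0
  then show ?case using norm_fourier_le by auto
next
  case (Suc k)
  have S: "(\<lambda>x. - \<i> * partial i \<phi> x) \<in> schwartz" for i
    using Suc.prems by (intro schwartz_cmult schwartz_partial)
  obtain B where B: "\<And>\<xi>. (1 + norm \<xi>) ^ k * norm (fourier \<phi> \<xi>) \<le> B" using Suc by blast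
  obtain B' where B': "\<And>i \<xi>. (1 + norm \<xi>) ^ k * norm (fourier (\<lambda>x. - \<i> * partial i \<phi> x) \<xi>) \<le> B' i"
    using Suc.IH[OF S] by metis
  have "(1 + norm \<xi>) ^ Suc k * norm (fourier \<phi> \<xi>) \<le> B + (\<Sum>i\<in>UNIV. B' i)" for \<xi>
  proof -
    have "norm \<xi> * norm (fourier \<phi> \<xi>) \<le> (\<Sum>i\<in>UNIV. \<bar>\<xi> $ i\<bar>) * norm (fourier \<phi> \<xi>)"
      by (intro mult_right_mono norm_le_l1_cart) simp
    also have "\<dots> = (\<Sum>i\<in>UNIV. norm (fourier (\<lambda>x. - \<i> * partial i \<phi> x) \<xi>))"
      unfolding fourier_partial[OF Suc.prems, symmetric] by (simp add: norm_mult sum_distrib_right)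
    finally have "(1 + norm \<xi>) ^ k * (norm \<xi> * norm (fourier \<phi> \<xi>)) \<le>
        (1 + norm \<xi>) ^ k * (\<Sum>i\<in>UNIV. norm (fourier (\<lambda>x. - \<i> * partial i \<phi> x) \<xi>))"
      by (rule mult_left_mono) simp
    also have "\<dots> \<le> (\<Sum>i\<in>UNIV. B' i)" unfolding sum_distrib_left by (intro sum_mono B')
    finally show ?thesis using B[of \<xi>] by (simp add: algebra_simps)
  qed
  then show ?case by blast
qed

lemma schwartz_fourier:
  assumes "\<phi> \<in> schwartz"
  shows "fourier \<phi> \<in> schwartz"
proof (rule schwartz_coinduct[where X = "fourier ` schwartz"])
  fix f i assume "f \<in> fourier ` schwartz"
  then obtain \<phi> where \<phi>: "f = fourier \<phi>" "\<phi> \<in> schwartz" by blast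
  show "partial i f \<in> fourier ` schwartz"
    unfolding \<phi>(1) partial_fourier[OF schwartz_rapid[OF \<phi>(2)]]
    by (intro imageI schwartz_cmult schwartz_coord_mult \<phi>(2))
qed (use assms in \<open>blast\<close>, auto simp: differentiable_fourier schwartz_rapid fourier_decay)

lemma inv_fourier_eq: "inv_fourier \<phi> x = 1 / (2 * pi) ^ CARD('n) * fourier \<phi> (- x)" for x :: "real^'n::finite"
  by (simp add: inv_fourier_def fourier_def inner_commute)

lemma schwartz_inv_fourier:
  fixes \<phi> :: "'n::finite test"
  assumes "\<phi> \<in> schwartz"
  shows "inv_fourier \<phi> \<in> schwartz"
proof -
  have "inv_fourier \<phi> = (\<lambda>x. (1 / (2 * pi) ^ CARD('n)) * fourier \<phi> (-1 *\<^sub>R x + 0))"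
    by (rule ext) (simp add: inv_fourier_eq)
  moreover have "\<dots> \<in> schwartz"
    by (intro schwartz_cmult schwartz_affine[of "fourier \<phi>" "-1" 0] schwartz_fourier assms) simp
  ultimately show ?thesis by simp
qed

lemma integrable_pair_mult:
  fixes f :: "'a::euclidean_space \<Rightarrow> complex" and g :: "'b::euclidean_space \<Rightarrow> complex"
  assumes f: "integrable lborel f" and g: "integrable lborel g"
  shows "integrable (lborel \<Otimes>\<^sub>M lborel) (\<lambda>(x, y). f x * g y)"
proof (rule lborel_pair.Fubini_integrable)
  note [measurable] = borel_measurable_integrable[OF f] borel_measurable_integrable[OF g]
  show "(\<lambda>(x, y). f x * g y) \<in> borel_measurable (lborel \<Otimes>\<^sub>M lborel)" by measurable
  show "integrable lborel (\<lambda>x. LINT y|lborel. norm (case (x, y) of (x, y) \<Rightarrow> f x * g y))"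
    using f by (simp add: norm_mult)
  show "AE x in lborel. integrable lborel (\<lambda>y. case (x, y) of (x, y) \<Rightarrow> f x * g y)"
    using g by simp
qed

text \<open>A convolution theorem obtained from Fubini alone. Since no inversion formula enters, it
  can serve in the proof of inversion.\<close>

lemma fourier_mult_inv_fourier:
  fixes \<phi> m :: "'n::finite test"
  assumes m: "integrable lborel m" and \<phi>: "integrable lborel \<phi>"
  shows "fourier (\<lambda>\<xi>. m \<xi> * inv_fourier \<phi> \<xi>) x
    = (LINT y|lborel. 1 / (2 * pi) ^ CARD('n) * fourier m (x - y) * \<phi> y)"
proof -
  note [measurable] = borel_measurable_integrable[OF m] borel_measurable_integrable[OF \<phi>]
  define c where "c = complex_of_real (1 / (2 * pi) ^ CARD('n))"
  have "integrable (lborel \<Otimes>\<^sub>M lborel) (\<lambda>z. cis (- (fst z \<bullet> x) + fst z \<bullet> snd z) * (case z of (\<xi>, y) \<Rightarrow> m \<xi> * \<phi> y))"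
    by (intro integrable_cis_mult integrable_pair_mult m \<phi>) measurable
  moreover have "(\<lambda>z. cis (- (fst z \<bullet> x) + fst z \<bullet> snd z) * (case z of (\<xi>, y) \<Rightarrow> m \<xi> * \<phi> y))
      = (\<lambda>(\<xi>, y). cis (- (\<xi> \<bullet> x)) * m \<xi> * (cis (\<xi> \<bullet> y) * \<phi> y))"
    by (rule ext) (simp only: split_def cis_mult[symmetric] mult_ac)
  ultimately have I: "integrable (lborel \<Otimes>\<^sub>M lborel) (\<lambda>(\<xi>, y). cis (- (\<xi> \<bullet> x)) * m \<xi> * (cis (\<xi> \<bullet> y) * \<phi> y))"
    by simp
  have cis: "cis (- (\<xi> \<bullet> (x - y))) = cis (- (\<xi> \<bullet> x)) * cis (\<xi> \<bullet> y)" for \<xi> y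
    by (simp add: cis_mult inner_diff_right)
  have "fourier (\<lambda>\<xi>. m \<xi> * inv_fourier \<phi> \<xi>) x
      = (LINT \<xi>|lborel. c * (cis (- (\<xi> \<bullet> x)) * m \<xi> * (LINT y|lborel. cis (\<xi> \<bullet> y) * \<phi> y)))"
    unfolding fourier_def inv_fourier_def c_def
    by (intro Bochner_Integration.integral_cong refl) simp
  also have "\<dots> = c * (LINT \<xi>|lborel. (LINT y|lborel. cis (- (\<xi> \<bullet> x)) * m \<xi> * (cis (\<xi> \<bullet> y) * \<phi> y)))"
    by simp
  also have "\<dots> = c * (LINT y|lborel. (LINT \<xi>|lborel. cis (- (\<xi> \<bullet> x)) * m \<xi> * (cis (\<xi> \<bullet> y) * \<phi> y)))"
    using lborel_pair.Fubini_integral[OF I] by simp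
  also have "\<dots> = c * (LINT y|lborel. (LINT \<xi>|lborel. cis (- (\<xi> \<bullet> (x - y))) * m \<xi>) * \<phi> y)"
    unfolding cis by (simp only: integral_mult_left_zero[symmetric] mult_ac, simp)
  also have "\<dots> = (LINT y|lborel. c * fourier m (x - y) * \<phi> y)"
    by (simp add: fourier_def mult.assoc)
  finally show ?thesis by (simp add: c_def)
qed

section \<open>Gaussians, dilations and Fourier inversion\<close>

text \<open>The characteristic function of the standard normal distribution, rescaled by
  \<open>sqrt t\<close>.\<close>

lemma gaussian_fourier_real:
  assumes t: "t > 0"
  shows "integrable lborel (\<lambda>s. cis (- (s * a)) * complex_of_real (exp (- (t * s\<^sup>2 / 2))))"
    and "(LINT s|lborel. cis (- (s * a)) * complex_of_real (exp (- (t * s\<^sup>2 / 2))))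
      = complex_of_real (sqrt (2 * pi / t) * exp (- (a\<^sup>2 / (2 * t))))"
proof -
  have g: "integrable lborel std_normal_density"
    by (simp add: integrable_normal_density)
  define f where "f s = cis (- (s * a)) * complex_of_real (exp (- (t * s\<^sup>2 / 2)))" for s
  have [measurable]: "f \<in> borel_measurable borel" unfolding f_def by measurable
  have sq: "(s / sqrt t)\<^sup>2 * t = s\<^sup>2" for s using t by (simp add: power_divide)
  have f: "f (0 + (1 / sqrt t) *\<^sub>R s) = complex_of_real (sqrt (2 * pi)) * (std_normal_density s *\<^sub>R iexp ((- a / sqrt t) * s))" for s
    using sq[of s] by (simp add: f_def std_normal_density_def cis_conv_exp scaleR_conv_of_real algebra_simps)
  have i: "integrable lborel (\<lambda>s. std_normal_density s *\<^sub>R iexp ((- a / sqrt t) * s))"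
    by (rule Bochner_Integration.integrable_bound[OF g]) auto
  have "integrable lborel (\<lambda>s. f (0 + (1 / sqrt t) *\<^sub>R s))"
    unfolding f by (rule integrable_mult_right[OF i])
  then show "integrable lborel f"
    using integrable_lborel_affine_iff[of f "1 / sqrt t" 0] t by simp
  have "(LINT s|lborel. std_normal_density s *\<^sub>R iexp ((- a / sqrt t) * s)) = char std_normal_distribution (- a / sqrt t)"
    unfolding char_def by (subst integral_density) auto
  also have "\<dots> = complex_of_real (exp (- (a\<^sup>2 / (2 * t))))"
    unfolding char_std_normal_distribution using t by (simp add: power_divide)
  finally have c: "(LINT s|lborel. std_normal_density s *\<^sub>R iexp ((- a / sqrt t) * s)) = complex_of_real (exp (- (a\<^sup>2 / (2 * t))))" .
  have "integral\<^sup>L lborel f = (1 / sqrt t) *\<^sub>R (LINT s|lborel. f (0 + (1 / sqrt t) *\<^sub>R s))"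
    using integral_lborel_affine[of f "1 / sqrt t" 0] t by simp
  also have "\<dots> = (1 / sqrt t) *\<^sub>R (complex_of_real (sqrt (2 * pi)) * complex_of_real (exp (- (a\<^sup>2 / (2 * t)))))"
    by (simp only: f c[symmetric] integral_mult_right_zero)
  also have "\<dots> = complex_of_real (sqrt (2 * pi / t) * exp (- (a\<^sup>2 / (2 * t))))"
    using t by (simp add: real_sqrt_divide scaleR_conv_of_real)
  finally show "integral\<^sup>L lborel f = complex_of_real (sqrt (2 * pi / t) * exp (- (a\<^sup>2 / (2 * t))))" .
qed

text \<open>Gaussian and character both factor over \<open>Basis\<close>. Expressing the transform
  through \<open>heat_kernel\<close> identifies convolution with the heat kernel as the multiplier
  \<open>exp (- (t * (norm \<xi>)\<^sup>2 / 2))\<close>.\<close>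

lemma
  fixes \<xi> :: "real^'n::finite"
  assumes t: "t > 0"
  shows integrable_gaussian: "integrable lborel (\<lambda>x::real^'n. complex_of_real (exp (- (t * (norm x)\<^sup>2 / 2))))"
    and fourier_gaussian: "fourier (\<lambda>x. complex_of_real (exp (- (t * (norm x)\<^sup>2 / 2)))) \<xi>
      = complex_of_real ((2 * pi) ^ CARD('n) * heat_kernel t \<xi>)"
proof -
  let ?f = "\<lambda>b s. cis (- (s * (\<xi> \<bullet> b))) * complex_of_real (exp (- (t * s\<^sup>2 / 2)))"
  have cis_sum: "cis (\<Sum>b\<in>A. h b) = (\<Prod>b\<in>A. cis (h b))" if "finite A" for A and h :: "real^'n \<Rightarrow> real"
    using that by (induction A) (auto simp: cis_mult[symmetric] simp del: cis_mult)
  have nrm: "(norm x)\<^sup>2 = (\<Sum>b\<in>Basis. (x \<bullet> b)\<^sup>2)" for x :: "real^'n"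
    unfolding power2_norm_eq_inner by (subst euclidean_inner) (simp add: power2_eq_square)
  have e: "exp (- (c * (norm x)\<^sup>2)) = (\<Prod>b\<in>Basis. exp (- (c * (x \<bullet> b)\<^sup>2)))" for x :: "real^'n" and c
    unfolding nrm by (simp add: exp_sum sum_distrib_left flip: sum_negf)
  have eq: "(\<Prod>b\<in>Basis. ?f b (x \<bullet> b)) = cis (- (x \<bullet> \<xi>)) * complex_of_real (exp (- (t * (norm x)\<^sup>2 / 2)))" for x :: "real^'n"
  proof -
    have "cis (- (x \<bullet> \<xi>)) = (\<Prod>b\<in>Basis. cis (- ((x \<bullet> b) * (\<xi> \<bullet> b))))"
      by (subst euclidean_inner) (simp add: cis_sum flip: sum_negf)
    moreover have "exp (- (t * (norm x)\<^sup>2 / 2)) = (\<Prod>b\<in>Basis. exp (- (t * (x \<bullet> b)\<^sup>2 / 2)))"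
      using e[of "t / 2" x] by simp
    ultimately show ?thesis by (simp add: prod.distrib)
  qed
  have "integrable lborel (\<lambda>x. \<Prod>b\<in>Basis. ?f b ((x::real^'n) \<bullet> b))"
    by (rule integrable_lborel_prod) (rule gaussian_fourier_real[OF t])
  then have "integrable lborel (\<lambda>x::real^'n. norm (cis (- (x \<bullet> \<xi>)) * complex_of_real (exp (- (t * (norm x)\<^sup>2 / 2)))))"
    unfolding eq by (rule integrable_norm)
  then show "integrable lborel (\<lambda>x::real^'n. complex_of_real (exp (- (t * (norm x)\<^sup>2 / 2))))"
    by (simp add: norm_mult)
  have "fourier (\<lambda>x. complex_of_real (exp (- (t * (norm x)\<^sup>2 / 2)))) \<xi> = (LINT x|lborel. (\<Prod>b\<in>Basis. ?f b ((x::real^'n) \<bullet> b)))"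
    by (simp add: eq fourier_def)
  also have "\<dots> = (\<Prod>b\<in>Basis. complex_of_real (sqrt (2 * pi / t) * exp (- ((\<xi> \<bullet> b)\<^sup>2 / (2 * t)))))"
    by (subst integral_lborel_prod) (use gaussian_fourier_real[OF t] in auto)
  also have "\<dots> = complex_of_real (sqrt (2 * pi / t) ^ CARD('n) * exp (- ((norm \<xi>)\<^sup>2 / (2 * t))))"
    using e[of "1 / (2 * t)" \<xi>] by (simp add: prod.distrib)
  also have "sqrt (2 * pi / t) ^ CARD('n) = (2 * pi) ^ CARD('n) * (2 * pi * t) powr (- real CARD('n) / 2)"
  proof -
    have "sqrt (2 * pi / t) = (2 * pi) * (2 * pi * t) powr (- 1 / 2)"
      using t by (simp add: powr_minus powr_half_sqrt real_sqrt_divide real_sqrt_mult field_simps)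
    then have "sqrt (2 * pi / t) ^ CARD('n) = (2 * pi) ^ CARD('n) * ((2 * pi * t) powr (- 1 / 2)) ^ CARD('n)"
      by (simp add: power_mult_distrib)
    also have "((2 * pi * t) powr (- 1 / 2)) ^ CARD('n) = (2 * pi * t) powr (- real CARD('n) / 2)"
      using t by (simp add: powr_power)
    finally show ?thesis .
  qed
  finally show "fourier (\<lambda>x. complex_of_real (exp (- (t * (norm x)\<^sup>2 / 2)))) \<xi>
      = complex_of_real ((2 * pi) ^ CARD('n) * heat_kernel t \<xi>)"
    by (simp add: heat_kernel_def)
qed

text \<open>Up to its normalising constant the heat kernel at time \<open>t\<close> is the Gaussian
  with parameter \<open>1 / t\<close>, and the integral of that Gaussian is its transform at the
  origin.\<close>

lemma integral_heat_kernel: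
  assumes t: "t > 0"
  shows "(LINT x|lborel. complex_of_real (heat_kernel t (x::real^'n::finite))) = 1"
proof -
  have "fourier (\<lambda>x. complex_of_real (exp (- ((1 / t) * (norm x)\<^sup>2 / 2)))) (0::real^'n)
      = complex_of_real ((2 * pi) ^ CARD('n) * heat_kernel (1 / t) (0::real^'n))"
    using t by (intro fourier_gaussian) simp
  then have I: "(LINT x|lborel. complex_of_real (exp (- (norm (x::real^'n))\<^sup>2 / (2 * t))))
      = complex_of_real ((2 * pi) ^ CARD('n) * (2 * pi / t) powr (- real CARD('n) / 2))"
    by (simp add: fourier_def heat_kernel_def mult.commute)
  have "(2 * pi * t) powr (- real CARD('n) / 2) * (2 * pi / t) powr (- real CARD('n) / 2)
      = ((2 * pi)\<^sup>2) powr (- real CARD('n) / 2)"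
    using t by (subst powr_mult[symmetric]) (auto simp: power2_eq_square)
  also have "\<dots> = (2 * pi) powr (- real CARD('n))"
    by (subst powr_numeral[symmetric], simp, subst powr_powr) simp
  also have "\<dots> = 1 / (2 * pi) ^ CARD('n)"
    by (simp add: powr_minus powr_realpow divide_inverse)
  finally have *: "(2 * pi * t) powr (- real CARD('n) / 2) * (2 * pi / t) powr (- real CARD('n) / 2)
      = 1 / (2 * pi) ^ CARD('n)" .
  have "(LINT x|lborel. complex_of_real (heat_kernel t (x::real^'n)))
      = complex_of_real ((2 * pi * t) powr (- real CARD('n) / 2)) * complex_of_real ((2 * pi) ^ CARD('n) * (2 * pi / t) powr (- real CARD('n) / 2))"
    unfolding I[symmetric] heat_kernel_def by simp
  also have "\<dots> = complex_of_real ((2 * pi) ^ CARD('n) * ((2 * pi * t) powr (- real CARD('n) / 2) * (2 * pi / t) powr (- real CARD('n) / 2)))"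
    by simp
  also have "\<dots> = 1" unfolding * by simp
  finally show ?thesis .
qed

lemma rapid_heat_kernel: "rapid (\<lambda>x::real^'n::finite. complex_of_real (heat_kernel t x))" if t: "t > 0"
proof (rule rapidI_bound)
  show "(\<lambda>x::real^'n. complex_of_real (heat_kernel t x)) \<in> borel_measurable borel"
    unfolding heat_kernel_def by measurable
  fix k
  define c where "c = (2 * pi * t) powr (- real CARD('n) / 2)"
  have "(1 + norm x) ^ k * norm (complex_of_real (heat_kernel t x)) \<le> c * (fact k * exp (1 + t / 2))" for x :: "real^'n"
  proof -
    define r where "r = norm x"
    have r: "r \<ge> 0" by (simp add: r_def)
    have "(1 + r) ^ k / fact k \<le> exp (1 + r)"
      using sum_le_suminf[OF summable_exp_generic[of "1 + r"], of "{k}"] r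
      by (simp add: exp_def scaleR_conv_of_real divide_inverse mult.commute)
    then have 1: "(1 + r) ^ k \<le> fact k * exp (1 + r)" by (simp add: field_simps)
    \<comment> \<open>This is \<open>(r - t)\<^sup>2 \<ge> 0\<close>. It replaces the Gaussian by
      \<open>exp (t / 2 - r)\<close>, which absorbs the factor \<open>exp (1 + r)\<close> bounding
      the polynomial.\<close>
    have "r - t / 2 \<le> r\<^sup>2 / (2 * t)"
      using t zero_le_power2[of "r - t"] by (simp add: field_simps power2_eq_square)
    then have 2: "exp (- (r\<^sup>2 / (2 * t))) \<le> exp (t / 2 - r)" by simp
    have "(1 + r) ^ k * exp (- (r\<^sup>2 / (2 * t))) \<le> (fact k * exp (1 + r)) * exp (t / 2 - r)"
      using r by (intro mult_mono 1 2) auto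
    also have "\<dots> = fact k * exp (1 + t / 2)" by (simp add: exp_add[symmetric] mult.assoc)
    finally have "c * ((1 + r) ^ k * exp (- (r\<^sup>2 / (2 * t)))) \<le> c * (fact k * exp (1 + t / 2))"
      by (rule mult_left_mono) (simp add: c_def)
    then show ?thesis by (simp add: heat_kernel_def c_def r_def norm_mult algebra_simps)
  qed
  then show "\<exists>B. \<forall>x::real^'n. (1 + norm x) ^ k * norm (complex_of_real (heat_kernel t x)) \<le> B" by blast
qed

text \<open>Scaling that preserves the integral and concentrates at the origin as \<open>c\<close>
  grows. Heat kernels arise with \<open>c = 1 / sqrt t\<close>, the kernels of the dyadic blocks
  with powers of 2.\<close>

definition dilate :: "real \<Rightarrow> (real^'n::finite \<Rightarrow> complex) \<Rightarrow> real^'n \<Rightarrow> complex" where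
  "dilate c f x = complex_of_real (c ^ CARD('n)) * f (c *\<^sub>R x)"

lemma
  fixes g :: "real^'n::finite \<Rightarrow> 'b::{banach, second_countable_topology}"
  assumes [measurable]: "g \<in> borel_measurable borel" and c: "c > 0"
  shows integral_dilate: "(LINT x|lborel. c ^ CARD('n) *\<^sub>R g (c *\<^sub>R x)) = integral\<^sup>L lborel g"
    and integrable_dilate: "integrable lborel (\<lambda>x. c ^ CARD('n) *\<^sub>R g (c *\<^sub>R x)) \<longleftrightarrow> integrable lborel g"
proof -
  show "(LINT x|lborel. c ^ CARD('n) *\<^sub>R g (c *\<^sub>R x)) = integral\<^sup>L lborel g"
    using integral_lborel_affine[of g c 0] c by simp
  have "integrable lborel (\<lambda>x. c ^ CARD('n) *\<^sub>R g (c *\<^sub>R x)) \<longleftrightarrow> integrable lborel (\<lambda>x. g (0 + c *\<^sub>R x))"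
    using c integrable_scaleR_right[of "1 / c ^ CARD('n)" lborel "\<lambda>x. c ^ CARD('n) *\<^sub>R g (0 + c *\<^sub>R x)"]
    by auto
  also have "\<dots> \<longleftrightarrow> integrable lborel g"
    using c by (intro integrable_lborel_affine_iff) auto
  finally show "integrable lborel (\<lambda>x. c ^ CARD('n) *\<^sub>R g (c *\<^sub>R x)) \<longleftrightarrow> integrable lborel g" .
qed

lemma one_plus_div_le: "1 + r / c \<le> (1 + 1 / c) * (1 + r)" if "c > 0" "r \<ge> 0" for r c :: real
  using that by (simp add: field_simps)

lemma dilate_measurable [measurable]:
  assumes [measurable]: "f \<in> borel_measurable borel"
  shows "dilate c f \<in> borel_measurable borel"
  unfolding dilate_def by measurable

lemma
  fixes f :: "real^'n::finite \<Rightarrow> complex"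
  assumes f: "rapid f" and c: "c > 0"
  shows rapid_dilate: "rapid (dilate c f)"
    and moment_dilate: "moment k (dilate c f) \<le> (1 + 1 / c) ^ k * moment k f"
    and integral_dilate_complex: "integral\<^sup>L lborel (dilate c f) = integral\<^sup>L lborel f"
proof -
  note [measurable] = rapid_measurable[OF f]
  define g where "g k x = (1 + norm x / c) ^ k * norm (f x)" for k x
  have [measurable]: "g k \<in> borel_measurable borel" for k unfolding g_def by measurable
  have g0: "g k x \<ge> 0" for k x using c by (simp add: g_def)
  have eq: "(1 + norm x) ^ k * norm (dilate c f x) = c ^ CARD('n) *\<^sub>R g k (c *\<^sub>R x)" for x k
    using c by (simp add: g_def dilate_def norm_mult norm_power)
  have gle: "g k x \<le> (1 + 1 / c) ^ k * ((1 + norm x) ^ k * norm (f x))" for k x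
  proof -
    have "(1 + norm x / c) ^ k \<le> ((1 + 1 / c) * (1 + norm x)) ^ k"
      using c by (intro power_mono one_plus_div_le) auto
    then show ?thesis unfolding g_def by (simp add: power_mult_distrib mult_right_mono flip: mult.assoc)
  qed
  have int_bd: "integrable lborel (\<lambda>x. (1 + 1 / c) ^ k * ((1 + norm x) ^ k * norm (f x)))" for k
    by (intro integrable_mult_right rapid_moment_integrable f)
  have int_g: "integrable lborel (g k)" for k
    by (rule Bochner_Integration.integrable_bound[OF int_bd[of k]], simp,
        rule AE_I2, simp only: real_norm_def abs_of_nonneg[OF g0], rule order_trans[OF gle abs_ge_self])
  show "rapid (dilate c f)"
    unfolding rapid_def
  proof
    fix k
    have "integrable lborel (\<lambda>x. (1 + norm x) ^ k * norm (dilate c f x))"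
      unfolding eq using int_g c by (subst integrable_dilate) auto
    then show "integrable lborel (\<lambda>x. (1 + norm x) ^ k *\<^sub>R dilate c f x)"
      by (subst integrable_norm_iff[symmetric]) (auto simp: power_abs)
  qed
  have "moment k (dilate c f) = integral\<^sup>L lborel (g k)"
    unfolding moment_def eq using c by (intro integral_dilate) auto
  also have "\<dots> \<le> (LINT x|lborel. (1 + 1 / c) ^ k * ((1 + norm x) ^ k * norm (f x)))"
    by (intro integral_mono int_g int_bd gle)
  finally show "moment k (dilate c f) \<le> (1 + 1 / c) ^ k * moment k f" by (simp add: moment_def)
  have "dilate c f = (\<lambda>x. c ^ CARD('n) *\<^sub>R f (c *\<^sub>R x))"
    by (rule ext) (simp add: dilate_def scaleR_conv_of_real[where 'a=complex])
  then show "integral\<^sup>L lborel (dilate c f) = integral\<^sup>L lborel f"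
    using integral_dilate[of f c] c by simp
qed

text \<open>The factor \<open>norm x\<close> records the displacement in the mean value inequality.
  Unlike \<open>moment\<close>, this quantity gains \<open>1 / c\<close> under
  \<open>dilate c\<close>, which is the source of the convergence rates of approximate identities
  and of the gain in the paraproduct.\<close>

definition shift_moment :: "nat \<Rightarrow> (real^'n::finite \<Rightarrow> complex) \<Rightarrow> real" where
  "shift_moment k f = (LINT x|lborel. norm x * (1 + norm x) ^ k * norm (f x))"

lemma shift_moment_integrable:
  assumes "rapid f"
  shows "integrable lborel (\<lambda>x. norm x * (1 + norm x) ^ k * norm (f x))"
proof (rule Bochner_Integration.integrable_bound[OF rapid_moment_integrable[OF assms, of "Suc k"]])
  note [measurable] = rapid_measurable[OF assms]
  show "(\<lambda>x. norm x * (1 + norm x) ^ k * norm (f x)) \<in> borel_measurable lborel" by measurable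
qed (auto intro!: AE_I2 mult_right_mono simp: abs_mult power_abs)

lemma shift_moment_nonneg: "shift_moment k f \<ge> 0"
  unfolding shift_moment_def by (intro integral_nonneg_AE) simp

lemma shift_moment_dilate:
  fixes f :: "real^'n::finite \<Rightarrow> complex"
  assumes f: "rapid f" and c: "c > 0"
  shows "shift_moment k (dilate c f) \<le> 1 / c * (1 + 1 / c) ^ k * shift_moment k f"
proof -
  note [measurable] = rapid_measurable[OF f]
  define g where "g x = norm x / c * (1 + norm x / c) ^ k * norm (f x)" for x
  have [measurable]: "g \<in> borel_measurable borel" unfolding g_def by measurable
  have g0: "g x \<ge> 0" for x using c by (simp add: g_def)
  have eq: "norm x * (1 + norm x) ^ k * norm (dilate c f x) = c ^ CARD('n) *\<^sub>R g (c *\<^sub>R x)" for x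
    using c by (simp add: g_def dilate_def norm_mult norm_power)
  have gle: "g x \<le> (1 / c * (1 + 1 / c) ^ k) * (norm x * (1 + norm x) ^ k * norm (f x))" for x
  proof -
    have "(1 + norm x / c) ^ k \<le> ((1 + 1 / c) * (1 + norm x)) ^ k"
      using c by (intro power_mono one_plus_div_le) auto
    then have "norm x / c * (1 + norm x / c) ^ k * norm (f x) \<le> norm x / c * ((1 + 1 / c) * (1 + norm x)) ^ k * norm (f x)"
      using c by (intro mult_right_mono mult_left_mono) auto
    then show ?thesis unfolding g_def by (simp add: power_mult_distrib mult_ac)
  qed
  have int_bd: "integrable lborel (\<lambda>x. (1 / c * (1 + 1 / c) ^ k) * (norm x * (1 + norm x) ^ k * norm (f x)))"
    by (intro integrable_mult_right shift_moment_integrable f)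
  have int_g: "integrable lborel g"
    by (rule Bochner_Integration.integrable_bound[OF int_bd], simp,
        rule AE_I2, simp only: real_norm_def abs_of_nonneg[OF g0], rule order_trans[OF gle abs_ge_self])
  have "shift_moment k (dilate c f) = integral\<^sup>L lborel g"
    unfolding shift_moment_def eq using c by (intro integral_dilate) auto
  also have "\<dots> \<le> (LINT x|lborel. (1 / c * (1 + 1 / c) ^ k) * (norm x * (1 + norm x) ^ k * norm (f x)))"
    by (intro integral_mono int_g int_bd gle)
  finally show ?thesis by (simp add: shift_moment_def)
qed

text \<open>Subtracting the total mass times \<open>h x\<close> leaves the integral of
  \<open>(h (x - y) - h x) * f y\<close>. Mass 1 gives the error of an approximate identity; mass 0
  bounds the convolution itself, as needed for band-pass kernels.\<close>

lemma conv_shift_bound: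
  fixes h f :: "'n::finite test"
  assumes h: "\<And>x y. (1 + norm x) ^ k * norm (h (x - y) - h x) \<le> B * norm y * (1 + norm y) ^ k"
    and m [measurable]: "h \<in> borel_measurable borel" and M: "\<And>x. norm (h x) \<le> M" and f: "rapid f"
  shows "(1 + norm x) ^ k * norm (conv h f x - integral\<^sup>L lborel f * h x) \<le> B * shift_moment k f"
proof -
  note [measurable] = rapid_measurable[OF f]
  have i1: "integrable lborel (\<lambda>y. h (x - y) * f y)"
    by (rule integrable_mult_bounded[OF rapid_integrable[OF f] _ M]) simp
  have i2: "integrable lborel (\<lambda>y. h x * f y)" using rapid_integrable[OF f] by simp
  have i: "integrable lborel (\<lambda>y. (h (x - y) - h x) * f y)"
    using i1 i2 by (simp add: left_diff_distrib)
  have "conv h f x - integral\<^sup>L lborel f * h x = (LINT y|lborel. (h (x - y) - h x) * f y)"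
  proof -
    have "integral\<^sup>L lborel f * h x = (LINT y|lborel. h x * f y)" by (simp add: mult.commute)
    then show ?thesis unfolding conv_def left_diff_distrib
      by (simp only: Bochner_Integration.integral_diff[OF i1 i2])
  qed
  then have "(1 + norm x) ^ k * norm (conv h f x - integral\<^sup>L lborel f * h x)
      \<le> (1 + norm x) ^ k * (LINT y|lborel. norm ((h (x - y) - h x) * f y))"
    by (simp add: mult_left_mono)
  also have "\<dots> = (LINT y|lborel. (1 + norm x) ^ k * norm ((h (x - y) - h x) * f y))" by simp
  also have "\<dots> \<le> (LINT y|lborel. B * (norm y * (1 + norm y) ^ k * norm (f y)))"
  proof (rule integral_mono)
    show "integrable lborel (\<lambda>y. (1 + norm x) ^ k * norm ((h (x - y) - h x) * f y))"
      using i by (intro integrable_mult_right integrable_norm)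
    show "integrable lborel (\<lambda>y. B * (norm y * (1 + norm y) ^ k * norm (f y)))"
      by (intro integrable_mult_right shift_moment_integrable f)
    show "(1 + norm x) ^ k * norm ((h (x - y) - h x) * f y) \<le> B * (norm y * (1 + norm y) ^ k * norm (f y))" for y
      using mult_right_mono[OF h[of x y], of "norm (f y)"] by (simp add: norm_mult mult_ac)
  qed
  finally show ?thesis by (simp add: shift_moment_def)
qed

lemma conv_approx_bound:
  fixes \<phi> f :: "'n::finite test"
  assumes B: "\<And>x y. (1 + norm x) ^ k * norm (\<phi> (x - y) - \<phi> x) \<le> B * norm y * (1 + norm y) ^ k"
    and \<phi>: "\<phi> \<in> schwartz" and f: "rapid f" "integral\<^sup>L lborel f = 1"
  shows "(1 + norm x) ^ k * norm (conv \<phi> f x - \<phi> x) \<le> B * shift_moment k f"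
proof -
  obtain M where M: "\<And>x. norm (\<phi> x) \<le> M" using schwartz_bounded[OF \<phi>] by blast
  show ?thesis using conv_shift_bound[OF B schwartz_measurable[OF \<phi>] M f(1), of x] by (simp add: f(2))
qed

text \<open>The mean value inequality takes one derivative more than the left-hand side, hence the
  order \<open>Suc k\<close>.\<close>

lemma schwartz_seminorm_translate_diff:
  fixes \<phi> :: "'n::finite test"
  assumes \<phi>: "\<phi> \<in> schwartz" and ds: "length ds \<le> k"
  shows "(1 + norm x) ^ k * norm (partials ds \<phi> (x - y) - partials ds \<phi> x)
      \<le> (CARD('n) * schwartz_seminorm (Suc k) \<phi>) * norm y * (1 + norm y) ^ k"
proof (rule translate_diff_bound)
  show "partials ds \<phi> differentiable at x" for x
    by (intro schwartz_differentiable schwartz_partials \<phi>)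
  fix i and z :: "real^'n"
  have "(1 + norm z) ^ k * norm (partial i (partials ds \<phi>) z) \<le> (1 + norm z) ^ Suc k * norm (partials (i # ds) \<phi> z)"
    unfolding partials_Cons by (intro mult_right_mono power_increasing) auto
  also have "\<dots> \<le> schwartz_seminorm (Suc k) \<phi>" using ds by (intro schwartz_seminorm_ge \<phi>) simp
  finally show "(1 + norm z) ^ k * norm (partial i (partials ds \<phi>) z) \<le> schwartz_seminorm (Suc k) \<phi>" .
qed

lemma schwartz_seminorm_conv_approx:
  fixes \<phi> f :: "'n::finite test"
  assumes \<phi>: "\<phi> \<in> schwartz" and f: "rapid f" "integral\<^sup>L lborel f = 1"
  shows "schwartz_seminorm k (\<lambda>x. conv \<phi> f x - \<phi> x) \<le> CARD('n) * schwartz_seminorm (Suc k) \<phi> * shift_moment k f"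
proof (rule schwartz_seminorm_le)
  fix x :: "real^'n" and ds :: "'n list" assume ds: "length ds \<le> k"
  show "(1 + norm x) ^ k * norm (partials ds (\<lambda>x. conv \<phi> f x - \<phi> x) x)
      \<le> CARD('n) * schwartz_seminorm (Suc k) \<phi> * shift_moment k f"
    unfolding partials_diff[OF schwartz_conv[OF \<phi> f(1)] \<phi>] partials_conv[OF \<phi> f(1)]
    by (intro conv_approx_bound schwartz_seminorm_translate_diff \<phi> ds f schwartz_partials)
qed

section \<open>Heat kernel as approximate identity and Fourier inversion\<close>

lemma heat_kernel_eq_dilate:
  fixes x :: "real^'n::finite"
  assumes t: "t > 0"
  shows "complex_of_real (heat_kernel t x) = dilate (1 / sqrt t) (\<lambda>x. complex_of_real (heat_kernel 1 x)) x"
proof -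
  have "(2 * pi * t) powr (- real CARD('n) / 2) = (2 * pi) powr (- real CARD('n) / 2) * (1 / sqrt t) ^ CARD('n)"
  proof -
    have "t powr (- real CARD('n) / 2) = (t powr (- (1 / 2))) ^ CARD('n)"
      using t by (simp add: powr_power)
    also have "t powr (- (1 / 2)) = 1 / sqrt t"
      using t by (simp add: powr_minus powr_half_sqrt inverse_eq_divide)
    finally show ?thesis using t by (simp add: powr_mult)
  qed
  moreover have "norm ((1 / sqrt t) *\<^sub>R x) ^ 2 = norm x ^ 2 / t"
    using t by (simp add: power_mult_distrib power_divide)
  ultimately show ?thesis by (simp add: heat_kernel_def dilate_def mult_ac del: norm_scaleR)
qed

lemma heat_eq_conv:
  assumes \<phi>: "\<phi> \<in> schwartz" and t: "t > 0"
  shows "heat t \<phi> = conv \<phi> (\<lambda>x. complex_of_real (heat_kernel t x))"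
proof -
  have "heat t \<phi> = conv (\<lambda>x. complex_of_real (heat_kernel t x)) \<phi>"
    using t by (simp add: fun_eq_iff heat_def conv_def)
  then show ?thesis
    using conv_commute[OF rapid_measurable[OF rapid_heat_kernel[OF t]] schwartz_measurable[OF \<phi>]] by simp
qed

lemma heat_eq_fourier_multiplier:
  fixes \<phi> :: "'n::finite test"
  assumes \<phi>: "\<phi> \<in> schwartz" and t: "t > 0"
  shows "heat t \<phi> x = fourier (\<lambda>\<xi>. complex_of_real (exp (- (t * (norm \<xi>)\<^sup>2 / 2))) * inv_fourier \<phi> \<xi>) x"
  using t unfolding fourier_mult_inv_fourier[OF integrable_gaussian[OF t] schwartz_integrable[OF \<phi>]] fourier_gaussian[OF t]
  by (simp add: heat_def)

text \<open>The limit of \<open>heat t \<phi> x\<close> as \<open>t\<close> tends to 0 is computed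
  twice: as a convolution with an approximate identity it is \<open>\<phi> x\<close>, as a Fourier
  multiplier it tends by dominated convergence to
  \<open>fourier (inv_fourier \<phi>) x\<close>.\<close>

lemma fourier_inv_fourier:
  fixes \<phi> :: "'n::finite test"
  assumes \<phi>: "\<phi> \<in> schwartz"
  shows "fourier (inv_fourier \<phi>) = \<phi>"
proof
  fix x
  define t where "t n = inverse (real (Suc n))" for n
  have t: "t n > 0" for n by (simp add: t_def)
  have t0: "t \<longlonglongrightarrow> 0" unfolding t_def[abs_def] by (rule LIMSEQ_inverse_real_of_nat)
  define h where "h = (\<lambda>x::real^'n. complex_of_real (heat_kernel 1 x))"
  have h: "rapid h" unfolding h_def by (rule rapid_heat_kernel) simp
  obtain B where B: "B \<ge> 0" "\<And>x y. (1 + norm x) ^ 0 * norm (\<phi> (x - y) - \<phi> x) \<le> B * norm y * (1 + norm y) ^ 0"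
    using schwartz_translate_diff[OF \<phi>] by metis
  have "norm (heat (t n) \<phi> x - \<phi> x) \<le> B * (sqrt (t n) * shift_moment 0 h)" for n
  proof -
    have hk: "(\<lambda>x::real^'n. complex_of_real (heat_kernel (t n) x)) = dilate (1 / sqrt (t n)) h"
      unfolding h_def using heat_kernel_eq_dilate[OF t] by blast
    have "norm (heat (t n) \<phi> x - \<phi> x) \<le> B * shift_moment 0 (dilate (1 / sqrt (t n)) h)"
      using conv_approx_bound[OF B(2) \<phi> rapid_heat_kernel[OF t[of n]] integral_heat_kernel[OF t[of n]], of x]
      unfolding heat_eq_conv[OF \<phi> t[of n]] hk by simp
    also have "\<dots> \<le> B * (sqrt (t n) * shift_moment 0 h)"
      using shift_moment_dilate[OF h, of "1 / sqrt (t n)" 0] t B(1) by (intro mult_left_mono) auto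
    finally show ?thesis .
  qed
  note bound = this
  have "(\<lambda>n. B * (sqrt (t n) * shift_moment 0 h)) \<longlonglongrightarrow> B * (sqrt 0 * shift_moment 0 h)"
    by (intro tendsto_intros t0)
  then have "(\<lambda>n. B * (sqrt (t n) * shift_moment 0 h)) \<longlonglongrightarrow> 0" by simp
  with always_eventually[OF allI[OF bound]] have "(\<lambda>n. heat (t n) \<phi> x - \<phi> x) \<longlonglongrightarrow> 0"
    by (rule Lim_null_comparison)
  then have 1: "(\<lambda>n. heat (t n) \<phi> x) \<longlonglongrightarrow> \<phi> x" by (simp add: LIM_zero_iff)
  note [measurable] = schwartz_measurable[OF schwartz_inv_fourier[OF \<phi>]]
  have "(\<lambda>n. LINT \<xi>|lborel. cis (- (\<xi> \<bullet> x)) * (complex_of_real (exp (- (t n * (norm \<xi>)\<^sup>2 / 2))) * inv_fourier \<phi> \<xi>))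
      \<longlonglongrightarrow> (LINT \<xi>|lborel. cis (- (\<xi> \<bullet> x)) * inv_fourier \<phi> \<xi>)"
  proof (rule integral_dominated_convergence[where w = "\<lambda>\<xi>. norm (inv_fourier \<phi> \<xi>)"])
    show "integrable lborel (\<lambda>\<xi>. norm (inv_fourier \<phi> \<xi>))"
      by (intro integrable_norm schwartz_integrable schwartz_inv_fourier \<phi>)
    show "AE \<xi> in lborel. (\<lambda>n. cis (- (\<xi> \<bullet> x)) * (complex_of_real (exp (- (t n * (norm \<xi>)\<^sup>2 / 2))) * inv_fourier \<phi> \<xi>))
        \<longlonglongrightarrow> cis (- (\<xi> \<bullet> x)) * inv_fourier \<phi> \<xi>"
    proof (rule AE_I2)
      fix \<xi>
      have "(\<lambda>n. cis (- (\<xi> \<bullet> x)) * (complex_of_real (exp (- (t n * (norm \<xi>)\<^sup>2 / 2))) * inv_fourier \<phi> \<xi>))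
          \<longlonglongrightarrow> cis (- (\<xi> \<bullet> x)) * (complex_of_real (exp (- (0 * (norm \<xi>)\<^sup>2 / 2))) * inv_fourier \<phi> \<xi>)"
        by (intro tendsto_intros t0) simp
      then show "(\<lambda>n. cis (- (\<xi> \<bullet> x)) * (complex_of_real (exp (- (t n * (norm \<xi>)\<^sup>2 / 2))) * inv_fourier \<phi> \<xi>))
          \<longlonglongrightarrow> cis (- (\<xi> \<bullet> x)) * inv_fourier \<phi> \<xi>" by simp
    qed
    show "AE \<xi> in lborel. norm (cis (- (\<xi> \<bullet> x)) * (complex_of_real (exp (- (t n * (norm \<xi>)\<^sup>2 / 2))) * inv_fourier \<phi> \<xi>))
        \<le> norm (inv_fourier \<phi> \<xi>)" for n
      using t[of n] by (intro AE_I2) (simp add: norm_mult mult_left_le_one_le)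
  qed measurable
  then have 2: "(\<lambda>n. heat (t n) \<phi> x) \<longlonglongrightarrow> fourier (inv_fourier \<phi>) x"
    unfolding heat_eq_fourier_multiplier[OF \<phi> t] fourier_def .
  show "fourier (inv_fourier \<phi>) x = \<phi> x" using LIMSEQ_unique[OF 2 1] .
qed

text \<open>Reflection in the frequency variable turns one order of the two transforms into the
  other.\<close>

lemma inv_fourier_fourier:
  fixes \<phi> :: "'n::finite test"
  assumes \<phi>: "\<phi> \<in> schwartz"
  shows "inv_fourier (fourier \<phi>) = \<phi>"
proof
  fix x :: "real^'n"
  define c where "c = complex_of_real (1 / (2 * pi) ^ CARD('n))"
  note [measurable] = schwartz_measurable[OF schwartz_fourier[OF \<phi>]]
  have "\<phi> x = fourier (inv_fourier \<phi>) x" using fourier_inv_fourier[OF \<phi>] by simp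
  also have "\<dots> = (LINT \<xi>|lborel. cis (- (\<xi> \<bullet> x)) * (c * fourier \<phi> (- \<xi>)))"
    by (simp add: fourier_def[of "inv_fourier \<phi>"] inv_fourier_eq c_def)
  also have "\<dots> = (LINT \<xi>|lborel. cis (- ((0 - \<xi>) \<bullet> x)) * (c * fourier \<phi> (- (0 - \<xi>))))"
    using integral_lborel_reflect[of "\<lambda>\<xi>. cis (- (\<xi> \<bullet> x)) * (c * fourier \<phi> (- \<xi>))" 0] by simp
  also have "\<dots> = c * (LINT \<xi>|lborel. cis (x \<bullet> \<xi>) * fourier \<phi> \<xi>)"
    by (subst integral_mult_right_zero[symmetric]) (simp add: inner_commute mult_ac)
  also have "\<dots> = inv_fourier (fourier \<phi>) x"
    by (simp add: inv_fourier_def c_def)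
  finally show "inv_fourier (fourier \<phi>) x = \<phi> x" by simp
qed

section \<open>Heat semigroup on Schwartz functions\<close>

text \<open>Written as a Fourier transform, each derivative is multiplication by a coordinate, and
  multiplications commute.\<close>

lemma partial_commute:
  fixes \<phi> :: "'n::finite test"
  assumes \<phi>: "\<phi> \<in> schwartz"
  shows "partial i (partial j \<phi>) = partial j (partial i \<phi>)"
proof -
  define \<psi> where "\<psi> = inv_fourier \<phi>"
  have \<psi>: "\<psi> \<in> schwartz" unfolding \<psi>_def using \<phi> by (rule schwartz_inv_fourier)
  have F: "\<phi> = fourier \<psi>" unfolding \<psi>_def using fourier_inv_fourier[OF \<phi>] by simp
  have S: "(\<lambda>x. - \<i> * (complex_of_real (x $ l) * \<psi> x)) \<in> schwartz" for l
    by (intro schwartz_cmult schwartz_coord_mult \<psi>)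
  show ?thesis
    unfolding F partial_fourier[OF schwartz_rapid[OF \<psi>]] partial_fourier[OF schwartz_rapid[OF S]]
    by (simp add: mult_ac)
qed

lemma partials_partial:
  assumes \<phi>: "\<phi> \<in> schwartz"
  shows "partials ds (partial i \<phi>) = partial i (partials ds \<phi>)"
  by (induction ds) (auto simp: partials_Cons partial_commute schwartz_partials \<phi>)

text \<open>The generator of the heat semigroup, in the literal form in which it occurs in
  \<open>weak_solution\<close>.\<close>

definition heat_gen :: "'n::finite test \<Rightarrow> 'n test" where
  "heat_gen \<phi> = (\<lambda>x. 1/2 * laplacian \<phi> x)"

lemma heat_gen_eq: "heat_gen \<phi> = (\<lambda>x. 1/2 * (\<Sum>i\<in>UNIV. partial i (partial i \<phi>) x))"
  by (simp add: heat_gen_def laplacian_def partials_Cons)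

lemma schwartz_heat_gen: "\<phi> \<in> schwartz \<Longrightarrow> heat_gen \<phi> \<in> schwartz"
  unfolding heat_gen_eq by (intro schwartz_cmult schwartz_sum schwartz_partial)

lemma partials_heat_gen:
  assumes \<phi>: "\<phi> \<in> schwartz"
  shows "partials ds (heat_gen \<phi>) = heat_gen (partials ds \<phi>)"
proof -
  have S: "(\<lambda>x. \<Sum>i\<in>UNIV. partial i (partial i \<phi>) x) \<in> schwartz"
    by (intro schwartz_sum schwartz_partial \<phi>)
  show ?thesis
    unfolding heat_gen_eq partials_cmult[OF S] by (simp add: partials_sum partials_partial schwartz_partial \<phi>)
qed

lemma heat_0 [simp]: "heat 0 \<phi> = \<phi>"
  by (simp add: heat_def fun_eq_iff)

lemma schwartz_heat: "\<phi> \<in> schwartz \<Longrightarrow> t \<ge> 0 \<Longrightarrow> heat t \<phi> \<in> schwartz"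
  by (cases "t = 0") (auto simp: heat_eq_conv schwartz_conv rapid_heat_kernel)

lemma partials_heat:
  assumes "\<phi> \<in> schwartz" "t \<ge> 0"
  shows "partials ds (heat t \<phi>) = heat t (partials ds \<phi>)"
  using assms by (cases "t = 0") (auto simp: heat_eq_conv partials_conv rapid_heat_kernel schwartz_partials)

lemma heat_cmult_sum:
  assumes "\<And>i. i \<in> I \<Longrightarrow> \<phi> i \<in> schwartz" "t \<ge> 0"
  shows "heat t (\<lambda>x. c * (\<Sum>i\<in>I. \<phi> i x)) = (\<lambda>x. c * (\<Sum>i\<in>I. heat t (\<phi> i) x))"
proof (cases "t = 0")
  case False
  then have t: "t > 0" using assms by simp
  have i: "integrable lborel (\<lambda>y. \<phi> i (x - y) * complex_of_real (heat_kernel t y))" if "i \<in> I" for x i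
    using integrable_conv[OF assms(1)[OF that] rapid_integrable[OF rapid_heat_kernel[OF t]]] .
  have S: "(\<lambda>x. c * (\<Sum>i\<in>I. \<phi> i x)) \<in> schwartz" using assms by (intro schwartz_cmult schwartz_sum)
  have "heat t (\<lambda>x. c * (\<Sum>i\<in>I. \<phi> i x)) x = c * (\<Sum>i\<in>I. conv (\<phi> i) (\<lambda>x. complex_of_real (heat_kernel t x)) x)" for x
    unfolding heat_eq_conv[OF S t] conv_def using i
    by (simp add: sum_distrib_right mult.assoc Bochner_Integration.integral_sum)
  moreover have "(\<Sum>i\<in>I. conv (\<phi> i) (\<lambda>x. complex_of_real (heat_kernel t x)) x) = (\<Sum>i\<in>I. heat t (\<phi> i) x)" for x
    using assms(1) t by (intro sum.cong) (auto simp: heat_eq_conv)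
  ultimately show ?thesis by (simp add: fun_eq_iff)
qed simp

lemma heat_gen_heat:
  assumes \<phi>: "\<phi> \<in> schwartz" and t: "t \<ge> 0"
  shows "heat_gen (heat t \<phi>) = heat t (heat_gen \<phi>)"
proof -
  have p: "partial i (heat t \<psi>) = heat t (partial i \<psi>)" if "\<psi> \<in> schwartz" for \<psi> i
    using partials_heat[OF that t, of "[i]"] by (simp add: partials_Cons)
  show ?thesis
    unfolding heat_gen_eq by (subst heat_cmult_sum) (auto simp: p schwartz_partial \<phi> t)
qed

text \<open>Uniformity in \<open>t\<close> holds because the kernel at time \<open>t\<close> is a
  dilation of the one at time 1, which multiplies the moments by at most
  \<open>(1 + sqrt t) ^ k\<close>.\<close>

lemma heat_seminorm_le:
  fixes T :: real
  obtains C where "C \<ge> 0" and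
    "\<And>t \<phi>. 0 \<le> t \<Longrightarrow> t \<le> T \<Longrightarrow> \<phi> \<in> schwartz \<Longrightarrow>
      schwartz_seminorm k (heat t (\<phi> :: 'n::finite test)) \<le> C * schwartz_seminorm k \<phi>"
proof -
  define h where "h = (\<lambda>x::real^'n. complex_of_real (heat_kernel 1 x))"
  have h: "rapid h" unfolding h_def by (rule rapid_heat_kernel) simp
  \<comment> \<open>The summand 1 covers \<open>t = 0\<close>, where \<open>heat\<close> is defined
    by a separate case.\<close>
  define C where "C = 1 + (1 + sqrt T) ^ k * moment k h"
  show ?thesis
  proof (cases "T \<ge> 0")
    case False
    then show ?thesis using that[of 0] by auto
  next
    case True
    have C: "C \<ge> 1" using True by (simp add: C_def moment_nonneg)
    have "schwartz_seminorm k (heat t \<phi>) \<le> C * schwartz_seminorm k \<phi>"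
      if t: "0 \<le> t" "t \<le> T" and \<phi>: "\<phi> \<in> schwartz" for t and \<phi> :: "'n test"
    proof (cases "t = 0")
      case True
      then show ?thesis using mult_right_mono[OF C schwartz_seminorm_nonneg[OF \<phi>, of k]] by simp
    next
      case False
      then have t0: "t > 0" using t by simp
      have hk: "(\<lambda>x::real^'n. complex_of_real (heat_kernel t x)) = dilate (1 / sqrt t) h"
        unfolding h_def using heat_kernel_eq_dilate[OF t0] by blast
      have "moment k (\<lambda>x::real^'n. complex_of_real (heat_kernel t x)) \<le> (1 + sqrt t) ^ k * moment k h"
        unfolding hk using moment_dilate[OF h, of "1 / sqrt t" k] t0 by simp
      also have "\<dots> \<le> (1 + sqrt T) ^ k * moment k h"
        using t by (intro mult_right_mono power_mono moment_nonneg) auto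
      also have "\<dots> \<le> C" by (simp add: C_def)
      finally have "schwartz_seminorm k \<phi> * moment k (\<lambda>x::real^'n. complex_of_real (heat_kernel t x)) \<le> schwartz_seminorm k \<phi> * C"
        by (intro mult_left_mono schwartz_seminorm_nonneg \<phi>)
      then show ?thesis
        using schwartz_seminorm_conv[OF \<phi> rapid_heat_kernel[OF t0], of k]
        unfolding heat_eq_conv[OF \<phi> t0] by (simp add: mult.commute)
    qed
    note bd = this
    have "C \<ge> 0" using C by simp
    then show ?thesis using bd by (rule that)
  qed
qed

section \<open>Time regularity of the heat flow\<close>

lemma inv_fourier_heat_gen:
  fixes \<phi> :: "'n::finite test"
  assumes \<phi>: "\<phi> \<in> schwartz"
  shows "inv_fourier (heat_gen \<phi>) \<xi> = - complex_of_real ((norm \<xi>)\<^sup>2 / 2) * inv_fourier \<phi> \<xi>"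
proof -
  have neg: "fourier (\<lambda>x. - \<i> * \<psi> x) \<xi> = - \<i> * fourier \<psi> \<xi>" for \<psi> :: "'n test" and \<xi>
    unfolding fourier_def by (subst integral_mult_right_zero[symmetric]) (simp add: algebra_simps)
  have p: "fourier (partial i \<psi>) \<xi> = \<i> * complex_of_real (\<xi> $ i) * fourier \<psi> \<xi>" if "\<psi> \<in> schwartz" for \<psi> :: "'n test" and i \<xi>
    using fourier_partial[OF that, of \<xi> i] unfolding neg by (simp add: mult.assoc)
  have pp: "fourier (partial i (partial i \<phi>)) \<xi> = - complex_of_real ((\<xi> $ i)\<^sup>2) * fourier \<phi> \<xi>" for i \<xi>
    unfolding p[OF schwartz_partial[OF \<phi>]] p[OF \<phi>] by (simp add: power2_eq_square algebra_simps)
  have i: "integrable lborel (\<lambda>x. cis (- (x \<bullet> \<xi>)) * partial i (partial i \<phi>) x)" for i \<xi>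
    by (intro integrable_cis_mult schwartz_integrable schwartz_partial \<phi>) measurable
  have "fourier (heat_gen \<phi>) \<eta> = - complex_of_real ((norm \<eta>)\<^sup>2 / 2) * fourier \<phi> \<eta>" for \<eta>
  proof -
    have nrm: "(norm \<eta>)\<^sup>2 = (\<Sum>i\<in>UNIV. (\<eta> $ i)\<^sup>2)"
      unfolding power2_norm_eq_inner by (simp add: inner_vec_def power2_eq_square)
    have "fourier (heat_gen \<phi>) \<eta> = (LINT x|lborel. 1/2 * (\<Sum>i\<in>UNIV. cis (- (x \<bullet> \<eta>)) * partial i (partial i \<phi>) x))"
      unfolding fourier_def heat_gen_eq by (simp add: sum_distrib_left)
    also have "\<dots> = 1/2 * (\<Sum>i\<in>UNIV. fourier (partial i (partial i \<phi>)) \<eta>)"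
      unfolding integral_mult_right_zero fourier_def by (subst Bochner_Integration.integral_sum) (auto simp: i)
    also have "\<dots> = - complex_of_real ((norm \<eta>)\<^sup>2 / 2) * fourier \<phi> \<eta>"
      unfolding pp nrm by (simp add: sum_negf sum_distrib_right)
    finally show ?thesis .
  qed
  then show ?thesis by (simp add: inv_fourier_eq)
qed

lemma heat_eq_fourier_multiplier':
  fixes \<phi> :: "'n::finite test"
  assumes \<phi>: "\<phi> \<in> schwartz" and t: "t \<ge> 0"
  shows "heat t \<phi> x = (LINT \<xi>|lborel. cis (- (\<xi> \<bullet> x)) * (complex_of_real (exp (- (t * ((norm \<xi>)\<^sup>2 / 2)))) * inv_fourier \<phi> \<xi>))"
proof (cases "t = 0")
  case True
  then show ?thesis using fun_cong[OF fourier_inv_fourier[OF \<phi>], of x] by (simp add: fourier_def)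
next
  case False
  then show ?thesis using heat_eq_fourier_multiplier[OF \<phi>, of t x] t by (simp add: fourier_def)
qed

text \<open>The inequality \<open>1 + z \<le> exp z\<close> at \<open>z = - y\<close> and
  \<open>z = y\<close> squeezes the remainder between 0 and \<open>y * (A - B)\<close>, and
  \<open>\<bar>A - B\<bar> \<le> \<bar>y\<bar>\<close>. With \<open>a\<close> and \<open>b\<close>
  in either order, the expansion serves on both sides of the base point.\<close>

lemma exp_taylor1:
  fixes a b q :: real
  assumes "a \<ge> 0" "b \<ge> 0" "q \<ge> 0"
  shows "\<bar>exp (- (b * q)) - exp (- (a * q)) + (b - a) * q * exp (- (a * q))\<bar> \<le> (b - a)\<^sup>2 * q\<^sup>2"
proof -
  define A B y where "A = exp (- (a * q))" and "B = exp (- (b * q))" and "y = (b - a) * q"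
  have AB: "B = A * exp (- y)" "A = B * exp y" "A > 0" "B > 0" "A \<le> 1" "B \<le> 1"
    using assms by (auto simp: A_def B_def y_def exp_add[symmetric] algebra_simps)
  have 1: "B \<ge> A * (1 - y)"
    unfolding AB(1) using AB(3) exp_ge_add_one_self[of "-y"] by (intro mult_left_mono) auto
  have 2: "A \<ge> B * (1 + y)"
    unfolding AB(2) using AB(4) exp_ge_add_one_self[of y] by (intro mult_left_mono) auto
  have 3: "B - A + y * A \<le> y * (A - B)" using 2 by (simp add: algebra_simps)
  have "\<bar>A - B\<bar> \<le> \<bar>y\<bar>"
  proof (rule abs_leI)
    have "A - B \<le> A * y" using 1 by (simp add: algebra_simps)
    also have "\<dots> \<le> \<bar>A * y\<bar>" by simp
    also have "\<dots> \<le> \<bar>y\<bar>" using AB by (simp add: abs_mult mult_left_le_one_le)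
    finally show "A - B \<le> \<bar>y\<bar>" .
    have "- (A - B) \<le> B * (- y)" using 2 by (simp add: algebra_simps)
    also have "\<dots> \<le> \<bar>B * y\<bar>" by simp
    also have "\<dots> \<le> \<bar>y\<bar>" using AB by (simp add: abs_mult mult_left_le_one_le)
    finally show "- (A - B) \<le> \<bar>y\<bar>" .
  qed
  then have "\<bar>y * (A - B)\<bar> \<le> \<bar>y\<bar> * \<bar>y\<bar>" unfolding abs_mult by (rule mult_left_mono) simp
  then have "y * (A - B) \<le> y\<^sup>2" by (simp add: power2_eq_square)
  with 1 3 have "\<bar>B - A + y * A\<bar> \<le> y\<^sup>2" by (simp add: algebra_simps)
  then show ?thesis by (simp add: A_def B_def y_def power_mult_distrib)
qed

text \<open>On the Fourier side the remainder is bounded by \<open>(t - s)\<^sup>2\<close> times the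
  multiplier of the squared generator, and that multiplier times \<open>inv_fourier \<phi>\<close>
  is integrable. Only the time derivative at a point is drawn from this; uniform estimates come from
  the mean value inequality afterwards.\<close>

lemma heat_taylor_pointwise:
  fixes \<phi> :: "'n::finite test"
  assumes \<phi>: "\<phi> \<in> schwartz"
  obtains K where "K \<ge> 0" "\<And>s t. s \<ge> 0 \<Longrightarrow> t \<ge> 0 \<Longrightarrow>
    norm (heat t \<phi> x - heat s \<phi> x - (t - s) *\<^sub>R heat s (heat_gen \<phi>) x) \<le> K * (t - s)\<^sup>2"
proof -
  define \<psi> where "\<psi> = inv_fourier \<phi>"
  define q where "q \<xi> = (norm \<xi>)\<^sup>2 / 2" for \<xi> :: "real^'n"
  have \<psi>: "\<psi> \<in> schwartz" unfolding \<psi>_def using \<phi> by (rule schwartz_inv_fourier)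
  note [measurable] = schwartz_measurable[OF \<psi>]
  have [measurable]: "q \<in> borel_measurable borel" unfolding q_def by measurable
  define \<psi>2 where "\<psi>2 = inv_fourier (heat_gen (heat_gen \<phi>))"
  have \<psi>2: "\<psi>2 \<xi> = complex_of_real ((q \<xi>)\<^sup>2) * \<psi> \<xi>" for \<xi>
    unfolding \<psi>2_def \<psi>_def q_def
    by (simp add: inv_fourier_heat_gen schwartz_heat_gen \<phi> power2_eq_square)
  have i2: "integrable lborel \<psi>2"
    unfolding \<psi>2_def by (intro schwartz_integrable schwartz_inv_fourier schwartz_heat_gen \<phi>)
  define K where "K = (LINT \<xi>|lborel. norm (\<psi>2 \<xi>))"
  have q0: "q \<xi> \<ge> 0" for \<xi> by (simp add: q_def)
  have int: "integrable lborel (\<lambda>\<xi>. cis (- (\<xi> \<bullet> x)) * (complex_of_real (exp (- (t * q \<xi>))) * f \<xi>))"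
    if "integrable lborel f" "t \<ge> 0" for t f
  proof (intro integrable_cis_mult)
    show "integrable lborel (\<lambda>\<xi>. complex_of_real (exp (- (t * q \<xi>))) * f \<xi>)"
      by (rule integrable_mult_bounded[where B = 1]) (use that q0 in auto)
  qed measurable
  have "norm (heat t \<phi> x - heat s \<phi> x - (t - s) *\<^sub>R heat s (heat_gen \<phi>) x) \<le> K * (t - s)\<^sup>2"
    if "s \<ge> 0" "t \<ge> 0" for s t
  proof -
    let ?E = "\<lambda>\<xi>. exp (- (t * q \<xi>)) - exp (- (s * q \<xi>)) + (t - s) * q \<xi> * exp (- (s * q \<xi>))"
    have 1: "heat r \<phi> x = (LINT \<xi>|lborel. cis (- (\<xi> \<bullet> x)) * (complex_of_real (exp (- (r * q \<xi>))) * \<psi> \<xi>))" if "r \<ge> 0" for r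
      using heat_eq_fourier_multiplier'[OF \<phi> that] by (simp add: q_def \<psi>_def)
    have 2: "heat s (heat_gen \<phi>) x = (LINT \<xi>|lborel. cis (- (\<xi> \<bullet> x)) * (complex_of_real (exp (- (s * q \<xi>))) * (- complex_of_real (q \<xi>) * \<psi> \<xi>)))"
      using heat_eq_fourier_multiplier'[OF schwartz_heat_gen[OF \<phi>] that(1)] by (simp add: q_def \<psi>_def inv_fourier_heat_gen \<phi>)
    have iq: "integrable lborel (\<lambda>\<xi>. - complex_of_real (q \<xi>) * \<psi> \<xi>)"
      using schwartz_integrable[OF schwartz_inv_fourier[OF schwartz_heat_gen[OF \<phi>]]]
      by (simp add: inv_fourier_heat_gen[OF \<phi>, abs_def] q_def \<psi>_def)
    define F where "F r f \<xi> = cis (- (\<xi> \<bullet> x)) * (complex_of_real (exp (- (r * q \<xi>))) * f \<xi>)" for r f \<xi>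
    define \<psi>1 where "\<psi>1 \<xi> = - complex_of_real (q \<xi>) * \<psi> \<xi>" for \<xi>
    have i: "integrable lborel (F t \<psi>)" "integrable lborel (F s \<psi>)" "integrable lborel (F s \<psi>1)"
      unfolding F_def \<psi>1_def
      by (rule int[OF schwartz_integrable[OF \<psi>] that(2)], rule int[OF schwartz_integrable[OF \<psi>] that(1)],
          rule int[OF iq that(1)])
    have "heat t \<phi> x - heat s \<phi> x - (t - s) *\<^sub>R heat s (heat_gen \<phi>) x
        = integral\<^sup>L lborel (F t \<psi>) - integral\<^sup>L lborel (F s \<psi>) - (t - s) *\<^sub>R integral\<^sup>L lborel (F s \<psi>1)"
      unfolding 1[OF that(1)] 1[OF that(2)] 2 F_def \<psi>1_def by (rule refl)
    also have "\<dots> = (LINT \<xi>|lborel. F t \<psi> \<xi> - F s \<psi> \<xi> - (t - s) *\<^sub>R F s \<psi>1 \<xi>)"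
      using i by simp
    also have "\<dots> = (LINT \<xi>|lborel. cis (- (\<xi> \<bullet> x)) * (complex_of_real (?E \<xi>) * \<psi> \<xi>))"
    proof (rule Bochner_Integration.integral_cong[OF refl])
      have alg: "c * (A * p) - c * (B * p) - d * (c * (B * (- r * p))) = c * ((A - B + d * r * B) * p)"
        for c A B p d r :: complex by (simp add: algebra_simps)
      show "F t \<psi> \<xi> - F s \<psi> \<xi> - (t - s) *\<^sub>R F s \<psi>1 \<xi> = cis (- (\<xi> \<bullet> x)) * (complex_of_real (?E \<xi>) * \<psi> \<xi>)" for \<xi>
        unfolding F_def \<psi>1_def scaleR_conv_of_real[where 'a = complex] alg by simp
    qed
    finally have "norm (heat t \<phi> x - heat s \<phi> x - (t - s) *\<^sub>R heat s (heat_gen \<phi>) x)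
        \<le> (LINT \<xi>|lborel. norm (cis (- (\<xi> \<bullet> x)) * (complex_of_real (?E \<xi>) * \<psi> \<xi>)))"
      by (simp only: integral_norm_bound)
    also have "\<dots> \<le> (LINT \<xi>|lborel. (t - s)\<^sup>2 * norm (\<psi>2 \<xi>))"
    proof (rule integral_mono_AE')
      show "integrable lborel (\<lambda>\<xi>. (t - s)\<^sup>2 * norm (\<psi>2 \<xi>))" using i2 by simp
      show "AE \<xi> in lborel. norm (cis (- (\<xi> \<bullet> x)) * (complex_of_real (?E \<xi>) * \<psi> \<xi>)) \<le> (t - s)\<^sup>2 * norm (\<psi>2 \<xi>)"
      proof (rule AE_I2)
        fix \<xi>
        have "\<bar>?E \<xi>\<bar> * norm (\<psi> \<xi>) \<le> ((t - s)\<^sup>2 * (q \<xi>)\<^sup>2) * norm (\<psi> \<xi>)"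
          by (intro mult_right_mono exp_taylor1 that q0) simp
        then show "norm (cis (- (\<xi> \<bullet> x)) * (complex_of_real (?E \<xi>) * \<psi> \<xi>)) \<le> (t - s)\<^sup>2 * norm (\<psi>2 \<xi>)"
          unfolding \<psi>2 norm_mult norm_of_real by (simp add: mult.assoc)
      qed
    qed simp
    also have "\<dots> = K * (t - s)\<^sup>2" by (simp add: K_def)
    finally show ?thesis .
  qed
  note bd = this
  have "K \<ge> 0" by (simp add: K_def)
  then show ?thesis using bd by (rule that)
qed

lemma heat_has_vector_derivative:
  assumes \<phi>: "\<phi> \<in> schwartz" and t: "t \<ge> 0"
  shows "((\<lambda>t. heat t \<phi> x) has_vector_derivative heat t (heat_gen \<phi>) x) (at t within {0..})"
proof -
  obtain K where "K \<ge> 0" and K: "\<And>s t. s \<ge> 0 \<Longrightarrow> t \<ge> 0 \<Longrightarrow>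
    norm (heat t \<phi> x - heat s \<phi> x - (t - s) *\<^sub>R heat s (heat_gen \<phi>) x) \<le> K * (t - s)\<^sup>2"
    by (rule heat_taylor_pointwise[OF \<phi>, where x = x]) (rule that)
  show ?thesis
    unfolding has_vector_derivative_def
  proof (rule has_derivativeI_sandwich[where e = 1])
    show "bounded_linear (\<lambda>h. h *\<^sub>R heat t (heat_gen \<phi>) x)" by (rule bounded_linear_scaleR_left)
    show "((\<lambda>y. K * \<bar>y - t\<bar>) \<longlongrightarrow> 0) (at t within {0..})"
      by (auto intro!: tendsto_eq_intros)
    fix y assume y: "y \<in> {0..}" "y \<noteq> t"
    have "norm (heat y \<phi> x - heat t \<phi> x - (y - t) *\<^sub>R heat t (heat_gen \<phi>) x) \<le> K * (y - t)\<^sup>2"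
      using K t y by auto
    also have "\<dots> = K * \<bar>y - t\<bar> * norm (y - t)" by (simp add: power2_eq_square abs_mult[symmetric])
    finally show "norm (heat y \<phi> x - heat t \<phi> x - (y - t) *\<^sub>R heat t (heat_gen \<phi>) x) / norm (y - t) \<le> K * \<bar>y - t\<bar>"
      using y by (simp add: divide_le_eq)
  qed simp
qed

text \<open>Mean value inequality in time for a fixed weight and a fixed derivative. Since
  \<open>partials ds\<close> commutes with the flow and with the generator, the time derivative is
  again a heat flow and \<open>heat_seminorm_le\<close> bounds it.\<close>

lemma heat_seminorm_diff_le:
  fixes T :: real
  obtains C where "C \<ge> 0" and
    "\<And>s t \<phi>. s \<in> {0..T} \<Longrightarrow> t \<in> {0..T} \<Longrightarrow> \<phi> \<in> schwartz \<Longrightarrow>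
      schwartz_seminorm k (\<lambda>x. heat t (\<phi> :: 'n::finite test) x - heat s \<phi> x) \<le> C * schwartz_seminorm k (heat_gen \<phi>) * \<bar>t - s\<bar>"
proof -
  obtain C where C: "C \<ge> 0" and bd: "\<And>t \<phi>. 0 \<le> t \<Longrightarrow> t \<le> T \<Longrightarrow> \<phi> \<in> schwartz \<Longrightarrow>
      schwartz_seminorm k (heat t (\<phi> :: 'n::finite test)) \<le> C * schwartz_seminorm k \<phi>"
    by (rule heat_seminorm_le[where T = T and k = k]) (rule that)
  have "schwartz_seminorm k (\<lambda>x. heat t \<phi> x - heat s \<phi> x) \<le> C * schwartz_seminorm k (heat_gen \<phi>) * \<bar>t - s\<bar>"
    if st: "s \<in> {0..T}" "t \<in> {0..T}" and \<phi>: "\<phi> \<in> schwartz" for s t and \<phi> :: "'n test"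
  proof (rule schwartz_seminorm_le)
    fix x :: "real^'n" and ds :: "'n list" assume ds: "length ds \<le> k"
    let ?w = "(1 + norm x) ^ k"
    let ?\<psi> = "partials ds \<phi>"
    have \<psi>: "?\<psi> \<in> schwartz" by (intro schwartz_partials \<phi>)
    have "norm (?w *\<^sub>R heat t ?\<psi> x - ?w *\<^sub>R heat s ?\<psi> x) \<le> C * schwartz_seminorm k (heat_gen \<phi>) * norm (t - s)"
    proof (rule differentiable_bound[where S = "{0..T}" and f' = "\<lambda>r h. h *\<^sub>R (?w *\<^sub>R heat r (heat_gen ?\<psi>) x)"])
      fix r assume r: "r \<in> {0..T}"
      show "((\<lambda>r. ?w *\<^sub>R heat r ?\<psi> x) has_derivative (\<lambda>h. h *\<^sub>R (?w *\<^sub>R heat r (heat_gen ?\<psi>) x))) (at r within {0..T})"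
        using has_vector_derivative_scaleR[OF DERIV_const heat_has_vector_derivative[OF \<psi>, of r x], of ?w] r
        unfolding has_vector_derivative_def by (auto intro: has_derivative_subset)
      have "norm (?w *\<^sub>R heat r (heat_gen ?\<psi>) x) \<le> C * schwartz_seminorm k (heat_gen \<phi>)"
      proof -
        have "heat r (heat_gen ?\<psi>) = partials ds (heat r (heat_gen \<phi>))"
          using r by (simp add: partials_heat schwartz_heat_gen \<phi> partials_heat_gen)
        then have "norm (?w *\<^sub>R heat r (heat_gen ?\<psi>) x) \<le> schwartz_seminorm k (heat r (heat_gen \<phi>))"
          using schwartz_seminorm_ge[OF schwartz_heat[OF schwartz_heat_gen[OF \<phi>]] ds, of r x] r by (simp add: power_abs)
        also have "\<dots> \<le> C * schwartz_seminorm k (heat_gen \<phi>)"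
          using r by (intro bd schwartz_heat_gen \<phi>) auto
        finally show ?thesis .
      qed
      note le = this
      show "onorm (\<lambda>h. h *\<^sub>R (?w *\<^sub>R heat r (heat_gen ?\<psi>) x)) \<le> C * schwartz_seminorm k (heat_gen \<phi>)"
      proof (rule onorm_le)
        fix h :: real
        have "norm (h *\<^sub>R (?w *\<^sub>R heat r (heat_gen ?\<psi>) x)) = \<bar>h\<bar> * norm (?w *\<^sub>R heat r (heat_gen ?\<psi>) x)"
          by (rule norm_scaleR)
        also have "\<dots> \<le> \<bar>h\<bar> * (C * schwartz_seminorm k (heat_gen \<phi>))"
          by (intro mult_left_mono le) simp
        also have "\<dots> = C * schwartz_seminorm k (heat_gen \<phi>) * norm h" by simp
        finally show "norm (h *\<^sub>R (?w *\<^sub>R heat r (heat_gen ?\<psi>) x)) \<le> C * schwartz_seminorm k (heat_gen \<phi>) * norm h" .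
      qed
    qed (use st in auto)
    then show "?w * norm (partials ds (\<lambda>x. heat t \<phi> x - heat s \<phi> x) x) \<le> C * schwartz_seminorm k (heat_gen \<phi>) * \<bar>t - s\<bar>"
      using st by (simp add: partials_diff schwartz_heat \<phi> partials_heat power_abs flip: scaleR_diff_right)
  qed
  with C show ?thesis by (rule that)
qed

text \<open>Mean value inequality for the flow minus its linearisation at \<open>s\<close>. The
  derivative is a difference of heat flows of \<open>heat_gen \<phi>\<close>, small by
  \<open>heat_seminorm_diff_le\<close>, which yields the second power.\<close>

lemma heat_seminorm_taylor:
  fixes T :: real
  obtains C where "C \<ge> 0" and
    "\<And>s t \<phi>. s \<in> {0..T} \<Longrightarrow> t \<in> {0..T} \<Longrightarrow> \<phi> \<in> schwartz \<Longrightarrow>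
      schwartz_seminorm k (\<lambda>x. heat t (\<phi> :: 'n::finite test) x - heat s \<phi> x - of_real (t - s) * heat s (heat_gen \<phi>) x)
        \<le> C * schwartz_seminorm k (heat_gen (heat_gen \<phi>)) * \<bar>t - s\<bar>\<^sup>2"
proof -
  obtain C where C: "C \<ge> 0" and bd: "\<And>s t \<phi>. s \<in> {0..T} \<Longrightarrow> t \<in> {0..T} \<Longrightarrow> \<phi> \<in> schwartz \<Longrightarrow>
      schwartz_seminorm k (\<lambda>x. heat t (\<phi> :: 'n::finite test) x - heat s \<phi> x) \<le> C * schwartz_seminorm k (heat_gen \<phi>) * \<bar>t - s\<bar>"
    by (rule heat_seminorm_diff_le[where T = T and k = k]) (rule that)
  have "schwartz_seminorm k (\<lambda>x. heat t \<phi> x - heat s \<phi> x - of_real (t - s) * heat s (heat_gen \<phi>) x)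
        \<le> C * schwartz_seminorm k (heat_gen (heat_gen \<phi>)) * \<bar>t - s\<bar>\<^sup>2"
    if st: "s \<in> {0..T}" "t \<in> {0..T}" and \<phi>: "\<phi> \<in> schwartz" for s t and \<phi> :: "'n test"
  proof (rule schwartz_seminorm_le)
    fix x :: "real^'n" and ds :: "'n list" assume ds: "length ds \<le> k"
    let ?w = "(1 + norm x) ^ k"
    let ?\<psi> = "partials ds \<phi>"
    let ?D = "\<lambda>r. heat r (heat_gen ?\<psi>) x"
    let ?M = "C * schwartz_seminorm k (heat_gen (heat_gen \<phi>))"
    have \<psi>: "?\<psi> \<in> schwartz" by (intro schwartz_partials \<phi>)
    have M0: "?M \<ge> 0" using C by (intro mult_nonneg_nonneg schwartz_seminorm_nonneg schwartz_heat_gen \<phi>) auto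
    \<comment> \<open>The segment replaces an interval because \<open>t\<close> may lie before or
      after \<open>s\<close>.\<close>
    let ?S = "closed_segment s t"
    have S: "r \<in> {0..T} \<and> \<bar>r - s\<bar> \<le> \<bar>t - s\<bar>" if "r \<in> ?S" for r
      using that st by (auto simp: closed_segment_eq_real_ivl split: if_splits)
    have "norm (?w *\<^sub>R (heat t ?\<psi> x - t *\<^sub>R ?D s) - ?w *\<^sub>R (heat s ?\<psi> x - s *\<^sub>R ?D s)) \<le> (?M * \<bar>t - s\<bar>) * norm (t - s)"
    proof (rule differentiable_bound[where S = ?S and f' = "\<lambda>r h. ?w *\<^sub>R (h *\<^sub>R ?D r - h *\<^sub>R ?D s)"])
      fix r assume "r \<in> ?S"
      note r = S[OF this]
      have "((\<lambda>r. heat r ?\<psi> x) has_derivative (\<lambda>h. h *\<^sub>R ?D r)) (at r within ?S)"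
        using heat_has_vector_derivative[OF \<psi>, of r x] r S unfolding has_vector_derivative_def
        by (auto intro: has_derivative_subset)
      moreover have "((\<lambda>r. r *\<^sub>R ?D s) has_derivative (\<lambda>h. h *\<^sub>R ?D s)) (at r within ?S)"
        by (auto intro!: derivative_eq_intros)
      ultimately show "((\<lambda>r. ?w *\<^sub>R (heat r ?\<psi> x - r *\<^sub>R ?D s)) has_derivative (\<lambda>h. ?w *\<^sub>R (h *\<^sub>R ?D r - h *\<^sub>R ?D s))) (at r within ?S)"
        by (intro has_derivative_scaleR_right has_derivative_diff)
      have "norm (?w *\<^sub>R (?D r - ?D s)) \<le> ?M * \<bar>t - s\<bar>"
      proof -
        have "?D r' = partials ds (heat r' (heat_gen \<phi>)) x" if "r' \<in> {0..T}" for r'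
          using that by (simp add: partials_heat schwartz_heat_gen \<phi> partials_heat_gen)
        then have eq: "?D r - ?D s = partials ds (\<lambda>x. heat r (heat_gen \<phi>) x - heat s (heat_gen \<phi>) x) x"
          using r st by (simp add: partials_diff schwartz_heat schwartz_heat_gen \<phi>)
        have "(\<lambda>x. heat r (heat_gen \<phi>) x - heat s (heat_gen \<phi>) x) \<in> schwartz"
          using r st by (intro schwartz_diff schwartz_heat schwartz_heat_gen \<phi>) auto
        from schwartz_seminorm_ge[OF this ds, of x]
        have "norm (?w *\<^sub>R (?D r - ?D s)) \<le> schwartz_seminorm k (\<lambda>x. heat r (heat_gen \<phi>) x - heat s (heat_gen \<phi>) x)"
          unfolding eq by (simp add: power_abs)
        also have "\<dots> \<le> ?M * \<bar>r - s\<bar>"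
          using r st by (intro bd schwartz_heat_gen \<phi>) auto
        also have "\<dots> \<le> ?M * \<bar>t - s\<bar>" using r by (intro mult_left_mono M0) auto
        finally show ?thesis .
      qed
      then have *: "\<bar>h\<bar> * norm (?w *\<^sub>R (?D r - ?D s)) \<le> \<bar>h\<bar> * (?M * \<bar>t - s\<bar>)" for h
        by (intro mult_left_mono) auto
      show "onorm (\<lambda>h. ?w *\<^sub>R (h *\<^sub>R ?D r - h *\<^sub>R ?D s)) \<le> ?M * \<bar>t - s\<bar>"
      proof (rule onorm_le)
        fix h :: real
        have "?w *\<^sub>R (h *\<^sub>R ?D r - h *\<^sub>R ?D s) = h *\<^sub>R (?w *\<^sub>R (?D r - ?D s))"
          by (simp only: scaleR_diff_right[symmetric] scaleR_scaleR mult.commute)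
        then have eq: "norm (?w *\<^sub>R (h *\<^sub>R ?D r - h *\<^sub>R ?D s)) = \<bar>h\<bar> * norm (?w *\<^sub>R (?D r - ?D s))"
          by (simp only: norm_scaleR[of h])
        have "\<bar>h\<bar> * norm (?w *\<^sub>R (?D r - ?D s)) \<le> \<bar>h\<bar> * (?M * \<bar>t - s\<bar>)" by (rule *)
        also have "\<dots> = ?M * \<bar>t - s\<bar> * norm h" by (simp only: real_norm_def mult.commute)
        finally show "norm (?w *\<^sub>R (h *\<^sub>R ?D r - h *\<^sub>R ?D s)) \<le> ?M * \<bar>t - s\<bar> * norm h"
          unfolding eq .
      qed
    qed auto
    note A = this
    have B: "partials ds (\<lambda>x. heat t \<phi> x - heat s \<phi> x - of_real (t - s) * heat s (heat_gen \<phi>) x) x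
        = (heat t ?\<psi> x - t *\<^sub>R ?D s) - (heat s ?\<psi> x - s *\<^sub>R ?D s)"
    proof -
      have "partials ds (\<lambda>x. heat t \<phi> x - heat s \<phi> x - of_real (t - s) * heat s (heat_gen \<phi>) x) x
          = heat t ?\<psi> x - heat s ?\<psi> x - of_real (t - s) * ?D s"
        using st
        by (simp add: partials_diff schwartz_diff schwartz_cmult partials_cmult schwartz_heat schwartz_heat_gen \<phi>
            partials_heat partials_heat_gen del: of_real_diff)
      also have "\<dots> = (heat t ?\<psi> x - t *\<^sub>R ?D s) - (heat s ?\<psi> x - s *\<^sub>R ?D s)"
        by (simp add: scaleR_conv_of_real[where 'a = complex] left_diff_distrib)
      finally show ?thesis .
    qed
    have C': "norm (?w *\<^sub>R a - ?w *\<^sub>R b) = ?w * norm (a - b)" for a b :: complex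
      by (simp add: power_abs flip: scaleR_diff_right)
    show "?w * norm (partials ds (\<lambda>x. heat t \<phi> x - heat s \<phi> x - of_real (t - s) * heat s (heat_gen \<phi>) x) x)
        \<le> ?M * \<bar>t - s\<bar>\<^sup>2"
      unfolding B C'[symmetric] using A by (simp only: power2_eq_square real_norm_def mult.assoc)
  qed
  with C show ?thesis by (rule that)
qed

section \<open>Uniform boundedness for tempered distributions\<close>

lemma tempered_boundE:
  assumes "u \<in> tempered"
  obtains C k where "C \<ge> 0" "\<And>\<phi>. \<phi> \<in> schwartz \<Longrightarrow> norm (u \<phi>) \<le> C * schwartz_seminorm k \<phi>"
proof -
  obtain C k where Ck: "\<And>\<phi>. \<phi> \<in> schwartz \<Longrightarrow> norm (u \<phi>) \<le> C * schwartz_seminorm k \<phi>"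
    using assms unfolding tempered_def by blast
  have "norm (u \<phi>) \<le> max C 0 * schwartz_seminorm k \<phi>" if "\<phi> \<in> schwartz" for \<phi>
    using Ck[OF that] mult_right_mono[OF max.cobounded1[of C 0] schwartz_seminorm_nonneg[OF that, of k]] by linarith
  then show ?thesis using that[of "max C 0" k] by simp
qed

lemma tempered_add: "u \<in> tempered \<Longrightarrow> \<phi> \<in> schwartz \<Longrightarrow> \<psi> \<in> schwartz \<Longrightarrow> u (\<lambda>x. \<phi> x + \<psi> x) = u \<phi> + u \<psi>"
  by (simp add: tempered_def)

lemma tempered_cmult: "u \<in> tempered \<Longrightarrow> \<phi> \<in> schwartz \<Longrightarrow> u (\<lambda>x. c * \<phi> x) = c * u \<phi>"
  by (simp add: tempered_def)

lemma tempered_diff: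
  assumes "u \<in> tempered" "\<phi> \<in> schwartz" "\<psi> \<in> schwartz"
  shows "u (\<lambda>x. \<phi> x - \<psi> x) = u \<phi> - u \<psi>"
  using tempered_add[OF assms(1,2) schwartz_cmult[OF assms(3), of "-1"]] tempered_cmult[OF assms(1,3), of "-1"] by simp

text \<open>Completeness in the form needed for a gliding hump: the orders \<open>K n\<close>
  increase while the tolerances at least halve. The candidates \<open>L ds\<close> are pointwise
  limits of derivatives, and uniform convergence of the next derivatives identifies
  \<open>L (i # ds)\<close> as the partial derivative of \<open>L ds\<close>.\<close>

lemma schwartz_complete:
  fixes \<Phi> :: "nat \<Rightarrow> 'n::finite test" and K :: "nat \<Rightarrow> nat" and e :: "nat \<Rightarrow> real"
  assumes \<Phi>: "\<And>n. \<Phi> n \<in> schwartz" and K: "\<And>n. K n \<ge> n" "\<And>n. K n \<le> K (Suc n)"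
    and e: "\<And>n. e n > 0" "\<And>n. e (Suc n) \<le> e n / 2"
    and step: "\<And>n. schwartz_seminorm (K n) (\<lambda>x. \<Phi> (Suc n) x - \<Phi> n x) \<le> e n"
  obtains \<phi> where "\<phi> \<in> schwartz" "\<And>n. schwartz_seminorm (K n) (\<lambda>x. \<phi> x - \<Phi> n x) \<le> 2 * e n"
proof -
  have K_mono: "K n \<le> K m" if "n \<le> m" for n m using that K(2) by (rule lift_Suc_mono_le[rotated])
  \<comment> \<open>The subtracted \<open>2 * e m\<close> makes the induction close: adding
    \<open>e m\<close> is compensated by \<open>2 * e (Suc m) \<le> e m\<close>.\<close>
  have tail: "schwartz_seminorm (K n) (\<lambda>x. \<Phi> m x - \<Phi> n x) \<le> 2 * e n - 2 * e m" if "n \<le> m" for n m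
    using that
  proof (induction m rule: dec_induct)
    case base
    have "schwartz_seminorm (K n) (\<lambda>x. 0 * \<Phi> n x) \<le> norm (0::complex) * schwartz_seminorm (K n) (\<Phi> n)"
      by (rule schwartz_seminorm_cmult[OF \<Phi>])
    then show ?case by simp
  next
    case (step m)
    have "schwartz_seminorm (K n) (\<lambda>x. \<Phi> (Suc m) x - \<Phi> n x)
        = schwartz_seminorm (K n) (\<lambda>x. (\<Phi> (Suc m) x - \<Phi> m x) + (\<Phi> m x - \<Phi> n x))" by simp
    also have "\<dots> \<le> schwartz_seminorm (K n) (\<lambda>x. \<Phi> (Suc m) x - \<Phi> m x) + schwartz_seminorm (K n) (\<lambda>x. \<Phi> m x - \<Phi> n x)"
      by (intro schwartz_seminorm_add schwartz_diff \<Phi>)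
    also have "schwartz_seminorm (K n) (\<lambda>x. \<Phi> (Suc m) x - \<Phi> m x) \<le> schwartz_seminorm (K m) (\<lambda>x. \<Phi> (Suc m) x - \<Phi> m x)"
      using step K_mono by (intro schwartz_seminorm_mono schwartz_diff \<Phi>) auto
    also have "\<dots> \<le> e m" by (rule assms(6))
    finally show ?case using step.IH e(2)[of m] by simp
  qed
  have e_le: "e n \<le> e 0 * (1/2) ^ n" for n
    by (induction n) (use e(2) in \<open>auto intro: order_trans\<close>)
  have e0: "e \<longlonglongrightarrow> 0"
  proof (rule tendsto_sandwich[of "\<lambda>_. 0" _ _ "\<lambda>n. e 0 * (1/2) ^ n"])
    show "(\<lambda>n. e 0 * (1/2) ^ n) \<longlonglongrightarrow> 0" by (intro tendsto_mult_right_zero LIMSEQ_power_zero) simp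
  qed (use e(1) e_le in \<open>auto simp: less_imp_le intro!: always_eventually\<close>)
  have pt: "(1 + norm x) ^ K n * norm (partials ds (\<Phi> m) x - partials ds (\<Phi> n) x) \<le> 2 * e n"
    if "length ds \<le> n" "n \<le> m" for n m ds x
  proof -
    have "length ds \<le> K n" using that(1) K(1) order_trans by blast
    from schwartz_seminorm_ge[OF schwartz_diff[OF \<Phi> \<Phi>] this, of x m n]
    show ?thesis using tail[OF that(2)] e(1)[of m] by (simp add: partials_diff \<Phi>)
  qed
  have one: "1 \<le> (1 + norm x) ^ j" for x :: "real^'n" and j by (rule one_le_power) simp
  have pt1: "norm (partials ds (\<Phi> m) x - partials ds (\<Phi> n) x) \<le> 2 * e n" if "length ds \<le> n" "n \<le> m" for n m ds x
    using pt[OF that, of x] mult_right_mono[OF one[of x "K n"], of "norm (partials ds (\<Phi> m) x - partials ds (\<Phi> n) x)"]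
    by simp
  define L where "L ds x = lim (\<lambda>n. partials ds (\<Phi> n) x)" for ds x
  have L: "(\<lambda>n. partials ds (\<Phi> n) x) \<longlonglongrightarrow> L ds x" for ds x
  proof -
    have "Cauchy (\<lambda>n. partials ds (\<Phi> n) x)"
    proof (rule metric_CauchyI)
      fix r :: real assume r: "r > 0"
      obtain N where N: "\<And>n. n \<ge> N \<Longrightarrow> e n < r / 4"
        using order_tendstoD(2)[OF e0, of "r / 4"] r by (auto simp: eventually_sequentially)
      define M where "M = max N (length ds)"
      have "norm (partials ds (\<Phi> m) x - partials ds (\<Phi> n) x) < r" if "m \<ge> M" "n \<ge> M" for m n
        using norm_diff_triangle_le[OF pt1[of ds M m x] , of "partials ds (\<Phi> n) x" "2 * e M"] pt1[of ds M n x] N[of M] that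
        by (auto simp: M_def norm_minus_commute)
      then show "\<exists>M. \<forall>m\<ge>M. \<forall>n\<ge>M. dist (partials ds (\<Phi> m) x) (partials ds (\<Phi> n) x) < r"
        unfolding dist_norm by blast
    qed
    then show ?thesis unfolding L_def by (simp add: Cauchy_convergent convergent_LIMSEQ_iff[symmetric])
  qed
  have Lb: "(1 + norm x) ^ K n * norm (L ds x - partials ds (\<Phi> n) x) \<le> 2 * e n" if "length ds \<le> K n" for n ds x
  proof (rule LIMSEQ_le_const2)
    show "(\<lambda>m. (1 + norm x) ^ K n * norm (partials ds (\<Phi> m) x - partials ds (\<Phi> n) x))
        \<longlonglongrightarrow> (1 + norm x) ^ K n * norm (L ds x - partials ds (\<Phi> n) x)"
      by (intro tendsto_intros L)
    have "(1 + norm x) ^ K n * norm (partials ds (\<Phi> m) x - partials ds (\<Phi> n) x) \<le> 2 * e n" if "m \<ge> n" for m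
      using schwartz_seminorm_ge[OF schwartz_diff[OF \<Phi> \<Phi>] \<open>length ds \<le> K n\<close>, of x m n] tail[OF that] e(1)[of m]
      by (simp add: partials_diff \<Phi>)
    then show "\<exists>N. \<forall>m\<ge>N. (1 + norm x) ^ K n * norm (partials ds (\<Phi> m) x - partials ds (\<Phi> n) x) \<le> 2 * e n" by blast
  qed
  have Lb1: "norm (L ds x - partials ds (\<Phi> n) x) \<le> 2 * e n" if "length ds \<le> n" for n ds x
    using Lb[OF order_trans[OF that K(1)], of x] mult_right_mono[OF one[of x "K n"], of "norm (L ds x - partials ds (\<Phi> n) x)"]
    by simp
  have D: "(L ds has_derivative (\<lambda>h. \<Sum>i\<in>UNIV. h $ i *\<^sub>R L (i # ds) x)) (at x)" for ds x
  proof -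
    have "\<exists>g. \<forall>x\<in>UNIV. (\<lambda>n. partials ds (\<Phi> n) x) \<longlonglongrightarrow> g x \<and>
        (g has_derivative (\<lambda>h. \<Sum>i\<in>UNIV. h $ i *\<^sub>R L (i # ds) x)) (at x within UNIV)"
    proof (rule has_derivative_sequence[where f' = "\<lambda>n x h. \<Sum>i\<in>UNIV. h $ i *\<^sub>R partials (i # ds) (\<Phi> n) x"])
      show "(partials ds (\<Phi> n) has_derivative (\<lambda>h. \<Sum>i\<in>UNIV. h $ i *\<^sub>R partials (i # ds) (\<Phi> n) x)) (at x within UNIV)" for n x
        using has_derivative_partials[OF schwartz_differentiable[OF schwartz_partials[OF \<Phi>]]] by (simp add: partials_Cons)
      show "\<forall>\<^sub>F n in sequentially. \<forall>x\<in>UNIV. \<forall>h. norm ((\<Sum>i\<in>UNIV. h $ i *\<^sub>R partials (i # ds) (\<Phi> n) x) - (\<Sum>i\<in>UNIV. h $ i *\<^sub>R L (i # ds) x)) \<le> r * norm h"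
        if r: "r > 0" for r
      proof -
        have "\<forall>\<^sub>F n in sequentially. e n < r / (2 * CARD('n))"
          using order_tendstoD(2)[OF e0, of "r / (2 * CARD('n))"] r by simp
        then show ?thesis using eventually_ge_at_top[of "Suc (length ds)"]
        proof eventually_elim
          case (elim n)
          have "norm ((\<Sum>i\<in>UNIV. h $ i *\<^sub>R partials (i # ds) (\<Phi> n) x) - (\<Sum>i\<in>UNIV. h $ i *\<^sub>R L (i # ds) x)) \<le> r * norm h" for h x
          proof -
            have "norm ((\<Sum>i\<in>UNIV. h $ i *\<^sub>R partials (i # ds) (\<Phi> n) x) - (\<Sum>i\<in>UNIV. h $ i *\<^sub>R L (i # ds) x))
                = norm (\<Sum>i\<in>UNIV. h $ i *\<^sub>R (partials (i # ds) (\<Phi> n) x - L (i # ds) x))"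
              by (simp add: sum_subtractf scaleR_diff_right)
            also have "\<dots> \<le> (\<Sum>i\<in>(UNIV::'n set). norm h * (2 * e n))"
              using elim Lb1[of "_ # ds" n x]
              by (intro sum_norm_le) (simp only: norm_scaleR, intro mult_mono, auto simp: component_le_norm_cart norm_minus_commute)
            also have "\<dots> = norm h * (2 * CARD('n) * e n)" by simp
            also have "\<dots> \<le> norm h * r"
              using elim(1) by (intro mult_left_mono) (simp_all add: field_simps)
            finally show ?thesis by (simp add: mult.commute)
          qed
          then show ?case by blast
        qed
      qed
      show "(\<lambda>n. partials ds (\<Phi> n) 0) \<longlonglongrightarrow> L ds 0" by (rule L)
    qed auto
    then obtain g where g: "\<And>x. (\<lambda>n. partials ds (\<Phi> n) x) \<longlonglongrightarrow> g x"
      "\<And>x. (g has_derivative (\<lambda>h. \<Sum>i\<in>UNIV. h $ i *\<^sub>R L (i # ds) x)) (at x)" by auto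
    have "g = L ds" using LIMSEQ_unique[OF g(1) L] by blast
    then show ?thesis using g(2) by simp
  qed
  have pL: "partial i (L ds) = L (i # ds)" for i ds
  proof
    fix x
    have "(\<Sum>j\<in>UNIV. axis i 1 $ j *\<^sub>R L (j # ds) x) = (\<Sum>j\<in>UNIV. if j = i then L (j # ds) x else 0)"
      by (intro sum.cong) (auto simp: axis_def)
    then show "partial i (L ds) x = L (i # ds) x" by (subst partial_eqI[OF D]) simp
  qed
  have LS: "L [] \<in> schwartz"
  proof (rule schwartz_coinduct[where X = "range L"])
    fix f k assume "f \<in> range L"
    then obtain ds where f: "f = L ds" by blast
    define n where "n = max k (length ds)"
    obtain B where B: "\<And>x. (1 + norm x) ^ k * norm (partials ds (\<Phi> n) x) \<le> B"
      using schwartz_bound[OF schwartz_partials[OF \<Phi>]] by blast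
    have nK: "n \<le> K n" by (rule K(1))
    have "(1 + norm x) ^ k * norm (f x) \<le> 2 * e n + B" for x
    proof -
      have "(1 + norm x) ^ k * norm (L ds x - partials ds (\<Phi> n) x) \<le> (1 + norm x) ^ K n * norm (L ds x - partials ds (\<Phi> n) x)"
        using nK by (intro mult_right_mono power_increasing) (auto simp: n_def)
      also have "\<dots> \<le> 2 * e n" using nK by (intro Lb) (simp add: n_def)
      finally have 1: "(1 + norm x) ^ k * norm (L ds x - partials ds (\<Phi> n) x) \<le> 2 * e n" .
      have "norm (f x) \<le> norm (L ds x - partials ds (\<Phi> n) x) + norm (partials ds (\<Phi> n) x)"
        unfolding f using norm_triangle_ineq[of "L ds x - partials ds (\<Phi> n) x" "partials ds (\<Phi> n) x"] by simp
      then have "(1 + norm x) ^ k * norm (f x) \<le> (1 + norm x) ^ k * (norm (L ds x - partials ds (\<Phi> n) x) + norm (partials ds (\<Phi> n) x))"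
        by (rule mult_left_mono) simp
      then show ?thesis using 1 B[of x] by (simp add: algebra_simps)
    qed
    then show "\<exists>B. \<forall>x. (1 + norm x) ^ k * norm (f x) \<le> B" by blast
  qed (use D pL in \<open>auto simp: differentiable_def\<close>)
  have PL: "partials ds (L []) = L ds" for ds
    by (induction ds) (auto simp: partials_Cons pL)
  have "schwartz_seminorm (K n) (\<lambda>x. L [] x - \<Phi> n x) \<le> 2 * e n" for n
    by (rule schwartz_seminorm_le) (simp add: partials_diff LS \<Phi> PL Lb)
  then show ?thesis using that LS by blast
qed

text \<open>Gliding hump: a failure of equicontinuity at every stage produces a convergent sequence of
  test functions, the limit of which violates pointwise boundedness.\<close>

theorem tempered_banach_steinhaus:
  fixes U :: "'i \<Rightarrow> 'n::finite distr"
  assumes U: "\<And>i. i \<in> I \<Longrightarrow> U i \<in> tempered"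
    and bd: "\<And>\<phi>. \<phi> \<in> schwartz \<Longrightarrow> \<exists>M. \<forall>i\<in>I. norm (U i \<phi>) \<le> M"
  obtains C k where "C \<ge> 0" "\<And>i \<phi>. i \<in> I \<Longrightarrow> \<phi> \<in> schwartz \<Longrightarrow> norm (U i \<phi>) \<le> C * schwartz_seminorm k \<phi>"
proof (rule ccontr)
  assume "\<not> thesis"
  with that have no: "\<exists>i\<in>I. \<exists>\<phi>\<in>schwartz. norm (U i \<phi>) > C * schwartz_seminorm k \<phi>" if "C \<ge> 0" for C k
    using \<open>C \<ge> 0\<close> by (meson not_less)
  \<comment> \<open>A state consists of the current test function, a seminorm order and a tolerance.
    \<open>Q\<close> demands a functional that stays at least \<open>n\<close> on a whole
    neighbourhood of the new test function, so that the largeness survives the passage to the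
    limit.\<close>
  define P where "P n x = (case x of (\<phi>, K, e) \<Rightarrow> \<phi> \<in> schwartz \<and> e > 0 \<and> K \<ge> n)"
    for n and x :: "'n test \<times> nat \<times> real"
  define Q where "Q n x y = (case x of (\<phi>, K, e) \<Rightarrow> case y of (\<phi>', K', e') \<Rightarrow>
      schwartz_seminorm K (\<lambda>x. \<phi>' x - \<phi> x) \<le> e \<and> K \<le> K' \<and> e' \<le> e / 2 \<and>
      (\<exists>i\<in>I. \<forall>\<psi>\<in>schwartz. schwartz_seminorm K' (\<lambda>x. \<psi> x - \<phi>' x) \<le> 2 * e' \<longrightarrow> norm (U i \<psi>) \<ge> real n))"
    for n and x y :: "'n test \<times> nat \<times> real"
  have "\<exists>f. \<forall>n. P n (f n) \<and> Q n (f n) (f (Suc n))"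
  proof (rule dependent_nat_choice)
    show "\<exists>x. P 0 x" by (rule exI[of _ "(\<lambda>x. 0, 0, 1)"]) (simp add: P_def)
    fix x n assume "P n x"
    then obtain \<phi> K e where x: "x = (\<phi>, K, e)" and \<phi>: "\<phi> \<in> schwartz" and e: "e > 0" and K: "K \<ge> n"
      by (cases x) (auto simp: P_def)
    obtain M0 where "\<forall>i\<in>I. norm (U i \<phi>) \<le> M0" using bd[OF \<phi>] by blast
    then obtain M where M: "M \<ge> 0" "\<And>i. i \<in> I \<Longrightarrow> norm (U i \<phi>) \<le> M"
      by (metis max.cobounded1 max.coboundedI1 max.commute)
    obtain i \<psi> where i: "i \<in> I" and \<psi>: "\<psi> \<in> schwartz"
      and big: "norm (U i \<psi>) > (n + 1 + M) / e * schwartz_seminorm K \<psi>"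
      using no[of "(n + 1 + M) / e" K] e M by auto
    define s where "s = schwartz_seminorm K \<psi>"
    have s: "s \<ge> 0" unfolding s_def by (rule schwartz_seminorm_nonneg[OF \<psi>])
    \<comment> \<open>\<open>c * \<psi>\<close> must be small in the seminorm and large under
      \<open>U i\<close>. If the seminorm of \<open>\<psi>\<close> vanishes, any \<open>c\<close> is
      small enough and the second condition fixes it; otherwise \<open>\<psi>\<close> is normalised
      to size \<open>e\<close>.\<close>
    obtain c :: real where c: "c > 0" "c * s \<le> e" "c * norm (U i \<psi>) \<ge> n + 1 + M"
    proof (cases "s = 0")
      case True
      then have "norm (U i \<psi>) > 0" using big by (simp add: s_def)
      then show ?thesis using True e M(1) by (intro that[of "(n + 1 + M) / norm (U i \<psi>)"]) auto
    next
      case False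
      then show ?thesis using s e big
        by (intro that[of "e / s"]) (auto simp: s_def[symmetric] field_simps)
    qed
    define \<phi>' where "\<phi>' = (\<lambda>x. \<phi> x + complex_of_real c * \<psi> x)"
    have \<phi>': "\<phi>' \<in> schwartz" unfolding \<phi>'_def by (intro schwartz_add schwartz_cmult \<phi> \<psi>)
    have near: "schwartz_seminorm K (\<lambda>x. \<phi>' x - \<phi> x) \<le> e"
      using schwartz_seminorm_cmult[OF \<psi>, of K "of_real c"] c by (simp add: \<phi>'_def s_def)
    have "U i \<phi>' = U i \<phi> + of_real c * U i \<psi>"
      unfolding \<phi>'_def tempered_add[OF U[OF i] \<phi> schwartz_cmult[OF \<psi>]] tempered_cmult[OF U[OF i] \<psi>] ..
    then have "norm (of_real c * U i \<psi>) \<le> norm (U i \<phi>') + norm (U i \<phi>)"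
      using norm_triangle_ineq4[of "U i \<phi>'" "U i \<phi>"] by simp
    then have large: "norm (U i \<phi>') \<ge> n + 1"
      using c M(2)[OF i] by (simp add: norm_mult)
    obtain C' k' where C': "C' \<ge> 0" and bd': "\<And>\<phi>. \<phi> \<in> schwartz \<Longrightarrow> norm (U i \<phi>) \<le> C' * schwartz_seminorm k' \<phi>"
      using tempered_boundE[OF U[OF i]] by blast
    \<comment> \<open>\<open>Suc K\<close> keeps the order at least the stage number. The bound
      \<open>1 / (2 * (C' + 1))\<close> on the tolerance lets \<open>U i\<close> drop by at most 1
      on the neighbourhood, from \<open>n + 1\<close> to \<open>n\<close>.\<close>
    define K' where "K' = max (Suc K) k'"
    define e' where "e' = min (e / 2) (1 / (2 * (C' + 1)))"
    have e': "e' > 0" "e' \<le> e / 2" using e C' by (auto simp: e'_def)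
    have "e' \<le> 1 / (2 * (C' + 1))" by (simp add: e'_def)
    then have "2 * e' \<le> 1 / (C' + 1)" using C' by (simp add: field_simps)
    then have Ce: "C' * (2 * e') \<le> 1"
      using C' e'(1) by (simp add: field_simps)
    have "norm (U i \<zeta>) \<ge> real n" if \<zeta>: "\<zeta> \<in> schwartz" and le: "schwartz_seminorm K' (\<lambda>x. \<zeta> x - \<phi>' x) \<le> 2 * e'" for \<zeta>
    proof -
      have "norm (U i \<zeta> - U i \<phi>') \<le> C' * schwartz_seminorm k' (\<lambda>x. \<zeta> x - \<phi>' x)"
        using bd'[OF schwartz_diff[OF \<zeta> \<phi>']] by (simp add: tempered_diff[OF U[OF i] \<zeta> \<phi>'])
      also have "\<dots> \<le> C' * schwartz_seminorm K' (\<lambda>x. \<zeta> x - \<phi>' x)"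
        using C' by (intro mult_left_mono schwartz_seminorm_mono schwartz_diff \<zeta> \<phi>') (auto simp: K'_def)
      also have "\<dots> \<le> C' * (2 * e')" using le C' by (intro mult_left_mono)
      finally have "norm (U i \<zeta> - U i \<phi>') \<le> 1" using Ce by simp
      then show ?thesis using large norm_triangle_ineq2[of "U i \<phi>'" "U i \<zeta>"] by (simp add: norm_minus_commute)
    qed
    then have "P (Suc n) (\<phi>', K', e') \<and> Q n x (\<phi>', K', e')"
      using \<phi>' e' K near i by (auto simp: P_def Q_def x K'_def)
    then show "\<exists>y. P (Suc n) y \<and> Q n x y" by blast
  qed
  then obtain f where f: "\<And>n. P n (f n)" "\<And>n. Q n (f n) (f (Suc n))" by blast
  define \<Phi> K e where "\<Phi> n = fst (f n)" and "K n = fst (snd (f n))" and "e n = snd (snd (f n))" for n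
  have fn: "f n = (\<Phi> n, K n, e n)" for n by (simp add: \<Phi>_def K_def e_def)
  have P': "\<Phi> n \<in> schwartz" "e n > 0" "K n \<ge> n" for n
    using f(1)[of n] by (auto simp: fn P_def)
  have Q': "schwartz_seminorm (K n) (\<lambda>x. \<Phi> (Suc n) x - \<Phi> n x) \<le> e n" "K n \<le> K (Suc n)" "e (Suc n) \<le> e n / 2"
    and Q'': "\<exists>i\<in>I. \<forall>\<psi>\<in>schwartz. schwartz_seminorm (K (Suc n)) (\<lambda>x. \<psi> x - \<Phi> (Suc n) x) \<le> 2 * e (Suc n) \<longrightarrow> norm (U i \<psi>) \<ge> real n"
    for n
    using f(2)[of n] unfolding fn Q_def by simp_all
  obtain \<phi> where \<phi>: "\<phi> \<in> schwartz" "\<And>n. schwartz_seminorm (K n) (\<lambda>x. \<phi> x - \<Phi> n x) \<le> 2 * e n"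
    by (rule schwartz_complete[OF P'(1) P'(3) Q'(2) P'(2) Q'(3) Q'(1)]) (rule that)
  obtain M where M: "\<And>i. i \<in> I \<Longrightarrow> norm (U i \<phi>) \<le> M" using bd[OF \<phi>(1)] by blast
  obtain n where n: "real n > M" using reals_Archimedean2 by blast
  obtain i where "i \<in> I" "norm (U i \<phi>) \<ge> real n"
    using Q''[of n] \<phi>(1) \<phi>(2)[of "Suc n"] by auto
  then show False using M[of i] n by simp
qed

section \<open>Weak and mild equations for distribution-valued curves\<close>

lemma CT_tempered_tempered: "w \<in> CT_tempered T \<Longrightarrow> s \<in> {0..T} \<Longrightarrow> w s \<in> tempered"
  by (simp add: CT_tempered_def)

lemma CT_tempered_continuous:
  "w \<in> CT_tempered T \<Longrightarrow> \<phi> \<in> schwartz \<Longrightarrow> S \<subseteq> {0..T} \<Longrightarrow> continuous_on S (\<lambda>s. w s \<phi>)"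
  unfolding CT_tempered_def by (blast intro: continuous_on_subset)

text \<open>Pointwise boundedness comes from compactness of the time interval. One pair
  \<open>C\<close>, \<open>k\<close> for all times is what allows the test function to vary with
  time.\<close>

lemma CT_tempered_equicontinuous:
  assumes w: "w \<in> CT_tempered T"
  obtains C k where "C \<ge> 0"
    "\<And>s \<phi>. s \<in> {0..T} \<Longrightarrow> \<phi> \<in> schwartz \<Longrightarrow> norm (w s \<phi>) \<le> C * schwartz_seminorm k \<phi>"
proof (rule tempered_banach_steinhaus[of "{0..T}" w])
  show "w s \<in> tempered" if "s \<in> {0..T}" for s using w that by (rule CT_tempered_tempered)
  show "\<exists>M. \<forall>s\<in>{0..T}. norm (w s \<phi>) \<le> M" if "\<phi> \<in> schwartz" for \<phi>
  proof -
    have "compact ((\<lambda>s. w s \<phi>) ` {0..T})"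
      by (intro compact_continuous_image CT_tempered_continuous[OF w that]) auto
    from compact_imp_bounded[OF this] show ?thesis by (auto simp: bounded_iff)
  qed
qed (rule that)

section \<open>Distributions and curves tested on the heat flow\<close>

lemma tempered_heat_has_vector_derivative:
  fixes u :: "'n::finite distr"
  assumes u: "u \<in> tempered" and \<phi>: "\<phi> \<in> schwartz" and t: "t \<in> {a..b}"
  shows "((\<lambda>t. u (heat (b - t) \<phi>)) has_vector_derivative - u (heat (b - t) (heat_gen \<phi>))) (at t within {a..b})"
proof -
  obtain C k where C: "C \<ge> 0" and bd: "\<And>\<phi>. \<phi> \<in> schwartz \<Longrightarrow> norm (u \<phi>) \<le> C * schwartz_seminorm k \<phi>"
    by (rule tempered_boundE[OF u]) (rule that)
  obtain L where L: "L \<ge> 0" and tay: "\<And>s t \<phi>. s \<in> {0..b - a} \<Longrightarrow> t \<in> {0..b - a} \<Longrightarrow> \<phi> \<in> schwartz \<Longrightarrow>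
      schwartz_seminorm k (\<lambda>x. heat t (\<phi> :: 'n::finite test) x - heat s \<phi> x - of_real (t - s) * heat s (heat_gen \<phi>) x)
        \<le> L * schwartz_seminorm k (heat_gen (heat_gen \<phi>)) * \<bar>t - s\<bar>\<^sup>2"
    by (rule heat_seminorm_taylor[where T = "b - a" and k = k]) (rule that)
  define M where "M = C * (L * schwartz_seminorm k (heat_gen (heat_gen \<phi>)))"
  show ?thesis
    unfolding has_vector_derivative_def
  proof (rule has_derivativeI_sandwich[where e = 1])
    show "bounded_linear (\<lambda>h. h *\<^sub>R - u (heat (b - t) (heat_gen \<phi>)))" by (rule bounded_linear_scaleR_left)
    have "((\<lambda>r. M * \<bar>r - t\<bar>) \<longlongrightarrow> M * \<bar>t - t\<bar>) (at t within {a..b})" by (intro tendsto_intros)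
    then show "((\<lambda>r. M * \<bar>r - t\<bar>) \<longlongrightarrow> 0) (at t within {a..b})" by simp
    fix r assume r: "r \<in> {a..b}" "r \<noteq> t"
    let ?E = "\<lambda>x. heat (b - r) \<phi> x - heat (b - t) \<phi> x - of_real ((b - r) - (b - t)) * heat (b - t) (heat_gen \<phi>) x"
    have S: "heat (b - r) \<phi> \<in> schwartz" "heat (b - t) \<phi> \<in> schwartz" "heat (b - t) (heat_gen \<phi>) \<in> schwartz"
      using r t by (auto intro!: schwartz_heat schwartz_heat_gen \<phi>)
    have "u ?E = u (heat (b - r) \<phi>) - u (heat (b - t) \<phi>) - of_real ((b - r) - (b - t)) * u (heat (b - t) (heat_gen \<phi>))"
      by (simp only: tempered_diff[OF u] tempered_cmult[OF u] S schwartz_diff schwartz_cmult)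
    also have "\<dots> = u (heat (b - r) \<phi>) - u (heat (b - t) \<phi>) - (r - t) *\<^sub>R - u (heat (b - t) (heat_gen \<phi>))"
      by (simp add: scaleR_conv_of_real[where 'a = complex] algebra_simps)
    finally have E: "u (heat (b - r) \<phi>) - u (heat (b - t) \<phi>) - (r - t) *\<^sub>R - u (heat (b - t) (heat_gen \<phi>)) = u ?E" by simp
    have "norm (u ?E) \<le> C * schwartz_seminorm k ?E"
      by (intro bd schwartz_diff schwartz_cmult S)
    also have "\<dots> \<le> C * (L * schwartz_seminorm k (heat_gen (heat_gen \<phi>)) * \<bar>(b - r) - (b - t)\<bar>\<^sup>2)"
      using r t by (intro mult_left_mono C tay \<phi>) auto
    also have "\<dots> = M * \<bar>r - t\<bar> * norm (r - t)"
      by (simp add: M_def power2_eq_square abs_minus_commute[of t r] mult_ac)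
    finally show "norm (u (heat (b - r) \<phi>) - u (heat (b - t) \<phi>) - (r - t) *\<^sub>R - u (heat (b - t) (heat_gen \<phi>))) / norm (r - t)
        \<le> M * \<bar>r - t\<bar>"
      unfolding E using r by (simp add: divide_le_eq)
  qed simp
qed

lemma tempered_heat_integral:
  fixes u :: "'n::finite distr"
  assumes u: "u \<in> tempered" and \<phi>: "\<phi> \<in> schwartz" and ab: "a \<le> b"
  shows "((\<lambda>t. u (heat (b - t) (heat_gen \<phi>))) has_integral u (heat (b - a) \<phi>) - u \<phi>) {a..b}"
proof -
  have "((\<lambda>t. - u (heat (b - t) (heat_gen \<phi>))) has_integral u (heat (b - b) \<phi>) - u (heat (b - a) \<phi>)) {a..b}"
    by (rule fundamental_theorem_of_calculus[OF ab tempered_heat_has_vector_derivative[OF u \<phi>]])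
  from has_integral_neg[OF this] show ?thesis by simp
qed

text \<open>The increment is split in two: a change of the heat time at the moving distribution,
  controlled by equicontinuity and the Lipschitz bound for the flow, and a change of the
  distribution at a fixed test function.\<close>

lemma CT_tempered_heat_continuous:
  fixes w :: "real \<Rightarrow> 'n::finite distr"
  assumes w: "w \<in> CT_tempered T" and \<phi>: "\<phi> \<in> schwartz"
  shows "continuous_on ({0..T} \<times> {0..T}) (\<lambda>(s, \<tau>). w s (heat \<tau> \<phi>))"
proof -
  obtain C k where C: "C \<ge> 0" and bd: "\<And>s \<phi>. s \<in> {0..T} \<Longrightarrow> \<phi> \<in> schwartz \<Longrightarrow> norm (w s \<phi>) \<le> C * schwartz_seminorm k \<phi>"
    by (rule CT_tempered_equicontinuous[OF w]) (rule that)
  obtain L where L: "L \<ge> 0" and lip: "\<And>s t \<phi>. s \<in> {0..T} \<Longrightarrow> t \<in> {0..T} \<Longrightarrow> \<phi> \<in> schwartz \<Longrightarrow>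
      schwartz_seminorm k (\<lambda>x. heat t (\<phi> :: 'n::finite test) x - heat s \<phi> x) \<le> L * schwartz_seminorm k (heat_gen \<phi>) * \<bar>t - s\<bar>"
    by (rule heat_seminorm_diff_le[where T = T and k = k]) (rule that)
  define M where "M = C * (L * schwartz_seminorm k (heat_gen \<phi>))"
  show ?thesis
    unfolding continuous_on_def
  proof
    fix z0 assume z0: "z0 \<in> {0..T} \<times> {0..T}"
    obtain s0 \<tau>0 where z0_eq: "z0 = (s0, \<tau>0)" by (cases z0)
    have z: "s0 \<in> {0..T}" "\<tau>0 \<in> {0..T}" using z0 by (auto simp: z0_eq)
    let ?F = "at (s0, \<tau>0) within {0..T} \<times> {0..T}"
    have S0: "heat \<tau>0 \<phi> \<in> schwartz" using z by (auto intro!: schwartz_heat \<phi>)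
    have 1: "((\<lambda>z. w (fst z) (heat (snd z) \<phi>) - w (fst z) (heat \<tau>0 \<phi>)) \<longlongrightarrow> 0) ?F"
    proof (rule Lim_null_comparison)
      show "\<forall>\<^sub>F z in ?F. norm (w (fst z) (heat (snd z) \<phi>) - w (fst z) (heat \<tau>0 \<phi>)) \<le> M * \<bar>snd z - \<tau>0\<bar>"
        unfolding eventually_at_filter
      proof (rule always_eventually, intro allI impI)
        fix z assume "z \<in> {0..T} \<times> {0..T}"
        then have z': "fst z \<in> {0..T}" "snd z \<in> {0..T}" by auto
        have S: "heat (snd z) \<phi> \<in> schwartz" using z' by (auto intro!: schwartz_heat \<phi>)
        have "norm (w (fst z) (\<lambda>x. heat (snd z) \<phi> x - heat \<tau>0 \<phi> x)) \<le> C * schwartz_seminorm k (\<lambda>x. heat (snd z) \<phi> x - heat \<tau>0 \<phi> x)"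
          by (intro bd z' schwartz_diff S S0)
        also have "\<dots> \<le> C * (L * schwartz_seminorm k (heat_gen \<phi>) * \<bar>snd z - \<tau>0\<bar>)"
          by (intro mult_left_mono C lip z z' \<phi>)
        finally show "norm (w (fst z) (heat (snd z) \<phi>) - w (fst z) (heat \<tau>0 \<phi>)) \<le> M * \<bar>snd z - \<tau>0\<bar>"
          by (simp add: M_def mult_ac tempered_diff[OF CT_tempered_tempered[OF w z'(1)] S S0])
      qed
      have "((\<lambda>z. M * \<bar>snd z - \<tau>0\<bar>) \<longlongrightarrow> M * \<bar>snd (s0, \<tau>0) - \<tau>0\<bar>) ?F" by (intro tendsto_intros)
      then show "((\<lambda>z. M * \<bar>snd z - \<tau>0\<bar>) \<longlongrightarrow> 0) ?F" by simp
    qed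
    have "continuous_on ({0..T} \<times> {0..T}) (\<lambda>z. w (fst z) (heat \<tau>0 \<phi>))"
      by (rule continuous_on_compose2[OF CT_tempered_continuous[OF w S0 subset_refl] continuous_on_fst[OF continuous_on_id]]) auto
    then have 2: "((\<lambda>z. w (fst z) (heat \<tau>0 \<phi>)) \<longlongrightarrow> w s0 (heat \<tau>0 \<phi>)) ?F"
      using z0 unfolding continuous_on_def z0_eq by fastforce
    show "((\<lambda>(s, \<tau>). w s (heat \<tau> \<phi>)) \<longlongrightarrow> (case z0 of (s, \<tau>) \<Rightarrow> w s (heat \<tau> \<phi>))) (at z0 within {0..T} \<times> {0..T})"
      using tendsto_add[OF 1 2] by (simp add: z0_eq split_def)
  qed
qed

lemma CT_tempered_heat_continuous':
  fixes w :: "real \<Rightarrow> 'n::finite distr"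
  assumes w: "w \<in> CT_tempered T" and \<phi>: "\<phi> \<in> schwartz" and t: "0 \<le> t"
  shows "continuous_on {t..T} (\<lambda>s. w s (heat (s - t) \<phi>))"
  by (rule continuous_on_compose2[OF CT_tempered_heat_continuous[OF w \<phi>],
        where f = "\<lambda>s. (s, s - t)", simplified])
    (use t in \<open>auto intro!: continuous_intros\<close>)

text \<open>A product rule for a pairing whose two sides both depend on \<open>s\<close>. Since
  \<open>\<zeta>\<close> is the generator applied to \<open>\<psi>\<close>, the time derivative of
  the test function cancels the generator term in the derivative of \<open>u\<close>.\<close>

lemma CT_tempered_heat_has_vector_derivative:
  fixes u w :: "real \<Rightarrow> 'n::finite distr"
  assumes u: "u \<in> CT_tempered T" and \<phi>: "\<phi> \<in> schwartz" and s: "s \<in> {t..T}" and t: "0 \<le> t"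
    and du: "\<And>\<psi>. \<psi> \<in> schwartz \<Longrightarrow> ((\<lambda>s. u s \<psi>) has_vector_derivative - (u s (heat_gen \<psi>) + w s \<psi>)) (at s within {0..T})"
  shows "((\<lambda>s. u s (heat (s - t) \<phi>)) has_vector_derivative - w s (heat (s - t) \<phi>)) (at s within {t..T})"
proof -
  obtain C k where C: "C \<ge> 0" and bd: "\<And>s \<phi>. s \<in> {0..T} \<Longrightarrow> \<phi> \<in> schwartz \<Longrightarrow> norm (u s \<phi>) \<le> C * schwartz_seminorm k \<phi>"
    by (rule CT_tempered_equicontinuous[OF u]) (rule that)
  obtain L where L: "L \<ge> 0" and tay: "\<And>s t \<phi>. s \<in> {0..T} \<Longrightarrow> t \<in> {0..T} \<Longrightarrow> \<phi> \<in> schwartz \<Longrightarrow>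
      schwartz_seminorm k (\<lambda>x. heat t (\<phi> :: 'n::finite test) x - heat s \<phi> x - of_real (t - s) * heat s (heat_gen \<phi>) x)
        \<le> L * schwartz_seminorm k (heat_gen (heat_gen \<phi>)) * \<bar>t - s\<bar>\<^sup>2"
    by (rule heat_seminorm_taylor[where T = T and k = k]) (rule that)
  define M where "M = C * (L * schwartz_seminorm k (heat_gen (heat_gen \<phi>)))"
  define \<psi> where "\<psi> = heat (s - t) \<phi>"
  define \<zeta> where "\<zeta> = heat (s - t) (heat_gen \<phi>)"
  have \<psi>: "\<psi> \<in> schwartz" and \<zeta>: "\<zeta> \<in> schwartz"
    using s by (auto simp: \<psi>_def \<zeta>_def intro!: schwartz_heat schwartz_heat_gen \<phi>)
  have gen: "heat_gen \<psi> = \<zeta>" using s by (simp add: \<psi>_def \<zeta>_def heat_gen_heat \<phi>)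
  define R where "R r = u r \<psi> - u s \<psi> - (r - s) *\<^sub>R - (u s \<zeta> + w s \<psi>)" for r
  have R0: "((\<lambda>r. norm (R r) / norm (r - s)) \<longlongrightarrow> 0) (at s within {t..T})"
  proof -
    have "((\<lambda>r. (1 / norm (r - s)) *\<^sub>R (u r \<psi> - (u s \<psi> + (r - s) *\<^sub>R - (u s \<zeta> + w s \<psi>)))) \<longlongrightarrow> 0) (at s within {0..T})"
      using du[OF \<psi>] unfolding has_vector_derivative_def has_derivative_within gen by (rule conjunct2)
    from tendsto_norm_zero[OF this]
    have "((\<lambda>r. norm (R r) / norm (r - s)) \<longlongrightarrow> 0) (at s within {0..T})"
      by (simp add: R_def divide_inverse mult.commute diff_diff_eq)
    then show ?thesis using t by (rule_tac tendsto_within_subset) auto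
  qed
  have c: "((\<lambda>r. norm (u r \<zeta> - u s \<zeta>)) \<longlongrightarrow> 0) (at s within {t..T})"
  proof -
    have "continuous_on {t..T} (\<lambda>r. u r \<zeta>)" using t by (intro CT_tempered_continuous[OF u \<zeta>]) auto
    then have "((\<lambda>r. u r \<zeta>) \<longlongrightarrow> u s \<zeta>) (at s within {t..T})" using s unfolding continuous_on_def by blast
    then show ?thesis by (intro tendsto_norm_zero) (simp add: LIM_zero)
  qed
  show ?thesis
    unfolding has_vector_derivative_def
  proof (rule has_derivativeI_sandwich[where e = 1])
    show "bounded_linear (\<lambda>h. h *\<^sub>R - w s (heat (s - t) \<phi>))" by (rule bounded_linear_scaleR_left)
    have "((\<lambda>r. M * \<bar>r - s\<bar> + norm (u r \<zeta> - u s \<zeta>) + norm (R r) / norm (r - s)) \<longlongrightarrow> M * \<bar>s - s\<bar> + 0 + 0) (at s within {t..T})"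
      by (intro tendsto_add c R0) (intro tendsto_intros)
    then show "((\<lambda>r. M * \<bar>r - s\<bar> + norm (u r \<zeta> - u s \<zeta>) + norm (R r) / norm (r - s)) \<longlongrightarrow> 0) (at s within {t..T})" by simp
    fix r assume r: "r \<in> {t..T}" "r \<noteq> s"
    let ?E = "\<lambda>x. heat (r - t) \<phi> x - \<psi> x - of_real ((r - t) - (s - t)) * \<zeta> x"
    have r0: "r \<in> {0..T}" using r t by simp
    note ur = CT_tempered_tempered[OF u r0]
    have S: "heat (r - t) \<phi> \<in> schwartz" using r by (auto intro!: schwartz_heat \<phi>)
    have "u r ?E = u r (heat (r - t) \<phi>) - u r \<psi> - of_real ((r - t) - (s - t)) * u r \<zeta>"
      by (simp only: tempered_diff[OF ur] tempered_cmult[OF ur] S \<psi> \<zeta> schwartz_diff schwartz_cmult)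
    \<comment> \<open>Three remainders: the Taylor error of the flow paired with \<open>u r\<close>,
      the difference between \<open>u r\<close> and \<open>u s\<close> on the fixed
      \<open>\<zeta>\<close>, and the error \<open>R r\<close> of \<open>u\<close> on the fixed
      \<open>\<psi>\<close>. The first uses equicontinuity because \<open>u r\<close> moves as
      well.\<close>
    then have E: "u r (heat (r - t) \<phi>) - u s \<psi> - (r - s) *\<^sub>R - w s \<psi>
        = u r ?E + (r - s) *\<^sub>R (u r \<zeta> - u s \<zeta>) + R r"
      by (simp add: R_def scaleR_conv_of_real[where 'a = complex] algebra_simps)
    have "norm (u r ?E) \<le> C * schwartz_seminorm k ?E"
      by (intro bd r0 schwartz_diff schwartz_cmult S \<psi> \<zeta>)
    also have "\<dots> \<le> C * (L * schwartz_seminorm k (heat_gen (heat_gen \<phi>)) * \<bar>(r - t) - (s - t)\<bar>\<^sup>2)"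
      unfolding \<psi>_def \<zeta>_def using r s t by (intro mult_left_mono C tay \<phi>) auto
    also have "\<dots> = M * \<bar>r - s\<bar> * norm (r - s)"
      by (simp add: M_def power2_eq_square mult_ac)
    finally have 1: "norm (u r ?E) \<le> M * \<bar>r - s\<bar> * norm (r - s)" .
    have "norm (u r (heat (r - t) \<phi>) - u s \<psi> - (r - s) *\<^sub>R - w s \<psi>)
        \<le> norm (u r ?E) + norm ((r - s) *\<^sub>R (u r \<zeta> - u s \<zeta>)) + norm (R r)"
      unfolding E by (intro order_trans[OF norm_triangle_ineq] add_right_mono norm_triangle_ineq)
    also have "\<dots> \<le> M * \<bar>r - s\<bar> * norm (r - s) + norm (u r \<zeta> - u s \<zeta>) * norm (r - s) + norm (R r)"
      using 1 by simp
    also have "\<dots> = (M * \<bar>r - s\<bar> + norm (u r \<zeta> - u s \<zeta>) + norm (R r) / norm (r - s)) * norm (r - s)"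
      using r by (simp add: distrib_right)
    finally show "norm (u r (heat (r - t) \<phi>) - u s (heat (s - t) \<phi>) - (r - s) *\<^sub>R - w s (heat (s - t) \<phi>)) / norm (r - s)
        \<le> M * \<bar>r - s\<bar> + norm (u r \<zeta> - u s \<zeta>) + norm (R r) / norm (r - s)"
      unfolding \<psi>_def[symmetric] using r by (simp add: divide_le_eq)
  qed simp
qed

section \<open>Equivalence of the weak and the mild equation for curves\<close>

lemma integral_lower_has_vector_derivative:
  fixes f :: "real \<Rightarrow> 'a::banach"
  assumes f: "continuous_on {a..b} f" and t: "t \<in> {a..b}"
  shows "((\<lambda>t. integral {t..b} f) has_vector_derivative - f t) (at t within {a..b})"
proof (rule has_vector_derivative_transform[OF t])
  show "integral {r..b} f = integral {a..b} f - integral {a..r} f" if "r \<in> {a..b}" for r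
    using Henstock_Kurzweil_Integration.integral_combine[of a r b f] integrable_continuous_real[OF f] that
    by (auto simp: algebra_simps)
  show "((\<lambda>r. integral {a..b} f - integral {a..r} f) has_vector_derivative - f t) (at t within {a..b})"
    using has_vector_derivative_diff[OF has_vector_derivative_const integral_has_vector_derivative[OF f t], of "integral {a..b} f"]
    by simp
qed

lemma weak_imp_mild:
  fixes u w :: "real \<Rightarrow> 'n::finite distr"
  assumes u: "u \<in> CT_tempered T" and w: "w \<in> CT_tempered T" and T: "T \<ge> 0"
    and weak: "\<And>t \<phi>. t \<in> {0..T} \<Longrightarrow> \<phi> \<in> schwartz \<Longrightarrow>
      u t \<phi> = vT \<phi> + integral {t..T} (\<lambda>s. u s (heat_gen \<phi>)) + integral {t..T} (\<lambda>s. w s \<phi>)"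
    and t: "t \<in> {0..T}" and \<phi>: "\<phi> \<in> schwartz"
  shows "u t \<phi> = vT (heat (T - t) \<phi>) + integral {t..T} (\<lambda>s. w s (heat (s - t) \<phi>))"
proof -
  have du: "((\<lambda>s. u s \<psi>) has_vector_derivative - (u s (heat_gen \<psi>) + w s \<psi>)) (at s within {0..T})"
    if \<psi>: "\<psi> \<in> schwartz" and s: "s \<in> {0..T}" for s \<psi>
  proof (rule has_vector_derivative_transform[OF s])
    show "u r \<psi> = vT \<psi> + integral {r..T} (\<lambda>s. u s (heat_gen \<psi>)) + integral {r..T} (\<lambda>s. w s \<psi>)" if "r \<in> {0..T}" for r
      by (rule weak[OF that \<psi>])
    have "((\<lambda>r. vT \<psi> + integral {r..T} (\<lambda>s. u s (heat_gen \<psi>)) + integral {r..T} (\<lambda>s. w s \<psi>)) has_vector_derivative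
        0 + - u s (heat_gen \<psi>) + - w s \<psi>) (at s within {0..T})"
      by (intro has_vector_derivative_add has_vector_derivative_const integral_lower_has_vector_derivative
          CT_tempered_continuous[OF u] CT_tempered_continuous[OF w] schwartz_heat_gen \<psi> s) auto
    then show "((\<lambda>r. vT \<psi> + integral {r..T} (\<lambda>s. u s (heat_gen \<psi>)) + integral {r..T} (\<lambda>s. w s \<psi>)) has_vector_derivative
        - (u s (heat_gen \<psi>) + w s \<psi>)) (at s within {0..T})" by (simp add: algebra_simps)
  qed
  have uT: "u T \<psi> = vT \<psi>" if "\<psi> \<in> schwartz" for \<psi>
    using weak[of T \<psi>] that T by simp
  have "((\<lambda>s. - w s (heat (s - t) \<phi>)) has_integral u T (heat (T - t) \<phi>) - u t (heat (t - t) \<phi>)) {t..T}"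
  proof (rule fundamental_theorem_of_calculus)
    fix s assume s: "s \<in> {t..T}"
    show "((\<lambda>s. u s (heat (s - t) \<phi>)) has_vector_derivative - w s (heat (s - t) \<phi>)) (at s within {t..T})"
      using s t by (intro CT_tempered_heat_has_vector_derivative[OF u \<phi> s] du) auto
  qed (use t in auto)
  from has_integral_neg[OF this]
  have "((\<lambda>s. w s (heat (s - t) \<phi>)) has_integral u t \<phi> - vT (heat (T - t) \<phi>)) {t..T}"
    using t by (simp add: uT schwartz_heat \<phi>)
  then show ?thesis by (simp add: integral_unique)
qed

lemma mild_imp_weak:
  fixes u w :: "real \<Rightarrow> 'n::finite distr"
  assumes u: "u \<in> CT_tempered T" and w: "w \<in> CT_tempered T" and vT: "vT \<in> tempered"
    and mild: "\<And>t \<phi>. t \<in> {0..T} \<Longrightarrow> \<phi> \<in> schwartz \<Longrightarrow>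
      u t \<phi> = vT (heat (T - t) \<phi>) + integral {t..T} (\<lambda>s. w s (heat (s - t) \<phi>))"
    and r: "r \<in> {0..T}" and \<phi>: "\<phi> \<in> schwartz"
  shows "u r \<phi> = vT \<phi> + integral {r..T} (\<lambda>s. u s (heat_gen \<phi>)) + integral {r..T} (\<lambda>s. w s \<phi>)"
proof -
  have r0: "0 \<le> r" and rT: "r \<le> T" using r by auto
  define c where "c s = w s (heat_gen \<phi>)" for s
  \<comment> \<open>\<open>F\<close> extends the integrand from the triangle to the square. Clamping
    the heat time at 0 and subtracting \<open>c s\<close>, the value there, makes the extension
    continuous and zero for \<open>s \<le> t\<close>, so that the order of integration can be
    exchanged on a rectangle.\<close>
  define F where "F t s = w s (heat (max (s - t) 0) (heat_gen \<phi>)) - c s" for t s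
  note L = schwartz_heat_gen[OF \<phi>]
  have cc: "continuous_on {r..T} c" unfolding c_def using r0 by (intro CT_tempered_continuous[OF w L]) auto
  have wc: "continuous_on {r..T} (\<lambda>s. w s \<phi>)" using r0 by (intro CT_tempered_continuous[OF w \<phi>]) auto
  have F0: "F t s = 0" if "s \<le> t" for s t using that by (simp add: F_def c_def)
  have "continuous_on ({r..T} \<times> {r..T}) (\<lambda>z. (\<lambda>(s, \<tau>). w s (heat \<tau> (heat_gen \<phi>))) (snd z, max (snd z - fst z) 0))"
    by (rule continuous_on_compose2[OF CT_tempered_heat_continuous[OF w L]])
      (use r0 in \<open>auto intro!: continuous_intros\<close>)
  moreover have "continuous_on ({r..T} \<times> {r..T}) (\<lambda>z. c (snd z))"
    by (rule continuous_on_compose2[OF cc]) (auto intro!: continuous_intros)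
  ultimately have Fc: "continuous_on ({r..T} \<times> {r..T}) (\<lambda>(t, s). F t s)"
    unfolding F_def split_def by (auto intro!: continuous_on_diff)
  have Fc1: "continuous_on {r..T} (F t)" if "t \<in> {r..T}" for t
  proof -
    have 1: "continuous_on {r..T} (\<lambda>s. (t, s))" by (intro continuous_intros)
    have 2: "(\<lambda>s. (t, s)) ` {r..T} \<subseteq> {r..T} \<times> {r..T}" using that by auto
    from continuous_on_compose2[OF Fc 1 2] show ?thesis by simp
  qed
  have Fc2: "continuous_on {r..T} (\<lambda>t. F t s)" if "s \<in> {r..T}" for s
  proof -
    have 1: "continuous_on {r..T} (\<lambda>t. (t, s))" by (intro continuous_intros)
    have 2: "(\<lambda>t. (t, s)) ` {r..T} \<subseteq> {r..T} \<times> {r..T}" using that by auto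
    from continuous_on_compose2[OF Fc 1 2] show ?thesis by simp
  qed
  have swap: "integral {r..T} (\<lambda>t. integral {r..T} (F t)) = integral {r..T} (\<lambda>s. integral {r..T} (\<lambda>t. F t s))"
    using integral_swap_continuous[of r r T T F] Fc by (simp add: cbox_Pair_eq)
  have inner1: "integral {t..T} (\<lambda>s. w s (heat (s - t) (heat_gen \<phi>))) = integral {r..T} (F t) + integral {t..T} c"
    if t: "t \<in> {r..T}" for t
  proof -
    have "integral {r..T} (F t) = integral {r..t} (F t) + integral {t..T} (F t)"
      using t integrable_continuous_real[OF Fc1[OF t]]
      by (intro Henstock_Kurzweil_Integration.integral_combine[symmetric]) auto
    also have "integral {r..t} (F t) = integral {r..t} (\<lambda>s. 0)"
      by (intro Henstock_Kurzweil_Integration.integral_cong F0) auto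
    also have "integral {t..T} (F t) = integral {t..T} (\<lambda>s. w s (heat (s - t) (heat_gen \<phi>)) - c s)"
      by (intro Henstock_Kurzweil_Integration.integral_cong) (auto simp: F_def max_def)
    also have "\<dots> = integral {t..T} (\<lambda>s. w s (heat (s - t) (heat_gen \<phi>))) - integral {t..T} c"
      using t r0 cc
      by (intro Henstock_Kurzweil_Integration.integral_diff integrable_continuous_real CT_tempered_heat_continuous'[OF w L])
        (auto intro: continuous_on_subset)
    finally show ?thesis by simp
  qed
  \<comment> \<open>Integrating the generator over the heat time telescopes to
    \<open>heat (s - r) \<phi>\<close> minus \<open>\<phi>\<close>; the subtracted constant
    contributes \<open>(s - r) *\<^sub>R c s\<close>.\<close>
  have inner2: "integral {r..T} (\<lambda>t. F t s) = w s (heat (s - r) \<phi>) - w s \<phi> - (s - r) *\<^sub>R c s"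
    if s: "s \<in> {r..T}" for s
  proof -
    have ws: "w s \<in> tempered" using s r0 by (intro CT_tempered_tempered[OF w]) auto
    have "integral {r..T} (\<lambda>t. F t s) = integral {r..s} (\<lambda>t. F t s) + integral {s..T} (\<lambda>t. F t s)"
      using s integrable_continuous_real[OF Fc2[OF s]]
      by (intro Henstock_Kurzweil_Integration.integral_combine[symmetric]) auto
    also have "integral {s..T} (\<lambda>t. F t s) = integral {s..T} (\<lambda>t. 0)"
      by (intro Henstock_Kurzweil_Integration.integral_cong F0) auto
    also have "integral {r..s} (\<lambda>t. F t s) = integral {r..s} (\<lambda>t. w s (heat (s - t) (heat_gen \<phi>)) - c s)"
      by (intro Henstock_Kurzweil_Integration.integral_cong) (auto simp: F_def max_def)
    also have "\<dots> = w s (heat (s - r) \<phi>) - w s \<phi> - (s - r) *\<^sub>R c s"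
      using has_integral_diff[OF tempered_heat_integral[OF ws \<phi>, of r s] has_integral_const_real[of "c s" r s]] s
      by (intro integral_unique) auto
    finally show ?thesis by simp
  qed
  \<comment> \<open>The two corrections caused by subtracting \<open>c\<close> cancel: the integrand
    is the derivative of \<open>t - r\<close> times the integral of \<open>c\<close> over
    \<open>{t..T}\<close>, which vanishes at both end points.\<close>
  have c_int: "((\<lambda>t. integral {t..T} c - (t - r) *\<^sub>R c t) has_integral 0) {r..T}"
  proof -
    have "((\<lambda>t. (t - r) *\<^sub>R - c t + 1 *\<^sub>R integral {t..T} c) has_integral
        (T - r) *\<^sub>R integral {T..T} c - (r - r) *\<^sub>R integral {r..T} c) {r..T}"
      using rT by (intro fundamental_theorem_of_calculus has_vector_derivative_scaleR integral_lower_has_vector_derivative cc)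
        (auto intro!: derivative_eq_intros)
    then show ?thesis by (simp add: algebra_simps)
  qed
  have I1: "((\<lambda>t. vT (heat (T - t) (heat_gen \<phi>))) has_integral vT (heat (T - r) \<phi>) - vT \<phi>) {r..T}"
    by (rule tempered_heat_integral[OF vT \<phi> rT])
  have uc: "continuous_on {r..T} (\<lambda>t. u t (heat_gen \<phi>))"
    using r0 by (intro CT_tempered_continuous[OF u L]) auto
  have ci: "continuous_on {r..T} (\<lambda>t. integral {t..T} c)"
    by (rule continuous_on_vector_derivative[OF integral_lower_has_vector_derivative[OF cc]])
  have sc: "continuous_on {r..T} (\<lambda>t. (t - r) *\<^sub>R c t)" by (intro continuous_intros cc)
  have Feq: "integral {r..T} (F t) = u t (heat_gen \<phi>) - vT (heat (T - t) (heat_gen \<phi>)) - integral {t..T} c"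
    if "t \<in> {r..T}" for t
    using inner1[OF that] mild[of t "heat_gen \<phi>"] L that r0 by simp
  have vi: "(\<lambda>t. vT (heat (T - t) (heat_gen \<phi>))) integrable_on {r..T}" using I1 by blast
  have ui: "(\<lambda>t. u t (heat_gen \<phi>)) integrable_on {r..T}" using uc by (rule integrable_continuous_real)
  have cii: "(\<lambda>t. integral {t..T} c) integrable_on {r..T}" using ci by (rule integrable_continuous_real)
  have "integral {r..T} (\<lambda>t. integral {r..T} (F t))
      = integral {r..T} (\<lambda>t. u t (heat_gen \<phi>) - vT (heat (T - t) (heat_gen \<phi>)) - integral {t..T} c)"
    by (intro Henstock_Kurzweil_Integration.integral_cong Feq)
  also have "\<dots> = integral {r..T} (\<lambda>t. u t (heat_gen \<phi>)) - (vT (heat (T - r) \<phi>) - vT \<phi>) - integral {r..T} (\<lambda>t. integral {t..T} c)"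
    using ui vi cii integral_unique[OF I1]
    by (simp add: Henstock_Kurzweil_Integration.integral_diff integrable_diff)
  finally have A: "integral {r..T} (\<lambda>t. integral {r..T} (F t)) = \<dots>" .
  have wi: "(\<lambda>s. w s (heat (s - r) \<phi>)) integrable_on {r..T}"
    by (intro integrable_continuous_real CT_tempered_heat_continuous'[OF w \<phi> r0])
  have "integral {r..T} (\<lambda>s. integral {r..T} (\<lambda>t. F t s))
      = integral {r..T} (\<lambda>s. w s (heat (s - r) \<phi>) - w s \<phi> - (s - r) *\<^sub>R c s)"
    by (intro Henstock_Kurzweil_Integration.integral_cong inner2)
  also have "\<dots> = integral {r..T} (\<lambda>s. w s (heat (s - r) \<phi>)) - integral {r..T} (\<lambda>s. w s \<phi>) - integral {r..T} (\<lambda>s. (s - r) *\<^sub>R c s)"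
    using wi integrable_continuous_real[OF wc] integrable_continuous_real[OF sc]
    by (simp add: Henstock_Kurzweil_Integration.integral_diff integrable_diff)
  finally have B: "integral {r..T} (\<lambda>s. integral {r..T} (\<lambda>t. F t s)) = \<dots>" .
  have "integral {r..T} (\<lambda>t. integral {t..T} c) - integral {r..T} (\<lambda>t. (t - r) *\<^sub>R c t) = 0"
    using integral_unique[OF c_int] Henstock_Kurzweil_Integration.integral_diff[OF cii integrable_continuous_real[OF sc]] by simp
  then have "integral {r..T} (\<lambda>t. u t (heat_gen \<phi>)) - (vT (heat (T - r) \<phi>) - vT \<phi>)
      = integral {r..T} (\<lambda>s. w s (heat (s - r) \<phi>)) - integral {r..T} (\<lambda>s. w s \<phi>)"
    using A B swap by (simp add: algebra_simps)
  then show ?thesis using mild[OF r \<phi>] by (simp add: algebra_simps)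
qed

section \<open>Convolution of a tempered distribution with a Schwartz function\<close>

lemma schwartz_seminorm_translate:
  fixes K :: "'n::finite test"
  assumes K: "K \<in> schwartz"
  shows "schwartz_seminorm k (\<lambda>y. K (y - x)) \<le> (1 + norm x) ^ k * schwartz_seminorm k K"
proof (rule schwartz_seminorm_le)
  fix y :: "real^'n" and ds :: "'n list" assume ds: "length ds \<le> k"
  have "(1 + norm y) ^ k * norm (partials ds K (y - x)) \<le> ((1 + norm (y - x)) ^ k * (1 + norm x) ^ k) * norm (partials ds K (y - x))"
    using one_plus_norm_power_le[of "y - x" x k] by (intro mult_right_mono) auto
  also have "\<dots> = (1 + norm x) ^ k * ((1 + norm (y - x)) ^ k * norm (partials ds K (y - x)))" by (simp only: mult_ac)
  also have "\<dots> \<le> (1 + norm x) ^ k * schwartz_seminorm k K"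
    by (intro mult_left_mono schwartz_seminorm_ge K ds) simp
  finally show "(1 + norm y) ^ k * norm (partials ds (\<lambda>y. K (y - x)) y) \<le> (1 + norm x) ^ k * schwartz_seminorm k K"
    by (simp add: partials_translate K)
qed

lemma schwartz_two_translates_bound:
  fixes K :: "'n::finite test"
  assumes K: "K \<in> schwartz" and ds: "length ds \<le> k"
  shows "(1 + norm y) ^ k * norm (partials ds K (y - x0) - partials ds K (y - x))
      \<le> CARD('n) * schwartz_seminorm (Suc k) K * norm (x0 - x) * (1 + norm (x0 - x)) ^ k * (1 + norm x) ^ k"
proof -
  have "(1 + norm y) ^ k * norm (partials ds K (y - x0) - partials ds K (y - x))
      \<le> ((1 + norm (y - x)) ^ k * (1 + norm x) ^ k) * norm (partials ds K ((y - x) - (x0 - x)) - partials ds K (y - x))"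
    using one_plus_norm_power_le[of "y - x" x k] by (intro mult_mono) auto
  also have "\<dots> = (1 + norm x) ^ k * ((1 + norm (y - x)) ^ k * norm (partials ds K ((y - x) - (x0 - x)) - partials ds K (y - x)))"
    by (simp only: mult_ac)
  also have "\<dots> \<le> (1 + norm x) ^ k * (CARD('n) * schwartz_seminorm (Suc k) K * norm (x0 - x) * (1 + norm (x0 - x)) ^ k)"
    by (intro mult_left_mono schwartz_seminorm_translate_diff K ds) simp
  finally show ?thesis by (simp only: mult_ac)
qed

lemma schwartz_seminorm_two_translates:
  fixes K :: "'n::finite test"
  assumes K: "K \<in> schwartz"
  shows "schwartz_seminorm k (\<lambda>y. K (y - x0) - K (y - x))
      \<le> CARD('n) * schwartz_seminorm (Suc k) K * norm (x0 - x) * (1 + norm (x0 - x)) ^ k * (1 + norm x) ^ k"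
proof (rule schwartz_seminorm_le)
  fix y :: "real^'n" and ds :: "'n list" assume ds: "length ds \<le> k"
  show "(1 + norm y) ^ k * norm (partials ds (\<lambda>y. K (y - x0) - K (y - x)) y)
      \<le> CARD('n) * schwartz_seminorm (Suc k) K * norm (x0 - x) * (1 + norm (x0 - x)) ^ k * (1 + norm x) ^ k"
    using schwartz_two_translates_bound[OF K ds]
    by (simp add: partials_diff partials_translate schwartz_translate K)
qed

text \<open>One cell of a Riemann sum for the convolution: the mass of \<open>f\<close> is
  concentrated at \<open>x0\<close>, and each translate is moved by at most \<open>\<delta>\<close>.
  As \<open>\<delta> \<le> 1\<close>, the factor \<open>2 ^ k\<close> bounds
  \<open>(1 + norm (x0 - x)) ^ k\<close>.\<close>

lemma schwartz_seminorm_conv_localized: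
  fixes K f :: "'n::finite test"
  assumes K: "K \<in> schwartz" and f: "rapid f" and loc: "\<And>x. f x \<noteq> 0 \<Longrightarrow> norm (x0 - x) \<le> \<delta>" and \<delta>: "0 \<le> \<delta>" "\<delta> \<le> 1"
  shows "schwartz_seminorm k (\<lambda>y. conv K f y - (LINT x|lborel. f x) * K (y - x0))
      \<le> CARD('n) * schwartz_seminorm (Suc k) K * 2 ^ k * \<delta> * moment k f"
proof (rule schwartz_seminorm_le)
  fix y :: "real^'n" and ds :: "'n list" assume ds: "length ds \<le> k"
  define D where "D = CARD('n) * schwartz_seminorm (Suc k) K"
  have D: "D \<ge> 0" unfolding D_def by (intro mult_nonneg_nonneg schwartz_seminorm_nonneg K) simp
  let ?K = "partials ds K"
  have Kd: "?K \<in> schwartz" by (intro schwartz_partials K)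
  have P: "partials ds (\<lambda>y. conv K f y - (LINT x|lborel. f x) * K (y - x0)) y = conv ?K f y - (LINT x|lborel. f x) * ?K (y - x0)"
    using K f by (simp add: partials_diff partials_cmult partials_conv partials_translate schwartz_conv schwartz_cmult schwartz_translate)
  have i1: "integrable lborel (\<lambda>x. ?K (y - x) * f x)" by (rule integrable_conv[OF Kd rapid_integrable[OF f]])
  have i2: "integrable lborel (\<lambda>x. ?K (y - x0) * f x)" using rapid_integrable[OF f] by simp
  have eq: "conv ?K f y - (LINT x|lborel. f x) * ?K (y - x0) = (LINT x|lborel. (?K (y - x) * f x - ?K (y - x0) * f x))"
    using i1 i2 by (simp add: conv_def mult.commute)
  have "(1 + norm y) ^ k * norm (conv ?K f y - (LINT x|lborel. f x) * ?K (y - x0))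
      \<le> (1 + norm y) ^ k * (LINT x|lborel. norm (?K (y - x) * f x - ?K (y - x0) * f x))"
    unfolding eq by (intro mult_left_mono integral_norm_bound) simp
  also have "\<dots> = (LINT x|lborel. (1 + norm y) ^ k * norm (?K (y - x) * f x - ?K (y - x0) * f x))" by simp
  also have "\<dots> \<le> (LINT x|lborel. D * 2 ^ k * \<delta> * ((1 + norm x) ^ k * norm (f x)))"
  proof (rule integral_mono)
    show "integrable lborel (\<lambda>x. (1 + norm y) ^ k * norm (?K (y - x) * f x - ?K (y - x0) * f x))"
      by (rule integrable_mult_right, rule integrable_norm, rule Bochner_Integration.integrable_diff[OF i1 i2])
    show "integrable lborel (\<lambda>x. D * 2 ^ k * \<delta> * ((1 + norm x) ^ k * norm (f x)))"
      by (intro integrable_mult_right rapid_moment_integrable f)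
    fix x
    show "(1 + norm y) ^ k * norm (?K (y - x) * f x - ?K (y - x0) * f x) \<le> D * 2 ^ k * \<delta> * ((1 + norm x) ^ k * norm (f x))"
    proof (cases "f x = 0")
      case False
      note l = loc[OF False]
      have "(1 + norm y) ^ k * norm (?K (y - x) * f x - ?K (y - x0) * f x)
          = ((1 + norm y) ^ k * norm (?K (y - x0) - ?K (y - x))) * norm (f x)"
        by (simp only: left_diff_distrib[symmetric] norm_mult norm_minus_commute mult.assoc)
      also have "\<dots> \<le> (D * norm (x0 - x) * (1 + norm (x0 - x)) ^ k * (1 + norm x) ^ k) * norm (f x)"
        unfolding D_def by (intro mult_right_mono schwartz_two_translates_bound K ds) simp
      also have "\<dots> \<le> (D * \<delta> * 2 ^ k * (1 + norm x) ^ k) * norm (f x)"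
        using l \<delta> D by (intro mult_right_mono mult_mono power_mono mult_nonneg_nonneg) auto
      finally show ?thesis by (simp only: mult_ac)
    qed simp
  qed
  also have "\<dots> = D * 2 ^ k * \<delta> * moment k f" by (simp add: moment_def)
  finally show "(1 + norm y) ^ k * norm (partials ds (\<lambda>y. conv K f y - (LINT x|lborel. f x) * K (y - x0)) y)
      \<le> CARD('n) * schwartz_seminorm (Suc k) K * 2 ^ k * \<delta> * moment k f"
    unfolding P D_def .
qed

text \<open>This function of \<open>x\<close> will represent \<open>u\<close> convolved with
  \<open>K\<close>; continuity and polynomial growth make it pairable.\<close>

lemma
  fixes u :: "'n::finite distr"
  assumes u: "u \<in> tempered" and K: "K \<in> schwartz"
  shows tempered_translate_continuous: "continuous_on UNIV (\<lambda>x. u (\<lambda>y. K (y - x)))"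
    and tempered_translate_growth: "\<exists>B k. \<forall>x. norm (u (\<lambda>y. K (y - x))) \<le> B * (1 + norm x) ^ k"
proof -
  obtain C k where C: "C \<ge> 0" and bd: "\<And>\<phi>. \<phi> \<in> schwartz \<Longrightarrow> norm (u \<phi>) \<le> C * schwartz_seminorm k \<phi>"
    by (rule tempered_boundE[OF u]) (rule that)
  have "norm (u (\<lambda>y. K (y - x))) \<le> (C * schwartz_seminorm k K) * (1 + norm x) ^ k" for x
  proof -
    have "norm (u (\<lambda>y. K (y - x))) \<le> C * schwartz_seminorm k (\<lambda>y. K (y - x))" by (intro bd schwartz_translate K)
    also have "\<dots> \<le> C * ((1 + norm x) ^ k * schwartz_seminorm k K)"
      by (intro mult_left_mono schwartz_seminorm_translate K C)
    finally show ?thesis by (simp only: mult_ac)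
  qed
  then show "\<exists>B k. \<forall>x. norm (u (\<lambda>y. K (y - x))) \<le> B * (1 + norm x) ^ k" by blast
  define D where "D = CARD('n) * schwartz_seminorm (Suc k) K"
  show "continuous_on UNIV (\<lambda>x. u (\<lambda>y. K (y - x)))"
    unfolding continuous_on_def
  proof
    fix x :: "real^'n"
    have "((\<lambda>x0. u (\<lambda>y. K (y - x0)) - u (\<lambda>y. K (y - x))) \<longlongrightarrow> 0) (at x within UNIV)"
    proof (rule Lim_null_comparison)
      have "norm (u (\<lambda>y. K (y - x0)) - u (\<lambda>y. K (y - x)))
          \<le> C * (D * norm (x0 - x) * (1 + norm (x0 - x)) ^ k * (1 + norm x) ^ k)" for x0
      proof -
        have "norm (u (\<lambda>y. K (y - x0) - K (y - x))) \<le> C * schwartz_seminorm k (\<lambda>y. K (y - x0) - K (y - x))"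
          by (intro bd schwartz_diff schwartz_translate K)
        also have "\<dots> \<le> C * (D * norm (x0 - x) * (1 + norm (x0 - x)) ^ k * (1 + norm x) ^ k)"
          unfolding D_def by (intro mult_left_mono schwartz_seminorm_two_translates K C)
        finally show ?thesis by (simp add: tempered_diff[OF u schwartz_translate[OF K] schwartz_translate[OF K]])
      qed
      then show "\<forall>\<^sub>F x0 in at x within UNIV. norm (u (\<lambda>y. K (y - x0)) - u (\<lambda>y. K (y - x)))
          \<le> C * (D * norm (x0 - x) * (1 + norm (x0 - x)) ^ k * (1 + norm x) ^ k)"
        by (intro always_eventually allI)
      have "((\<lambda>x0. C * (D * norm (x0 - x) * (1 + norm (x0 - x)) ^ k * (1 + norm x) ^ k))
          \<longlongrightarrow> C * (D * norm (x - x) * (1 + norm (x - x)) ^ k * (1 + norm x) ^ k)) (at x within UNIV)"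
        by (intro tendsto_intros)
      then show "((\<lambda>x0. C * (D * norm (x0 - x) * (1 + norm (x0 - x)) ^ k * (1 + norm x) ^ k)) \<longlongrightarrow> 0) (at x within UNIV)"
        by simp
    qed
    then show "((\<lambda>x. u (\<lambda>y. K (y - x))) \<longlongrightarrow> u (\<lambda>y. K (y - x))) (at x within UNIV)" by (simp add: LIM_zero_iff)
  qed
qed

lemma pairable_growth:
  fixes h :: "real^'n::finite \<Rightarrow> complex"
  assumes c: "continuous_on UNIV h" and B: "\<And>x. norm (h x) \<le> B * (1 + norm x) ^ k"
  shows "pairable h"
  unfolding pairable_def
proof (intro conjI ballI c)
  fix \<phi> :: "'n test" assume \<phi>: "\<phi> \<in> schwartz"
  have [measurable]: "h \<in> borel_measurable borel" using c by (rule borel_measurable_continuous_onI)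
  note [measurable] = schwartz_measurable[OF \<phi>]
  show "integrable lborel (\<lambda>x. \<phi> x * h x)"
  proof (rule Bochner_Integration.integrable_bound)
    show "integrable lborel (\<lambda>x. B * ((1 + norm x) ^ k * norm (\<phi> x)))"
      by (intro integrable_mult_right rapid_moment_integrable schwartz_rapid \<phi>)
    have "norm (\<phi> x * h x) \<le> B * ((1 + norm x) ^ k * norm (\<phi> x))" for x
      using mult_right_mono[OF B[of x], of "norm (\<phi> x)"] by (simp add: norm_mult mult_ac)
    then show "AE x in lborel. norm (\<phi> x * h x) \<le> norm (B * ((1 + norm x) ^ k * norm (\<phi> x)))"
      by (intro AE_I2) (metis abs_ge_self order_trans real_norm_def)
  qed measurable
qed

text \<open>The distribution is moved under the integral by cutting the domain of integration into finitely
  many small pieces and a tail.\<close>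

lemma tempered_conv:
  fixes u :: "'n::finite distr"
  assumes u: "u \<in> tempered" and K: "K \<in> schwartz" and \<phi>: "\<phi> \<in> schwartz"
  shows "u (conv K \<phi>) = (LINT x|lborel. \<phi> x * u (\<lambda>y. K (y - x)))"
proof -
  obtain C k where C: "C \<ge> 0" and bd: "\<And>\<phi>. \<phi> \<in> schwartz \<Longrightarrow> norm (u \<phi>) \<le> C * schwartz_seminorm k \<phi>"
    by (rule tempered_boundE[OF u]) (rule that)
  define h where "h x = u (\<lambda>y. K (y - x))" for x
  have hc: "continuous_on UNIV h" unfolding h_def by (rule tempered_translate_continuous[OF u K])
  then have [measurable]: "h \<in> borel_measurable borel" by (rule borel_measurable_continuous_onI)
  note [measurable] = schwartz_measurable[OF \<phi>]
  have TS: "(\<lambda>y. K (y - x)) \<in> schwartz" for x by (rule schwartz_translate[OF K])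
  define S where "S = C * schwartz_seminorm k K"
  have S: "S \<ge> 0" unfolding S_def by (intro mult_nonneg_nonneg C schwartz_seminorm_nonneg K)
  have hb: "norm (h x) \<le> S * (1 + norm x) ^ k" for x
  proof -
    have "norm (h x) \<le> C * schwartz_seminorm k (\<lambda>y. K (y - x))" unfolding h_def by (intro bd TS)
    also have "\<dots> \<le> C * ((1 + norm x) ^ k * schwartz_seminorm k K)"
      by (intro mult_left_mono schwartz_seminorm_translate K C)
    finally show ?thesis by (simp only: S_def mult_ac)
  qed
  define D where "D = CARD('n) * schwartz_seminorm (Suc k) K"
  have D: "D \<ge> 0" unfolding D_def by (intro mult_nonneg_nonneg schwartz_seminorm_nonneg K) simp
  have hd: "norm (h x0 - h x) \<le> C * (D * norm (x0 - x) * (1 + norm (x0 - x)) ^ k * (1 + norm x) ^ k)" for x0 x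
  proof -
    have "norm (u (\<lambda>y. K (y - x0) - K (y - x))) \<le> C * schwartz_seminorm k (\<lambda>y. K (y - x0) - K (y - x))"
      by (intro bd schwartz_diff TS)
    also have "\<dots> \<le> C * (D * norm (x0 - x) * (1 + norm (x0 - x)) ^ k * (1 + norm x) ^ k)"
      unfolding D_def by (intro mult_left_mono schwartz_seminorm_two_translates K C)
    finally show ?thesis by (simp add: h_def tempered_diff[OF u TS TS])
  qed
  define f where "f A x = complex_of_real (indicator A x) * \<phi> x" for A x
  have f: "rapid (f A)" if "A \<in> sets borel" for A
    unfolding f_def using that by (intro rapid_mult_bounded[OF schwartz_rapid[OF \<phi>], where B = 1]) (auto simp: indicator_def)
  have fm[measurable]: "f A \<in> borel_measurable borel" if "A \<in> sets borel" for A using f[OF that] by (rule rapid_measurable)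
  have pair: "integrable lborel (\<lambda>x. f A x * h x)" if "A \<in> sets borel" for A
  proof (rule Bochner_Integration.integrable_bound)
    show "integrable lborel (\<lambda>x. S * ((1 + norm x) ^ k * norm (f A x)))"
      by (intro integrable_mult_right rapid_moment_integrable f that)
    have "norm (f A x * h x) \<le> S * ((1 + norm x) ^ k * norm (f A x))" for x
      using mult_right_mono[OF hb[of x], of "norm (f A x)"] by (simp add: norm_mult mult_ac)
    then show "AE x in lborel. norm (f A x * h x) \<le> norm (S * ((1 + norm x) ^ k * norm (f A x)))"
      by (intro AE_I2) (metis abs_ge_self order_trans real_norm_def)
  qed (use that in measurable)
  define \<mu> where "\<mu> A = moment k (f A)" for A
  \<comment> \<open>The claim is \<open>E UNIV = 0\<close>. Both \<open>E\<close> and the majorant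
    \<open>\<mu>\<close> are additive on disjoint sets, so estimates proportional to
    \<open>\<mu>\<close> add up without a count of the pieces.\<close>
  define E where "E A = u (conv K (f A)) - (LINT x|lborel. f A x * h x)" for A
  have f_Un: "f (A \<union> B) = (\<lambda>x. f A x + f B x)" if "A \<inter> B = {}" for A B
    using that by (auto simp: f_def indicator_def fun_eq_iff)
  have E_Un: "E (A \<union> B) = E A + E B" if "A \<in> sets borel" "B \<in> sets borel" "A \<inter> B = {}" for A B
  proof -
    have "conv K (f (A \<union> B)) = (\<lambda>x. conv K (f A) x + conv K (f B) x)"
      unfolding f_Un[OF that(3)] conv_def
      using integrable_conv[OF K rapid_integrable[OF f]] that by (simp add: distrib_left fun_eq_iff)
    then have "u (conv K (f (A \<union> B))) = u (conv K (f A)) + u (conv K (f B))"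
      by (simp add: tempered_add[OF u] schwartz_conv K f that)
    moreover have "(LINT x|lborel. f (A \<union> B) x * h x) = (LINT x|lborel. f A x * h x) + (LINT x|lborel. f B x * h x)"
      unfolding f_Un[OF that(3)] using pair that by (simp add: distrib_right)
    ultimately show ?thesis by (simp add: E_def)
  qed
  have \<mu>_Un: "\<mu> (A \<union> B) = \<mu> A + \<mu> B" if "A \<in> sets borel" "B \<in> sets borel" "A \<inter> B = {}" for A B
  proof -
    have "norm (f (A \<union> B) x) = norm (f A x) + norm (f B x)" for x
      using that(3) by (auto simp: f_def indicator_def)
    then show ?thesis
      unfolding \<mu>_def moment_def using rapid_moment_integrable[OF f] that by (simp add: distrib_left)
  qed
  have \<mu>_mono: "\<mu> A \<le> moment k \<phi>" if "A \<in> sets borel" for A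
    unfolding \<mu>_def moment_def using rapid_moment_integrable[OF f[OF that]] rapid_moment_integrable[OF schwartz_rapid[OF \<phi>]]
    by (intro integral_mono) (auto simp: f_def norm_mult indicator_def)
  have small: "norm (E A) \<le> 2 * C * D * 2 ^ k * \<delta> * \<mu> A"
    if A: "A \<in> sets borel" "A \<subseteq> ball x0 \<delta>" and \<delta>: "0 < \<delta>" "\<delta> \<le> 1" for A x0 \<delta>
  proof -
    have loc: "norm (x0 - x) \<le> \<delta>" if "f A x \<noteq> 0" for x
      using that A(2) by (auto simp: f_def indicator_def dist_norm split: if_splits)
    let ?c = "LINT x|lborel. f A x"
    have 1: "norm (u (conv K (f A)) - ?c * h x0) \<le> C * (D * 2 ^ k * \<delta> * \<mu> A)"
    proof -
      have "u (conv K (f A)) - ?c * h x0 = u (\<lambda>y. conv K (f A) y - ?c * K (y - x0))"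
        unfolding h_def by (simp only: tempered_diff[OF u] tempered_cmult[OF u] schwartz_conv K f A schwartz_cmult TS)
      moreover have "norm (u (\<lambda>y. conv K (f A) y - ?c * K (y - x0))) \<le> C * schwartz_seminorm k (\<lambda>y. conv K (f A) y - ?c * K (y - x0))"
        by (intro bd schwartz_diff schwartz_conv schwartz_cmult K f A TS)
      moreover have "\<dots> \<le> C * (D * 2 ^ k * \<delta> * \<mu> A)"
        unfolding D_def \<mu>_def using \<delta> by (intro mult_left_mono C schwartz_seminorm_conv_localized K f A loc) auto
      ultimately show ?thesis by simp
    qed
    have i: "integrable lborel (\<lambda>x. f A x * h x0)" using rapid_integrable[OF f[OF A(1)]] by simp
    have "?c * h x0 - (LINT x|lborel. f A x * h x) = (LINT x|lborel. f A x * h x0 - f A x * h x)"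
      using i pair[OF A(1)] rapid_integrable[OF f[OF A(1)]] by simp
    also have "norm (LINT x|lborel. f A x * h x0 - f A x * h x) \<le> (LINT x|lborel. norm (f A x * h x0 - f A x * h x))"
      by (rule integral_norm_bound)
    also have "\<dots> \<le> (LINT x|lborel. C * D * 2 ^ k * \<delta> * ((1 + norm x) ^ k * norm (f A x)))"
    proof (rule integral_mono)
      show "integrable lborel (\<lambda>x. norm (f A x * h x0 - f A x * h x))"
        using i pair[OF A(1)] by (intro integrable_norm Bochner_Integration.integrable_diff)
      show "integrable lborel (\<lambda>x. C * D * 2 ^ k * \<delta> * ((1 + norm x) ^ k * norm (f A x)))"
        by (intro integrable_mult_right rapid_moment_integrable f A)
      fix x
      show "norm (f A x * h x0 - f A x * h x) \<le> C * D * 2 ^ k * \<delta> * ((1 + norm x) ^ k * norm (f A x))"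
      proof (cases "f A x = 0")
        case False
        have "norm (f A x * h x0 - f A x * h x) = norm (f A x) * norm (h x0 - h x)"
          by (simp only: right_diff_distrib[symmetric] norm_mult)
        also have "\<dots> \<le> norm (f A x) * (C * (D * norm (x0 - x) * (1 + norm (x0 - x)) ^ k * (1 + norm x) ^ k))"
          by (intro mult_left_mono hd) simp
        also have "\<dots> \<le> norm (f A x) * (C * (D * \<delta> * 2 ^ k * (1 + norm x) ^ k))"
          using loc[OF False] \<delta> C D by (intro mult_left_mono mult_right_mono mult_mono power_mono mult_nonneg_nonneg) auto
        finally show ?thesis by (simp only: mult_ac)
      qed simp
    qed
    also have "\<dots> = C * D * 2 ^ k * \<delta> * \<mu> A" by (simp add: moment_def \<mu>_def)
    finally have 2: "norm (?c * h x0 - (LINT x|lborel. f A x * h x)) \<le> C * D * 2 ^ k * \<delta> * \<mu> A" .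
    have "norm (E A) \<le> norm (u (conv K (f A)) - ?c * h x0) + norm (?c * h x0 - (LINT x|lborel. f A x * h x))"
      unfolding E_def using norm_triangle_ineq[of "u (conv K (f A)) - ?c * h x0" "?c * h x0 - (LINT x|lborel. f A x * h x)"] by simp
    then show ?thesis using 1 2 by (simp add: algebra_simps)
  qed
  \<comment> \<open>The balls are removed one at a time, which makes the pieces disjoint.\<close>
  have cover: "norm (E A) \<le> 2 * C * D * 2 ^ k * \<delta> * \<mu> A"
    if X: "finite X" and A: "A \<in> sets borel" "A \<subseteq> (\<Union>x\<in>X. ball x \<delta>)" and \<delta>: "0 < \<delta>" "\<delta> \<le> 1" for A X \<delta>
    using X A
  proof (induction X arbitrary: A)
    case empty
    then have "A = {}" by simp
    then show ?case using small[of A 0 \<delta>] \<delta> by simp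
  next
    case (insert x X)
    let ?A1 = "A \<inter> ball x \<delta>" and ?A2 = "A - ball x \<delta>"
    have A12: "?A1 \<in> sets borel" "?A2 \<in> sets borel" "?A1 \<inter> ?A2 = {}" "A = ?A1 \<union> ?A2"
      using insert.prems by auto
    have "E A = E ?A1 + E ?A2" using E_Un[OF A12(1-3)] A12(4) by simp
    moreover have "norm (E ?A1) \<le> 2 * C * D * 2 ^ k * \<delta> * \<mu> ?A1" using A12(1) \<delta> by (intro small) auto
    moreover have "norm (E ?A2) \<le> 2 * C * D * 2 ^ k * \<delta> * \<mu> ?A2" using A12(2) insert.prems by (intro insert.IH) auto
    moreover have "\<mu> A = \<mu> ?A1 + \<mu> ?A2" using \<mu>_Un[OF A12(1-3)] A12(4) by simp
    ultimately show ?case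
      using norm_triangle_ineq[of "E ?A1" "E ?A2"] by (simp add: distrib_left)
  qed
  have tail: "norm (E A) \<le> 2 * S * \<mu> A" if A: "A \<in> sets borel" for A
  proof -
    have "norm (u (conv K (f A))) \<le> C * schwartz_seminorm k (conv K (f A))"
      by (intro bd schwartz_conv K f A)
    also have "\<dots> \<le> C * (schwartz_seminorm k K * \<mu> A)"
      unfolding \<mu>_def by (intro mult_left_mono schwartz_seminorm_conv K f A C)
    finally have 1: "norm (u (conv K (f A))) \<le> S * \<mu> A" by (simp only: S_def mult_ac)
    have "norm (LINT x|lborel. f A x * h x) \<le> (LINT x|lborel. norm (f A x * h x))" by (rule integral_norm_bound)
    also have "\<dots> \<le> (LINT x|lborel. S * ((1 + norm x) ^ k * norm (f A x)))"
    proof (rule integral_mono)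
      show "norm (f A x * h x) \<le> S * ((1 + norm x) ^ k * norm (f A x))" for x
        using mult_right_mono[OF hb[of x], of "norm (f A x)"] by (simp add: norm_mult mult_ac)
      show "integrable lborel (\<lambda>x. S * ((1 + norm x) ^ k * norm (f A x)))"
        by (intro integrable_mult_right rapid_moment_integrable f A)
    qed (use pair[OF A] in simp)
    also have "\<dots> = S * \<mu> A" by (simp add: \<mu>_def moment_def)
    finally have 2: "norm (LINT x|lborel. f A x * h x) \<le> S * \<mu> A" .
    show ?thesis using norm_triangle_ineq4[of "u (conv K (f A))" "LINT x|lborel. f A x * h x"] 1 2 by (simp add: E_def)
  qed
  \<comment> \<open>Outside the ball the factor \<open>(1 + norm x) / R\<close> exceeds 1 and may be
    inserted.\<close>
  have \<mu>_tail: "\<mu> (- cball 0 R) \<le> moment (Suc k) \<phi> / R" if R: "R > 0" for R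
  proof -
    have "\<mu> (- cball 0 R) \<le> (LINT x|lborel. (1 + norm x) ^ Suc k * norm (\<phi> x) / R)"
      unfolding \<mu>_def moment_def
    proof (rule integral_mono)
      show "integrable lborel (\<lambda>x. (1 + norm x) ^ k * norm (f (- cball 0 R) x))" by (intro rapid_moment_integrable f) auto
      show "integrable lborel (\<lambda>x. (1 + norm x) ^ Suc k * norm (\<phi> x) / R)"
        using rapid_moment_integrable[OF schwartz_rapid[OF \<phi>], of "Suc k"] by simp
      fix x :: "real^'n"
      show "(1 + norm x) ^ k * norm (f (- cball 0 R) x) \<le> (1 + norm x) ^ Suc k * norm (\<phi> x) / R"
      proof (cases "norm x \<le> R")
        case False
        then have "R * ((1 + norm x) ^ k * norm (\<phi> x)) \<le> (1 + norm x) * ((1 + norm x) ^ k * norm (\<phi> x))"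
          by (intro mult_right_mono) auto
        then show ?thesis using R False by (simp add: f_def field_simps norm_mult)
      qed (use R in \<open>simp add: f_def\<close>)
    qed
    then show ?thesis by (simp add: moment_def)
  qed
  define M where "M = 2 * C * D * 2 ^ k * moment k \<phi> + 2 * S * moment (Suc k) \<phi>"
  \<comment> \<open>One parameter plays both roles: \<open>\<delta>\<close> is the mesh, and
    \<open>1 / \<delta>\<close> the radius beyond which the tail is estimated crudely.\<close>
  have main: "norm (E UNIV) \<le> M * \<delta>" if \<delta>: "0 < \<delta>" "\<delta> \<le> 1" for \<delta>
  proof -
    have "\<forall>\<epsilon>>0. \<exists>X. finite X \<and> cball (0::real^'n) (1 / \<delta>) \<subseteq> (\<Union>x\<in>X. ball x \<epsilon>)"
      using compact_cball[of "0::real^'n" "1 / \<delta>"] unfolding compact_eq_totally_bounded by (rule conjunct2)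
    then obtain X where X: "finite X" "cball (0::real^'n) (1 / \<delta>) \<subseteq> (\<Union>x\<in>X. ball x \<delta>)"
      using \<delta>(1) by blast
    let ?A = "cball (0::real^'n) (1 / \<delta>)"
    have "norm (E ?A) \<le> 2 * C * D * 2 ^ k * \<delta> * \<mu> ?A" using X \<delta> by (intro cover[OF X(1)]) auto
    also have "\<dots> \<le> 2 * C * D * 2 ^ k * \<delta> * moment k \<phi>"
      using C D \<delta> by (intro mult_left_mono \<mu>_mono mult_nonneg_nonneg) auto
    finally have 1: "norm (E ?A) \<le> 2 * C * D * 2 ^ k * \<delta> * moment k \<phi>" .
    have "norm (E (- ?A)) \<le> 2 * S * \<mu> (- ?A)" by (intro tail) auto
    also have "\<dots> \<le> 2 * S * (moment (Suc k) \<phi> / (1 / \<delta>))" using S \<delta> by (intro mult_left_mono \<mu>_tail) auto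
    finally have 2: "norm (E (- ?A)) \<le> 2 * S * moment (Suc k) \<phi> * \<delta>" by simp
    have "E UNIV = E ?A + E (- ?A)" using E_Un[of ?A "- ?A"] by (simp add: Compl_partition)
    then show ?thesis using norm_triangle_ineq[of "E ?A" "E (- ?A)"] 1 2 by (simp add: M_def algebra_simps)
  qed
  have "norm (E UNIV) \<le> 0"
  proof (rule tendsto_lowerbound)
    have "((\<lambda>\<delta>. M * \<delta>) \<longlongrightarrow> M * 0) (at_right 0)" by (intro tendsto_intros)
    then show "((\<lambda>\<delta>. M * \<delta>) \<longlongrightarrow> 0) (at_right 0)" by simp
    show "\<forall>\<^sub>F \<delta> in at_right 0. norm (E UNIV) \<le> M * \<delta>"
      using eventually_at_right_less[of 0] eventually_at_right_real[of 0 1]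
      by (rule eventually_elim2) (auto intro: main)
  qed simp
  then have "E UNIV = 0" by simp
  moreover have "f UNIV = \<phi>" by (simp add: f_def fun_eq_iff)
  ultimately show ?thesis by (simp add: E_def h_def)
qed

section \<open>Littlewood--Paley blocks\<close>

text \<open>Products of two Schwartz functions are not visibly closed under \<open>partial\<close>,
  finite sums of such products are; this is the family for \<open>schwartz_coinduct\<close>.\<close>

inductive_set schwartz_span :: "'n::finite test set" where
  mult: "f \<in> schwartz \<Longrightarrow> g \<in> schwartz \<Longrightarrow> (\<lambda>x. f x * g x) \<in> schwartz_span"
| add: "f \<in> schwartz_span \<Longrightarrow> g \<in> schwartz_span \<Longrightarrow> (\<lambda>x. f x + g x) \<in> schwartz_span"

lemma schwartz_span_differentiable: "f \<in> schwartz_span \<Longrightarrow> f differentiable at x"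
  by (induction rule: schwartz_span.induct)
    (auto intro!: differentiable_mult differentiable_add intro: schwartz_differentiable)

lemma schwartz_span_partial: "f \<in> schwartz_span \<Longrightarrow> partial i f \<in> schwartz_span"
proof (induction rule: schwartz_span.induct)
  case (mult f g)
  then have "partial i (\<lambda>x. f x * g x) = (\<lambda>x. f x * partial i g x + partial i f x * g x)"
    by (intro ext partial_mult schwartz_differentiable)
  then show ?case using mult by (auto intro!: schwartz_span.intros schwartz_partial)
next
  case (add f g)
  then have "partial i (\<lambda>x. f x + g x) = (\<lambda>x. partial i f x + partial i g x)"
    by (intro ext partial_add schwartz_span_differentiable)
  then show ?case using add by (auto intro!: schwartz_span.intros)
qed

lemma schwartz_span_bound:
  "f \<in> schwartz_span \<Longrightarrow> \<exists>B. \<forall>x. (1 + norm x) ^ k * norm (f x) \<le> B"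
proof (induction rule: schwartz_span.induct)
  case (mult f g)
  obtain B where B: "B \<ge> 0" "\<And>x. (1 + norm x) ^ k * norm (f x) \<le> B"
    using schwartz_boundE[OF mult(1), of k] by metis
  obtain B' where B': "\<And>x. norm (g x) \<le> B'" using schwartz_bounded[OF mult(2)] by blast
  have "(1 + norm x) ^ k * norm (f x * g x) \<le> B * B'" for x
    using mult_mono[OF B(2)[of x] B'[of x] B(1)] by (simp add: norm_mult mult.assoc)
  then show ?case by blast
next
  case (add f g)
  then obtain B B' where B: "\<And>x. (1 + norm x) ^ k * norm (f x) \<le> B" and B': "\<And>x. (1 + norm x) ^ k * norm (g x) \<le> B'"
    by blast
  have "(1 + norm x) ^ k * norm (f x + g x) \<le> B + B'" for x
  proof -
    have "(1 + norm x) ^ k * norm (f x + g x) \<le> (1 + norm x) ^ k * (norm (f x) + norm (g x))"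
      by (intro mult_left_mono norm_triangle_ineq) simp
    then show ?thesis using B[of x] B'[of x] by (simp add: distrib_left)
  qed
  then show ?case by blast
qed

lemma schwartz_mult:
  assumes "f \<in> schwartz" "g \<in> schwartz"
  shows "(\<lambda>x. f x * g x) \<in> schwartz"
  by (rule schwartz_coinduct[where X = schwartz_span])
    (use assms schwartz_span_partial schwartz_span_differentiable schwartz_span_bound in \<open>auto intro: schwartz_span.intros\<close>)

lemma smooth_differentiable: "smooth f \<Longrightarrow> f differentiable at x"
  unfolding smooth_def by (metis partials_Nil)

lemma smooth_partial: "smooth f \<Longrightarrow> smooth (partial i f)"
  unfolding smooth_def using partials_append[where es = "[i]" and f = f] by (simp add: partials_Cons) metis

lemma schwartz_compact_support:
  fixes f :: "real^'n::finite \<Rightarrow> real"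
  assumes f: "smooth f" and R: "\<And>x. norm x > R \<Longrightarrow> f x = 0"
  shows "(\<lambda>x. complex_of_real (f x)) \<in> schwartz"
proof (rule schwartz_coinduct[where X = "{\<lambda>x. complex_of_real (f x) |f. smooth f \<and> (\<forall>x. norm x > R \<longrightarrow> f x = 0)}"])
  let ?X = "{\<lambda>x::real^'n. complex_of_real (f x) |f. smooth f \<and> (\<forall>x. norm x > R \<longrightarrow> f x = 0)}"
  show "(\<lambda>x. complex_of_real (f x)) \<in> ?X" using f R by blast
  have D: "((\<lambda>x. complex_of_real (f x)) has_derivative (\<lambda>h. complex_of_real (frechet_derivative f (at x) h))) (at x)"
    if "smooth f" for f :: "real^'n \<Rightarrow> real" and x
    using has_derivative_of_real[OF frechet_derivative_works[THEN iffD1, OF smooth_differentiable[OF that, of x]]] .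
  show "g differentiable at x" if "g \<in> ?X" for g x
    using that D by (auto simp: differentiable_def)
  show "partial i g \<in> ?X" if g: "g \<in> ?X" for g i
  proof -
    obtain f where f: "g = (\<lambda>x. complex_of_real (f x))" "smooth f" "\<And>x. norm x > R \<Longrightarrow> f x = 0" using g by blast
    have "partial i g = (\<lambda>x. complex_of_real (partial i f x))"
      unfolding f(1) by (rule ext, subst partial_eqI[OF D[OF f(2)]]) (simp add: partial_def)
    moreover have "partial i f x = 0" if "norm x > R" for x
    proof -
      \<comment> \<open>The strict inequality makes the region open, so vanishing there passes to
        the derivative.\<close>
      have "open {x::real^'n. norm x > R}" by (intro open_Collect_less continuous_intros)
      then have "(f has_derivative (\<lambda>h. 0)) (at x)"
        using that f(3) by (intro has_derivative_transform_within_open[OF has_derivative_const, of "{x. norm x > R}"]) auto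
      then show ?thesis by (simp add: partial_eqI)
    qed
    ultimately show ?thesis using smooth_partial[OF f(2)] by blast
  qed
  show "\<exists>B. \<forall>x. (1 + norm x) ^ k * norm (g x) \<le> B" if g: "g \<in> ?X" for g k
  proof -
    obtain f where f: "g = (\<lambda>x. complex_of_real (f x))" "smooth f" "\<And>x. norm x > R \<Longrightarrow> f x = 0" using g by blast
    have "continuous_on (cball 0 R) (\<lambda>x. (1 + norm x) ^ k * norm (g x))"
      unfolding f(1) using smooth_differentiable[OF f(2)]
      by (intro continuous_intros continuous_at_imp_continuous_on) (auto intro: differentiable_imp_continuous_within)
    then have "bounded ((\<lambda>x. (1 + norm x) ^ k * norm (g x)) ` cball 0 R)"
      by (intro compact_imp_bounded compact_continuous_image) auto
    then obtain B where B: "\<And>x. x \<in> cball 0 R \<Longrightarrow> (1 + norm x) ^ k * norm (g x) \<le> B"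
      unfolding bounded_iff by fastforce
    have "(1 + norm x) ^ k * norm (g x) \<le> max B 0" for x
      using B[of x] f(3)[of x] by (cases "norm x \<le> R") (auto simp: f(1) le_max_iff_disj)
    then show ?thesis by blast
  qed
qed

text \<open>The reflection of \<open>inv_fourier m\<close>. Blocks are defined by duality, so a test
  function is hit by \<open>inv_fourier\<close>, the multiplier and \<open>fourier\<close> in turn;
  this is the convolution kernel of that operator.\<close>

definition kernel_of :: "'n::finite test \<Rightarrow> 'n test" where
  "kernel_of m x = 1 / (2 * pi) ^ CARD('n) * fourier m x"

lemma schwartz_kernel_of: "m \<in> schwartz \<Longrightarrow> kernel_of m \<in> schwartz"
  unfolding kernel_of_def[abs_def] by (intro schwartz_cmult schwartz_fourier)

lemma fourier_multiplier_eq_conv: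
  assumes "m \<in> schwartz" "\<phi> \<in> schwartz"
  shows "fourier (\<lambda>\<xi>. m \<xi> * inv_fourier \<phi> \<xi>) = conv (kernel_of m) \<phi>"
  using fourier_mult_inv_fourier[OF schwartz_integrable schwartz_integrable, OF assms]
  by (simp add: fun_eq_iff conv_def kernel_of_def)

lemma conv_kernel_of_mult:
  assumes m: "m \<in> schwartz" and m': "m' \<in> schwartz" and \<phi>: "\<phi> \<in> schwartz"
  shows "conv (kernel_of m) (conv (kernel_of m') \<phi>) = conv (kernel_of (\<lambda>\<xi>. m \<xi> * m' \<xi>)) \<phi>"
proof -
  have S: "(\<lambda>\<xi>. m' \<xi> * inv_fourier \<phi> \<xi>) \<in> schwartz" by (intro schwartz_mult m' schwartz_inv_fourier \<phi>)
  have "conv (kernel_of m') \<phi> \<in> schwartz" by (intro schwartz_conv schwartz_kernel_of m' schwartz_rapid \<phi>)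
  then have "conv (kernel_of m) (conv (kernel_of m') \<phi>)
      = fourier (\<lambda>\<xi>. m \<xi> * inv_fourier (fourier (\<lambda>\<xi>. m' \<xi> * inv_fourier \<phi> \<xi>)) \<xi>)"
    by (simp add: fourier_multiplier_eq_conv m m' \<phi>)
  also have "\<dots> = fourier (\<lambda>\<xi>. (m \<xi> * m' \<xi>) * inv_fourier \<phi> \<xi>)"
    unfolding inv_fourier_fourier[OF S] by (simp add: mult.assoc)
  also have "\<dots> = conv (kernel_of (\<lambda>\<xi>. m \<xi> * m' \<xi>)) \<phi>"
    by (intro fourier_multiplier_eq_conv schwartz_mult m m' \<phi>)
  finally show ?thesis .
qed

lemma integral_kernel_of:
  assumes "m \<in> schwartz"
  shows "integral\<^sup>L lborel (kernel_of m) = m 0"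
  using fun_cong[OF inv_fourier_fourier[OF assms], of 0] unfolding inv_fourier_def kernel_of_def[abs_def] by simp

lemma kernel_of_dilate:
  fixes m :: "'n::finite test"
  assumes m: "m \<in> schwartz" and c: "c > 0"
  shows "kernel_of (\<lambda>\<xi>. m ((1 / c) *\<^sub>R \<xi>)) = dilate c (kernel_of m)"
proof
  fix x :: "real^'n"
  note [measurable] = schwartz_measurable[OF m]
  let ?g = "\<lambda>\<xi>. cis (- (\<xi> \<bullet> x)) * m ((1 / c) *\<^sub>R \<xi>)"
  have "fourier (\<lambda>\<xi>. m ((1 / c) *\<^sub>R \<xi>)) x = integral\<^sup>L lborel ?g" by (simp only: fourier_def)
  also have "\<dots> = \<bar>c\<bar> ^ DIM(real^'n) *\<^sub>R (LINT \<xi>|lborel. ?g (0 + c *\<^sub>R \<xi>))"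
    using c by (intro integral_lborel_affine) auto
  also have "\<dots> = complex_of_real (c ^ CARD('n)) * fourier m (c *\<^sub>R x)"
    using c by (simp add: fourier_def scaleR_conv_of_real[where 'a = complex])
  finally show "kernel_of (\<lambda>\<xi>. m ((1 / c) *\<^sub>R \<xi>)) x = dilate c (kernel_of m) x"
    by (simp add: kernel_of_def dilate_def)
qed

lemma kernel_of_sum:
  assumes "\<And>i. i \<in> I \<Longrightarrow> m i \<in> schwartz"
  shows "kernel_of (\<lambda>\<xi>. \<Sum>i\<in>I. m i \<xi>) = (\<lambda>x. \<Sum>i\<in>I. kernel_of (m i) x)"
proof
  fix x
  have i: "integrable lborel (\<lambda>\<xi>. cis (- (\<xi> \<bullet> x)) * m i \<xi>)" if "i \<in> I" for i
    by (intro integrable_cis_mult schwartz_integrable assms that) measurable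
  have "fourier (\<lambda>\<xi>. \<Sum>i\<in>I. m i \<xi>) x = (\<Sum>i\<in>I. fourier (m i) x)"
    unfolding fourier_def sum_distrib_left by (rule Bochner_Integration.integral_sum[OF i])
  then show "kernel_of (\<lambda>\<xi>. \<Sum>i\<in>I. m i \<xi>) x = (\<Sum>i\<in>I. kernel_of (m i) x)"
    by (simp only: kernel_of_def sum_distrib_left)
qed

lemma conv_sum_left:
  assumes "\<And>i. i \<in> I \<Longrightarrow> K i \<in> schwartz" "rapid f"
  shows "conv (\<lambda>x. \<Sum>i\<in>I. K i x) f x = (\<Sum>i\<in>I. conv (K i) f x)"
  unfolding conv_def sum_distrib_right
  by (rule Bochner_Integration.integral_sum) (intro integrable_conv assms rapid_integrable)

lemma tempered_sum:
  assumes u: "u \<in> tempered" and "\<And>i. i \<in> I \<Longrightarrow> \<phi> i \<in> schwartz"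
  shows "u (\<lambda>x. \<Sum>i\<in>I. \<phi> i x) = (\<Sum>i\<in>I. u (\<phi> i))"
proof -
  have 0: "u (\<lambda>x. 0) = 0" using tempered_cmult[OF u schwartz_zero, of 0] by simp
  show ?thesis using assms(2)
    by (induction I rule: infinite_finite_induct) (auto simp: 0 tempered_add[OF u] schwartz_sum)
qed

lemma pairable_continuous: "pairable h \<Longrightarrow> continuous_on A h"
  by (auto simp: pairable_def intro: continuous_on_subset)

lemma pairable_integrable: "pairable h \<Longrightarrow> \<phi> \<in> schwartz \<Longrightarrow> integrable lborel (\<lambda>x. \<phi> x * h x)"
  by (simp add: pairable_def)

lemma pairable_measurable: "pairable h \<Longrightarrow> h \<in> borel_measurable borel"
  by (intro borel_measurable_continuous_onI pairable_continuous)

lemma pairable_bounded: "continuous_on UNIV h \<Longrightarrow> (\<And>x. norm (h x) \<le> B) \<Longrightarrow> pairable h"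
  by (rule pairable_growth[where k = 0]) auto

section \<open>Dyadic partitions, their kernels and blocks as functions\<close>

locale dyadic =
  fixes \<rho> :: "nat \<Rightarrow> real^'n::finite \<Rightarrow> real"
  assumes dyadic: "dyadic_partition \<rho>"
begin

definition \<rho>c :: "nat \<Rightarrow> 'n test" where "\<rho>c j \<xi> = complex_of_real (\<rho> j \<xi>)"

text \<open>\<open>dyadic_partition\<close> asserts only that a profile exists; a witness is fixed
  so that its kernel can be named.\<close>

definition profile :: "real^'n \<Rightarrow> real" where
  "profile = (SOME \<theta>. smooth \<theta> \<and> (\<exists>r>0. \<exists>R. supp \<theta> \<subseteq> {\<xi>. r \<le> norm \<xi> \<and> norm \<xi> \<le> R}) \<and>
     (\<forall>j\<ge>1. \<forall>\<xi>. \<rho> j \<xi> = \<theta> ((1 / 2 ^ j) *\<^sub>R \<xi>)))"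

lemma dyadicD: "smooth (\<rho> 0)" "\<forall>\<xi>. \<rho> 0 \<xi> \<ge> 0" "\<exists>R. supp (\<rho> 0) \<subseteq> cball 0 R"
  "\<forall>\<xi>. (\<lambda>j. \<rho> j \<xi>) sums 1" "\<forall>i j. i + 1 < j \<longrightarrow> supp (\<rho> i) \<inter> supp (\<rho> j) = {}"
proof -
  note d = dyadic[unfolded dyadic_partition_def]
  note d2 = d[THEN conjunct2, THEN conjunct2]
  note d5 = d2[THEN conjunct2, THEN conjunct2, THEN conjunct2]
  show "smooth (\<rho> 0)" using d by (rule conjunct1)
  show "\<forall>\<xi>. \<rho> 0 \<xi> \<ge> 0" using d2 by (rule conjunct1)
  show "\<exists>R. supp (\<rho> 0) \<subseteq> cball 0 R" using d2[THEN conjunct2] by (rule conjunct1)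
  show "\<forall>\<xi>. (\<lambda>j. \<rho> j \<xi>) sums 1" using d5 by (rule conjunct1)
  show "\<forall>i j. i + 1 < j \<longrightarrow> supp (\<rho> i) \<inter> supp (\<rho> j) = {}" using d5 by (rule conjunct2)
qed

lemma profile: "smooth profile" "\<exists>r>0. \<exists>R. supp profile \<subseteq> {\<xi>. r \<le> norm \<xi> \<and> norm \<xi> \<le> R}"
  "j \<ge> 1 \<Longrightarrow> \<rho> j \<xi> = profile ((1 / 2 ^ j) *\<^sub>R \<xi>)"
proof -
  obtain \<theta> where \<theta>: "smooth \<theta> \<and> radial \<theta> \<and> (\<forall>\<xi>. \<theta> \<xi> \<ge> 0) \<and>
        (\<exists>r>0. \<exists>R. supp \<theta> \<subseteq> {\<xi>. r \<le> norm \<xi> \<and> norm \<xi> \<le> R}) \<and>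
        (\<forall>j\<ge>1. \<forall>\<xi>. \<rho> j \<xi> = \<theta> ((1 / 2 ^ j) *\<^sub>R \<xi>))"
    using dyadic[unfolded dyadic_partition_def, THEN conjunct2, THEN conjunct2, THEN conjunct2, THEN conjunct2, THEN conjunct1]
    by (rule exE)
  have "smooth \<theta> \<and> (\<exists>r>0. \<exists>R. supp \<theta> \<subseteq> {\<xi>. r \<le> norm \<xi> \<and> norm \<xi> \<le> R}) \<and>
     (\<forall>j\<ge>1. \<forall>\<xi>. \<rho> j \<xi> = \<theta> ((1 / 2 ^ j) *\<^sub>R \<xi>))"
    using \<theta> by (elim conjE, intro conjI)
  from someI[where P = "\<lambda>\<theta>. smooth \<theta> \<and> (\<exists>r>0. \<exists>R. supp \<theta> \<subseteq> {\<xi>. r \<le> norm \<xi> \<and> norm \<xi> \<le> R}) \<and>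
     (\<forall>j\<ge>1. \<forall>\<xi>. \<rho> j \<xi> = \<theta> ((1 / 2 ^ j) *\<^sub>R \<xi>))", OF this, folded profile_def]
  have P: "smooth profile \<and> (\<exists>r>0. \<exists>R. supp profile \<subseteq> {\<xi>. r \<le> norm \<xi> \<and> norm \<xi> \<le> R}) \<and>
     (\<forall>j\<ge>1. \<forall>\<xi>. \<rho> j \<xi> = profile ((1 / 2 ^ j) *\<^sub>R \<xi>))" .
  show "smooth profile" using P by (rule conjunct1)
  show "\<exists>r>0. \<exists>R. supp profile \<subseteq> {\<xi>. r \<le> norm \<xi> \<and> norm \<xi> \<le> R}" using P[THEN conjunct2] by (rule conjunct1)
  show "j \<ge> 1 \<Longrightarrow> \<rho> j \<xi> = profile ((1 / 2 ^ j) *\<^sub>R \<xi>)" using P[THEN conjunct2, THEN conjunct2] by simp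
qed

definition profilec :: "'n test" where "profilec \<xi> = complex_of_real (profile \<xi>)"

lemma in_supp: "f \<xi> \<noteq> 0 \<Longrightarrow> \<xi> \<in> supp f" for f :: "real^'n \<Rightarrow> real"
  unfolding supp_def by (rule closure_subset[THEN subsetD]) simp

text \<open>The value of a multiplier at 0 is the integral of its kernel, so this is the mean-zero
  property of all blocks but the first.\<close>

lemma profile_0: "profile 0 = 0"
proof (rule ccontr)
  assume "profile 0 \<noteq> 0"
  then have "0 \<in> supp profile" by (rule in_supp)
  then show False using profile(2) by auto
qed

lemma schwartz_profilec: "profilec \<in> schwartz"
proof -
  obtain r R where "supp profile \<subseteq> {\<xi>. r \<le> norm \<xi> \<and> norm \<xi> \<le> R}" using profile(2) by blast
  then have "profile x = 0" if "norm x > R" for x using that in_supp[of profile x] by fastforce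
  then show ?thesis unfolding profilec_def[abs_def] by (rule schwartz_compact_support[OF profile(1)])
qed

lemma \<rho>0_support: "\<exists>R. \<forall>x. norm x > R \<longrightarrow> \<rho> 0 x = 0"
proof -
  obtain R where "supp (\<rho> 0) \<subseteq> cball 0 R" using dyadicD(3) by blast
  then have "\<rho> 0 x = 0" if "norm x > R" for x using that in_supp[of "\<rho> 0" x] by fastforce
  then show ?thesis by blast
qed

lemma \<rho>c_eq: "\<rho>c (Suc j) = (\<lambda>\<xi>. profilec ((1 / 2 ^ Suc j) *\<^sub>R \<xi>))"
  by (rule ext) (simp only: \<rho>c_def profilec_def profile(3)[of "Suc j"] le_Suc_eq, simp add: profile(3)[of "Suc j"])

lemma schwartz_\<rho>c: "\<rho>c j \<in> schwartz"
proof (cases j)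
  case 0
  obtain R where "\<And>x. norm x > R \<Longrightarrow> \<rho> 0 x = 0" using \<rho>0_support by blast
  moreover note dyadicD(1)
  ultimately have "(\<lambda>x. complex_of_real (\<rho> 0 x)) \<in> schwartz" by (intro schwartz_compact_support)
  then show ?thesis unfolding 0 \<rho>c_def[abs_def] .
next
  case (Suc i)
  have "(\<lambda>\<xi>. profilec ((1 / 2 ^ Suc i) *\<^sub>R \<xi> + 0)) \<in> schwartz" by (intro schwartz_affine schwartz_profilec) simp
  then show ?thesis unfolding Suc \<rho>c_eq by simp
qed

lemma \<rho>_sums: "(\<lambda>j. \<rho> j \<xi>) sums 1"
  using dyadicD(4) by blast

lemma \<rho>_0_0: "\<rho> 0 0 = 1"
proof -
  have "\<rho> j 0 = 0" if "j \<notin> {0}" for j using profile(3)[of j 0] profile_0 that by simp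
  then have "(\<lambda>j. \<rho> j 0) sums (\<Sum>j\<in>{0}. \<rho> j 0)" by (intro sums_finite) auto
  then have "(\<lambda>j. \<rho> j 0) sums \<rho> 0 0" by simp
  from sums_unique2[OF this \<rho>_sums] show ?thesis .
qed

text \<open>Dilation by \<open>2 ^ N\<close> shifts the index in the partition identity. The series
  for \<open>\<xi>\<close> beyond index \<open>N\<close> and the series for the rescaled point
  beyond index 0 have the same terms, hence equal complements.\<close>

lemma \<rho>_partial_sum: "(\<Sum>j<Suc N. \<rho> j \<xi>) = \<rho> 0 ((1 / 2 ^ N) *\<^sub>R \<xi>)"
proof -
  let ?\<eta> = "(1 / 2 ^ N) *\<^sub>R \<xi>"
  have eq: "\<rho> (Suc j) ?\<eta> = \<rho> (j + Suc N) \<xi>" for j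
    using profile(3)[of "Suc j" ?\<eta>] profile(3)[of "j + Suc N" \<xi>] by (simp add: power_add mult_ac)
  have 1: "(\<lambda>j. \<rho> (Suc j) ?\<eta>) sums (1 - \<rho> 0 ?\<eta>)" using \<rho>_sums[of ?\<eta>] by (subst sums_Suc_iff) simp
  have 2: "(\<lambda>j. \<rho> (j + Suc N) \<xi>) sums (1 - (\<Sum>j<Suc N. \<rho> j \<xi>))"
    using \<rho>_sums[of \<xi>] by (subst sums_iff_shift) (simp del: sum.lessThan_Suc)
  show ?thesis using sums_unique2[OF 1[unfolded eq] 2] by (simp del: sum.lessThan_Suc)
qed

text \<open>A bump made from \<open>\<rho> 0\<close>, which is nonnegative, compactly supported and
  equal to 1 at the origin, is concentrated where \<open>Re (h y / h x0)\<close> is at least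
  \<open>1 / 2\<close>. Testing with it would make the integral of the bump nonpositive.\<close>

lemma pairable_zero:
  fixes h :: "'n test"
  assumes h: "pairable h" and z: "\<And>\<phi>. \<phi> \<in> schwartz \<Longrightarrow> (LINT x|lborel. \<phi> x * h x) = 0"
  shows "h x0 = 0"
proof (rule ccontr)
  assume h0: "h x0 \<noteq> 0"
  obtain R0 where R0: "\<And>x. norm x > R0 \<Longrightarrow> \<rho> 0 x = 0" using \<rho>0_support by blast
  define R where "R = max R0 1"
  have R: "R > 0" "\<And>x. norm x > R \<Longrightarrow> \<rho> 0 x = 0" using R0 by (auto simp: R_def)
  define g where "g y = Re (h y / h x0)" for y
  have "continuous_on UNIV g" unfolding g_def by (intro continuous_intros pairable_continuous h) (simp add: h0)
  moreover have "g x0 = 1" using h0 by (simp add: g_def)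
  ultimately have "\<exists>\<delta>>0. \<forall>y. dist y x0 < \<delta> \<longrightarrow> dist (g y) 1 < 1 / 2"
    using continuous_on_iff[of UNIV g] by (metis UNIV_I half_gt_zero zero_less_one)
  then obtain \<delta> where \<delta>: "\<delta> > 0" "\<And>y. norm (y - x0) < \<delta> \<Longrightarrow> \<bar>g y - 1\<bar> < 1 / 2"
    by (auto simp: dist_norm)
  \<comment> \<open>Shrinks the support, of radius \<open>R\<close>, to radius
    \<open>\<delta> / 2\<close>.\<close>
  define c where "c = 2 * R / \<delta>"
  have c: "c > 0" using R \<delta> by (simp add: c_def)
  define a where "a = - (c *\<^sub>R x0)"
  have aff: "c *\<^sub>R y + a = c *\<^sub>R (y - x0)" for y by (simp add: a_def scaleR_diff_right)
  define \<phi> where "\<phi> y = \<rho>c 0 (c *\<^sub>R y + a)" for y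
  have \<phi>: "\<phi> \<in> schwartz" unfolding \<phi>_def[abs_def] using c by (intro schwartz_affine schwartz_\<rho>c) auto
  define \<kappa> where "\<kappa> y = \<rho> 0 (c *\<^sub>R y + a)" for y
  have \<phi>\<kappa>: "\<phi> y = complex_of_real (\<kappa> y)" for y by (simp add: \<phi>_def \<kappa>_def \<rho>c_def)
  have \<kappa>0: "\<kappa> y \<ge> 0" for y unfolding \<kappa>_def using dyadicD(2) by blast
  have i\<kappa>: "integrable lborel \<kappa>"
    using integrable_Re[OF schwartz_integrable[OF \<phi>]] by (simp add: \<phi>\<kappa>)
  have ih: "integrable lborel (\<lambda>y. \<phi> y * h y / h x0)" using pairable_integrable[OF h \<phi>] by simp
  then have ig: "integrable lborel (\<lambda>y. \<kappa> y * g y)"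
    using integrable_Re[OF ih] by (simp add: \<phi>\<kappa> g_def times_divide_eq_right[symmetric] del: times_divide_eq_right)
  have "(LINT y|lborel. \<kappa> y * g y) = Re (LINT y|lborel. \<phi> y * h y / h x0)"
    using integral_Re[OF ih] by (simp add: \<phi>\<kappa> g_def times_divide_eq_right[symmetric] del: times_divide_eq_right)
  also have "\<dots> = 0" using z[OF \<phi>] by simp
  finally have g0: "(LINT y|lborel. \<kappa> y * g y) = 0" .
  have "(LINT y|lborel. \<kappa> y) \<le> (LINT y|lborel. 2 * (\<kappa> y * g y))"
  proof (rule integral_mono[OF i\<kappa>])
    show "integrable lborel (\<lambda>y. 2 * (\<kappa> y * g y))" using ig by simp
    fix y
    show "\<kappa> y \<le> 2 * (\<kappa> y * g y)"
    proof (cases "\<kappa> y = 0")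
      case False
      then have "c * norm (y - x0) \<le> R" using R(2)[of "c *\<^sub>R (y - x0)"] c unfolding \<kappa>_def aff by force
      then have "norm (y - x0) \<le> \<delta> / 2" using R \<delta> by (simp add: c_def field_simps)
      then have "g y \<ge> 1 / 2" using \<delta> by (smt (verit) field_sum_of_halves)
      then show ?thesis using mult_left_mono[of "1 / 2" "g y" "\<kappa> y"] \<kappa>0[of y] by simp
    qed simp
  qed
  then have "(LINT y|lborel. \<kappa> y) \<le> 0" using g0 by simp
  then have "(LINT y|lborel. \<kappa> y) = 0" using \<kappa>0 by (simp add: antisym)
  then have "AE y in lborel. \<kappa> y = 0" using integral_nonneg_eq_0_iff_AE[OF i\<kappa>] \<kappa>0 by simp
  then have N: "{y. \<kappa> y \<noteq> 0} \<in> null_sets lborel"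
    using i\<kappa> by (subst (asm) AE_iff_null) auto
  then have "negligible {y. \<kappa> y \<noteq> 0}"
    unfolding negligible_iff_null_sets by (rule null_sets_completionI)
  moreover have "open {y. \<kappa> y \<noteq> 0}"
  proof -
    have "continuous_on UNIV \<phi>" by (rule schwartz_continuous[OF \<phi>])
    then have "open (\<phi> -` (- {0}))" by (intro open_vimage) auto
    moreover have "\<phi> -` (- {0}) = {y. \<kappa> y \<noteq> 0}" by (auto simp: \<phi>\<kappa>)
    ultimately show ?thesis by simp
  qed
  moreover have "\<kappa> x0 = 1" unfolding \<kappa>_def aff using \<rho>_0_0 by simp
  then have "{y. \<kappa> y \<noteq> 0} \<noteq> {}" by force
  ultimately show False using open_not_negligible by blast
qed

text \<open>Uniqueness of the continuous representative, without which the description in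
  \<open>cont_rep\<close> would have no determined value.\<close>

lemma pairable_unique:
  fixes h h' :: "'n test"
  assumes h: "pairable h" and h': "pairable h'"
    and eq: "\<And>\<phi>. \<phi> \<in> schwartz \<Longrightarrow> distr_of h \<phi> = distr_of h' \<phi>"
  shows "h = h'"
proof
  fix x
  have "pairable (\<lambda>x. h x - h' x)"
    using h h' unfolding pairable_def by (auto simp: right_diff_distrib intro!: continuous_intros)
  then have "h x - h' x = 0"
  proof (rule pairable_zero)
    fix \<phi> :: "'n test" assume "\<phi> \<in> schwartz"
    then show "(LINT x|lborel. \<phi> x * (h x - h' x)) = 0"
      using eq pairable_integrable[OF h] pairable_integrable[OF h'] by (simp add: right_diff_distrib distr_of_def)
  qed
  then show "h x = h' x" by simp
qed

definition LPk :: "nat \<Rightarrow> 'n test" where "LPk j = kernel_of (\<rho>c j)"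

lemma schwartz_LPk: "LPk j \<in> schwartz"
  unfolding LPk_def by (intro schwartz_kernel_of schwartz_\<rho>c)

text \<open>Resolves the definite description behind \<open>LP_block\<close>:
  \<open>tempered_conv\<close> shows that pairing \<open>u\<close> with translates of the kernel
  represents the block, and \<open>pairable_unique\<close> excludes any other function.\<close>

lemma
  assumes u: "u \<in> tempered"
  shows LP_block_eq: "LP_block \<rho> j u = (\<lambda>x. u (\<lambda>y. LPk j (y - x)))"
    and pairable_LP_block: "pairable (LP_block \<rho> j u)"
    and distr_of_LP_block: "\<phi> \<in> schwartz \<Longrightarrow> distr_of (LP_block \<rho> j u) \<phi> = u (conv (LPk j) \<phi>)"
proof -
  let ?h = "\<lambda>x. u (\<lambda>y. LPk j (y - x))"
  obtain B k where B: "\<And>x. norm (?h x) \<le> B * (1 + norm x) ^ k"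
    using tempered_translate_growth[OF u schwartz_LPk] by blast
  have p: "pairable ?h"
    by (rule pairable_growth[OF tempered_translate_continuous[OF u schwartz_LPk] B])
  have eq: "u (conv (LPk j) \<phi>) = distr_of ?h \<phi>" if "\<phi> \<in> schwartz" for \<phi>
    unfolding distr_of_def by (rule tempered_conv[OF u schwartz_LPk that])
  have L: "inv_fourier_distr (mult_distr (\<rho> j) (fourier_distr u)) \<phi> = u (conv (LPk j) \<phi>)" if "\<phi> \<in> schwartz" for \<phi>
    using fourier_multiplier_eq_conv[OF schwartz_\<rho>c that, of j]
    by (simp add: inv_fourier_distr_def mult_distr_def fourier_distr_def LPk_def \<rho>c_def)
  have LP: "LP_block \<rho> j u = ?h"
    unfolding LP_block_def cont_rep_def
  proof (rule the_equality)
    show "pairable ?h \<and> (\<forall>\<phi>\<in>schwartz. inv_fourier_distr (mult_distr (\<rho> j) (fourier_distr u)) \<phi> = distr_of ?h \<phi>)"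
      using p L eq by simp
    show "h = ?h" if "pairable h \<and> (\<forall>\<phi>\<in>schwartz. inv_fourier_distr (mult_distr (\<rho> j) (fourier_distr u)) \<phi> = distr_of h \<phi>)" for h
      using that p L eq by (intro pairable_unique) auto
  qed
  then show "LP_block \<rho> j u = ?h" .
  show "pairable (LP_block \<rho> j u)" unfolding LP by (rule p)
  show "distr_of (LP_block \<rho> j u) \<phi> = u (conv (LPk j) \<phi>)" if "\<phi> \<in> schwartz" unfolding LP using eq[OF that] by simp
qed

lemma LP_sum_kernel: "(\<lambda>x. \<Sum>j<Suc N. LPk j x) = dilate (2 ^ N) (LPk 0)"
proof -
  have "(\<lambda>x. \<Sum>j<Suc N. LPk j x) = kernel_of (\<lambda>\<xi>. \<Sum>j<Suc N. \<rho>c j \<xi>)"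
    unfolding LPk_def by (rule kernel_of_sum[symmetric]) (rule schwartz_\<rho>c)
  also have "(\<lambda>\<xi>. \<Sum>j<Suc N. \<rho>c j \<xi>) = (\<lambda>\<xi>. \<rho>c 0 ((1 / 2 ^ N) *\<^sub>R \<xi>))"
    unfolding \<rho>c_def using \<rho>_partial_sum by (metis (no_types) of_real_sum)
  also have "kernel_of \<dots> = dilate (2 ^ N) (LPk 0)"
    unfolding LPk_def by (rule kernel_of_dilate[OF schwartz_\<rho>c]) simp
  finally show ?thesis .
qed

text \<open>Partial sums of the kernels are dilations of \<open>LPk 0\<close>, whose integral is
  \<open>\<rho> 0 0 = 1\<close>. They form an approximate identity, with error of order
  \<open>(1 / 2) ^ N\<close> in every seminorm.\<close>

lemma LP_sum_converges:
  assumes u: "u \<in> tempered" and \<phi>: "\<phi> \<in> schwartz"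
  shows "(\<lambda>j. distr_of (LP_block \<rho> j u) \<phi>) sums u \<phi>"
proof -
  obtain C k where C: "C \<ge> 0" and bd: "\<And>\<phi>. \<phi> \<in> schwartz \<Longrightarrow> norm (u \<phi>) \<le> C * schwartz_seminorm k \<phi>"
    by (rule tempered_boundE[OF u]) (rule that)
  define f where "f N = dilate (2 ^ N) (LPk 0)" for N :: nat
  have rk: "rapid (LPk 0)" by (rule schwartz_rapid[OF schwartz_LPk])
  have f: "rapid (f N)" "integral\<^sup>L lborel (f N) = 1" for N
    unfolding f_def using rapid_dilate[OF rk] integral_dilate_complex[OF rk] integral_kernel_of[OF schwartz_\<rho>c, of 0] \<rho>_0_0
    by (auto simp: LPk_def \<rho>c_def)
  have cs: "conv (LPk j) \<phi> \<in> schwartz" for j by (intro schwartz_conv schwartz_LPk schwartz_rapid \<phi>)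
  have S: "(\<Sum>j<Suc N. distr_of (LP_block \<rho> j u) \<phi>) = u (conv \<phi> (f N))" for N
  proof -
    have "(\<Sum>j<Suc N. distr_of (LP_block \<rho> j u) \<phi>) = (\<Sum>j<Suc N. u (conv (LPk j) \<phi>))"
      by (intro sum.cong refl distr_of_LP_block u \<phi>)
    also have "\<dots> = u (\<lambda>x. \<Sum>j<Suc N. conv (LPk j) \<phi> x)" by (rule tempered_sum[OF u, symmetric]) (rule cs)
    also have "(\<lambda>x. \<Sum>j<Suc N. conv (LPk j) \<phi> x) = conv (\<lambda>x. \<Sum>j<Suc N. LPk j x) \<phi>"
      by (rule ext, rule conv_sum_left[symmetric]) (auto intro: schwartz_LPk schwartz_rapid \<phi>)
    also have "\<dots> = conv \<phi> (f N)"
      unfolding LP_sum_kernel f_def[symmetric] by (rule conv_commute[OF rapid_measurable[OF f(1)] schwartz_measurable[OF \<phi>]])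
    finally show ?thesis .
  qed
  define M where "M = C * (CARD('n) * schwartz_seminorm (Suc k) \<phi>) * (2 ^ k * shift_moment k (LPk 0))"
  have "(\<lambda>N. u (conv \<phi> (f N)) - u \<phi>) \<longlonglongrightarrow> 0"
  proof (rule Lim_null_comparison)
    have "norm (u (conv \<phi> (f N)) - u \<phi>) \<le> M * (1 / 2) ^ N" for N
    proof -
      have cS: "conv \<phi> (f N) \<in> schwartz" by (intro schwartz_conv \<phi> f)
      have "shift_moment k (f N) \<le> 1 / 2 ^ N * (1 + 1 / 2 ^ N) ^ k * shift_moment k (LPk 0)"
        unfolding f_def by (rule shift_moment_dilate[OF rk]) simp
      also have "\<dots> \<le> 1 / 2 ^ N * 2 ^ k * shift_moment k (LPk 0)"
        by (intro mult_right_mono mult_left_mono power_mono shift_moment_nonneg) auto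
      finally have sm: "shift_moment k (f N) \<le> (1 / 2) ^ N * (2 ^ k * shift_moment k (LPk 0))" by (simp add: power_divide)
      have "norm (u (conv \<phi> (f N)) - u \<phi>) = norm (u (\<lambda>x. conv \<phi> (f N) x - \<phi> x))"
        by (simp add: tempered_diff[OF u cS \<phi>])
      also have "\<dots> \<le> C * schwartz_seminorm k (\<lambda>x. conv \<phi> (f N) x - \<phi> x)" by (intro bd schwartz_diff cS \<phi>)
      also have "\<dots> \<le> C * (CARD('n) * schwartz_seminorm (Suc k) \<phi> * shift_moment k (f N))"
        by (intro mult_left_mono schwartz_seminorm_conv_approx \<phi> f C)
      also have "\<dots> \<le> C * (CARD('n) * schwartz_seminorm (Suc k) \<phi> * ((1 / 2) ^ N * (2 ^ k * shift_moment k (LPk 0))))"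
        by (intro mult_left_mono sm C mult_nonneg_nonneg schwartz_seminorm_nonneg \<phi>) simp
      finally show ?thesis by (simp only: M_def mult_ac)
    qed
    then show "\<forall>\<^sub>F N in sequentially. norm (u (conv \<phi> (f N)) - u \<phi>) \<le> M * (1 / 2) ^ N" by (intro always_eventually allI)
    show "(\<lambda>N. M * (1 / 2) ^ N) \<longlonglongrightarrow> 0" by (intro tendsto_mult_right_zero LIMSEQ_power_zero) simp
  qed
  then have "(\<lambda>N. \<Sum>j<Suc N. distr_of (LP_block \<rho> j u) \<phi>) \<longlonglongrightarrow> u \<phi>" unfolding S by (simp add: LIM_zero_iff)
  then show ?thesis unfolding sums_def by (subst (asm) filterlim_sequentially_Suc)
qed

end

text \<open>Short shifts use the mean value inequality with an integrable weight; for shifts longer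
  than 1 the trivial bound by twice the mass is already linear.\<close>

lemma L1_modulus:
  fixes K :: "'n::finite test"
  assumes K: "K \<in> schwartz"
  obtains L where "L \<ge> 0" "\<And>a. (LINT z|lborel. norm (K (z - a) - K z)) \<le> L * norm a"
proof -
  define m where "m = 2 * CARD('n)"
  obtain B where B: "B \<ge> 0" "\<And>x y. (1 + norm x) ^ m * norm (K (x - y) - K x) \<le> B * norm y * (1 + norm y) ^ m"
    by (rule schwartz_translate_diff[OF K, of m]) (rule that)
  define W where "W = (LINT z|lborel. 1 / (1 + norm (z::real^'n)) ^ m)"
  have W: "W \<ge> 0" unfolding W_def by (intro integral_nonneg_AE) simp
  have iW: "integrable lborel (\<lambda>z::real^'n. 1 / (1 + norm z) ^ m)" unfolding m_def by (rule integrable_weight)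
  have iK: "integrable lborel K" by (rule schwartz_integrable[OF K])
  have iKa: "integrable lborel (\<lambda>z. K (z - a))" for a
    by (rule schwartz_integrable[OF schwartz_translate[OF K]])
  define N where "N = (LINT z|lborel. norm (K z))"
  have N: "N \<ge> 0" unfolding N_def by (intro integral_nonneg_AE) simp
  define L where "L = max (B * 2 ^ m * W) (2 * N)"
  have "(LINT z|lborel. norm (K (z - a) - K z)) \<le> L * norm a" for a
  proof (cases "norm a \<le> 1")
    case True
    have "(LINT z|lborel. norm (K (z - a) - K z)) \<le> (LINT z|lborel. (B * norm a * 2 ^ m) * (1 / (1 + norm (z::real^'n)) ^ m))"
    proof (rule integral_mono)
      show "integrable lborel (\<lambda>z. norm (K (z - a) - K z))" using iK iKa by simp
      show "integrable lborel (\<lambda>z::real^'n. (B * norm a * 2 ^ m) * (1 / (1 + norm z) ^ m))"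
        by (intro integrable_mult_right iW)
      fix z
      have "(1 + norm z) ^ m * norm (K (z - a) - K z) \<le> B * norm a * (1 + norm a) ^ m" by (rule B)
      also have "\<dots> \<le> B * norm a * 2 ^ m" using True B(1) by (intro mult_left_mono power_mono) auto
      finally show "norm (K (z - a) - K z) \<le> (B * norm a * 2 ^ m) * (1 / (1 + norm z) ^ m)"
        by (simp add: pos_le_divide_eq add_pos_nonneg mult.commute)
    qed
    also have "\<dots> = (B * 2 ^ m * W) * norm a" by (simp only: W_def integral_mult_right_zero mult_ac)
    also have "\<dots> \<le> L * norm a" by (intro mult_right_mono) (auto simp: L_def)
    finally show ?thesis .
  next
    case False
    have "(LINT z|lborel. norm (K (z - a) - K z)) \<le> (LINT z|lborel. norm (K (z - a)) + norm (K z))"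
      using iK iKa by (intro integral_mono norm_triangle_ineq4) auto
    also have "\<dots> = 2 * N"
      using iK iKa integral_lborel_translate[of "\<lambda>z. norm (K z)" a] schwartz_measurable[OF K] by (simp add: N_def)
    also have "\<dots> \<le> (2 * N) * norm a" using False N by (simp add: mult_le_cancel_left1)
    also have "\<dots> \<le> L * norm a" by (intro mult_right_mono) (auto simp: L_def)
    finally show ?thesis .
  qed
  moreover have "L \<ge> 0" using N by (simp add: L_def le_max_iff_disj)
  ultimately show ?thesis using that by blast
qed

lemma L1_modulus_dilate:
  fixes K :: "'n::finite test"
  assumes K: "K \<in> schwartz" and c: "c > 0"
    and L: "\<And>a. (LINT z|lborel. norm (K (z - a) - K z)) \<le> L * norm a"
  shows "(LINT z|lborel. norm (dilate c K (z - a) - dilate c K z)) \<le> L * c * norm a"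
proof -
  note [measurable] = schwartz_measurable[OF K]
  have "norm (dilate c K (z - a) - dilate c K z) = c ^ CARD('n) *\<^sub>R norm (K (c *\<^sub>R z - c *\<^sub>R a) - K (c *\<^sub>R z))" for z
    using c by (simp add: dilate_def scaleR_diff_right norm_mult norm_power flip: right_diff_distrib)
  then have "(LINT z|lborel. norm (dilate c K (z - a) - dilate c K z)) = (LINT z|lborel. norm (K (z - c *\<^sub>R a) - K z))"
    using c integral_dilate[of "\<lambda>z. norm (K (z - c *\<^sub>R a) - K z)" c] by simp
  also have "\<dots> \<le> L * norm (c *\<^sub>R a)" by (rule L)
  finally show ?thesis using c by (simp add: mult.assoc)
qed

lemma integrable_pair_translate:
  fixes K \<phi> H :: "real^'n::finite \<Rightarrow> complex"
  assumes K: "integrable lborel K" and \<phi>: "integrable lborel \<phi>"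
    and H [measurable]: "H \<in> borel_measurable borel" and M: "\<And>y. norm (H y) \<le> M"
  shows "integrable (lborel \<Otimes>\<^sub>M lborel) (\<lambda>(x, y). \<phi> x * (H y * K (y - x)))"
proof -
  note [measurable] = borel_measurable_integrable[OF K, simplified] borel_measurable_integrable[OF \<phi>, simplified]
  have iK: "integrable lborel (\<lambda>y. norm (K (y - x)))" "(LINT y|lborel. norm (K (y - x))) = (LINT y|lborel. norm (K y))" for x
    using integrable_lborel_translate[of "\<lambda>y. norm (K y)" x] integral_lborel_translate[of "\<lambda>y. norm (K y)" x] K by auto
  have iK': "integrable lborel (\<lambda>y. K (y - x))" for x
    using integrable_lborel_translate[of K x] K by auto
  have "integrable (lborel \<Otimes>\<^sub>M lborel) (\<lambda>(x, y). \<phi> x * K (y - x))"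
  proof (rule lborel_pair.Fubini_integrable)
    show "(\<lambda>(x, y). \<phi> x * K (y - x)) \<in> borel_measurable (lborel \<Otimes>\<^sub>M lborel)" by measurable
    show "integrable lborel (\<lambda>x. LINT y|lborel. norm (case (x, y) of (x, y) \<Rightarrow> \<phi> x * K (y - x)))"
      using \<phi> by (simp add: norm_mult iK)
    show "AE x in lborel. integrable lborel (\<lambda>y. case (x, y) of (x, y) \<Rightarrow> \<phi> x * K (y - x))"
      using iK' by simp
  qed
  then have "integrable (lborel \<Otimes>\<^sub>M lborel) (\<lambda>z. H (snd z) * (case z of (x, y) \<Rightarrow> \<phi> x * K (y - x)))"
    by (rule integrable_mult_bounded) (use M in auto)
  then show ?thesis by (simp add: split_def mult_ac)
qed

lemma norm_distr_of_growth:
  fixes h \<phi> :: "'n::finite test"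
  assumes \<phi>: "\<phi> \<in> schwartz" and M: "\<And>x. norm (h x) \<le> M * (1 + norm x) ^ k"
  shows "norm (distr_of h \<phi>) \<le> M * moment k \<phi>"
proof -
  have "norm (distr_of h \<phi>) \<le> (LINT x|lborel. norm (\<phi> x * h x))"
    unfolding distr_of_def by (rule integral_norm_bound)
  also have "\<dots> \<le> (LINT x|lborel. M * ((1 + norm x) ^ k * norm (\<phi> x)))"
  proof (rule integral_mono_AE')
    show "integrable lborel (\<lambda>x. M * ((1 + norm x) ^ k * norm (\<phi> x)))"
      by (intro integrable_mult_right rapid_moment_integrable schwartz_rapid \<phi>)
    show "AE x in lborel. norm (\<phi> x * h x) \<le> M * ((1 + norm x) ^ k * norm (\<phi> x))"
      using mult_right_mono[OF M norm_ge_zero] by (intro AE_I2) (simp add: norm_mult mult_ac)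
    have "0 \<le> M" using order_trans[OF norm_ge_zero M[of 0]] by simp
    then show "AE x in lborel. 0 \<le> M * ((1 + norm x) ^ k * norm (\<phi> x))" by simp
  qed
  finally show ?thesis by (simp add: moment_def)
qed

lemma norm_distr_of_le:
  fixes h \<phi> :: "'n::finite test"
  assumes "\<phi> \<in> schwartz" "\<And>x. norm (h x) \<le> M"
  shows "norm (distr_of h \<phi>) \<le> M * moment 0 \<phi>"
  using norm_distr_of_growth[OF assms(1), of h M 0] assms(2) by simp

lemma sum_power_le_divide:
  fixes q :: real
  assumes "q > 1"
  shows "(\<Sum>i<n. q ^ i) \<le> q ^ n / (q - 1)"
  using assms by (simp add: sum_gp_strict divide_right_mono field_simps)

lemma sum_power_le_inverse:
  fixes a :: real
  assumes "0 \<le> a" "a < 1"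
  shows "(\<Sum>i<n. a ^ i) \<le> 1 / (1 - a)"
  using assms by (simp add: sum_gp_strict divide_right_mono)

lemma Collect_low: "{i. i + 1 < j} = {..<j - 1}" for j :: nat by auto

text \<open>Serves two purposes: the index set of the resonant product, and the indices
  \<open>i\<close> for which the supports of \<open>\<rho> i\<close> and \<open>\<rho> j\<close> can
  meet.\<close>

definition near :: "nat \<Rightarrow> nat set" where "near j = {i. i \<le> j + 1 \<and> j \<le> i + 1}"

lemma near_subset: "near j \<subseteq> {j - 1, j, j + 1}" by (auto simp: near_def)

lemma finite_near [simp]: "finite (near j)" using near_subset by (rule finite_subset) simp

lemma card_near: "card (near j) \<le> 3"
proof -
  have "card (near j) \<le> card {j - 1, j, j + 1}" by (intro card_mono near_subset) simp
  also have "\<dots> \<le> 3" by (rule order_trans[OF card_insert_le_m1]) (auto simp: card_insert_if)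
  finally show ?thesis .
qed

lemma sum_near_le:
  fixes f :: "nat \<Rightarrow> real"
  assumes "\<And>i. i \<in> near j \<Longrightarrow> f i \<le> M" "M \<ge> 0"
  shows "sum f (near j) \<le> 3 * M"
proof -
  have "sum f (near j) \<le> card (near j) * M" using sum_bounded_above[of "near j" f M] assms by simp
  also have "\<dots> \<le> 3 * M" using card_near[of j] assms(2) by (intro mult_right_mono) auto
  finally show ?thesis .
qed

section \<open>Reproducing formula and Bernstein estimates\<close>

context dyadic
begin

abbreviation LP :: "nat \<Rightarrow> 'n distr \<Rightarrow> 'n test" where "LP \<equiv> LP_block \<rho>"

text \<open>The fattened block: its multiplier is 1 wherever \<open>\<rho> j\<close> is nonzero, so
  convolving with it leaves block \<open>j\<close> unchanged.\<close>

definition LPw :: "nat \<Rightarrow> 'n test" where "LPw j = (\<lambda>x. \<Sum>i\<in>near j. LPk i x)"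

lemma schwartz_LPw: "LPw j \<in> schwartz"
  unfolding LPw_def by (intro schwartz_sum schwartz_LPk)

lemma LPw_eq: "LPw j = kernel_of (\<lambda>\<xi>. \<Sum>i\<in>near j. \<rho>c i \<xi>)"
  unfolding LPw_def LPk_def by (rule kernel_of_sum[symmetric]) (rule schwartz_\<rho>c)

lemma \<rho>c_near: "\<rho>c j \<xi> * (\<Sum>i\<in>near j. \<rho>c i \<xi>) = \<rho>c j \<xi>"
proof (cases "\<rho> j \<xi> = 0")
  case False
  have z: "\<rho> i \<xi> = 0" if "i \<notin> near j" for i
  proof (rule ccontr)
    assume "\<rho> i \<xi> \<noteq> 0"
    then have "\<xi> \<in> supp (\<rho> i)" "\<xi> \<in> supp (\<rho> j)" using False by (auto intro: in_supp)
    moreover have "i + 1 < j \<or> j + 1 < i" using that by (auto simp: near_def)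
    ultimately show False using dyadicD(5) by blast
  qed
  have "(\<lambda>i. \<rho> i \<xi>) sums (\<Sum>i\<in>near j. \<rho> i \<xi>)" using z by (intro sums_finite) auto
  from sums_unique2[OF this \<rho>_sums] have "(\<Sum>i\<in>near j. \<rho>c i \<xi>) = 1"
    unfolding \<rho>c_def by (metis of_real_1 of_real_sum)
  then show ?thesis by simp
qed (simp add: \<rho>c_def)

lemma LPk_reproducing:
  assumes \<phi>: "\<phi> \<in> schwartz"
  shows "conv (LPk j) (conv (LPw j) \<phi>) = conv (LPk j) \<phi>"
proof -
  have "conv (LPk j) (conv (LPw j) \<phi>) = conv (kernel_of (\<lambda>\<xi>. \<rho>c j \<xi> * (\<Sum>i\<in>near j. \<rho>c i \<xi>))) \<phi>"
    unfolding LPw_eq LPk_def by (intro conv_kernel_of_mult schwartz_\<rho>c schwartz_sum \<phi>)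
  then show ?thesis unfolding \<rho>c_near LPk_def by simp
qed

lemma LPk_Suc: "LPk (Suc j) = dilate (2 ^ Suc j) (kernel_of profilec)"
  unfolding LPk_def \<rho>c_eq by (rule kernel_of_dilate[OF schwartz_profilec]) simp

text \<open>One constant suffices because the blocks from index 1 on are dilations of a single
  kernel, and a dilation by \<open>c\<close> multiplies the modulus by \<open>c\<close>.\<close>

lemma LPk_modulus:
  obtains L where "L \<ge> 0" "\<And>j a. (LINT z|lborel. norm (LPk j (z - a) - LPk j z)) \<le> L * 2 ^ j * norm a"
proof -
  obtain L0 where L0: "L0 \<ge> 0" "\<And>a. (LINT z|lborel. norm (LPk 0 (z - a) - LPk 0 z)) \<le> L0 * norm a"
    by (rule L1_modulus[OF schwartz_LPk]) (rule that)
  obtain L1 where L1: "L1 \<ge> 0" "\<And>a. (LINT z|lborel. norm (kernel_of profilec (z - a) - kernel_of profilec z)) \<le> L1 * norm a"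
    by (rule L1_modulus[OF schwartz_kernel_of[OF schwartz_profilec]]) (rule that)
  have "(LINT z|lborel. norm (LPk j (z - a) - LPk j z)) \<le> max L0 L1 * 2 ^ j * norm a" for j a
  proof (cases j)
    case 0
    have "L0 * norm a \<le> max L0 L1 * norm a" by (intro mult_right_mono) auto
    then show ?thesis using L0(2)[of a] by (simp add: 0)
  next
    case (Suc i)
    have "(LINT z|lborel. norm (LPk j (z - a) - LPk j z)) \<le> L1 * 2 ^ Suc i * norm a"
      unfolding Suc LPk_Suc by (rule L1_modulus_dilate[OF schwartz_kernel_of[OF schwartz_profilec] _ L1(2)]) simp
    also have "\<dots> \<le> max L0 L1 * 2 ^ Suc i * norm a" by (intro mult_right_mono) auto
    finally show ?thesis by (simp only: Suc)
  qed
  moreover have "max L0 L1 \<ge> 0" using L0(1) by (simp add: le_max_iff_disj)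
  ultimately show ?thesis using that by blast
qed

lemma LPw_modulus:
  obtains L where "L \<ge> 0" "\<And>j x x'. (LINT y|lborel. norm (LPw j (y - x) - LPw j (y - x'))) \<le> L * 2 ^ j * norm (x - x')"
proof -
  obtain L where L: "L \<ge> 0" "\<And>j a. (LINT z|lborel. norm (LPk j (z - a) - LPk j z)) \<le> L * 2 ^ j * norm a"
    by (rule LPk_modulus) (rule that)
  have "(LINT y|lborel. norm (LPw j (y - x) - LPw j (y - x'))) \<le> (6 * L) * 2 ^ j * norm (x - x')" for j x x'
  proof -
    let ?a = "x - x'"
    note [measurable] = schwartz_measurable[OF schwartz_LPw] schwartz_measurable[OF schwartz_LPk]
    have i: "integrable lborel (\<lambda>z. norm (LPk i (z - ?a) - LPk i z))" for i
      using schwartz_integrable[OF schwartz_diff[OF schwartz_translate[OF schwartz_LPk] schwartz_LPk]]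
      by (rule integrable_norm)
    have "(LINT y|lborel. norm (LPw j (y - x) - LPw j (y - x'))) = (LINT z|lborel. norm (LPw j (z - ?a) - LPw j z))"
      using integral_lborel_translate[of "\<lambda>z. norm (LPw j (z - ?a) - LPw j z)" x'] by (simp add: algebra_simps)
    also have "\<dots> \<le> (LINT z|lborel. (\<Sum>i\<in>near j. norm (LPk i (z - ?a) - LPk i z)))"
    proof (rule integral_mono)
      show "integrable lborel (\<lambda>z. norm (LPw j (z - ?a) - LPw j z))"
        using schwartz_integrable[OF schwartz_diff[OF schwartz_translate[OF schwartz_LPw] schwartz_LPw]]
        by (rule integrable_norm)
      show "norm (LPw j (z - ?a) - LPw j z) \<le> (\<Sum>i\<in>near j. norm (LPk i (z - ?a) - LPk i z))" for z
        unfolding LPw_def sum_subtractf[symmetric] by (rule norm_sum)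
    qed (intro Bochner_Integration.integrable_sum i)
    also have "\<dots> = (\<Sum>i\<in>near j. (LINT z|lborel. norm (LPk i (z - ?a) - LPk i z)))"
      by (rule Bochner_Integration.integral_sum) (rule i)
    also have "\<dots> \<le> 3 * (L * 2 ^ (j + 1) * norm ?a)"
    proof (rule sum_near_le)
      fix i assume "i \<in> near j"
      then have "i \<le> j + 1" by (simp add: near_def)
      then have "L * 2 ^ i * norm ?a \<le> L * 2 ^ (j + 1) * norm ?a"
        using L(1) by (intro mult_right_mono mult_left_mono power_increasing) auto
      then show "(LINT z|lborel. norm (LPk i (z - ?a) - LPk i z)) \<le> L * 2 ^ (j + 1) * norm ?a"
        using L(2)[of i ?a] by linarith
    qed (use L(1) in simp)
    finally show ?thesis by (simp add: mult_ac)
  qed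
  moreover have "6 * L \<ge> 0" using L(1) by simp
  ultimately show ?thesis using that by blast
qed

lemma bounded_LPw_lipschitz:
  fixes H :: "'n test"
  assumes H [measurable]: "H \<in> borel_measurable borel" and M: "\<And>y. norm (H y) \<le> M"
    and L: "(LINT y|lborel. norm (LPw j (y - x) - LPw j (y - x'))) \<le> L * 2 ^ j * norm (x - x')"
  shows "norm ((LINT y|lborel. H y * LPw j (y - x)) - (LINT y|lborel. H y * LPw j (y - x'))) \<le> M * (L * 2 ^ j * norm (x - x'))"
proof -
  have M0: "M \<ge> 0" using M[of 0] norm_ge_zero order_trans by blast
  have i: "integrable lborel (\<lambda>y. H y * LPw j (y - x))" for x
    by (rule integrable_mult_bounded[OF schwartz_integrable[OF schwartz_translate[OF schwartz_LPw]] _ M]) simp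
  have i2: "integrable lborel (\<lambda>y. norm (LPw j (y - x) - LPw j (y - x')))"
    by (intro integrable_norm Bochner_Integration.integrable_diff schwartz_integrable schwartz_translate schwartz_LPw)
  have "(LINT y|lborel. H y * LPw j (y - x)) - (LINT y|lborel. H y * LPw j (y - x'))
      = (LINT y|lborel. H y * LPw j (y - x) - H y * LPw j (y - x'))"
    using i by simp
  then have "norm ((LINT y|lborel. H y * LPw j (y - x)) - (LINT y|lborel. H y * LPw j (y - x')))
      \<le> (LINT y|lborel. norm (H y * LPw j (y - x) - H y * LPw j (y - x')))"
    by simp
  also have "\<dots> \<le> (LINT y|lborel. M * norm (LPw j (y - x) - LPw j (y - x')))"
  proof (rule integral_mono)
    show "integrable lborel (\<lambda>y. norm (H y * LPw j (y - x) - H y * LPw j (y - x')))"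
      by (intro integrable_norm Bochner_Integration.integrable_diff i)
    show "integrable lborel (\<lambda>y. M * norm (LPw j (y - x) - LPw j (y - x')))" by (intro integrable_mult_right i2)
    show "norm (H y * LPw j (y - x) - H y * LPw j (y - x')) \<le> M * norm (LPw j (y - x) - LPw j (y - x'))" for y
      unfolding right_diff_distrib[symmetric] norm_mult by (intro mult_right_mono M) simp
  qed
  also have "\<dots> = M * (LINT y|lborel. norm (LPw j (y - x) - LPw j (y - x')))" by simp
  also have "\<dots> \<le> M * (L * 2 ^ j * norm (x - x'))" by (intro mult_left_mono L M0)
  finally show ?thesis .
qed

text \<open>Fubini moves the fattened kernel onto the test function, where
  \<open>LPk_reproducing\<close> removes it. The bound \<open>M\<close> makes Fubini applicable, and
  the Lipschitz estimate makes the right-hand side continuous, so equality of distributions becomes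
  equality at every point.\<close>

lemma LP_reproducing:
  assumes u: "u \<in> tempered" and M: "\<And>x. norm (LP j u x) \<le> M"
  shows "LP j u x = (LINT y|lborel. LP j u y * LPw j (y - x))"
proof -
  obtain L where L: "L \<ge> 0" "\<And>j x x'. (LINT y|lborel. norm (LPw j (y - x) - LPw j (y - x'))) \<le> L * 2 ^ j * norm (x - x')"
    by (rule LPw_modulus) (rule that)
  define G where "G x = (LINT y|lborel. LP j u y * LPw j (y - x))" for x
  note p = pairable_LP_block[OF u, of j]
  note [measurable] = pairable_measurable[OF p] schwartz_measurable[OF schwartz_LPw]
  define M' where "M' = M * (L * 2 ^ j)"
  have lip: "norm (G x - G x') \<le> M' * norm (x - x')" for x x'
    using bounded_LPw_lipschitz[OF _ M L(2), where x = x and x' = x'] by (simp add: G_def M'_def mult_ac)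
  have cont: "continuous_on UNIV G"
    unfolding continuous_on_def
  proof
    fix x
    have "((\<lambda>x'. G x' - G x) \<longlongrightarrow> 0) (at x within UNIV)"
    proof (rule Lim_null_comparison)
      show "\<forall>\<^sub>F x' in at x within UNIV. norm (G x' - G x) \<le> M' * norm (x' - x)" using lip by (intro always_eventually allI)
      have "((\<lambda>x'. M' * norm (x' - x)) \<longlongrightarrow> M' * norm (x - x)) (at x within UNIV)" by (intro tendsto_intros)
      then show "((\<lambda>x'. M' * norm (x' - x)) \<longlongrightarrow> 0) (at x within UNIV)" by simp
    qed
    then show "(G \<longlongrightarrow> G x) (at x within UNIV)" by (simp add: LIM_zero_iff)
  qed
  have bd: "norm (G x) \<le> M * (LINT y|lborel. norm (LPw j y))" for x
  proof -
    have i: "integrable lborel (\<lambda>y. LP j u y * LPw j (y - x))"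
      by (rule integrable_mult_bounded[OF schwartz_integrable[OF schwartz_translate[OF schwartz_LPw]] _ M]) simp
    have "norm (G x) \<le> (LINT y|lborel. norm (LP j u y * LPw j (y - x)))" unfolding G_def by (rule integral_norm_bound)
    also have "\<dots> \<le> (LINT y|lborel. M * norm (LPw j (y - x)))"
    proof (rule integral_mono)
      show "integrable lborel (\<lambda>y. M * norm (LPw j (y - x)))"
        by (intro integrable_mult_right integrable_norm schwartz_integrable schwartz_translate schwartz_LPw)
      show "norm (LP j u y * LPw j (y - x)) \<le> M * norm (LPw j (y - x))" for y
        unfolding norm_mult by (intro mult_right_mono M) simp
    qed (use i in simp)
    also have "\<dots> = M * (LINT y|lborel. norm (LPw j y))"
      using integral_lborel_translate[of "\<lambda>y. norm (LPw j y)" x] by simp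
    finally show ?thesis .
  qed
  have pG: "pairable G" by (rule pairable_bounded[OF cont bd])
  have "LP j u = G"
  proof (rule pairable_unique[OF p pG])
    fix \<phi> :: "'n test" assume \<phi>: "\<phi> \<in> schwartz"
    note [measurable] = schwartz_measurable[OF \<phi>]
    have I: "integrable (lborel \<Otimes>\<^sub>M lborel) (\<lambda>(x, y). \<phi> x * (LP j u y * LPw j (y - x)))"
      by (rule integrable_pair_translate[OF schwartz_integrable[OF schwartz_LPw] schwartz_integrable[OF \<phi>] _ M]) simp
    have "distr_of G \<phi> = (LINT x|lborel. (LINT y|lborel. \<phi> x * (LP j u y * LPw j (y - x))))"
      by (simp add: distr_of_def G_def)
    also have "\<dots> = (LINT y|lborel. (LINT x|lborel. \<phi> x * (LP j u y * LPw j (y - x))))"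
      using lborel_pair.Fubini_integral[OF I] by simp
    also have "\<dots> = (LINT y|lborel. conv (LPw j) \<phi> y * LP j u y)"
    proof (intro Bochner_Integration.integral_cong refl)
      fix y
      have "(LINT x|lborel. \<phi> x * (LP j u y * LPw j (y - x))) = (LINT x|lborel. LP j u y * (LPw j (y - x) * \<phi> x))"
        by (intro Bochner_Integration.integral_cong refl) (simp only: mult_ac)
      then show "(LINT x|lborel. \<phi> x * (LP j u y * LPw j (y - x))) = conv (LPw j) \<phi> y * LP j u y"
        by (simp add: conv_def mult.commute)
    qed
    also have "\<dots> = distr_of (LP j u) (conv (LPw j) \<phi>)" by (simp add: distr_of_def)
    also have "\<dots> = u (conv (LPk j) (conv (LPw j) \<phi>))"
      by (intro distr_of_LP_block u schwartz_conv schwartz_LPw schwartz_rapid \<phi>)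
    also have "\<dots> = distr_of (LP j u) \<phi>"
      unfolding LPk_reproducing[OF \<phi>] by (rule distr_of_LP_block[OF u \<phi>, symmetric])
    finally show "distr_of (LP j u) \<phi> = distr_of G \<phi>" by simp
  qed
  from fun_cong[OF this, of x] show ?thesis unfolding G_def .
qed

text \<open>Bernstein's inequality in difference form: in the reproducing formula the increment
  falls on the kernel, whose L1 modulus is of order \<open>2 ^ j\<close>.\<close>

lemma LP_lipschitz:
  obtains L where "L \<ge> 0" "\<And>u j M x x'. u \<in> tempered \<Longrightarrow> \<forall>x. norm (LP j u x) \<le> M \<Longrightarrow>
    norm (LP j u x - LP j u x') \<le> M * (L * 2 ^ j * norm (x - x'))"
proof -
  obtain L where L: "L \<ge> 0" "\<And>j x x'. (LINT y|lborel. norm (LPw j (y - x) - LPw j (y - x'))) \<le> L * 2 ^ j * norm (x - x')"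
    by (rule LPw_modulus) (rule that)
  have "norm (LP j u x - LP j u x') \<le> M * (L * 2 ^ j * norm (x - x'))"
    if u: "u \<in> tempered" and M': "\<forall>x. norm (LP j u x) \<le> M" for u j M x x'
  proof -
    note M = M'[rule_format]
    have eq: "LP j u z = (LINT y|lborel. LP j u y * LPw j (y - z))" for z by (rule LP_reproducing[OF u M])
    show ?thesis
      by (subst eq[of x], subst eq[of x'])
        (rule bounded_LPw_lipschitz[OF pairable_measurable[OF pairable_LP_block[OF u]] M L(2)])
  qed
  note lip = this
  show ?thesis by (rule that[OF L(1) lip])
qed

text \<open>From \<open>j = 2\<close> on, every neighbour of \<open>j\<close> has index at least 1,
  so only dilations of the profile kernel occur, each of width of order
  \<open>(1 / 2) ^ j\<close>.\<close>

lemma LPw_shift_moment: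
  obtains C where "C \<ge> 0" "\<And>j. j \<ge> 2 \<Longrightarrow> shift_moment m (LPw j) \<le> C * (1 / 2) ^ j"
proof -
  define \<kappa> where "\<kappa> = kernel_of profilec"
  have \<kappa>: "rapid \<kappa>" unfolding \<kappa>_def by (intro schwartz_rapid schwartz_kernel_of schwartz_profilec)
  define s where "s = 2 ^ m * shift_moment m \<kappa>"
  have s: "s \<ge> 0" unfolding s_def by (intro mult_nonneg_nonneg shift_moment_nonneg) simp
  have one: "shift_moment m (LPk i) \<le> (1 / 2) ^ i * s" if i1: "i \<ge> 1" for i
  proof -
    obtain i' where i: "i = Suc i'" using i1 by (cases i) auto
    have "shift_moment m (LPk i) \<le> 1 / 2 ^ i * (1 + 1 / 2 ^ i) ^ m * shift_moment m \<kappa>"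
      unfolding i LPk_Suc \<kappa>_def[symmetric] by (rule shift_moment_dilate[OF \<kappa>]) simp
    also have "\<dots> \<le> 1 / 2 ^ i * 2 ^ m * shift_moment m \<kappa>"
      by (intro mult_right_mono mult_left_mono power_mono shift_moment_nonneg) auto
    finally show ?thesis by (simp add: s_def power_divide)
  qed
  have "shift_moment m (LPw j) \<le> (6 * s) * (1 / 2) ^ j" if j: "j \<ge> 2" for j
  proof -
    have r: "rapid (LPk i)" for i by (intro schwartz_rapid schwartz_LPk)
    have "shift_moment m (LPw j) \<le> (LINT x|lborel. (\<Sum>i\<in>near j. norm x * (1 + norm x) ^ m * norm (LPk i x)))"
      unfolding shift_moment_def
    proof (rule integral_mono)
      show "integrable lborel (\<lambda>x. norm x * (1 + norm x) ^ m * norm (LPw j x))"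
        by (intro shift_moment_integrable schwartz_rapid schwartz_LPw)
      show "integrable lborel (\<lambda>x. \<Sum>i\<in>near j. norm x * (1 + norm x) ^ m * norm (LPk i x))"
        by (intro Bochner_Integration.integrable_sum shift_moment_integrable r)
      show "norm x * (1 + norm x) ^ m * norm (LPw j x) \<le> (\<Sum>i\<in>near j. norm x * (1 + norm x) ^ m * norm (LPk i x))" for x
        unfolding LPw_def sum_distrib_left[symmetric] by (intro mult_left_mono norm_sum) simp
    qed
    also have "\<dots> = (\<Sum>i\<in>near j. shift_moment m (LPk i))"
      unfolding shift_moment_def by (rule Bochner_Integration.integral_sum) (rule shift_moment_integrable[OF r])
    also have "\<dots> \<le> 3 * ((1 / 2) ^ (j - 1) * s)"
    proof (rule sum_near_le)
      fix i assume "i \<in> near j"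
      then have i: "j - 1 \<le> i" "i \<ge> 1" using j by (auto simp: near_def)
      have "shift_moment m (LPk i) \<le> (1 / 2) ^ i * s" by (rule one[OF i(2)])
      also have "\<dots> \<le> (1 / 2) ^ (j - 1) * s" using s i by (intro mult_right_mono power_decreasing) auto
      finally show "shift_moment m (LPk i) \<le> (1 / 2) ^ (j - 1) * s" .
    qed (use s in simp)
    also have "(1 / 2 :: real) ^ (j - 1) = 2 * (1 / 2) ^ j" using j by (cases j) auto
    finally show ?thesis by (simp add: mult_ac)
  qed
  moreover have "6 * s \<ge> 0" using s by simp
  ultimately show ?thesis using that by blast
qed

lemma integral_LPw: "integral\<^sup>L lborel (LPw j) = 0" if "j \<ge> 2"
proof -
  have "\<rho>c i 0 = 0" if "i \<in> near j" for i
    using profile(3)[of i 0] profile_0 that \<open>j \<ge> 2\<close> by (auto simp: near_def \<rho>c_def)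
  then show ?thesis
    unfolding LPw_eq by (subst integral_kernel_of) (auto intro: schwartz_sum schwartz_\<rho>c)
qed

end

section \<open>Bony's product\<close>

lemma moment_le_seminorm:
  obtains W where "W \<ge> 0" "\<And>\<phi> :: 'n::finite test. \<phi> \<in> schwartz \<Longrightarrow> moment k \<phi> \<le> W * schwartz_seminorm (k + 2 * CARD('n)) \<phi>"
proof -
  define W where "W = (LINT z|lborel. 1 / (1 + norm (z::real^'n)) ^ (2 * CARD('n)))"
  have W: "W \<ge> 0" unfolding W_def by (intro integral_nonneg_AE) simp
  have "moment k \<phi> \<le> W * schwartz_seminorm (k + 2 * CARD('n)) \<phi>" if \<phi>: "\<phi> \<in> schwartz" for \<phi> :: "'n test"
  proof -
    have "moment k \<phi> \<le> (LINT z|lborel. schwartz_seminorm (k + 2 * CARD('n)) \<phi> * (1 / (1 + norm (z::real^'n)) ^ (2 * CARD('n))))"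
      unfolding moment_def
    proof (rule integral_mono)
      show "integrable lborel (\<lambda>x. (1 + norm x) ^ k * norm (\<phi> x))" by (intro rapid_moment_integrable schwartz_rapid \<phi>)
      show "integrable lborel (\<lambda>z::real^'n. schwartz_seminorm (k + 2 * CARD('n)) \<phi> * (1 / (1 + norm z) ^ (2 * CARD('n))))"
        by (intro integrable_mult_right integrable_weight)
      fix x :: "real^'n"
      have "(1 + norm x) ^ (k + 2 * CARD('n)) * norm (partials [] \<phi> x) \<le> schwartz_seminorm (k + 2 * CARD('n)) \<phi>"
        by (intro schwartz_seminorm_ge \<phi>) simp
      then have "((1 + norm x) ^ k * norm (\<phi> x)) * (1 + norm x) ^ (2 * CARD('n)) \<le> schwartz_seminorm (k + 2 * CARD('n)) \<phi>"
        by (simp add: power_add mult_ac)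
      then show "(1 + norm x) ^ k * norm (\<phi> x) \<le> schwartz_seminorm (k + 2 * CARD('n)) \<phi> * (1 / (1 + norm x) ^ (2 * CARD('n)))"
        by (simp add: pos_le_divide_eq add_pos_nonneg)
    qed
    also have "\<dots> = W * schwartz_seminorm (k + 2 * CARD('n)) \<phi>" by (simp only: W_def integral_mult_right_zero mult.commute)
    finally show ?thesis .
  qed
  with W show ?thesis by (rule that)
qed

lemma distr_of_add:
  assumes "pairable h" "\<phi> \<in> schwartz" "\<psi> \<in> schwartz"
  shows "distr_of h (\<lambda>x. \<phi> x + \<psi> x) = distr_of h \<phi> + distr_of h \<psi>"
  using pairable_integrable[OF assms(1,2)] pairable_integrable[OF assms(1,3)] by (simp add: distr_of_def distrib_right)

lemma distr_of_diff_left: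
  assumes "pairable h" "pairable h'" "\<phi> \<in> schwartz"
  shows "distr_of (\<lambda>x. h x - h' x) \<phi> = distr_of h \<phi> - distr_of h' \<phi>"
  using pairable_integrable[OF assms(1,3)] pairable_integrable[OF assms(2,3)] by (simp add: distr_of_def right_diff_distrib)

lemma distr_of_tempered:
  fixes h :: "'n::finite test"
  assumes h: "continuous_on UNIV h" and M: "\<And>x. norm (h x) \<le> M * (1 + norm x) ^ k"
  shows "distr_of h \<in> tempered"
proof -
  have p: "pairable h" by (rule pairable_growth[OF h M])
  obtain W where W: "W \<ge> 0" "\<And>\<phi> :: 'n test. \<phi> \<in> schwartz \<Longrightarrow> moment k \<phi> \<le> W * schwartz_seminorm (k + 2 * CARD('n)) \<phi>"
    by (rule moment_le_seminorm) (rule that)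
  have M0: "0 \<le> M" using order_trans[OF norm_ge_zero M[of 0]] by simp
  have "norm (distr_of h \<phi>) \<le> (M * W) * schwartz_seminorm (k + 2 * CARD('n)) \<phi>" if "\<phi> \<in> schwartz" for \<phi>
    using norm_distr_of_growth[OF that M] mult_left_mono[OF W(2)[OF that] M0] by (simp add: mult.assoc)
  moreover have "distr_of h (\<lambda>x. c * \<phi> x) = c * distr_of h \<phi>" for c \<phi>
    by (simp add: distr_of_def mult.assoc)
  ultimately show ?thesis
    unfolding tempered_def using distr_of_add[OF p] by blast
qed

lemma temperedI_bound:
  assumes "\<And>\<phi> \<psi>. \<phi> \<in> schwartz \<Longrightarrow> \<psi> \<in> schwartz \<Longrightarrow> u (\<lambda>x. \<phi> x + \<psi> x) = u \<phi> + u \<psi>"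
    "\<And>c \<phi>. \<phi> \<in> schwartz \<Longrightarrow> u (\<lambda>x. c * \<phi> x) = c * u \<phi>"
    "\<And>\<phi>. \<phi> \<in> schwartz \<Longrightarrow> norm (u \<phi>) \<le> C * schwartz_seminorm k \<phi>"
  shows "u \<in> tempered"
  unfolding tempered_def using assms by blast

lemma tempered_linear_comb:
  assumes u: "u \<in> tempered" and v: "v \<in> tempered"
  shows "(\<lambda>\<phi>. a * u \<phi> + b * v \<phi>) \<in> tempered"
proof -
  obtain C k where C: "C \<ge> 0" "\<And>\<phi>. \<phi> \<in> schwartz \<Longrightarrow> norm (u \<phi>) \<le> C * schwartz_seminorm k \<phi>"
    by (rule tempered_boundE[OF u]) (rule that)
  obtain C' k' where C': "C' \<ge> 0" "\<And>\<phi>. \<phi> \<in> schwartz \<Longrightarrow> norm (v \<phi>) \<le> C' * schwartz_seminorm k' \<phi>"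
    by (rule tempered_boundE[OF v]) (rule that)
  show ?thesis
  proof (rule temperedI_bound)
    fix \<phi> :: "'a test" assume \<phi>: "\<phi> \<in> schwartz"
    let ?K = "max k k'"
    have 1: "norm (u \<phi>) \<le> C * schwartz_seminorm ?K \<phi>"
      using C(2)[OF \<phi>] mult_left_mono[OF schwartz_seminorm_mono[OF \<phi>, of k ?K] C(1)] by simp
    have 2: "norm (v \<phi>) \<le> C' * schwartz_seminorm ?K \<phi>"
      using C'(2)[OF \<phi>] mult_left_mono[OF schwartz_seminorm_mono[OF \<phi>, of k' ?K] C'(1)] by simp
    have "norm (a * u \<phi> + b * v \<phi>) \<le> norm a * norm (u \<phi>) + norm b * norm (v \<phi>)"
      using norm_triangle_ineq[of "a * u \<phi>" "b * v \<phi>"] by (simp add: norm_mult)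
    also have "\<dots> \<le> norm a * (C * schwartz_seminorm ?K \<phi>) + norm b * (C' * schwartz_seminorm ?K \<phi>)"
      by (intro add_mono mult_left_mono 1 2) auto
    finally show "norm (a * u \<phi> + b * v \<phi>) \<le> (norm a * C + norm b * C') * schwartz_seminorm ?K \<phi>"
      by (simp add: algebra_simps)
  qed (simp_all add: tempered_add[OF u] tempered_add[OF v] tempered_cmult[OF u] tempered_cmult[OF v] algebra_simps)
qed

lemma tempered_minus: "u \<in> tempered \<Longrightarrow> v \<in> tempered \<Longrightarrow> (\<lambda>\<phi>. u \<phi> - v \<phi>) \<in> tempered"
  using tempered_linear_comb[of u v 1 "-1"] by simp

lemma tempered_plus: "u \<in> tempered \<Longrightarrow> v \<in> tempered \<Longrightarrow> (\<lambda>\<phi>. u \<phi> + v \<phi>) \<in> tempered"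
  using tempered_linear_comb[of u v 1 1] by simp

lemma tempered_zero: "(\<lambda>\<phi>. 0) \<in> tempered"
  by (rule temperedI_bound[where C = 0]) auto

lemma tempered_sum_distr: "(\<And>i. i \<in> I \<Longrightarrow> u i \<in> tempered) \<Longrightarrow> (\<lambda>\<phi>. \<Sum>i\<in>I. u i \<phi>) \<in> tempered"
  by (induction I rule: infinite_finite_induct) (auto intro: tempered_zero tempered_plus)

lemma tempered_cong:
  assumes u: "u \<in> tempered" and eq: "\<And>\<phi>. \<phi> \<in> schwartz \<Longrightarrow> v \<phi> = u \<phi>"
  shows "v \<in> tempered"
proof -
  obtain C k where C: "C \<ge> 0" "\<And>\<phi>. \<phi> \<in> schwartz \<Longrightarrow> norm (u \<phi>) \<le> C * schwartz_seminorm k \<phi>"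
    by (rule tempered_boundE[OF u]) (rule that)
  show ?thesis
    by (rule temperedI_bound[where C = C and k = k])
      (use C(2) in \<open>auto simp: eq schwartz_add schwartz_cmult tempered_add[OF u] tempered_cmult[OF u]\<close>)
qed

text \<open>Convergence gives pointwise boundedness, and Banach--Steinhaus a common seminorm
  estimate that survives the limit. Product estimates whose constants depend on
  \<open>\<phi>\<close> in an uncontrolled way are thereby enough for temperedness.\<close>

lemma tempered_limit:
  fixes U :: "nat \<Rightarrow> 'n::finite distr"
  assumes U: "\<And>n. U n \<in> tempered" and lim: "\<And>\<phi>. \<phi> \<in> schwartz \<Longrightarrow> (\<lambda>n. U n \<phi>) \<longlonglongrightarrow> u \<phi>"
  shows "u \<in> tempered"
proof -
  have bdd: "\<exists>M. \<forall>n\<in>UNIV. norm (U n \<phi>) \<le> M" if "\<phi> \<in> schwartz" for \<phi>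
    using convergent_imp_Bseq[OF convergentI[OF lim[OF that]]] by (auto simp: Bseq_def)
  obtain C k where C: "C \<ge> 0" "\<And>n \<phi>. n \<in> UNIV \<Longrightarrow> \<phi> \<in> schwartz \<Longrightarrow> norm (U n \<phi>) \<le> C * schwartz_seminorm k \<phi>"
    by (rule tempered_banach_steinhaus[of UNIV U, OF U bdd]) (assumption, rule that)
  show ?thesis
  proof (rule temperedI_bound)
    fix \<phi> \<psi> :: "'n test" assume S: "\<phi> \<in> schwartz" "\<psi> \<in> schwartz"
    have "(\<lambda>n. U n \<phi> + U n \<psi>) \<longlonglongrightarrow> u \<phi> + u \<psi>" by (intro tendsto_add lim S)
    then have "(\<lambda>n. U n (\<lambda>x. \<phi> x + \<psi> x)) \<longlonglongrightarrow> u \<phi> + u \<psi>" by (simp add: tempered_add[OF U S])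
    with lim[OF schwartz_add[OF S]] show "u (\<lambda>x. \<phi> x + \<psi> x) = u \<phi> + u \<psi>" by (rule LIMSEQ_unique)
  next
    fix c and \<phi> :: "'n test" assume S: "\<phi> \<in> schwartz"
    have "(\<lambda>n. c * U n \<phi>) \<longlonglongrightarrow> c * u \<phi>" by (intro tendsto_intros lim S)
    then have "(\<lambda>n. U n (\<lambda>x. c * \<phi> x)) \<longlonglongrightarrow> c * u \<phi>" by (simp add: tempered_cmult[OF U S])
    with lim[OF schwartz_cmult[OF S]] show "u (\<lambda>x. c * \<phi> x) = c * u \<phi>" by (rule LIMSEQ_unique)
  next
    fix \<phi> :: "'n test" assume S: "\<phi> \<in> schwartz"
    show "norm (u \<phi>) \<le> C * schwartz_seminorm k \<phi>"
      using C(2)[OF UNIV_I S] by (intro LIMSEQ_le_const2[OF tendsto_norm[OF lim[OF S]]]) auto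
  qed
qed

section \<open>Geometric block bounds and the terms of the product\<close>

context dyadic
begin

text \<open>For \<open>a = 2 powr (- \<gamma>)\<close> this says that the Besov norm of order \<open>\<gamma>\<close> is at most \<open>N\<close>.\<close>

definition bes :: "real \<Rightarrow> real \<Rightarrow> 'n distr \<Rightarrow> bool" where
  "bes a N u \<longleftrightarrow> u \<in> tempered \<and> (\<forall>j x. norm (LP j u x) \<le> N * a ^ j)"

lemma bes_tempered: "bes a N u \<Longrightarrow> u \<in> tempered"
  and bes_bound: "bes a N u \<Longrightarrow> norm (LP j u x) \<le> N * a ^ j"
  by (auto simp: bes_def)

lemma bes_nonneg: "bes a N u \<Longrightarrow> N \<ge> 0"
  by (drule order_trans[OF norm_ge_zero bes_bound[where j = 0]]) simp

lemma LP_minus: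
  assumes "u \<in> tempered" "v \<in> tempered"
  shows "LP j (\<lambda>\<phi>. u \<phi> - v \<phi>) x = LP j u x - LP j v x"
  by (simp add: LP_block_eq assms tempered_minus)

lemma LP_cong:
  assumes "u \<in> tempered" "v \<in> tempered" "\<And>\<phi>. \<phi> \<in> schwartz \<Longrightarrow> u \<phi> = v \<phi>"
  shows "LP j u = LP j v"
  using assms(3)[OF schwartz_translate[OF schwartz_LPk]] by (simp add: LP_block_eq assms(1,2))

text \<open>For \<open>a < 1\<close> the blocks sum uniformly to a continuous \<open>H\<close>, and
  \<open>H\<close> represents the same distribution as \<open>F\<close>, so the two functions
  coincide. Applied to gradients, this turns a Besov norm into a sup bound.\<close>

lemma bes_function_bound:
  fixes F :: "'n test"
  assumes F: "pairable F" and b: "bes a N (distr_of F)" and a: "0 \<le> a" "a < 1"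
  shows "norm (F x) \<le> N / (1 - a)"
proof -
  define u where "u = distr_of F"
  have u: "u \<in> tempered" and ub: "\<And>j x. norm (LP j u x) \<le> N * a ^ j"
    using b by (auto simp: u_def bes_tempered bes_bound)
  have sM: "summable (\<lambda>j. N * a ^ j)" using a by (intro summable_mult summable_geometric) simp
  define H where "H x = (\<Sum>j. LP j u x)" for x
  have sn: "summable (\<lambda>j. norm (LP j u x))" for x
    by (rule summable_comparison_test'[OF sM, of 0]) (simp add: ub)
  have Hb: "norm (H x) \<le> N / (1 - a)" for x
  proof -
    have "norm (H x) \<le> (\<Sum>j. norm (LP j u x))" unfolding H_def by (rule summable_norm[OF sn])
    also have "\<dots> \<le> (\<Sum>j. N * a ^ j)" by (intro suminf_le ub sn sM)
    also have "\<dots> = N / (1 - a)" using a by (simp add: suminf_mult suminf_geometric summable_geometric divide_inverse)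
    finally show ?thesis .
  qed
  have ul: "uniform_limit UNIV (\<lambda>n x. \<Sum>j<n. LP j u x) H sequentially"
    unfolding H_def by (rule Weierstrass_m_test[OF ub sM])
  have Hc: "continuous_on UNIV H"
  proof (rule uniform_limit_theorem[OF _ ul])
    show "\<forall>\<^sub>F n in sequentially. continuous_on UNIV (\<lambda>x. \<Sum>j<n. LP j u x)"
      by (intro always_eventually allI continuous_on_sum pairable_continuous pairable_LP_block u)
  qed simp
  have pH: "pairable H" by (rule pairable_bounded[OF Hc Hb])
  have "F = H"
  proof (rule pairable_unique[OF F pH])
    fix \<phi> :: "'n test" assume \<phi>: "\<phi> \<in> schwartz"
    have pS: "pairable (\<lambda>x. \<Sum>j<n. LP j u x)" for n
      by (rule pairable_bounded[where B = "\<Sum>j<n. N * a ^ j"])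
        (intro continuous_on_sum pairable_continuous pairable_LP_block u, intro sum_norm_le ub)
    have S: "distr_of (\<lambda>x. \<Sum>j<n. LP j u x) \<phi> = (\<Sum>j<n. distr_of (LP j u) \<phi>)" for n
      unfolding distr_of_def sum_distrib_left
      by (rule Bochner_Integration.integral_sum) (rule pairable_integrable[OF pairable_LP_block[OF u] \<phi>])
    have "(\<lambda>n. distr_of (\<lambda>x. \<Sum>j<n. LP j u x) \<phi> - distr_of H \<phi>) \<longlonglongrightarrow> 0"
    proof (rule LIMSEQ_I)
      fix r :: real assume r: "r > 0"
      define e where "e = r / (2 * (moment 0 \<phi> + 1))"
      have m0: "moment 0 \<phi> \<ge> 0" by (rule moment_nonneg)
      have e: "e > 0" "e * moment 0 \<phi> < r" using r m0 by (auto simp: e_def field_simps add_pos_nonneg)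
      obtain n0 where n0: "\<And>n x. n \<ge> n0 \<Longrightarrow> dist (\<Sum>j<n. LP j u x) (H x) < e"
        using ul e(1) unfolding uniform_limit_sequentially_iff by blast
      have "norm (distr_of (\<lambda>x. \<Sum>j<n. LP j u x) \<phi> - distr_of H \<phi> - 0) < r" if "n \<ge> n0" for n
      proof -
        have "norm (distr_of (\<lambda>x. (\<Sum>j<n. LP j u x) - H x) \<phi>) \<le> e * moment 0 \<phi>"
          using n0[OF that] by (intro norm_distr_of_le \<phi>) (simp add: dist_norm less_imp_le)
        then show ?thesis using e(2) by (simp add: distr_of_diff_left[OF pS pH \<phi>])
      qed
      then show "\<exists>no. \<forall>n\<ge>no. norm (distr_of (\<lambda>x. \<Sum>j<n. LP j u x) \<phi> - distr_of H \<phi> - 0) < r" by blast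
    qed
    then have "(\<lambda>n. \<Sum>j<n. distr_of (LP j u) \<phi>) \<longlonglongrightarrow> distr_of H \<phi>" unfolding S by (simp add: LIM_zero_iff)
    moreover have "(\<lambda>n. \<Sum>j<n. distr_of (LP j u) \<phi>) \<longlonglongrightarrow> u \<phi>" using LP_sum_converges[OF u \<phi>] by (simp add: sums_def)
    ultimately show "distr_of F \<phi> = distr_of H \<phi>" unfolding u_def[symmetric] by (metis LIMSEQ_unique)
  qed
  then show ?thesis using Hb by simp
qed

text \<open>The partial sum up to index \<open>j - 2\<close>, which is the low-frequency factor of
  the paraproduct.\<close>

definition low :: "nat \<Rightarrow> 'n distr \<Rightarrow> 'n test" where "low j u x = (\<Sum>i | i + 1 < j. LP i u x)"

definition mid :: "nat \<Rightarrow> 'n distr \<Rightarrow> 'n test" where "mid j u x = (\<Sum>i\<in>near j. LP i u x)"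

lemma low_continuous: "u \<in> tempered \<Longrightarrow> continuous_on A (low j u)"
  unfolding low_def[abs_def] by (intro continuous_on_sum pairable_continuous pairable_LP_block)

lemma mid_continuous: "u \<in> tempered \<Longrightarrow> continuous_on A (mid j u)"
  unfolding mid_def[abs_def] by (intro continuous_on_sum pairable_continuous pairable_LP_block)

lemma low_minus: "u \<in> tempered \<Longrightarrow> v \<in> tempered \<Longrightarrow> low j (\<lambda>\<phi>. u \<phi> - v \<phi>) x = low j u x - low j v x"
  by (simp add: low_def LP_minus sum_subtractf)

lemma mid_minus: "u \<in> tempered \<Longrightarrow> v \<in> tempered \<Longrightarrow> mid j (\<lambda>\<phi>. u \<phi> - v \<phi>) x = mid j u x - mid j v x"
  by (simp add: mid_def LP_minus sum_subtractf)

lemma low_bound: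
  assumes "bes a N u"
  shows "norm (low j u x) \<le> N * (\<Sum>i<j - 1. a ^ i)"
  unfolding low_def Collect_low sum_distrib_left by (intro sum_norm_le bes_bound assms)

lemma low_bound_regular:
  assumes u: "bes a N u" and a: "0 \<le> a" "a < 1"
  shows "norm (low j u x) \<le> N / (1 - a)"
proof -
  have "norm (low j u x) \<le> N * (\<Sum>i<j - 1. a ^ i)" by (rule low_bound[OF u])
  also have "\<dots> \<le> N * (1 / (1 - a))" by (intro mult_left_mono sum_power_le_inverse a bes_nonneg[OF u])
  finally show ?thesis by simp
qed

text \<open>For growing blocks the geometric sum is comparable to its last term; the constant
  \<open>1 / (q - 1)\<close> is why \<open>q\<close> has to stay strictly above 1.\<close>

lemma low_bound_singular:
  assumes u: "bes q N u" and q: "q > 1"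
  shows "norm (low j u x) \<le> N * q ^ j / (q - 1)"
proof -
  have "norm (low j u x) \<le> N * (\<Sum>i<j - 1. q ^ i)" by (rule low_bound[OF u])
  also have "\<dots> \<le> N * (q ^ (j - 1) / (q - 1))" by (intro mult_left_mono sum_power_le_divide q bes_nonneg[OF u])
  also have "\<dots> \<le> N * (q ^ j / (q - 1))" using q by (intro mult_left_mono divide_right_mono power_increasing bes_nonneg[OF u]) auto
  finally show ?thesis by simp
qed

lemma mid_bound:
  assumes u: "bes a N u" and a: "0 < a" "a < 1"
  shows "norm (mid j u x) \<le> 3 * (N * a ^ j / a)"
proof -
  have N: "N \<ge> 0" by (rule bes_nonneg[OF u])
  have "norm (mid j u x) \<le> (\<Sum>i\<in>near j. norm (LP i u x))" unfolding mid_def by (rule norm_sum)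
  also have "\<dots> \<le> 3 * (N * a ^ j / a)"
  proof (rule sum_near_le)
    fix i assume "i \<in> near j"
    \<comment> \<open>The lowest neighbour \<open>j - 1\<close> has the largest bound, larger by
      \<open>1 / a\<close> than that at \<open>j\<close>.\<close>
    then have "a ^ Suc i \<le> a ^ j" using a by (intro power_decreasing) (auto simp: near_def)
    then have "N * a ^ i \<le> N * a ^ j / a" using a mult_left_mono[of "a ^ Suc i" "a ^ j" N] N by (simp add: field_simps)
    then show "norm (LP i u x) \<le> N * a ^ j / a" using bes_bound[OF u, of i x] by linarith
  qed (use N a in simp)
  finally show ?thesis .
qed

definition tP :: "nat \<Rightarrow> 'n distr \<Rightarrow> 'n distr \<Rightarrow> 'n distr" where
  "tP j f g = distr_of (\<lambda>x. low j f x * LP j g x)"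

definition tR :: "nat \<Rightarrow> 'n distr \<Rightarrow> 'n distr \<Rightarrow> 'n distr" where
  "tR j f g = distr_of (\<lambda>x. mid j f x * LP j g x)"

text \<open>With the low frequencies taken from the singular factor, the blocks of \<open>f\<close>
  decay at the rate required, and sup bounds suffice without any cancellation.\<close>

lemma tP_singular_bound:
  assumes f: "bes a N f" and g: "bes q N' g" and a: "0 < a" and q: "q > 1" and \<phi>: "\<phi> \<in> schwartz"
  shows "norm (tP j g f \<phi>) \<le> (moment 0 \<phi> / (q - 1)) * N * N' * (a * q) ^ j"
proof -
  have "norm (low j g x * LP j f x) \<le> (N' * q ^ j / (q - 1)) * (N * a ^ j)" for x
    unfolding norm_mult using q bes_nonneg[OF g]
    by (intro mult_mono low_bound_singular[OF g q] bes_bound[OF f]) auto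
  from norm_distr_of_le[OF \<phi> this] show ?thesis
    unfolding tP_def by (simp add: power_mult_distrib mult_ac)
qed

lemma tR_bound:
  assumes f: "bes a N f" and g: "bes q N' g" and a: "0 < a" "a < 1" and \<phi>: "\<phi> \<in> schwartz"
  shows "norm (tR j f g \<phi>) \<le> (3 * moment 0 \<phi> / a) * N * N' * (a * q) ^ j"
proof -
  have "norm (mid j f x * LP j g x) \<le> (3 * (N * a ^ j / a)) * (N' * q ^ j)" for x
    unfolding norm_mult using a bes_nonneg[OF f]
    by (intro mult_mono mid_bound[OF f a] bes_bound[OF g]) auto
  from norm_distr_of_le[OF \<phi> this] show ?thesis
    unfolding tR_def by (simp add: power_mult_distrib mult_ac)
qed

text \<open>Bernstein's inequality gives block \<open>i\<close> a Lipschitz constant of order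
  \<open>(2 * a) ^ i\<close>. As \<open>2 * a > 1\<close>, the sum is governed by its last
  term.\<close>

lemma low_lipschitz:
  assumes f: "bes a N f" and a: "1 / 2 < a"
    and L: "L \<ge> 0" "\<And>u j M x x'. u \<in> tempered \<Longrightarrow> \<forall>x. norm (LP j u x) \<le> M \<Longrightarrow>
    norm (LP j u x - LP j u x') \<le> M * (L * 2 ^ j * norm (x - x'))"
  shows "norm (low j f x - low j f x') \<le> N * L / (2 * a - 1) * (2 * a) ^ j * norm (x - x')"
proof -
  have N: "N \<ge> 0" by (rule bes_nonneg[OF f])
  have "norm (low j f x - low j f x') \<le> (\<Sum>i<j - 1. (N * a ^ i) * (L * 2 ^ i * norm (x - x')))"
    unfolding low_def Collect_low sum_subtractf[symmetric]
    by (intro sum_norm_le L(2) allI bes_tempered[OF f] bes_bound[OF f])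
  also have "\<dots> = (N * L * norm (x - x')) * (\<Sum>i<j - 1. (2 * a) ^ i)"
    by (simp add: sum_distrib_left power_mult_distrib mult_ac)
  also have "\<dots> \<le> (N * L * norm (x - x')) * ((2 * a) ^ (j - 1) / (2 * a - 1))"
    using N L a by (intro mult_left_mono sum_power_le_divide) auto
  also have "\<dots> \<le> (N * L * norm (x - x')) * ((2 * a) ^ j / (2 * a - 1))"
    using N L a by (intro mult_left_mono divide_right_mono power_increasing) auto
  finally show ?thesis by (simp add: mult_ac)
qed

text \<open>The high-frequency factor is written as its own convolution with a kernel of mean zero and
  width \<open>2 ^ (- j)\<close>; moving the convolution to the other factor gains \<open>2 ^ (- j)\<close> times the Lipschitz
  constant of the low-frequency part, which makes the series converge without any use of the
  spectral support of the products.\<close>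

lemma tP_regular_bound:
  assumes a: "1 / 2 < a" "a < 1" and \<phi>: "\<phi> \<in> schwartz"
  obtains C where "C \<ge> 0" "\<And>f g N N' q j. bes a N f \<Longrightarrow> bes q N' g \<Longrightarrow> q > 1 \<Longrightarrow>
    norm (tP j f g \<phi>) \<le> C * N * N' * (a * q) ^ j"
proof -
  define m where "m = 2 * CARD('n)"
  obtain B where B: "B \<ge> 0" "\<And>x y. (1 + norm x) ^ m * norm (\<phi> (x - y) - \<phi> x) \<le> B * norm y * (1 + norm y) ^ m"
    by (rule schwartz_translate_diff[OF \<phi>, of m]) (rule that)
  obtain B0 where B0: "B0 \<ge> 0" "\<And>x. (1 + norm x) ^ m * norm (\<phi> x) \<le> B0"
    by (rule schwartz_boundE[OF \<phi>, of m]) (rule that)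
  obtain L where L: "L \<ge> 0" "\<And>u j M x x'. u \<in> tempered \<Longrightarrow> \<forall>x. norm (LP j u x) \<le> M \<Longrightarrow>
    norm (LP j u x - LP j u x') \<le> M * (L * 2 ^ j * norm (x - x'))"
    by (rule LP_lipschitz) (rule that)
  obtain s where s: "s \<ge> 0" "\<And>j. j \<ge> 2 \<Longrightarrow> shift_moment m (LPw j) \<le> s * (1 / 2) ^ j"
    by (rule LPw_shift_moment[of m]) (rule that)
  define W where "W = (LINT z|lborel. 1 / (1 + norm (z::real^'n)) ^ m)"
  have W: "W \<ge> 0" unfolding W_def by (intro integral_nonneg_AE) simp
  have iW: "integrable lborel (\<lambda>z::real^'n. 1 / (1 + norm z) ^ m)" unfolding m_def by (rule integrable_weight)
  \<comment> \<open>The two summands are the two ways in which \<open>low j f * \<phi>\<close>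
    varies: through \<open>\<phi>\<close> with \<open>low j f\<close> bounded, and through
    \<open>low j f\<close> with \<open>\<phi>\<close> bounded.\<close>
  define P where "P = B / (1 - a) + B0 * L / (2 * a - 1)"
  have P: "P \<ge> 0" unfolding P_def using B(1) B0(1) L(1) a by (intro add_nonneg_nonneg divide_nonneg_nonneg mult_nonneg_nonneg) auto
  define C where "C = P * s * W"
  have C: "C \<ge> 0" unfolding C_def using P s(1) W by simp
  have "norm (tP j f g \<phi>) \<le> C * N * N' * (a * q) ^ j"
    if f: "bes a N f" and g: "bes q N' g" and q: "q > 1" for f g N N' q j
  proof (cases "j \<ge> 2")
    \<comment> \<open>For \<open>j < 2\<close> the low-frequency sum is empty, so the kernels
      without mean zero never occur.\<close>
    case False
    then have "{i. i + 1 < j} = {}" by auto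
    then have "tP j f g \<phi> = 0" by (simp add: tP_def low_def distr_of_def)
    then show ?thesis using C bes_nonneg[OF f] bes_nonneg[OF g] a q by simp
  next
    case j: True
    have N: "N \<ge> 0" and N': "N' \<ge> 0" using bes_nonneg f g by auto
    note gt = bes_tempered[OF g] and ft = bes_tempered[OF f]
    have a0: "0 \<le> a" "0 < a" using a by auto
    define h where "h x = low j f x * \<phi> x" for x
    have lowm [measurable]: "low j f \<in> borel_measurable borel"
      by (intro borel_measurable_continuous_onI low_continuous ft)
    have [measurable]: "LP j g \<in> borel_measurable borel" by (rule pairable_measurable[OF pairable_LP_block[OF gt]])
    note [measurable] = schwartz_measurable[OF \<phi>]
    have hm [measurable]: "h \<in> borel_measurable borel" unfolding h_def by measurable
    have hr: "rapid h" unfolding h_def by (rule rapid_mult_bounded[OF schwartz_rapid[OF \<phi>] lowm low_bound_regular[OF f a0(1) a(2)]])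
    obtain B1 where B1: "\<And>x. norm (\<phi> x) \<le> B1" using schwartz_bounded[OF \<phi>] by blast
    have hb: "norm (h x) \<le> N / (1 - a) * B1" for x
      unfolding h_def norm_mult using N a by (intro mult_mono low_bound_regular[OF f a0(1) a(2)] B1) auto
    \<comment> \<open>Lets the summand that does not grow with \<open>j\<close> share the factor
      \<open>(2 * a) ^ j\<close> of the other.\<close>
    have p1: "1 \<le> (2 * a) ^ j" using a by (intro one_le_power) auto
    have hd: "(1 + norm y) ^ m * norm (h (y - z) - h y) \<le> (N * P * (2 * a) ^ j) * norm z * (1 + norm z) ^ m" for y z
    proof -
      have "h (y - z) - h y = low j f (y - z) * (\<phi> (y - z) - \<phi> y) + (low j f (y - z) - low j f y) * \<phi> y"
        by (simp add: h_def algebra_simps)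
      then have "norm (h (y - z) - h y) \<le> norm (low j f (y - z)) * norm (\<phi> (y - z) - \<phi> y) + norm (low j f (y - z) - low j f y) * norm (\<phi> y)"
        using norm_triangle_ineq[of "low j f (y - z) * (\<phi> (y - z) - \<phi> y)" "(low j f (y - z) - low j f y) * \<phi> y"]
        by (simp add: norm_mult)
      then have "(1 + norm y) ^ m * norm (h (y - z) - h y)
          \<le> (1 + norm y) ^ m * (norm (low j f (y - z)) * norm (\<phi> (y - z) - \<phi> y) + norm (low j f (y - z) - low j f y) * norm (\<phi> y))"
        by (rule mult_left_mono) simp
      also have "\<dots> = norm (low j f (y - z)) * ((1 + norm y) ^ m * norm (\<phi> (y - z) - \<phi> y))
          + norm (low j f (y - z) - low j f y) * ((1 + norm y) ^ m * norm (\<phi> y))" by (simp add: algebra_simps)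
      also have "\<dots> \<le> (N / (1 - a)) * (B * norm z * (1 + norm z) ^ m)
          + (N * L / (2 * a - 1) * (2 * a) ^ j * norm ((y - z) - y)) * B0"
        using N a L(1)
        by (intro add_mono mult_mono low_bound_regular[OF f a0(1) a(2)] B(2) B0(2) low_lipschitz[OF f a(1) L]) auto
      also have "\<dots> \<le> (N / (1 - a)) * (B * norm z * (1 + norm z) ^ m) * (2 * a) ^ j
          + (N * L / (2 * a - 1) * (2 * a) ^ j * norm z) * B0 * (1 + norm z) ^ m"
      proof (rule add_mono)
        have "0 \<le> (N / (1 - a)) * (B * norm z * (1 + norm z) ^ m)" using N a B(1) by simp
        from mult_left_mono[OF p1 this]
        show "(N / (1 - a)) * (B * norm z * (1 + norm z) ^ m) \<le> (N / (1 - a)) * (B * norm z * (1 + norm z) ^ m) * (2 * a) ^ j"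
          by simp
        have "0 \<le> (N * L / (2 * a - 1) * (2 * a) ^ j * norm z) * B0" using N a L(1) B0(1) by simp
        moreover have "1 \<le> (1 + norm z) ^ m" by (rule one_le_power) simp
        ultimately show "(N * L / (2 * a - 1) * (2 * a) ^ j * norm ((y - z) - y)) * B0
            \<le> (N * L / (2 * a - 1) * (2 * a) ^ j * norm z) * B0 * (1 + norm z) ^ m"
          using mult_left_mono[of 1 "(1 + norm z) ^ m" "(N * L / (2 * a - 1) * (2 * a) ^ j * norm z) * B0"] by simp
      qed
      also have "\<dots> = (N * P * (2 * a) ^ j) * norm z * (1 + norm z) ^ m"
        unfolding P_def by (simp add: algebra_simps)
      finally show ?thesis .
    qed
    \<comment> \<open>\<open>LPw j\<close> has mean zero, so \<open>conv_shift_bound\<close>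
      controls the convolution itself, and the growth \<open>(2 * a) ^ j\<close> meets the width
      \<open>(1 / 2) ^ j\<close>.\<close>
    have Ib: "(1 + norm y) ^ m * norm (conv (LPw j) h y) \<le> N * P * s * a ^ j" for y
    proof -
      have "conv (LPw j) h = conv h (LPw j)" by (rule conv_commute[OF schwartz_measurable[OF schwartz_LPw] hm])
      then have "(1 + norm y) ^ m * norm (conv (LPw j) h y) \<le> (N * P * (2 * a) ^ j) * shift_moment m (LPw j)"
        using conv_shift_bound[OF hd hm hb schwartz_rapid[OF schwartz_LPw], of y j] integral_LPw[OF j] by simp
      also have "\<dots> \<le> (N * P * (2 * a) ^ j) * (s * (1 / 2) ^ j)"
        using N P a by (intro mult_left_mono s(2) j) auto
      also have "\<dots> = N * P * s * a ^ j" by (simp add: power_mult_distrib power_divide)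
      finally show ?thesis .
    qed
    have I: "integrable (lborel \<Otimes>\<^sub>M lborel) (\<lambda>(x, y). h x * (LP j g y * LPw j (y - x)))"
      by (rule integrable_pair_translate[OF schwartz_integrable[OF schwartz_LPw] rapid_integrable[OF hr] _ bes_bound[OF g]]) simp
    have "tP j f g \<phi> = (LINT x|lborel. h x * LP j g x)"
      unfolding tP_def distr_of_def h_def by (simp only: mult_ac)
    also have "\<dots> = (LINT x|lborel. h x * (LINT y|lborel. LP j g y * LPw j (y - x)))"
      by (simp only: LP_reproducing[OF gt bes_bound[OF g], symmetric])
    also have "\<dots> = (LINT x|lborel. (LINT y|lborel. h x * (LP j g y * LPw j (y - x))))"
      by simp
    also have "\<dots> = (LINT y|lborel. (LINT x|lborel. h x * (LP j g y * LPw j (y - x))))"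
      using lborel_pair.Fubini_integral[OF I] by simp
    also have "\<dots> = (LINT y|lborel. LP j g y * conv (LPw j) h y)"
    proof (intro Bochner_Integration.integral_cong refl)
      fix y
      have "(LINT x|lborel. h x * (LP j g y * LPw j (y - x))) = (LINT x|lborel. LP j g y * (LPw j (y - x) * h x))"
        by (intro Bochner_Integration.integral_cong refl) (simp only: mult_ac)
      then show "(LINT x|lborel. h x * (LP j g y * LPw j (y - x))) = LP j g y * conv (LPw j) h y"
        by (simp add: conv_def)
    qed
    finally have "norm (tP j f g \<phi>) \<le> (LINT y|lborel. norm (LP j g y * conv (LPw j) h y))"
      by (simp only: integral_norm_bound)
    also have "\<dots> \<le> (LINT y|lborel. (N' * q ^ j * (N * P * s * a ^ j)) * (1 / (1 + norm (y::real^'n)) ^ m))"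
    proof (rule integral_mono_AE')
      show "integrable lborel (\<lambda>y::real^'n. (N' * q ^ j * (N * P * s * a ^ j)) * (1 / (1 + norm y) ^ m))"
        by (intro integrable_mult_right iW)
      show "AE y in lborel. norm (LP j g y * conv (LPw j) h y) \<le> (N' * q ^ j * (N * P * s * a ^ j)) * (1 / (1 + norm y) ^ m)"
      proof (rule AE_I2)
        fix y
        have "norm (conv (LPw j) h y) \<le> (N * P * s * a ^ j) * (1 / (1 + norm y) ^ m)"
          using Ib[of y] by (simp add: pos_le_divide_eq add_pos_nonneg mult.commute)
        then have "norm (LP j g y) * norm (conv (LPw j) h y) \<le> (N' * q ^ j) * ((N * P * s * a ^ j) * (1 / (1 + norm y) ^ m))"
          using N' q by (intro mult_mono bes_bound[OF g]) auto
        then show "norm (LP j g y * conv (LPw j) h y) \<le> (N' * q ^ j * (N * P * s * a ^ j)) * (1 / (1 + norm y) ^ m)"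
          by (simp only: norm_mult mult.assoc)
      qed
      show "AE y in lborel. 0 \<le> (N' * q ^ j * (N * P * s * a ^ j)) * (1 / (1 + norm (y::real^'n)) ^ m)"
        using N N' P s(1) a q by simp
    qed
    also have "\<dots> = (N' * q ^ j * (N * P * s * a ^ j)) * W" by (simp only: W_def integral_mult_right_zero)
    also have "\<dots> = C * N * N' * (a * q) ^ j" by (simp only: C_def power_mult_distrib mult_ac)
    finally show ?thesis .
  qed
  note bd = this
  show ?thesis by (rule that[OF C bd])
qed

end

lemma CT_tempered_linear_comb:
  assumes u: "u \<in> CT_tempered T" and v: "v \<in> CT_tempered T"
  shows "(\<lambda>s \<phi>. a * u s \<phi> + b * v s \<phi>) \<in> CT_tempered T"
  using u v unfolding CT_tempered_def by (auto intro!: tempered_linear_comb continuous_intros)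

lemma CT_tempered_sum:
  assumes "\<And>i. i \<in> I \<Longrightarrow> u i \<in> CT_tempered T"
  shows "(\<lambda>s \<phi>. \<Sum>i\<in>I. u i s \<phi>) \<in> CT_tempered T"
  using assms unfolding CT_tempered_def by (auto intro!: tempered_sum_distr continuous_intros)

lemma bounded_gradient_growth:
  fixes h :: "real^'n::finite \<Rightarrow> real" and M :: real
  assumes d: "\<And>x. h differentiable at x" and M: "\<And>i x. \<bar>partial i h x\<bar> \<le> M"
  shows "\<bar>h x\<bar> \<le> \<bar>h 0\<bar> + CARD('n) * M * norm x"
proof -
  have "norm (h x - h 0) \<le> (CARD('n) * M) * norm (x - 0)"
  proof (rule differentiable_bound[where S = UNIV])
    show "(h has_derivative (\<lambda>v. \<Sum>i\<in>UNIV. v $ i *\<^sub>R partial i h y)) (at y within UNIV)" for y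
      using has_derivative_partials[OF d] by simp
    show "onorm (\<lambda>v. \<Sum>i\<in>UNIV. v $ i *\<^sub>R partial i h y) \<le> CARD('n) * M" for y
    proof (rule onorm_le)
      fix v :: "real^'n"
      have "norm (\<Sum>i\<in>UNIV. v $ i *\<^sub>R partial i h y) \<le> (\<Sum>i\<in>(UNIV::'n set). norm v * M)"
        by (intro sum_norm_le) (simp only: norm_scaleR, intro mult_mono, auto simp: M component_le_norm_cart)
      then show "norm (\<Sum>i\<in>UNIV. v $ i *\<^sub>R partial i h y) \<le> CARD('n) * M * norm v" by (simp add: mult_ac)
    qed
  qed auto
  then show ?thesis by simp
qed

section \<open>Boundedness, bilinearity and temperedness of the product\<close>

context dyadic
begin

lemma bes_minus:
  assumes f: "bes a N f" and f': "bes a N' f'"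
  shows "bes a (N + N') (\<lambda>\<phi>. f \<phi> - f' \<phi>)"
proof -
  note t = bes_tempered[OF f] bes_tempered[OF f']
  have "norm (LP j (\<lambda>\<phi>. f \<phi> - f' \<phi>) x) \<le> (N + N') * a ^ j" for j x
    unfolding LP_minus[OF t] using norm_triangle_ineq4[of "LP j f x" "LP j f' x"] bes_bound[OF f, of j x] bes_bound[OF f', of j x]
    by (simp add: distrib_right)
  then show ?thesis using tempered_minus[OF t] by (simp add: bes_def)
qed

definition tB :: "nat \<Rightarrow> 'n distr \<Rightarrow> 'n distr \<Rightarrow> 'n distr" where
  "tB j f g \<phi> = tP j f g \<phi> + tR j f g \<phi> + tP j g f \<phi>"

lemma bony_terms_bound:
  assumes a: "1 / 2 < a" "a < 1" and q: "q > 1" and \<phi>: "\<phi> \<in> schwartz"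
  obtains C where "C \<ge> 0" "\<And>f g N N' j. bes a N f \<Longrightarrow> bes q N' g \<Longrightarrow>
    norm (tP j f g \<phi>) \<le> C * N * N' * (a * q) ^ j \<and> norm (tR j f g \<phi>) \<le> C * N * N' * (a * q) ^ j \<and>
    norm (tP j g f \<phi>) \<le> C * N * N' * (a * q) ^ j"
proof -
  obtain C1 where C1: "C1 \<ge> 0" "\<And>f g N N' q j. bes a N f \<Longrightarrow> bes q N' g \<Longrightarrow> q > 1 \<Longrightarrow>
    norm (tP j f g \<phi>) \<le> C1 * N * N' * (a * q) ^ j"
    by (rule tP_regular_bound[OF a \<phi>]) (rule that)
  define C2 where "C2 = moment 0 \<phi> / (q - 1)"
  define C3 where "C3 = 3 * moment 0 \<phi> / a"
  have C23: "C2 \<ge> 0" "C3 \<ge> 0" using a q moment_nonneg[of 0 \<phi>] by (auto simp: C2_def C3_def)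
  define C where "C = C1 + C2 + C3"
  have "norm (tP j f g \<phi>) \<le> C * N * N' * (a * q) ^ j \<and> norm (tR j f g \<phi>) \<le> C * N * N' * (a * q) ^ j \<and>
    norm (tP j g f \<phi>) \<le> C * N * N' * (a * q) ^ j" if f: "bes a N f" and g: "bes q N' g" for f g N N' j
  proof -
    have K: "K * N * N' * (a * q) ^ j \<le> C * N * N' * (a * q) ^ j" if "K \<le> C" for K
      using that bes_nonneg[OF f] bes_nonneg[OF g] a q by (intro mult_right_mono) auto
    show ?thesis
      using C1(2)[OF f g q, of j] tR_bound[OF f g _ a(2) \<phi>, of j, folded C3_def] tP_singular_bound[OF f g _ q \<phi>, of j, folded C2_def]
        K[of C1] K[of C2] K[of C3] C1(1) C23 a by (auto simp: C_def intro: order_trans)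
  qed
  note bd = this
  have "C \<ge> 0" using C1(1) C23 by (simp add: C_def)
  then show ?thesis by (rule that[OF _ bd])
qed

text \<open>The three series converge absolutely with ratio \<open>a * q < 1\<close>, so they may be
  merged into one series with terms \<open>tB\<close>.\<close>

lemma bony_sums:
  assumes a: "1 / 2 < a" "a < 1" and q: "q > 1" "a * q < 1" and \<phi>: "\<phi> \<in> schwartz"
    and f: "bes a N f" and g: "bes q N' g"
  shows "(\<lambda>j. tB j f g \<phi>) sums bony_product \<rho> f g \<phi>"
proof -
  obtain C where C: "C \<ge> 0" "\<And>f g N N' j. bes a N f \<Longrightarrow> bes q N' g \<Longrightarrow>
    norm (tP j f g \<phi>) \<le> C * N * N' * (a * q) ^ j \<and> norm (tR j f g \<phi>) \<le> C * N * N' * (a * q) ^ j \<and>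
    norm (tP j g f \<phi>) \<le> C * N * N' * (a * q) ^ j"
    by (rule bony_terms_bound[OF a q(1) \<phi>]) (rule that)
  have sM: "summable (\<lambda>j. C * N * N' * (a * q) ^ j)"
    using a q by (intro summable_mult summable_geometric) (simp add: abs_mult)
  have s: "summable (\<lambda>j. tP j f g \<phi>)" "summable (\<lambda>j. tR j f g \<phi>)" "summable (\<lambda>j. tP j g f \<phi>)"
    by (rule summable_comparison_test'[OF sM, of 0], use C(2)[OF f g] in blast)+
  have "paraproduct \<rho> f g \<phi> = (\<Sum>j. tP j f g \<phi>)" for f g
    by (simp add: paraproduct_def tP_def low_def)
  moreover have "resonant \<rho> f g \<phi> = (\<Sum>j. tR j f g \<phi>)"
    by (simp add: resonant_def tR_def mid_def near_def)
  ultimately show ?thesis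
    unfolding bony_product_def tB_def using s by (auto intro!: sums_add summable_sums)
qed

text \<open>The constant is fixed before \<open>f\<close> and \<open>g\<close> are chosen; this
  uniformity is what continuity in time rests on.\<close>

lemma bony_bound:
  assumes a: "1 / 2 < a" "a < 1" and q: "q > 1" "a * q < 1" and \<phi>: "\<phi> \<in> schwartz"
  obtains C where "C \<ge> 0" "\<And>f g N N'. bes a N f \<Longrightarrow> bes q N' g \<Longrightarrow> norm (bony_product \<rho> f g \<phi>) \<le> C * N * N'"
proof -
  obtain C where C: "C \<ge> 0" "\<And>f g N N' j. bes a N f \<Longrightarrow> bes q N' g \<Longrightarrow>
    norm (tP j f g \<phi>) \<le> C * N * N' * (a * q) ^ j \<and> norm (tR j f g \<phi>) \<le> C * N * N' * (a * q) ^ j \<and>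
    norm (tP j g f \<phi>) \<le> C * N * N' * (a * q) ^ j"
    by (rule bony_terms_bound[OF a q(1) \<phi>]) (rule that)
  have g0: "0 \<le> a * q" using a q by simp
  have sG: "summable (\<lambda>j. (a * q) ^ j)" using a q by (intro summable_geometric) (simp add: abs_mult)
  have "norm (bony_product \<rho> f g \<phi>) \<le> (3 * C * (1 / (1 - a * q))) * N * N'" if f: "bes a N f" and g: "bes q N' g" for f g N N'
  proof -
    have b: "norm (tB j f g \<phi>) \<le> 3 * C * N * N' * (a * q) ^ j" for j
    proof -
      have "norm (tB j f g \<phi>) \<le> norm (tP j f g \<phi>) + norm (tR j f g \<phi>) + norm (tP j g f \<phi>)"
        unfolding tB_def by (intro order_trans[OF norm_triangle_ineq] add_right_mono norm_triangle_ineq)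
      then show ?thesis using C(2)[OF f g, of j] by linarith
    qed
    have "norm (\<Sum>j. tB j f g \<phi>) \<le> (\<Sum>j. 3 * C * N * N' * (a * q) ^ j)"
      by (rule norm_suminf_le[OF b summable_mult[OF sG]])
    also have "\<dots> = 3 * C * N * N' * (1 / (1 - a * q))"
      using g0 q by (subst suminf_mult[OF sG]) (simp add: suminf_geometric)
    finally show ?thesis
      using sums_unique[OF bony_sums[OF a q \<phi> f g]] by (simp add: mult_ac)
  qed
  note bd = this
  have "3 * C * (1 / (1 - a * q)) \<ge> 0" using C(1) q by simp
  then show ?thesis by (rule that[OF _ bd])
qed

lemma bes_product_pairable:
  assumes "continuous_on UNIV h" "\<And>x. norm (h x) \<le> M" "bes q N u"
  shows "pairable (\<lambda>x. h x * LP j u x)"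
proof (rule pairable_bounded)
  show "continuous_on UNIV (\<lambda>x. h x * LP j u x)"
    by (intro continuous_on_mult assms pairable_continuous pairable_LP_block bes_tempered[OF assms(3)])
  show "norm (h x * LP j u x) \<le> M * (N * q ^ j)" for x
    unfolding norm_mult using order_trans[OF norm_ge_zero assms(2)]
    by (intro mult_mono assms(2) bes_bound[OF assms(3)]) auto
qed

lemma mid_bounded: "bes a N u \<Longrightarrow> norm (mid j u x) \<le> N * (\<Sum>i\<in>near j. a ^ i)"
  unfolding mid_def sum_distrib_left by (intro sum_norm_le bes_bound)

lemma tP_pairable:
  assumes f: "bes a N f" and g: "bes q N' g"
  shows "pairable (\<lambda>x. low j f x * LP j g x)"
  by (rule bes_product_pairable[OF low_continuous[OF bes_tempered[OF f]] low_bound[OF f] g])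

lemma tR_pairable:
  assumes f: "bes a N f" and g: "bes q N' g"
  shows "pairable (\<lambda>x. mid j f x * LP j g x)"
  by (rule bes_product_pairable[OF mid_continuous[OF bes_tempered[OF f]] mid_bounded[OF f] g])

lemma tP_minus_left:
  assumes f: "bes a N f" "bes a' M f'" and g: "bes q N' g" and \<phi>: "\<phi> \<in> schwartz"
  shows "tP j (\<lambda>\<phi>. f \<phi> - f' \<phi>) g \<phi> = tP j f g \<phi> - tP j f' g \<phi>"
  unfolding tP_def distr_of_diff_left[OF tP_pairable[OF f(1) g] tP_pairable[OF f(2) g] \<phi>, symmetric]
  by (simp add: low_minus bes_tempered[OF f(1)] bes_tempered[OF f(2)] left_diff_distrib)

lemma tP_minus_right:
  assumes f: "bes a N f" and g: "bes q N' g" "bes q' M g'" and \<phi>: "\<phi> \<in> schwartz"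
  shows "tP j f (\<lambda>\<phi>. g \<phi> - g' \<phi>) \<phi> = tP j f g \<phi> - tP j f g' \<phi>"
  unfolding tP_def distr_of_diff_left[OF tP_pairable[OF f g(1)] tP_pairable[OF f g(2)] \<phi>, symmetric]
  by (simp add: LP_minus bes_tempered[OF g(1)] bes_tempered[OF g(2)] right_diff_distrib)

lemma tR_minus_left:
  assumes f: "bes a N f" "bes a' M f'" and g: "bes q N' g" and \<phi>: "\<phi> \<in> schwartz"
  shows "tR j (\<lambda>\<phi>. f \<phi> - f' \<phi>) g \<phi> = tR j f g \<phi> - tR j f' g \<phi>"
  unfolding tR_def distr_of_diff_left[OF tR_pairable[OF f(1) g] tR_pairable[OF f(2) g] \<phi>, symmetric]
  by (simp add: mid_minus bes_tempered[OF f(1)] bes_tempered[OF f(2)] left_diff_distrib)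

lemma tR_minus_right:
  assumes f: "bes a N f" and g: "bes q N' g" "bes q' M g'" and \<phi>: "\<phi> \<in> schwartz"
  shows "tR j f (\<lambda>\<phi>. g \<phi> - g' \<phi>) \<phi> = tR j f g \<phi> - tR j f g' \<phi>"
  unfolding tR_def distr_of_diff_left[OF tR_pairable[OF f g(1)] tR_pairable[OF f g(2)] \<phi>, symmetric]
  by (simp add: LP_minus bes_tempered[OF g(1)] bes_tempered[OF g(2)] right_diff_distrib)

text \<open>\<open>suminf\<close> is additive only on convergent series, so even bilinearity of the
  product rests on the convergence proved before.\<close>

lemma bony_minus_left:
  assumes a: "1 / 2 < a" "a < 1" and q: "q > 1" "a * q < 1" and \<phi>: "\<phi> \<in> schwartz"
    and f: "bes a N f" "bes a M f'" and g: "bes q N' g"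
  shows "bony_product \<rho> (\<lambda>\<phi>. f \<phi> - f' \<phi>) g \<phi> = bony_product \<rho> f g \<phi> - bony_product \<rho> f' g \<phi>"
proof -
  have "tB j (\<lambda>\<phi>. f \<phi> - f' \<phi>) g \<phi> = tB j f g \<phi> - tB j f' g \<phi>" for j
    unfolding tB_def by (simp add: tP_minus_left[OF f g \<phi>] tR_minus_left[OF f g \<phi>] tP_minus_right[OF g f \<phi>])
  then have "(\<lambda>j. tB j f g \<phi> - tB j f' g \<phi>) sums bony_product \<rho> (\<lambda>\<phi>. f \<phi> - f' \<phi>) g \<phi>"
    using bony_sums[OF a q \<phi> bes_minus[OF f] g] by simp
  from sums_unique2[OF this sums_diff[OF bony_sums[OF a q \<phi> f(1) g] bony_sums[OF a q \<phi> f(2) g]]] show ?thesis .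
qed

lemma bony_minus_right:
  assumes a: "1 / 2 < a" "a < 1" and q: "q > 1" "a * q < 1" and \<phi>: "\<phi> \<in> schwartz"
    and f: "bes a N f" and g: "bes q N' g" "bes q M g'"
  shows "bony_product \<rho> f (\<lambda>\<phi>. g \<phi> - g' \<phi>) \<phi> = bony_product \<rho> f g \<phi> - bony_product \<rho> f g' \<phi>"
proof -
  have "tB j f (\<lambda>\<phi>. g \<phi> - g' \<phi>) \<phi> = tB j f g \<phi> - tB j f g' \<phi>" for j
    unfolding tB_def by (simp add: tP_minus_right[OF f g \<phi>] tR_minus_right[OF f g \<phi>] tP_minus_left[OF g f \<phi>])
  then have "(\<lambda>j. tB j f g \<phi> - tB j f g' \<phi>) sums bony_product \<rho> f (\<lambda>\<phi>. g \<phi> - g' \<phi>) \<phi>"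
    using bony_sums[OF a q \<phi> f bes_minus[OF g]] by simp
  from sums_unique2[OF this sums_diff[OF bony_sums[OF a q \<phi> f g(1)] bony_sums[OF a q \<phi> f g(2)]]] show ?thesis .
qed

lemma bony_tempered:
  assumes a: "1 / 2 < a" "a < 1" and q: "q > 1" "a * q < 1" and f: "bes a N f" and g: "bes q N' g"
  shows "bony_product \<rho> f g \<in> tempered"
proof (rule tempered_limit[where U = "\<lambda>n \<phi>. \<Sum>j<n. tB j f g \<phi>"])
  have prod: "distr_of (\<lambda>x. h x * LP j u x) \<in> tempered"
    if h: "continuous_on UNIV h" "\<And>x. norm (h x) \<le> M" and u: "bes p K u" for h M p K u j
  proof (rule distr_of_tempered[where k = 0])
    show "continuous_on UNIV (\<lambda>x. h x * LP j u x)"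
      by (intro continuous_on_mult h pairable_continuous pairable_LP_block bes_tempered[OF u])
    show "norm (h x * LP j u x) \<le> M * (K * p ^ j) * (1 + norm x) ^ 0" for x
      unfolding norm_mult power_0 mult_1_right using order_trans[OF norm_ge_zero h(2)]
      by (intro mult_mono h(2) bes_bound[OF u]) auto
  qed
  show "(\<lambda>\<phi>. \<Sum>j<n. tB j f g \<phi>) \<in> tempered" for n
    unfolding tB_def
  proof (intro tempered_sum_distr tempered_plus)
    show "(\<lambda>\<phi>. tP j f g \<phi>) \<in> tempered" for j
      unfolding tP_def by (rule prod[OF low_continuous[OF bes_tempered[OF f]] low_bound[OF f] g])
    show "(\<lambda>\<phi>. tP j g f \<phi>) \<in> tempered" for j
      unfolding tP_def by (rule prod[OF low_continuous[OF bes_tempered[OF g]] low_bound[OF g] f])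
    show "(\<lambda>\<phi>. tR j f g \<phi>) \<in> tempered" for j
      unfolding tR_def by (rule prod[OF mid_continuous[OF bes_tempered[OF f]] mid_bounded[OF f] g])
  qed
  show "(\<lambda>n. \<Sum>j<n. tB j f g \<phi>) \<longlonglongrightarrow> bony_product \<rho> f g \<phi>" if "\<phi> \<in> schwartz" for \<phi>
    using bony_sums[OF a q that f g] by (simp add: sums_def)
qed

text \<open>Norm continuity with a real modulus \<open>n\<close> in place of extended norms. The
  bound on differences is asked for only near \<open>s\<close>, where the norm is known to be
  finite.\<close>

definition bes_curve :: "real \<Rightarrow> real \<Rightarrow> (real \<Rightarrow> 'n distr) \<Rightarrow> bool" where
  "bes_curve T a f \<longleftrightarrow> (\<forall>t\<in>{0..T}. \<exists>N. bes a N (f t)) \<and>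
     (\<forall>s\<in>{0..T}. \<exists>n. (n \<longlongrightarrow> 0) (at s within {0..T}) \<and>
       (\<forall>\<^sub>F t in at s within {0..T}. bes a (n t) (\<lambda>\<phi>. f t \<phi> - f s \<phi>)))"

lemma
  assumes "bes_curve T a f" "s \<in> {0..T}"
  shows bes_curve_bes: "\<exists>N. bes a N (f s)"
    and bes_curve_diff: "\<exists>n. (n \<longlongrightarrow> 0) (at s within {0..T}) \<and>
       (\<forall>\<^sub>F t in at s within {0..T}. bes a (n t) (\<lambda>\<phi>. f t \<phi> - f s \<phi>))"
  using assms unfolding bes_curve_def by (blast, simp)

lemma bony_CT_tempered:
  assumes a: "1 / 2 < a" "a < 1" and q: "q > 1" "a * q < 1"
    and f: "bes_curve T a f" and g: "bes_curve T q g"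
  shows "(\<lambda>t. bony_product \<rho> (f t) (g t)) \<in> CT_tempered T"
  unfolding CT_tempered_def
proof (intro CollectI conjI ballI)
  show "bony_product \<rho> (f t) (g t) \<in> tempered" if t: "t \<in> {0..T}" for t
  proof -
    obtain N where N: "bes a N (f t)" using bes_curve_bes[OF f t] by (rule exE)
    obtain N' where N': "bes q N' (g t)" using bes_curve_bes[OF g t] by (rule exE)
    show ?thesis by (rule bony_tempered[OF a q N N'])
  qed
  fix \<phi> :: "'n test" assume \<phi>: "\<phi> \<in> schwartz"
  obtain C where C: "C \<ge> 0" "\<And>f g N N'. bes a N f \<Longrightarrow> bes q N' g \<Longrightarrow> norm (bony_product \<rho> f g \<phi>) \<le> C * N * N'"
    by (rule bony_bound[OF a q \<phi>]) (rule that)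
  show "continuous_on {0..T} (\<lambda>t. bony_product \<rho> (f t) (g t) \<phi>)"
    unfolding continuous_on_def
  proof
    fix s assume s: "s \<in> {0..T}"
    let ?F = "at s within {0..T}"
    obtain N where fs: "bes a N (f s)" using bes_curve_bes[OF f s] by (rule exE)
    obtain N' where gs: "bes q N' (g s)" using bes_curve_bes[OF g s] by (rule exE)
    obtain n where "(n \<longlongrightarrow> 0) ?F \<and> (\<forall>\<^sub>F t in ?F. bes a (n t) (\<lambda>\<phi>. f t \<phi> - f s \<phi>))"
      using bes_curve_diff[OF f s] by (rule exE)
    note n = conjunct1[OF this] conjunct2[OF this]
    obtain n' where "(n' \<longlongrightarrow> 0) ?F \<and> (\<forall>\<^sub>F t in ?F. bes q (n' t) (\<lambda>\<phi>. g t \<phi> - g s \<phi>))"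
      using bes_curve_diff[OF g s] by (rule exE)
    note n' = conjunct1[OF this] conjunct2[OF this]
    have "((\<lambda>t. bony_product \<rho> (f t) (g t) \<phi> - bony_product \<rho> (f s) (g s) \<phi>) \<longlongrightarrow> 0) ?F"
    proof (rule Lim_null_comparison)
      have "((\<lambda>t. C * n t * n' t + C * n t * N' + C * N * n' t) \<longlongrightarrow> C * 0 * 0 + C * 0 * N' + C * N * 0) ?F"
        by (intro tendsto_intros n n')
      then show "((\<lambda>t. C * n t * n' t + C * n t * N' + C * N * n' t) \<longlongrightarrow> 0) ?F" by simp
      have "\<forall>\<^sub>F t in ?F. t \<in> {0..T}" by (simp add: eventually_at_filter)
      then show "\<forall>\<^sub>F t in ?F. norm (bony_product \<rho> (f t) (g t) \<phi> - bony_product \<rho> (f s) (g s) \<phi>)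
          \<le> C * n t * n' t + C * n t * N' + C * N * n' t"
        using n(2) n'(2)
      proof eventually_elim
        case (elim t)
        obtain M where ft: "bes a M (f t)" using bes_curve_bes[OF f elim(1)] by (rule exE)
        obtain M' where gt: "bes q M' (g t)" using bes_curve_bes[OF g elim(1)] by (rule exE)
        let ?df = "\<lambda>\<phi>. f t \<phi> - f s \<phi>" and ?dg = "\<lambda>\<phi>. g t \<phi> - g s \<phi>"
        \<comment> \<open>All norms arising from this expansion are those of the increments and of
          the values at the fixed time \<open>s\<close>.\<close>
        have eq: "bony_product \<rho> (f t) (g t) \<phi> - bony_product \<rho> (f s) (g s) \<phi>
            = bony_product \<rho> ?df ?dg \<phi> + bony_product \<rho> ?df (g s) \<phi> + bony_product \<rho> (f s) ?dg \<phi>"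
          by (simp add: bony_minus_right[OF a q \<phi> elim(2) gt gs] bony_minus_left[OF a q \<phi> ft fs gt]
              bony_minus_left[OF a q \<phi> ft fs gs] bony_minus_right[OF a q \<phi> fs gt gs])
        have "norm (bony_product \<rho> (f t) (g t) \<phi> - bony_product \<rho> (f s) (g s) \<phi>)
            \<le> norm (bony_product \<rho> ?df ?dg \<phi>) + norm (bony_product \<rho> ?df (g s) \<phi>) + norm (bony_product \<rho> (f s) ?dg \<phi>)"
          unfolding eq by (intro order_trans[OF norm_triangle_ineq] add_right_mono norm_triangle_ineq)
        also have "\<dots> \<le> C * n t * n' t + C * n t * N' + C * N * n' t"
          by (intro add_mono C(2) elim fs gs)
        finally show ?case .
      qed
    qed
    then show "((\<lambda>t. bony_product \<rho> (f t) (g t) \<phi>) \<longlongrightarrow> bony_product \<rho> (f s) (g s) \<phi>) ?F"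
      by (simp add: LIM_zero_iff)
  qed
qed

section \<open>From Besov norms to curves with geometric block bounds\<close>

lemma bes_of_besov_norm:
  assumes u: "u \<in> tempered" and B: "besov_norm \<rho> \<gamma> u \<le> ennreal B" "B \<ge> 0"
  shows "bes (2 powr (- \<gamma>)) B u"
  unfolding bes_def
proof (intro conjI allI u)
  fix j x
  have "ennreal (2 powr (real j * \<gamma>)) * ennreal (norm (LP j u x))
      \<le> ennreal (2 powr (real j * \<gamma>)) * (SUP x. ennreal (norm (LP j u x)))"
    by (intro mult_left_mono SUP_upper) auto
  also have "\<dots> \<le> besov_norm \<rho> \<gamma> u" unfolding besov_norm_def by (rule SUP_upper) simp
  also note B(1)
  finally have "2 powr (real j * \<gamma>) * norm (LP j u x) \<le> B"
    using B(2) by (simp add: ennreal_mult[symmetric])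
  then have "norm (LP j u x) \<le> B * 2 powr (- (real j * \<gamma>))"
    by (simp add: powr_minus field_simps)
  also have "2 powr (- (real j * \<gamma>)) = (2 powr (- \<gamma>)) ^ j"
    by (simp add: powr_power mult.commute)
  finally show "norm (LP j u x) \<le> B * (2 powr (- \<gamma>)) ^ j" .
qed

lemma besov_norm_mono:
  assumes "\<gamma> \<le> \<gamma>'"
  shows "besov_norm \<rho> \<gamma> u \<le> besov_norm \<rho> \<gamma>' u"
  unfolding besov_norm_def
  by (intro SUP_mono' mult_right_mono ennreal_leI powr_mono mult_left_mono assms) auto

text \<open>\<open>enn2real\<close> sends infinity to 0, so the real-valued limit alone would lose
  information; the second conclusion records that near the limit point nothing is lost.\<close>

lemma eventually_enn2real:
  assumes "(F \<longlongrightarrow> 0) A" "\<forall>\<^sub>F t in A. P t"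
  shows "((\<lambda>t. enn2real (F t)) \<longlongrightarrow> 0) A" "\<forall>\<^sub>F t in A. P t \<and> F t = ennreal (enn2real (F t))"
proof -
  show "((\<lambda>t. enn2real (F t)) \<longlongrightarrow> 0) A" using assms(1) by (intro tendsto_enn2real) auto
  have "\<forall>\<^sub>F t in A. F t < 1" using order_tendstoD(2)[OF assms(1), of 1] by simp
  then show "\<forall>\<^sub>F t in A. P t \<and> F t = ennreal (enn2real (F t))"
    using assms(2)
  proof eventually_elim
    case (elim t)
    then have "F t < top" using ennreal_one_less_top less_trans by blast
    then show ?case using elim by simp
  qed
qed

lemma CT_besov_curve:
  assumes f: "f \<in> CT_besov \<rho> T \<gamma>'" and \<gamma>: "\<gamma> \<le> \<gamma>'"
  shows "bes_curve T (2 powr (- \<gamma>)) f"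
  unfolding bes_curve_def
proof (intro conjI ballI)
  have ft: "f t \<in> tempered" "besov_norm \<rho> \<gamma>' (f t) < \<infinity>" if "t \<in> {0..T}" for t
    using f that by (auto simp: CT_besov_def besov_def)
  show "\<exists>N. bes (2 powr (- \<gamma>)) N (f t)" if t: "t \<in> {0..T}" for t
  proof -
    have "besov_norm \<rho> \<gamma> (f t) \<le> ennreal (enn2real (besov_norm \<rho> \<gamma>' (f t)))"
      using besov_norm_mono[OF \<gamma>, of "f t"] ft(2)[OF t] by simp
    from bes_of_besov_norm[OF ft(1)[OF t] this] show ?thesis by auto
  qed
  fix s assume s: "s \<in> {0..T}"
  let ?F = "at s within {0..T}"
  define G where "G t = besov_norm \<rho> \<gamma>' (\<lambda>\<phi>. f t \<phi> - f s \<phi>)" for t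
  have "(G \<longlongrightarrow> 0) ?F" unfolding G_def[abs_def] using f s unfolding CT_besov_def by blast
  moreover have "\<forall>\<^sub>F t in ?F. t \<in> {0..T}" by (simp add: eventually_at_filter)
  ultimately have G: "((\<lambda>t. enn2real (G t)) \<longlongrightarrow> 0) ?F" "\<forall>\<^sub>F t in ?F. t \<in> {0..T} \<and> G t = ennreal (enn2real (G t))"
    by (rule eventually_enn2real)+
  from G(2) have "\<forall>\<^sub>F t in ?F. bes (2 powr (- \<gamma>)) (enn2real (G t)) (\<lambda>\<phi>. f t \<phi> - f s \<phi>)"
  proof eventually_elim
    case (elim t)
    have "besov_norm \<rho> \<gamma> (\<lambda>\<phi>. f t \<phi> - f s \<phi>) \<le> ennreal (enn2real (G t))"
      using besov_norm_mono[OF \<gamma>, of "\<lambda>\<phi>. f t \<phi> - f s \<phi>"] elim by (simp add: G_def)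
    then show ?case using elim by (intro bes_of_besov_norm tempered_minus ft(1) s) auto
  qed
  with G(1) show "\<exists>n. (n \<longlongrightarrow> 0) ?F \<and> (\<forall>\<^sub>F t in ?F. bes (2 powr (- \<gamma>)) (n t) (\<lambda>\<phi>. f t \<phi> - f s \<phi>))"
    by (intro exI[of _ "\<lambda>t. enn2real (G t)"] conjI)
qed

lemma DC_gradient_bes:
  assumes p: "\<And>i. pairable (\<lambda>x. complex_of_real (partial i h x))"
    and t: "\<And>i. distr_of_real (partial i h) \<in> tempered" and B: "DC_norm \<rho> \<beta> h \<le> ennreal B" "B \<ge> 0"
  shows "bes (2 powr (- \<beta>)) B (distr_of_real (partial i h))" and "\<bar>h 0\<bar> \<le> B"
    and "\<beta> > 0 \<Longrightarrow> \<bar>partial i h x\<bar> \<le> B / (1 - 2 powr (- \<beta>))"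
proof -
  have "besov_norm \<rho> \<beta> (distr_of_real (partial i h)) \<le> (\<Sum>i\<in>UNIV. besov_norm \<rho> \<beta> (distr_of_real (partial i h)))"
    by (rule member_le_sum) auto
  also have "\<dots> \<le> DC_norm \<rho> \<beta> h" unfolding DC_norm_def by (simp add: add_increasing)
  also note B(1)
  finally show b: "bes (2 powr (- \<beta>)) B (distr_of_real (partial i h))"
    by (intro bes_of_besov_norm t B(2))
  have "ennreal \<bar>h 0\<bar> \<le> DC_norm \<rho> \<beta> h" unfolding DC_norm_def by (simp add: add_increasing2 sum_nonneg)
  also note B(1)
  finally show "\<bar>h 0\<bar> \<le> B" using B(2) by simp
  assume \<beta>: "\<beta> > 0"
  then have "2 powr (- \<beta>) < (1::real)" by (simp add: powr_less_one)
  then show "\<bar>partial i h x\<bar> \<le> B / (1 - 2 powr (- \<beta>))"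
    using bes_function_bound[OF p b[unfolded distr_of_real_def], of x] by simp
qed

text \<open>The value at the origin and the sup bound of the gradient control the function up to
  linear growth. The estimate is linear in \<open>B\<close>, so that it also measures the difference
  of the function at two times.\<close>

lemma DC_growth:
  assumes d: "\<And>x. h differentiable at x" and \<beta>: "\<beta> > 0"
    and p: "\<And>i. pairable (\<lambda>x. complex_of_real (partial i h x))"
    and t: "\<And>i. distr_of_real (partial i h) \<in> tempered" and B: "DC_norm \<rho> \<beta> h \<le> ennreal B" "B \<ge> 0"
  shows "\<bar>h x\<bar> \<le> B * (1 + CARD('n) / (1 - 2 powr (- \<beta>))) * (1 + norm x) ^ 1"
proof -
  have a: "2 powr (- \<beta>) < (1::real)" using \<beta> by (simp add: powr_less_one)
  define c where "c = CARD('n) / (1 - 2 powr (- \<beta>))"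
  have c: "c \<ge> 0" using a by (simp add: c_def)
  have "\<bar>h x\<bar> \<le> \<bar>h 0\<bar> + CARD('n) * (B / (1 - 2 powr (- \<beta>))) * norm x"
    by (rule bounded_gradient_growth[OF d]) (rule DC_gradient_bes(3)[OF p t B \<beta>])
  also have "\<dots> \<le> B + B * c * norm x"
    using DC_gradient_bes(2)[OF p t B] by (simp add: c_def mult_ac)
  also have "\<dots> \<le> B * (1 + c) * (1 + norm x) ^ 1"
    using c B(2) by (simp add: algebra_simps)
  finally show ?thesis by (simp add: c_def)
qed

lemma CT_DC_curves:
  assumes v: "v \<in> CT_DC \<rho> T \<beta>" and \<beta>: "\<beta> > 0"
  shows "bes_curve T (2 powr (- \<beta>)) (\<lambda>t. distr_of_real (partial i (v t)))"
    and "(\<lambda>t. distr_of_real (v t)) \<in> CT_tempered T"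
proof -
  have vd: "\<And>x. v t differentiable at x" and vp: "\<And>i. pairable (\<lambda>x. complex_of_real (partial i (v t) x))"
    and vb: "\<And>i. distr_of_real (partial i (v t)) \<in> besov \<rho> \<beta>" if "t \<in> {0..T}" for t
    using v that by (auto simp: CT_DC_def DC_def)
  have vt: "distr_of_real (partial i (v t)) \<in> tempered" if "t \<in> {0..T}" for t i
    using vb[OF that] by (simp add: besov_def)
  have fin: "DC_norm \<rho> \<beta> (v t) < \<infinity>" if "t \<in> {0..T}" for t
    using vb[OF that] by (auto simp: DC_norm_def besov_def)
  define B where "B t = enn2real (DC_norm \<rho> \<beta> (v t))" for t
  have B: "DC_norm \<rho> \<beta> (v t) \<le> ennreal (B t)" "B t \<ge> 0" if "t \<in> {0..T}" for t
    using fin[OF that] by (auto simp: B_def)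
  define c where "c = 1 + CARD('n) / (1 - 2 powr (- \<beta>))"
  have gr: "norm (complex_of_real (v t x)) \<le> (B t * c) * (1 + norm x) ^ 1" if "t \<in> {0..T}" for t x
    using DC_growth[OF vd[OF that] \<beta> vp[OF that] vt[OF that] B[OF that]] by (simp add: c_def)
  have vc: "continuous_on UNIV (\<lambda>x. complex_of_real (v t x))" if "t \<in> {0..T}" for t
    using vd[OF that] by (intro continuous_intros continuous_at_imp_continuous_on) (auto intro: differentiable_imp_continuous_within)
  have pv: "pairable (\<lambda>x. complex_of_real (v t x))" if "t \<in> {0..T}" for t
    by (rule pairable_growth[OF vc[OF that] gr[OF that]])
  \<comment> \<open>The norm in \<open>CT_DC\<close> is taken of a difference of functions, whereas
    the curves to be treated consist of differences of distributions. The facts on \<open>h\<close>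
    translate between the two.\<close>
  define h where "h s t x = v t x - v s x" for s t x
  have hd: "h s t differentiable at x" and hp: "partial i (h s t) x = partial i (v t) x - partial i (v s) x"
    if "s \<in> {0..T}" "t \<in> {0..T}" for s t i x
    unfolding h_def[abs_def] using vd that by (auto intro: differentiable_diff partial_diff)
  have hpp: "pairable (\<lambda>x. complex_of_real (partial i (h s t) x))" if "s \<in> {0..T}" "t \<in> {0..T}" for s t i
    using vp[OF that(1), of i] vp[OF that(2), of i] unfolding hp[OF that] pairable_def
    by (auto simp: right_diff_distrib intro!: continuous_intros)
  have hdistr: "distr_of_real (partial i (h s t)) \<phi> = distr_of_real (partial i (v t)) \<phi> - distr_of_real (partial i (v s)) \<phi>"
    if "s \<in> {0..T}" "t \<in> {0..T}" "\<phi> \<in> schwartz" for s t i \<phi>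
    using distr_of_diff_left[OF vp[OF that(2)] vp[OF that(1)] that(3)]
    unfolding distr_of_real_def hp[OF that(1,2)] by simp
  have tm: "(\<lambda>\<phi>. distr_of_real (partial i (v t)) \<phi> - distr_of_real (partial i (v s)) \<phi>) \<in> tempered"
    if "s \<in> {0..T}" "t \<in> {0..T}" for s t i
    by (intro tempered_minus vt that)
  have ht: "distr_of_real (partial i (h s t)) \<in> tempered" if "s \<in> {0..T}" "t \<in> {0..T}" for s t i
    by (rule tempered_cong[OF tm[OF that] hdistr[OF that]])
  define n where "n s t = enn2real (DC_norm \<rho> \<beta> (h s t))" for s t
  have n: "(n s \<longlongrightarrow> 0) (at s within {0..T})"
    "\<forall>\<^sub>F t in at s within {0..T}. t \<in> {0..T} \<and> DC_norm \<rho> \<beta> (h s t) = ennreal (n s t)"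
    if s: "s \<in> {0..T}" for s
  proof -
    have "((\<lambda>t. DC_norm \<rho> \<beta> (h s t)) \<longlongrightarrow> 0) (at s within {0..T})"
      using v s unfolding CT_DC_def h_def[abs_def] by blast
    moreover have "\<forall>\<^sub>F t in at s within {0..T}. t \<in> {0..T}" by (simp add: eventually_at_filter)
    ultimately show "(n s \<longlongrightarrow> 0) (at s within {0..T})"
      "\<forall>\<^sub>F t in at s within {0..T}. t \<in> {0..T} \<and> DC_norm \<rho> \<beta> (h s t) = ennreal (n s t)"
      unfolding n_def[abs_def] by (rule eventually_enn2real)+
  qed
  have n0: "n s t \<ge> 0" for s t by (simp add: n_def)
  show "bes_curve T (2 powr (- \<beta>)) (\<lambda>t. distr_of_real (partial i (v t)))"
    unfolding bes_curve_def
  proof (intro conjI ballI)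
    show "\<exists>N. bes (2 powr (- \<beta>)) N (distr_of_real (partial i (v t)))" if "t \<in> {0..T}" for t
      using DC_gradient_bes(1)[OF vp[OF that] vt[OF that] B[OF that]] by blast
    fix s assume s: "s \<in> {0..T}"
    from n(2)[OF s] have "\<forall>\<^sub>F t in at s within {0..T}. bes (2 powr (- \<beta>)) (n s t)
        (\<lambda>\<phi>. distr_of_real (partial i (v t)) \<phi> - distr_of_real (partial i (v s)) \<phi>)"
    proof eventually_elim
      case (elim t)
      then have t: "t \<in> {0..T}" and le: "DC_norm \<rho> \<beta> (h s t) \<le> ennreal (n s t)" by auto
      have b: "bes (2 powr (- \<beta>)) (n s t) (distr_of_real (partial i (h s t)))"
        by (rule DC_gradient_bes(1)[OF hpp[OF s t] ht[OF s t] le n0])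
      \<comment> \<open>The two functionals are known to agree on \<open>schwartz\<close> only,
        hence \<open>LP_cong\<close> in place of rewriting.\<close>
      have "LP j (\<lambda>\<phi>. distr_of_real (partial i (v t)) \<phi> - distr_of_real (partial i (v s)) \<phi>) = LP j (distr_of_real (partial i (h s t)))" for j
        by (rule LP_cong[OF tm[OF s t] ht[OF s t]]) (simp add: hdistr[OF s t])
      then show ?case using b tm[OF s t] unfolding bes_def by simp
    qed
    with n(1)[OF s] show "\<exists>n. (n \<longlongrightarrow> 0) (at s within {0..T}) \<and> (\<forall>\<^sub>F t in at s within {0..T}. bes (2 powr (- \<beta>)) (n t)
        (\<lambda>\<phi>. distr_of_real (partial i (v t)) \<phi> - distr_of_real (partial i (v s)) \<phi>))"
      by (intro exI[of _ "n s"] conjI)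
  qed
  show "(\<lambda>t. distr_of_real (v t)) \<in> CT_tempered T"
    unfolding CT_tempered_def
  proof (intro CollectI conjI ballI)
    show "distr_of_real (v t) \<in> tempered" if "t \<in> {0..T}" for t
      unfolding distr_of_real_def by (rule distr_of_tempered[OF vc[OF that] gr[OF that]])
    fix \<phi> :: "'n test" assume \<phi>: "\<phi> \<in> schwartz"
    show "continuous_on {0..T} (\<lambda>t. distr_of_real (v t) \<phi>)"
      unfolding continuous_on_def
    proof
      fix s assume s: "s \<in> {0..T}"
      have "((\<lambda>t. distr_of_real (v t) \<phi> - distr_of_real (v s) \<phi>) \<longlongrightarrow> 0) (at s within {0..T})"
      proof (rule Lim_null_comparison)
        have "((\<lambda>t. n s t * c * moment 1 \<phi>) \<longlongrightarrow> 0 * c * moment 1 \<phi>) (at s within {0..T})"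
          by (intro tendsto_intros n(1) s)
        then show "((\<lambda>t. n s t * c * moment 1 \<phi>) \<longlongrightarrow> 0) (at s within {0..T})" by simp
        show "\<forall>\<^sub>F t in at s within {0..T}. norm (distr_of_real (v t) \<phi> - distr_of_real (v s) \<phi>) \<le> n s t * c * moment 1 \<phi>"
          using n(2)[OF s]
        proof eventually_elim
          case (elim t)
          then have t: "t \<in> {0..T}" and le: "DC_norm \<rho> \<beta> (h s t) \<le> ennreal (n s t)" by auto
          have "norm (complex_of_real (v t x) - complex_of_real (v s x)) \<le> (n s t * c) * (1 + norm x) ^ 1" for x
            using DC_growth[OF hd[OF s t] \<beta> hpp[OF s t] ht[OF s t] le n0, of x]
            unfolding of_real_diff[symmetric] norm_of_real by (simp add: c_def h_def)
          from norm_distr_of_growth[OF \<phi> this] show ?case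
            unfolding distr_of_real_def distr_of_diff_left[OF pv[OF t] pv[OF s] \<phi>] .
        qed
      qed
      then show "((\<lambda>t. distr_of_real (v t) \<phi>) \<longlongrightarrow> distr_of_real (v s) \<phi>) (at s within {0..T})"
        by (simp add: LIM_zero_iff)
    qed
  qed
qed

lemma grad_prod_CT_tempered:
  assumes \<beta>: "0 < \<beta>" "\<beta> < 1" and b: "b \<in> CT_besov_plus_vec \<rho> T (- \<beta>)" and v: "v \<in> CT_DC \<rho> T \<beta>"
  shows "(\<lambda>s. grad_prod \<rho> (v s) (b s)) \<in> CT_tempered T"
proof -
  obtain \<alpha> where \<alpha>: "\<alpha> > - \<beta>" and bi: "\<And>i. (\<lambda>t. b t i) \<in> CT_besov \<rho> T \<alpha>"
    using b unfolding CT_besov_plus_vec_def by blast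
  \<comment> \<open>At most \<open>\<alpha>\<close>, so that \<open>b\<close> has this regularity;
    negative, so that \<open>q > 1\<close>; above \<open>- \<beta>\<close>, so that
    \<open>a * q < 1\<close>.\<close>
  define \<gamma> where "\<gamma> = min \<alpha> (- \<beta> / 2)"
  have \<gamma>: "\<gamma> \<le> \<alpha>" "\<gamma> < 0" "\<gamma> > - \<beta>" using \<alpha> \<beta> by (auto simp: \<gamma>_def)
  \<comment> \<open>The condition \<open>1 / 2 < a\<close> of the paraproduct estimate is
    \<open>\<beta> < 1\<close>.\<close>
  have "2 powr (- 1) < (2::real) powr (- \<beta>)" using \<beta> by (intro powr_less_mono) auto
  moreover have "2 powr (- \<beta>) < (2::real) powr 0" using \<beta> by (intro powr_less_mono) auto
  ultimately have a: "1 / 2 < (2::real) powr (- \<beta>)" "2 powr (- \<beta>) < (1::real)"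
    by (simp_all add: powr_minus_divide)
  have "2 powr 0 < (2::real) powr (- \<gamma>)" by (rule powr_less_mono) (use \<gamma> in auto)
  moreover have "(2::real) powr (- \<beta> - \<gamma>) < 2 powr 0" by (rule powr_less_mono) (use \<gamma> in auto)
  ultimately have q: "(2::real) powr (- \<gamma>) > 1" "2 powr (- \<beta>) * 2 powr (- \<gamma>) < (1::real)"
    by (simp_all add: powr_add[symmetric])
  have "(\<lambda>s \<phi>. \<Sum>i\<in>UNIV. bony_product \<rho> (distr_of_real (partial i (v s))) (b s i) \<phi>) \<in> CT_tempered T"
    by (intro CT_tempered_sum bony_CT_tempered[OF a q] CT_DC_curves(1)[OF v \<beta>(1)] CT_besov_curve[OF bi \<gamma>(1)])
  then show ?thesis by (simp add: grad_prod_def[abs_def])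
qed

end

section \<open>Weak and mild solutions of the backward equation\<close>

theorem proposition4p5:
  fixes \<rho> :: "nat \<Rightarrow> real^'n::finite \<Rightarrow> real"
    and T l \<beta> :: real
    and b :: "real \<Rightarrow> 'n \<Rightarrow> 'n distr"
    and g :: "real \<Rightarrow> 'n distr"
    and vT :: "'n distr"
    and v :: "real \<Rightarrow> real^'n \<Rightarrow> real"
  assumes "dyadic_partition \<rho>"
    and "T > 0"
    and "0 < \<beta>" and "\<beta> < 1/2"
    and "b \<in> CT_besov_plus_vec \<rho> T (- \<beta>)"
    and "vT \<in> tempered"
    and "g \<in> CT_tempered T"
    and "v \<in> CT_DC \<rho> T \<beta>"
  shows "weak_solution \<rho> T l b g vT v \<longleftrightarrow> mild_solution \<rho> T l b g vT v"
proof -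
  interpret dyadic \<rho> by standard (rule assms(1))
  define u where "u s = distr_of_real (v s)" for s
  define G where "G s = grad_prod \<rho> (v s) (b s)" for s
  define r where "r s \<phi> = of_real l * u s \<phi> + g s \<phi>" for s \<phi>
  \<comment> \<open>All terms except the Laplacian are collected into one forcing, with the sign for
    which both equations take the form treated in \<open>weak_imp_mild\<close> and
    \<open>mild_imp_weak\<close>.\<close>
  define w where "w s \<phi> = G s \<phi> - r s \<phi>" for s \<phi>
  have u: "u \<in> CT_tempered T"
    unfolding u_def[abs_def] by (rule CT_DC_curves(2)[OF assms(8,3)])
  have G: "G \<in> CT_tempered T"
    unfolding G_def[abs_def] using assms(3,4) by (intro grad_prod_CT_tempered[OF _ _ assms(5,8)]) auto
  have r: "r \<in> CT_tempered T"
    using CT_tempered_linear_comb[OF u assms(7), of "of_real l" 1] by (simp add: r_def[abs_def])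
  have w: "w \<in> CT_tempered T"
    using CT_tempered_linear_comb[OF G r, of 1 "-1"] by (simp add: w_def[abs_def])
  \<comment> \<open>Splitting the integral requires both integrands to be integrable; this uses the
    continuity of the product curve \<open>G\<close> itself, not only that of
    \<open>w\<close>.\<close>
  have int1: "integral {t..T} (\<lambda>s. w s \<phi>) = integral {t..T} (\<lambda>s. G s \<phi>) - integral {t..T} (\<lambda>s. r s \<phi>)"
    if "t \<in> {0..T}" "\<phi> \<in> schwartz" for t \<phi>
    unfolding w_def using that
    by (intro Henstock_Kurzweil_Integration.integral_diff integrable_continuous_real CT_tempered_continuous[OF G] CT_tempered_continuous[OF r]) auto
  have int2: "integral {t..T} (\<lambda>s. w s (heat (s - t) \<phi>))
      = integral {t..T} (\<lambda>s. G s (heat (s - t) \<phi>)) - integral {t..T} (\<lambda>s. r s (heat (s - t) \<phi>))"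
    if "t \<in> {0..T}" "\<phi> \<in> schwartz" for t \<phi>
    unfolding w_def using that
    by (intro Henstock_Kurzweil_Integration.integral_diff integrable_continuous_real CT_tempered_heat_continuous'[OF G] CT_tempered_heat_continuous'[OF r]) auto
  have W: "weak_solution \<rho> T l b g vT v \<longleftrightarrow> (\<forall>\<phi>\<in>schwartz. \<forall>t\<in>{0..T}.
      u t \<phi> = vT \<phi> + integral {t..T} (\<lambda>s. u s (heat_gen \<phi>)) + integral {t..T} (\<lambda>s. w s \<phi>))"
  proof -
    have "weak_solution \<rho> T l b g vT v \<longleftrightarrow> (\<forall>\<phi>\<in>schwartz. \<forall>t\<in>{0..T}.
        vT \<phi> - u t \<phi> + integral {t..T} (\<lambda>s. u s (heat_gen \<phi>)) + integral {t..T} (\<lambda>s. G s \<phi>) = integral {t..T} (\<lambda>s. r s \<phi>))"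
      by (simp only: weak_solution_def u_def G_def r_def heat_gen_def)
    also have "\<dots> \<longleftrightarrow> (\<forall>\<phi>\<in>schwartz. \<forall>t\<in>{0..T}.
      u t \<phi> = vT \<phi> + integral {t..T} (\<lambda>s. u s (heat_gen \<phi>)) + integral {t..T} (\<lambda>s. w s \<phi>))"
    proof (intro ball_cong refl)
      fix \<phi> :: "'n test" and t assume "\<phi> \<in> schwartz" "t \<in> {0..T}"
      moreover have "a - b + c + d = e \<longleftrightarrow> b = a + c + (d - e)" for a b c d e :: complex
        by (auto simp: algebra_simps)
      ultimately show "vT \<phi> - u t \<phi> + integral {t..T} (\<lambda>s. u s (heat_gen \<phi>)) + integral {t..T} (\<lambda>s. G s \<phi>) = integral {t..T} (\<lambda>s. r s \<phi>)
          \<longleftrightarrow> u t \<phi> = vT \<phi> + integral {t..T} (\<lambda>s. u s (heat_gen \<phi>)) + integral {t..T} (\<lambda>s. w s \<phi>)"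
        by (simp only: int1)
    qed
    finally show ?thesis .
  qed
  have M: "mild_solution \<rho> T l b g vT v \<longleftrightarrow> (\<forall>t\<in>{0..T}. \<forall>\<phi>\<in>schwartz.
      u t \<phi> = vT (heat (T - t) \<phi>) + integral {t..T} (\<lambda>s. w s (heat (s - t) \<phi>)))"
  proof -
    have "mild_solution \<rho> T l b g vT v \<longleftrightarrow> (\<forall>t\<in>{0..T}. \<forall>\<phi>\<in>schwartz.
      u t \<phi> = vT (heat (T - t) \<phi>) + integral {t..T} (\<lambda>s. G s (heat (s - t) \<phi>)) - integral {t..T} (\<lambda>s. r s (heat (s - t) \<phi>)))"
      by (simp only: mild_solution_def u_def G_def r_def heat_distr_def distr_integral_def)
    then show ?thesis by (simp add: int2 add_diff_eq)
  qed
  show ?thesis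
    unfolding W M
  proof (intro iffI ballI)
    fix t and \<phi> :: "'n test"
    assume weak: "\<forall>\<phi>\<in>schwartz. \<forall>t\<in>{0..T}.
        u t \<phi> = vT \<phi> + integral {t..T} (\<lambda>s. u s (heat_gen \<phi>)) + integral {t..T} (\<lambda>s. w s \<phi>)"
      and t: "t \<in> {0..T}" and \<phi>: "\<phi> \<in> schwartz"
    have "T \<ge> 0" using assms(2) by simp
    from weak_imp_mild[OF u w this weak[rule_format] t \<phi>]
    show "u t \<phi> = vT (heat (T - t) \<phi>) + integral {t..T} (\<lambda>s. w s (heat (s - t) \<phi>))" .
  next
    fix t and \<phi> :: "'n test"
    assume mild: "\<forall>t\<in>{0..T}. \<forall>\<phi>\<in>schwartz.
        u t \<phi> = vT (heat (T - t) \<phi>) + integral {t..T} (\<lambda>s. w s (heat (s - t) \<phi>))"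
      and \<phi>: "\<phi> \<in> schwartz" and t: "t \<in> {0..T}"
    from mild_imp_weak[OF u w assms(6) mild[rule_format] t \<phi>]
    show "u t \<phi> = vT \<phi> + integral {t..T} (\<lambda>s. u s (heat_gen \<phi>)) + integral {t..T} (\<lambda>s. w s \<phi>)" .
  qed
qed

end
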